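(* The Gelfand--Tsetlin subalgebra $\mathcal C\subset\mathcal S(\mathfrak{gl}_n)$ is complete on every adjoint orbit of $G=\mathrm{GL}_n$.
   Context: $\Bbbk$ is an algebraically closed field of characteristic $0$, $\mathfrak{gl}_n=\mathfrak{gl}_n(\Bbbk)$, $\mathrm{GL}_n=\mathrm{GL}_n(\Bbbk)$, and $\mathfrak{gl}_n\simeq\mathfrak{gl}_n^*$ as $\mathrm{GL}_n$-modules via the trace form. Let $E_{ij}$ be the matrix units and consider the chain $\mathfrak{gl}_n\supset\mathfrak{gl}_{n-1}\supset\dots\supset\mathfrak{gl}_1$ with $\mathfrak{gl}_{n-k}=\langle E_{ij}\mid i,j>k\rangle_{\Bbbk}$. For $A\in\mathfrak{gl}_n$ and $0\le m\le n-1$, let $A_m\in\mathfrak{gl}_{n-m}$ be the south-east corner of $A$ of size $n-m$, and let $\Delta^{[m]}_k$ ($1\le k\le n-m$) be the (degree $k$) coefficients of the characteristic polynomial of $A_m$, viewed as elements of $\mathcal S^k(\mathfrak{gl}_{n-m})\subset\mathcal S^k(\mathfrak{gl}_n)$. The Gelfand--Tsetlin subalgebra $\mathcal C\subset\mathcal S(\mathfrak{gl}_n)$ is generated by all $\Delta^{[m]}_k$ with $0\le m\le n-1$, $1\le k\le n-m$; it is Poisson-commutative for the Lie--Poisson bracket on $\mathcal S(\mathfrak{gl}_n)$ determined by $\{x,y\}=[x,y]$ for $x,y\in\mathfrak{gl}_n$. A Poisson-commutative subalgebra $\mathcal A\subset\mathcal S(\mathfrak g)=\Bbbk[\mathfrak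 g^*]$ is complete on a (co)adjoint orbit $Gx$ if $\mathrm{tr.deg}(\mathcal A|_{Gx})=\frac12\dim(Gx)$, where $\mathcal A|_{Gx}\subset\Bbbk[Gx]$ is the restriction of $\mathcal A$ to $Gx$. *)

theory Defs
  imports
    "HOL-Library.Poly_Mapping"
    "HOL-Library.FuncSet"
    "HOL-Library.Extended_Nat"
    "Jordan_Normal_Form.Char_Poly"
begin

section \<open>Multivariate polynomials\<close>

text \<open>Monomials are finitely supported exponent functions.\<close>

type_synonym ('v, 'a) mpoly = "('v \<Rightarrow>\<^sub>0 nat) \<Rightarrow>\<^sub>0 'a"

definition var :: "'v \<Rightarrow> ('v, 'a::comm_ring_1) mpoly" where
  "var v = Poly_Mapping.single (Poly_Mapping.single v 1) 1"

definition const :: "'a \<Rightarrow> ('v, 'a::comm_ring_1) mpoly" where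
  "const c = Poly_Mapping.single 0 c"

definition vars :: "('v, 'a::comm_ring_1) mpoly \<Rightarrow> 'v set" where
  "vars P = (\<Union>m\<in>Poly_Mapping.keys P. Poly_Mapping.keys m)"

definition insertion :: "('v \<Rightarrow> 'a) \<Rightarrow> ('v, 'a::comm_ring_1) mpoly \<Rightarrow> 'a" where
  "insertion \<phi> P = (\<Sum>m\<in>Poly_Mapping.keys P. Poly_Mapping.lookup P m *
      (\<Prod>v\<in>Poly_Mapping.keys m. \<phi> v ^ Poly_Mapping.lookup m v))"

definition partial_deriv :: "'v \<Rightarrow> ('v, 'a::comm_ring_1) mpoly \<Rightarrow> ('v, 'a) mpoly" where
  "partial_deriv v P = (\<Sum>m\<in>Poly_Mapping.keys P.
      Poly_Mapping.single (m - Poly_Mapping.single v 1)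
        (of_nat (Poly_Mapping.lookup m v) * Poly_Mapping.lookup P m))"

section \<open>The symmetric algebra of $\mathfrak{gl}_n$ and its Lie--Poisson bracket\<close>

text \<open>
  The variable \<open>(i, j)\<close> is the matrix unit $E_{ij}$, an element of degree one of
  $\mathcal S(\mathfrak{gl}_n)$. Indices run from \<open>0\<close> to \<open>n - 1\<close>.
\<close>

definition sym_gl :: "nat \<Rightarrow> (nat \<times> nat, 'a::comm_ring_1) mpoly set" where
  "sym_gl n = {P. vars P \<subseteq> {..<n} \<times> {..<n}}"

text \<open>$[E_{ij}, E_{kl}] = \delta_{jk} E_{il} - \delta_{li} E_{kj}$\<close>

definition lie_bracket_units ::
    "nat \<times> nat \<Rightarrow> nat \<times> nat \<Rightarrow> (nat \<times> nat, 'a::comm_ring_1) mpoly" where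
  "lie_bracket_units p q =
     (if snd p = fst q then var (fst p, snd q) else 0)
   - (if snd q = fst p then var (fst q, snd p) else 0)"

text \<open>The biderivation extending the Lie bracket of $\mathfrak{gl}_n$.\<close>

definition lie_poisson :: "nat \<Rightarrow> (nat \<times> nat, 'a::comm_ring_1) mpoly
    \<Rightarrow> (nat \<times> nat, 'a) mpoly \<Rightarrow> (nat \<times> nat, 'a) mpoly" where
  "lie_poisson n P Q =
     (\<Sum>p\<in>{..<n} \<times> {..<n}. \<Sum>q\<in>{..<n} \<times> {..<n}.
        partial_deriv p P * partial_deriv q Q * lie_bracket_units p q)"

lemma partial_deriv_var:
  "partial_deriv v (var w :: ('v, 'a::comm_ring_1) mpoly) = (if v = w then 1 else 0)"
  by (simp add: partial_deriv_def var_def lookup_single)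

lemma lie_poisson_var:
  assumes "p \<in> {..<n} \<times> {..<n}" "q \<in> {..<n} \<times> {..<n}"
  shows "lie_poisson n (var p) (var q) = (lie_bracket_units p q :: (_, 'a::comm_ring_1) mpoly)"
proof -
  let ?I = "{..<n} \<times> {..<n}" and ?b = "lie_bracket_units :: _ \<Rightarrow> _ \<Rightarrow> (nat \<times> nat, 'a) mpoly"
  have summand: "(if p' = p then 1 else 0) * (if q' = q then 1 else 0) * ?b p' q'
      = (if p' = p then (if q' = q then ?b p' q' else 0) else 0)" for p' q'
    by simp
  have inner: "(\<Sum>q'\<in>?I. if p' = p then (if q' = q then ?b p' q' else 0) else 0)
      = (if p' = p then ?b p' q else 0)" for p'
    using sum.delta[of ?I q "?b p'"] assms(2) by (cases "p' = p") simp_all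
  show ?thesis
    unfolding lie_poisson_def partial_deriv_var summand inner
    using sum.delta[of ?I p "\<lambda>p'. ?b p' q"] assms(1) by simp
qed

definition poisson_commutative_subalgebra ::
    "nat \<Rightarrow> (nat \<times> nat, 'a::comm_ring_1) mpoly set \<Rightarrow> bool" where
  "poisson_commutative_subalgebra n \<A> \<longleftrightarrow>
     \<A> \<subseteq> sym_gl n \<and> (\<forall>c. const c \<in> \<A>) \<and>
     (\<forall>P\<in>\<A>. \<forall>Q\<in>\<A>. P + Q \<in> \<A> \<and> P * Q \<in> \<A> \<and> lie_poisson n P Q = 0)"

inductive_set subalgebra_generated ::
    "('v, 'a::comm_ring_1) mpoly set \<Rightarrow> ('v, 'a) mpoly set" for G where
  const: "const c \<in> subalgebra_generated G"
| gen: "P \<in> G \<Longrightarrow> P \<in> subalgebra_generated G"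
| add: "\<lbrakk>P \<in> subalgebra_generated G; Q \<in> subalgebra_generated G\<rbrakk>
    \<Longrightarrow> P + Q \<in> subalgebra_generated G"
| mult: "\<lbrakk>P \<in> subalgebra_generated G; Q \<in> subalgebra_generated G\<rbrakk>
    \<Longrightarrow> P * Q \<in> subalgebra_generated G"

section \<open>The Gelfand--Tsetlin subalgebra\<close>

text \<open>
  The trace form identifies $E_{ij}$ with the linear function
  $A \mapsto \mathrm{tr}(E_{ij} A) = A_{ji}$; this is the reason for the transposed indices here
  and in \<open>generic_matrix\<close>.
\<close>

definition eval_at :: "(nat \<times> nat, 'a::comm_ring_1) mpoly \<Rightarrow> 'a mat \<Rightarrow> 'a" where
  "eval_at P A = insertion (\<lambda>(i, j). A $$ (j, i)) P"

definition generic_matrix :: "nat \<Rightarrow> (nat \<times> nat, 'a::comm_ring_1) mpoly mat" where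
  "generic_matrix n = mat n n (\<lambda>(i, j). var (j, i))"

definition south_east_corner :: "nat \<Rightarrow> 'b mat \<Rightarrow> 'b mat" where
  "south_east_corner m A =
     mat (dim_row A - m) (dim_col A - m) (\<lambda>(i, j). A $$ (i + m, j + m))"

text \<open>
  The characteristic polynomial is $\det(t - A_m)$, so the coefficient of degree \<open>k\<close> in the
  matrix entries is the one at $t^{n-m-k}$.
\<close>

definition Delta :: "nat \<Rightarrow> nat \<Rightarrow> nat \<Rightarrow> (nat \<times> nat, 'a::comm_ring_1) mpoly" where
  "Delta n m k = coeff (char_poly (south_east_corner m (generic_matrix n))) (n - m - k)"

definition gelfand_tsetlin :: "nat \<Rightarrow> (nat \<times> nat, 'a::comm_ring_1) mpoly set" where
  "gelfand_tsetlin n =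
     subalgebra_generated {Delta n m k | m k. m \<le> n - 1 \<and> 1 \<le> k \<and> k \<le> n - m}"

section \<open>Transcendence degree, dimension and completeness\<close>

text \<open>Elements of $\Bbbk[X]$ are functions with value \<open>undefined\<close> outside \<open>X\<close>.\<close>

definition restrict_functions ::
    "'a::comm_ring_1 mat set \<Rightarrow> (nat \<times> nat, 'a) mpoly set \<Rightarrow> ('a mat \<Rightarrow> 'a) set" where
  "restrict_functions X \<A> = (\<lambda>P. restrict (eval_at P) X) ` \<A>"

definition algebraically_independent ::
    "'b set \<Rightarrow> nat \<Rightarrow> (nat \<Rightarrow> 'b \<Rightarrow> 'a::comm_ring_1) \<Rightarrow> bool" where
  "algebraically_independent X r f \<longleftrightarrow>
     (\<forall>P :: (nat, 'a) mpoly. vars P \<subseteq> {..<r} \<longrightarrow>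
        (\<forall>x\<in>X. insertion (\<lambda>i. f i x) P = 0) \<longrightarrow> P = 0)"

definition tr_deg :: "'b set \<Rightarrow> ('b \<Rightarrow> 'a::comm_ring_1) set \<Rightarrow> enat" where
  "tr_deg X F = Sup {enat r | r. \<exists>f. (\<forall>i<r. f i \<in> F) \<and> algebraically_independent X r f}"

definition adjoint_orbit :: "'a::comm_ring_1 mat \<Rightarrow> 'a mat set" where
  "adjoint_orbit x = {y. similar_mat y x}"

text \<open>
  The dimension of a variety is the transcendence degree of its function field. For a locally
  closed \<open>X\<close> in $\mathfrak{gl}_n$ (such as an orbit) the polynomial functions restricted to \<open>X\<close>
  form the coordinate ring of the closure of \<open>X\<close>, which has the same transcendence degree.
\<close>

definition dim_variety :: "nat \<Rightarrow> 'a::comm_ring_1 mat set \<Rightarrow> enat" where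
  "dim_variety n X = tr_deg X (restrict_functions X (sym_gl n))"

definition complete_on ::
    "nat \<Rightarrow> (nat \<times> nat, 'a::comm_ring_1) mpoly set \<Rightarrow> 'a mat set \<Rightarrow> bool" where
  "complete_on n \<A> X \<longleftrightarrow>
     poisson_commutative_subalgebra n \<A> \<and>
     2 * tr_deg X (restrict_functions X \<A>) = dim_variety n X"

end

theory Submission imports Defs begin

text \<open>
  Every orbit contains a point at which the Hamiltonian vector fields of the Gelfand--Tsetlin
  generators span the common kernel, in the tangent space, of the differentials of these generators.
  Such a point (\<open>lagrangian n y\<close>) is found by induction along the chain: splitting off a cyclic
  summand brings the matrix into an arrow form whose south-east corner is the direct sum of a
  generic diagonal matrix and a matrix killed by the minimal polynomial; conjugation with block
  matrices \<open>1 \<oplus> P\<close> then moves the corner itself to such a point of its own orbit.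

  If \<open>N\<close> is the rank of the differentials there, the orbit has a tangent space of dimension at most
  \<open>2 N\<close>, while \<open>N\<close> generators stay independent on the orbit. Conversely \<open>r\<close> independent
  Poisson-commuting functions provide \<open>r\<close> independent Hamiltonian vector fields on which their
  differentials vanish, so the orbit carries at least \<open>2 r\<close> independent functions; and it carries
  at most as many as the dimension of its tangent space, by counting monomials in a rational chart.
\<close>

section \<open>Linear independence of functions on a finite set\<close>

text \<open>Half of completeness is free: commuting generators have Hamiltonian vector fields inside
  the common kernel of their differentials. The obstacle is the converse inclusion on an orbit of
  arbitrary Jordan type. The induction needs the corner of a tangent vector to be tangent to the
  orbit of the corner, but orthogonality to the polynomials in a matrix does not imply this: the
  tangent space of an orbit is the orthogonal complement of the whole centralizer, which is larger
  than the polynomials as soon as the matrix is derogatory. In the arrow form the border avoids the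
  summand \<open>R\<close> that may be derogatory, so the \<open>R\<close> block of any tangent
  vector is already a commutator with \<open>R\<close>. The eigenvalues \<open>\<mu>\<close> of the
  diagonal summand of the corner can be prescribed; choosing them distinct and outside the roots of
  the minimal polynomial lets the other blocks be solved by division. Varieties enter only through
  transcendence degrees, so irreducibility, generic rank and dimension are obtained by restricting
  polynomials to rational curves and to one rational chart of the orbit.\<close>

definition lin_indep :: "'i set \<Rightarrow> nat \<Rightarrow> (nat \<Rightarrow> 'i \<Rightarrow> 'a::field) \<Rightarrow> bool" where
  "lin_indep I N v \<longleftrightarrow> (\<forall>c. (\<forall>p\<in>I. (\<Sum>j<N. c j * v j p) = 0) \<longrightarrow> (\<forall>j<N. c j = 0))"

definition in_span :: "'i set \<Rightarrow> nat \<Rightarrow> (nat \<Rightarrow> 'i \<Rightarrow> 'a::field) \<Rightarrow> ('i \<Rightarrow> 'a) \<Rightarrow> bool" where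
  "in_span I N v w \<longleftrightarrow> (\<exists>c. \<forall>p\<in>I. w p = (\<Sum>j<N. c j * v j p))"

lemma lin_indepD:
  "lin_indep I N v \<Longrightarrow> (\<And>p. p \<in> I \<Longrightarrow> (\<Sum>j<N. c j * v j p) = 0) \<Longrightarrow> j < N \<Longrightarrow> c j = 0"
  unfolding lin_indep_def by blast

lemma in_spanI: "(\<And>p. p \<in> I \<Longrightarrow> w p = (\<Sum>j<N. c j * v j p)) \<Longrightarrow> in_span I N v w"
  unfolding in_span_def by blast

text \<open>Gaussian elimination of the last unknown that occurs in the first equation.\<close>

lemma homogeneous_system_solution:
  fixes M :: "nat \<Rightarrow> nat \<Rightarrow> 'a::field"
  assumes "s < N"
  shows "\<exists>c. (\<exists>j<N. c j \<noteq> 0) \<and> (\<forall>i<s. (\<Sum>j<N. M i j * c j) = 0)"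
  using assms
proof (induction s arbitrary: N M)
  case 0
  then show ?case by (intro exI[of _ "\<lambda>_. 1"]) auto
next
  case (Suc s)
  show ?case
  proof (cases "\<forall>j<N. M s j = 0")
    case True
    from Suc.IH[of N M] Suc.prems obtain c where
      c: "\<exists>j<N. c j \<noteq> 0" "\<forall>i<s. (\<Sum>j<N. M i j * c j) = 0" by auto
    with True have "\<forall>i<Suc s. (\<Sum>j<N. M i j * c j) = 0"
      by (auto simp: less_Suc_eq intro!: sum.neutral)
    with c show ?thesis by blast
  next
    case False
    then obtain k where k: "k < N" "M s k \<noteq> 0" by blast
    obtain N' where N: "N = Suc N'" using Suc.prems by (cases N) auto
    \<comment> \<open>\<open>\<tau>\<close> enumerates the indices other than \<open>k\<close>, so
      that eliminating the unknown \<open>k\<close> leaves a system in the first \<open>N'\<close>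
      unknowns.\<close>
    define \<tau> where "\<tau> j = (if j < k then j else Suc j)" for j
    have bij: "bij_betw \<tau> {..<N'} ({..<N} - {k})"
      by (rule bij_betw_byWitness[where f' = "\<lambda>j. if j < k then j else j - 1"])
        (use k N in \<open>auto simp: \<tau>_def\<close>)
    \<comment> \<open>Equation \<open>s\<close> determines the unknown \<open>k\<close>;
      substituting its value into the other equations gives \<open>M'\<close>.\<close>
    define M' where "M' i j = M i (\<tau> j) - M i k * M s (\<tau> j) / M s k" for i j
    from Suc.IH[of N' M'] Suc.prems N obtain c where
      c: "\<exists>j<N'. c j \<noteq> 0" "\<forall>i<s. (\<Sum>j<N'. M' i j * c j) = 0" by auto
    define e where "e j = (if j < k then c j else if j = k then - (\<Sum>j<N'. M s (\<tau> j) * c j) / M s k else c (j - 1))" for j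
    have e\<tau>: "e (\<tau> j) = c j" for j by (simp add: e_def \<tau>_def)
    have split: "(\<Sum>j<N. f j * e j) = f k * e k + (\<Sum>j<N'. f (\<tau> j) * c j)" for f
    proof -
      have "(\<Sum>j<N. f j * e j) = f k * e k + (\<Sum>j\<in>{..<N} - {k}. f j * e j)"
        using k by (subst sum.remove[of _ k]) auto
      also have "(\<Sum>j\<in>{..<N} - {k}. f j * e j) = (\<Sum>j<N'. f (\<tau> j) * e (\<tau> j))"
        by (rule sum.reindex_bij_betw[OF bij, symmetric])
      finally show ?thesis by (simp add: e\<tau>)
    qed
    have ek: "e k = - (\<Sum>j<N'. M s (\<tau> j) * c j) / M s k" by (simp add: e_def)
    have "(\<Sum>j<N. M i j * e j) = 0" if "i < Suc s" for i
    proof (cases "i = s")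
      case True
      then show ?thesis unfolding split ek using k by simp
    next
      case False
      with that have "(\<Sum>j<N'. M' i j * c j) = 0" using c by auto
      then have "(\<Sum>j<N'. M i (\<tau> j) * c j) - M i k * (\<Sum>j<N'. M s (\<tau> j) * c j) / M s k = 0"
        unfolding M'_def by (simp add: left_diff_distrib sum_subtractf sum_distrib_left sum_divide_distrib mult.assoc)
      then show ?thesis unfolding split ek by simp
    qed
    moreover from c(1) obtain j where "j < N'" "c j \<noteq> 0" by blast
    with e\<tau>[of j] have "\<exists>j<N. e j \<noteq> 0" using bij N unfolding bij_betw_def
      by (metis (no_types, lifting) Diff_iff image_eqI lessThan_iff)
    ultimately show ?thesis by blast
  qed
qed

text \<open>With \<open>s < N\<close>, the coefficients of the \<open>v j\<close> in the generators
  form a homogeneous system with fewer equations than unknowns, and any non-trivial solution is a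
  linear relation between the \<open>v j\<close>.\<close>

lemma steinitz_bound:
  assumes ind: "lin_indep I N v" and sp: "\<And>j. j < N \<Longrightarrow> in_span I s u (v j)"
  shows "N \<le> s"
proof (rule ccontr)
  assume "\<not> N \<le> s"
  from sp have "\<exists>c. \<forall>j<N. \<forall>p\<in>I. v j p = (\<Sum>i<s. c j i * u i p)"
    unfolding in_span_def by metis
  then obtain c where c: "\<And>j p. j < N \<Longrightarrow> p \<in> I \<Longrightarrow> v j p = (\<Sum>i<s. c j i * u i p)" by blast
  from homogeneous_system_solution[of s N "\<lambda>i j. c j i"] \<open>\<not> N \<le> s\<close> obtain e where
    e: "\<exists>j<N. e j \<noteq> 0" "\<forall>i<s. (\<Sum>j<N. c j i * e j) = 0" by auto
  have "(\<Sum>j<N. e j * v j p) = 0" if "p \<in> I" for p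
  proof -
    have "(\<Sum>j<N. e j * v j p) = (\<Sum>j<N. \<Sum>i<s. (c j i * e j) * u i p)"
      using c that by (simp add: sum_distrib_left mult_ac)
    also have "\<dots> = (\<Sum>i<s. (\<Sum>j<N. c j i * e j) * u i p)"
      by (subst sum.swap) (simp add: sum_distrib_right)
    finally show ?thesis using e by simp
  qed
  with lin_indepD[OF ind, of e] e show False by blast
qed

lemma in_span_unit_vectors:
  assumes "bij_betw h {..<card I} I" "finite I"
  shows "in_span I (card I) (\<lambda>j p. if p = h j then 1 else 0) w"
proof (rule in_spanI)
  fix p assume p: "p \<in> I"
  with assms obtain j where j: "j < card I" "h j = p" unfolding bij_betw_def by (metis imageE lessThan_iff)
  have "(\<Sum>i<card I. w (h i) * (if p = h i then 1 else 0)) = (\<Sum>i<card I. if i = j then w p else 0)"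
    using assms j by (intro sum.cong) (auto simp: bij_betw_def inj_on_def)
  then show "w p = (\<Sum>i<card I. w (h i) * (if p = h i then 1 else 0))"
    using j by simp
qed

lemma lin_indep_le_card:
  assumes "lin_indep I N v" "finite I" shows "N \<le> card I"
proof -
  from ex_bij_betw_nat_finite[OF assms(2)] obtain h where "bij_betw h {..<card I} I"
    unfolding lessThan_atLeast0 by blast
  show ?thesis by (rule steinitz_bound[OF assms(1) in_span_unit_vectors[OF \<open>bij_betw h {..<card I} I\<close> assms(2)]])
qed

lemma lin_indep_extend:
  assumes ind: "lin_indep I N v" and w: "\<not> in_span I N v w"
  shows "lin_indep I (Suc N) (v(N := w))"
  unfolding lin_indep_def
proof (intro allI impI)
  fix c j
  assume c: "\<forall>p\<in>I. (\<Sum>j<Suc N. c j * (v(N := w)) j p) = 0" and j: "j < Suc N"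
  have c': "(\<Sum>j<N. c j * v j p) + c N * w p = 0" if "p \<in> I" for p
    using c[rule_format, OF that] by simp
  have cN: "c N = 0"
  proof (rule ccontr)
    assume "c N \<noteq> 0"
    have "w p = (\<Sum>j<N. (- c j / c N) * v j p)" if "p \<in> I" for p
    proof -
      have "w p = - (\<Sum>j<N. c j * v j p) / c N"
        using c'[OF that] \<open>c N \<noteq> 0\<close> by (simp add: field_simps eq_neg_iff_add_eq_0)
      also have "\<dots> = (\<Sum>j<N. (- c j / c N) * v j p)"
        by (simp add: sum_negf[symmetric] sum_divide_distrib)
      finally show ?thesis .
    qed
    then have "in_span I N v w" by (rule in_spanI)
    with w show False by simp
  qed
  then have "j < N \<Longrightarrow> c j = 0" using lin_indepD[OF ind, of c j] c' by simp
  with cN j show "c j = 0" by (auto simp: less_Suc_eq)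
qed

lemma lin_indep_cong:
  "(\<And>j p. j < N \<Longrightarrow> p \<in> I \<Longrightarrow> v j p = v' j p) \<Longrightarrow> lin_indep I N v = lin_indep I N v'"
  unfolding lin_indep_def by simp

text \<open>The lengths of independent families are bounded by \<open>card I\<close>, so a longest
  one that prolongs \<open>u\<close> inside \<open>W\<close> exists, and maximality means spanning.
  \<open>W\<close> is an arbitrary set: it will be a subspace, the image of a linear map, or a
  finite family.\<close>

lemma basis_extension:
  assumes I: "finite I" and ind: "lin_indep I r u" and u: "\<And>j. j < r \<Longrightarrow> u j \<in> W"
  obtains N v where "r \<le> N" "lin_indep I N v" "\<And>j. j < r \<Longrightarrow> v j = u j"
    "\<And>j. j < N \<Longrightarrow> v j \<in> W" "\<And>w. w \<in> W \<Longrightarrow> in_span I N v w"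
proof -
  let ?P = "\<lambda>N. \<exists>v. r \<le> N \<and> lin_indep I N v \<and> (\<forall>j<r. v j = u j) \<and> (\<forall>j<N. v j \<in> W)"
  have "?P r" using ind u by blast
  moreover have "\<forall>N. ?P N \<longrightarrow> N \<le> card I" using lin_indep_le_card[OF _ I] by blast
  ultimately have P: "?P (GREATEST N. ?P N)" and max: "\<And>N. ?P N \<Longrightarrow> N \<le> (GREATEST N. ?P N)"
    using GreatestI_nat[of ?P r "card I"] Greatest_le_nat[of ?P _ "card I"] by blast+
  define N where "N = (GREATEST N. ?P N)"
  from P obtain v where v: "r \<le> N" "lin_indep I N v" "\<forall>j<r. v j = u j" "\<forall>j<N. v j \<in> W"
    unfolding N_def by blast
  have "in_span I N v w" if "w \<in> W" for w
  proof (rule ccontr)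
    assume "\<not> in_span I N v w"
    from lin_indep_extend[OF v(2) this] have "?P (Suc N)"
      using v that by (intro exI[of _ "v(N := w)"]) (auto simp: less_Suc_eq)
    with max[of "Suc N"] show False unfolding N_def by simp
  qed
  with v show thesis by (intro that[of N v]) auto
qed

lemma lin_indep_card_spans:
  assumes "finite I" "lin_indep I (card I) v"
  shows "in_span I (card I) v w"
proof (rule ccontr)
  assume "\<not> ?thesis"
  from lin_indep_le_card[OF lin_indep_extend[OF assms(2) this] assms(1)] show False by simp
qed

lemma dual_family:
  assumes I: "finite I" and ind: "lin_indep I N v"
  obtains w where "\<And>i j. i < N \<Longrightarrow> j < N \<Longrightarrow> (\<Sum>p\<in>I. w i p * v j p) = (if i = j then 1 else 0)"
proof -
  obtain D u where Du: "N \<le> D" "lin_indep I D u" "\<And>j. j < N \<Longrightarrow> u j = v j" "\<And>w. in_span I D u w"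
    by (rule basis_extension[OF I ind, of UNIV]) auto
  \<comment> \<open>The coefficients of the unit vectors in the extended basis form the inverse of
    the basis matrix; its columns are the dual functionals.\<close>
  have "\<forall>p. \<exists>c. \<forall>q\<in>I. (if q = p then 1 else 0) = (\<Sum>j<D. c j * u j q)"
    by (intro allI Du(4)[unfolded in_span_def])
  then obtain C where C: "\<And>p q. q \<in> I \<Longrightarrow> (if q = p then 1 else 0) = (\<Sum>j<D. C p j * u j q)"
    by metis
  have "(\<Sum>p\<in>I. C p i * v j p) = (if i = j then 1 else 0)" if ij: "i < N" "j < N" for i j
  proof -
    \<comment> \<open>These numbers are the difference of two expansions of \<open>v j\<close> in
      the basis, hence zero.\<close>
    let ?c = "\<lambda>i. (\<Sum>p\<in>I. C p i * v j p) - (if i = j then 1 else 0)"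
    have "(\<Sum>i<D. ?c i * u i q) = 0" if q: "q \<in> I" for q
    proof -
      have "(\<Sum>i<D. (\<Sum>p\<in>I. C p i * v j p) * u i q) = (\<Sum>i<D. \<Sum>p\<in>I. v j p * (C p i * u i q))"
        by (simp add: sum_distrib_left sum_distrib_right mult_ac)
      also have "\<dots> = (\<Sum>p\<in>I. v j p * (\<Sum>i<D. C p i * u i q))"
        by (subst sum.swap) (simp add: sum_distrib_left)
      also have "\<dots> = (\<Sum>p\<in>I. if p = q then v j q else 0)"
        using q by (intro sum.cong) (auto simp flip: C)
      also have "\<dots> = v j q" using I q by simp
      finally have 1: "(\<Sum>i<D. (\<Sum>p\<in>I. C p i * v j p) * u i q) = v j q" .
      have "(\<Sum>i<D. (if i = j then 1 else 0) * u i q) = (\<Sum>i<D. if i = j then u j q else 0)"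
        by (intro sum.cong) auto
      also have "\<dots> = v j q" using ij Du by simp
      finally show ?thesis using 1 by (simp add: left_diff_distrib sum_subtractf)
    qed
    with lin_indepD[OF Du(2), of ?c i] ij Du(1) show ?thesis by simp
  qed
  then show thesis by (rule that[of "\<lambda>i p. C p i"])
qed

lemma independent_subfamily:
  fixes D :: "'k \<Rightarrow> 'i \<Rightarrow> 'a::field"
  assumes I: "finite I"
  obtains N \<sigma> where "lin_indep I N (\<lambda>j. D (\<sigma> j))" "\<And>j. j < N \<Longrightarrow> \<sigma> j \<in> K"
    "\<And>k. k \<in> K \<Longrightarrow> in_span I N (\<lambda>j. D (\<sigma> j)) (D k)"
proof -
  obtain N v where v: "lin_indep I N v" "\<And>j. j < N \<Longrightarrow> v j \<in> D ` K" "\<And>w. w \<in> D ` K \<Longrightarrow> in_span I N v w"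
    by (rule basis_extension[OF I, of 0 _ "D ` K"]) (auto simp: lin_indep_def)
  from v(2) have "\<forall>j. \<exists>k. j < N \<longrightarrow> k \<in> K \<and> v j = D k" by blast
  then obtain \<sigma> where \<sigma>: "\<And>j. j < N \<Longrightarrow> \<sigma> j \<in> K \<and> v j = D (\<sigma> j)" by metis
  show thesis
  proof (rule that[of N \<sigma>])
    show "lin_indep I N (\<lambda>j. D (\<sigma> j))" using v(1) \<sigma> lin_indep_cong[of N I v "\<lambda>j. D (\<sigma> j)"] by simp
    show "in_span I N (\<lambda>j. D (\<sigma> j)) (D k)" if "k \<in> K" for k
      using v(3)[of "D k"] that \<sigma> unfolding in_span_def by auto
  qed (use \<sigma> in auto)
qed

section \<open>Evaluation and derivatives of multivariate polynomials\<close>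

text \<open>Truncated subtraction of exponents is not injective, but it can only collide on
  monomials free of \<open>v\<close>, and these carry the factor 0. The coefficientwise form makes
  linearity immediate.\<close>

lemma partial_deriv_lookup:
  "Poly_Mapping.lookup (partial_deriv v P) m
    = of_nat (Poly_Mapping.lookup m v + 1) * Poly_Mapping.lookup P (m + Poly_Mapping.single v 1)"
proof -
  let ?d = "Poly_Mapping.single v (1::nat)"
  let ?a = "of_nat (Poly_Mapping.lookup m v + 1) * Poly_Mapping.lookup P (m + ?d)"
  have "Poly_Mapping.lookup (partial_deriv v P) m = (\<Sum>m'\<in>Poly_Mapping.keys P.
      (of_nat (Poly_Mapping.lookup m' v) * Poly_Mapping.lookup P m' when m' - ?d = m))"
    unfolding partial_deriv_def by (simp add: lookup_sum lookup_single)
  also have "\<dots> = (\<Sum>m'\<in>Poly_Mapping.keys P. if m' = m + ?d then ?a else 0)"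
  proof (rule sum.cong[OF refl])
    fix m'
    show "(of_nat (Poly_Mapping.lookup m' v) * Poly_Mapping.lookup P m' when m' - ?d = m)
        = (if m' = m + ?d then ?a else 0)"
    proof (cases "Poly_Mapping.lookup m' v = 0")
      case True
      then have "m' \<noteq> m + ?d" by (auto simp: lookup_add)
      with True show ?thesis by simp
    next
      case False
      have "m' - ?d + ?d = m'"
        by (rule poly_mapping_eqI) (use False in \<open>auto simp: lookup_add lookup_minus lookup_single when_def\<close>)
      then have "m' - ?d = m \<longleftrightarrow> m' = m + ?d" by auto
      then show ?thesis by (auto simp: lookup_add)
    qed
  qed
  also have "\<dots> = ?a" by (simp add: in_keys_iff)
  finally show ?thesis .
qed

lemma partial_deriv_add: "partial_deriv v (P + Q) = partial_deriv v P + partial_deriv v Q"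
  by (rule poly_mapping_eqI) (simp add: partial_deriv_lookup lookup_add algebra_simps)

lemma partial_deriv_zero [simp]: "partial_deriv v 0 = 0"
  by (rule poly_mapping_eqI) (simp add: partial_deriv_lookup)

lemma partial_deriv_uminus: "partial_deriv v (- P) = - partial_deriv v P"
  by (rule poly_mapping_eqI) (simp add: partial_deriv_lookup)

lemma partial_deriv_sum: "partial_deriv v (\<Sum>i\<in>A. f i) = (\<Sum>i\<in>A. partial_deriv v (f i))"
  by (induction A rule: infinite_finite_induct) (auto simp: partial_deriv_add)

lemma partial_deriv_single:
  "partial_deriv v (Poly_Mapping.single m a)
    = Poly_Mapping.single (m - Poly_Mapping.single v 1) (of_nat (Poly_Mapping.lookup m v) * a)"
  unfolding partial_deriv_def by simp

lemma mpoly_eq_sum_single: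
  "P = (\<Sum>m\<in>Poly_Mapping.keys P. Poly_Mapping.single m (Poly_Mapping.lookup P m))"
  by (rule poly_mapping_eqI) (simp add: lookup_sum lookup_single when_def in_keys_iff)

lemma partial_deriv_mult:
  fixes P Q :: "('v, 'a::comm_ring_1) mpoly"
  shows "partial_deriv v (P * Q) = partial_deriv v P * Q + P * partial_deriv v Q"
proof -
  let ?d = "Poly_Mapping.single v (1::nat)"
  \<comment> \<open>If \<open>v\<close> does not occur in \<open>m\<close>, the two exponents may
    differ because subtraction is truncated, but then the coefficient vanishes.\<close>
  have shift: "Poly_Mapping.single (m - ?d + k) (of_nat (Poly_Mapping.lookup m v) * c)
      = Poly_Mapping.single (m + k - ?d) (of_nat (Poly_Mapping.lookup m v) * c)" for m k and c :: 'a
  proof (cases "Poly_Mapping.lookup m v = 0")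
    case False
    then have "m - ?d + k = m + k - ?d"
      by (intro poly_mapping_eqI) (auto simp: lookup_add lookup_minus lookup_single when_def)
    then show ?thesis by simp
  qed simp
  have single: "partial_deriv v (Poly_Mapping.single m a * Poly_Mapping.single k b)
      = partial_deriv v (Poly_Mapping.single m a) * Poly_Mapping.single k b
        + Poly_Mapping.single m a * partial_deriv v (Poly_Mapping.single k b)" for m k and a b :: 'a
  proof -
    have "Poly_Mapping.single (m - ?d + k) (of_nat (Poly_Mapping.lookup m v) * a * b)
        = Poly_Mapping.single (m + k - ?d) (of_nat (Poly_Mapping.lookup m v) * (a * b))"
      using shift[of m k "a * b"] by (simp add: mult.assoc)
    moreover have "Poly_Mapping.single (m + (k - ?d)) (a * (of_nat (Poly_Mapping.lookup k v) * b))
        = Poly_Mapping.single (m + k - ?d) (of_nat (Poly_Mapping.lookup k v) * (a * b))"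
      using shift[of k m "a * b"] by (simp add: add.commute mult_ac)
    ultimately show ?thesis
      by (simp add: mult_single partial_deriv_single lookup_add distrib_right
          flip: single_add)
  qed
  have left: "partial_deriv v (P * Poly_Mapping.single k b)
      = partial_deriv v P * Poly_Mapping.single k b
        + P * partial_deriv v (Poly_Mapping.single k b)" for k and b :: 'a
    by (subst (1 2 3) mpoly_eq_sum_single[of P])
       (simp add: sum_distrib_right partial_deriv_sum single sum.distrib)
  show ?thesis
    by (subst (1 2 3) mpoly_eq_sum_single[of Q])
       (simp add: sum_distrib_left partial_deriv_sum left sum.distrib)
qed

lemma partial_deriv_const [simp]: "partial_deriv v (const c) = 0"
  by (simp add: const_def partial_deriv_single)

lemma partial_deriv_one [simp]: "partial_deriv v 1 = 0"
  using partial_deriv_const[of v 1] by (simp add: const_def)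

section \<open>Evaluation at a point as a ring homomorphism\<close>

definition mon_value :: "('v \<Rightarrow> 'a) \<Rightarrow> ('v \<Rightarrow>\<^sub>0 nat) \<Rightarrow> 'a::comm_ring_1" where
  "mon_value \<phi> m = (\<Prod>v\<in>Poly_Mapping.keys m. \<phi> v ^ Poly_Mapping.lookup m v)"

lemma mon_value_superset:
  "finite S \<Longrightarrow> Poly_Mapping.keys m \<subseteq> S \<Longrightarrow> mon_value \<phi> m = (\<Prod>v\<in>S. \<phi> v ^ Poly_Mapping.lookup m v)"
  unfolding mon_value_def by (rule prod.mono_neutral_left) (auto simp: in_keys_iff)

lemma mon_value_add: "mon_value \<phi> (m + k) = mon_value \<phi> m * mon_value \<phi> k"
proof -
  let ?S = "Poly_Mapping.keys m \<union> Poly_Mapping.keys k"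
  have "mon_value \<phi> (m + k) = (\<Prod>v\<in>?S. \<phi> v ^ Poly_Mapping.lookup (m + k) v)"
    by (rule mon_value_superset) (use keys_add[of m k] in auto)
  also have "\<dots> = (\<Prod>v\<in>?S. \<phi> v ^ Poly_Mapping.lookup m v) * (\<Prod>v\<in>?S. \<phi> v ^ Poly_Mapping.lookup k v)"
    by (simp add: lookup_add power_add prod.distrib)
  finally show ?thesis by (simp add: mon_value_superset[of ?S])
qed

lemma insertion_superset:
  "finite S \<Longrightarrow> Poly_Mapping.keys P \<subseteq> S \<Longrightarrow> insertion \<phi> P = (\<Sum>m\<in>S. Poly_Mapping.lookup P m * mon_value \<phi> m)"
  unfolding insertion_def mon_value_def by (rule sum.mono_neutral_left) (auto simp: in_keys_iff)

lemma insertion_add: "insertion \<phi> (P + Q) = insertion \<phi> P + insertion \<phi> Q"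
proof -
  let ?S = "Poly_Mapping.keys P \<union> Poly_Mapping.keys Q"
  have "insertion \<phi> (P + Q) = (\<Sum>m\<in>?S. Poly_Mapping.lookup (P + Q) m * mon_value \<phi> m)"
    by (rule insertion_superset) (use keys_add[of P Q] in auto)
  then show ?thesis
    by (simp add: insertion_superset[of ?S] lookup_add distrib_right sum.distrib)
qed

lemma insertion_zero [simp]: "insertion \<phi> 0 = 0"
  by (simp add: insertion_def)

lemma insertion_single: "insertion \<phi> (Poly_Mapping.single m a) = a * mon_value \<phi> m"
  by (simp add: insertion_superset[of "{m}"])

lemma insertion_sum: "insertion \<phi> (\<Sum>i\<in>A. f i) = (\<Sum>i\<in>A. insertion \<phi> (f i))"
  by (induction A rule: infinite_finite_induct) (auto simp: insertion_add)

lemma insertion_mult: "insertion \<phi> (P * Q) = insertion \<phi> P * insertion \<phi> Q"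
proof -
  have single: "insertion \<phi> (P * Poly_Mapping.single k b)
      = insertion \<phi> P * insertion \<phi> (Poly_Mapping.single k b)" for k b
    by (subst (1 2) mpoly_eq_sum_single[of P])
       (simp only: sum_distrib_right insertion_sum mult_single insertion_single mon_value_add,
        simp add: mult_ac)
  show ?thesis
    by (subst (1 2) mpoly_eq_sum_single[of Q]) (simp add: sum_distrib_left insertion_sum single)
qed

lemma insertion_const [simp]: "insertion \<phi> (const c) = c"
  by (simp add: const_def insertion_single mon_value_def)

lemma insertion_var [simp]: "insertion \<phi> (var v) = \<phi> v"
  by (simp add: var_def insertion_single mon_value_def)

lemma insertion_one [simp]: "insertion \<phi> 1 = 1"
  using insertion_const[of \<phi> 1] by (simp add: const_def)

lemma insertion_uminus: "insertion \<phi> (- P) = - insertion \<phi> P"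
  using insertion_add[of \<phi> P "- P"] by (simp add: eq_neg_iff_add_eq_0 add.commute)

lemma insertion_diff: "insertion \<phi> (P - Q) = insertion \<phi> P - insertion \<phi> Q"
  using insertion_add[of \<phi> P "- Q"] by (simp add: insertion_uminus)

lemma insertion_prod: "insertion \<phi> (\<Prod>i\<in>A. f i) = (\<Prod>i\<in>A. insertion \<phi> (f i))"
  by (induction A rule: infinite_finite_induct) (auto simp: insertion_mult)

lemma insertion_cong:
  "(\<And>v. v \<in> vars P \<Longrightarrow> \<phi> v = \<psi> v) \<Longrightarrow> insertion \<phi> P = insertion \<psi> P"
  unfolding insertion_def vars_def
  by (intro sum.cong refl arg_cong[of _ _ "(*) _"] prod.cong) force

lemma insertion_comm_ring_hom: "comm_ring_hom (insertion \<phi>)"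
  by unfold_locales (auto simp: insertion_add insertion_mult)

section \<open>The variables that occur in a polynomial\<close>

lemma vars_add: "vars (P + Q) \<subseteq> vars P \<union> vars Q"
  using keys_add[of P Q] unfolding vars_def by blast

lemma vars_uminus [simp]: "vars (- P) = vars P"
  by (simp add: vars_def in_keys_iff)

lemma vars_diff: "vars (P - Q) \<subseteq> vars P \<union> vars Q"
  using vars_add[of P "- Q"] by simp

lemma vars_mult: "vars (P * Q) \<subseteq> vars P \<union> vars Q"
proof
  fix v assume "v \<in> vars (P * Q)"
  then obtain m where m: "m \<in> Poly_Mapping.keys (P * Q)" "v \<in> Poly_Mapping.keys m"
    unfolding vars_def by blast
  from m(1) keys_mult[of P Q] obtain a b where
    "m = a + b" "a \<in> Poly_Mapping.keys P" "b \<in> Poly_Mapping.keys Q" by blast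
  with m(2) keys_add[of a b] show "v \<in> vars P \<union> vars Q" unfolding vars_def by blast
qed

lemma vars_const [simp]: "vars (const c) = {}"
  by (simp add: vars_def const_def)

lemma vars_zero [simp]: "vars 0 = {}"
  by (simp add: vars_def)

lemma vars_one [simp]: "vars (1 :: ('v, 'a::comm_ring_1) mpoly) = {}"
  using vars_const[of 1] by (simp add: const_def)

lemma vars_var [simp]: "vars (var v :: ('v, 'a::comm_ring_1) mpoly) = {v}"
  by (simp add: vars_def var_def)

lemma vars_sum: "(\<And>i. i \<in> A \<Longrightarrow> vars (f i) \<subseteq> V) \<Longrightarrow> vars (\<Sum>i\<in>A. f i) \<subseteq> V"
proof (induction A rule: infinite_finite_induct)
  case (insert x F)
  then show ?case using vars_add[of "f x" "sum f F"] by auto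
qed auto

lemma vars_prod: "(\<And>i. i \<in> A \<Longrightarrow> vars (f i) \<subseteq> V) \<Longrightarrow> vars (\<Prod>i\<in>A. f i) \<subseteq> V"
proof (induction A rule: infinite_finite_induct)
  case (insert x F)
  then show ?case using vars_mult[of "f x" "prod f F"] by auto
qed auto

lemma vars_partial_deriv: "vars (partial_deriv v P) \<subseteq> vars P"
proof
  fix w assume "w \<in> vars (partial_deriv v P)"
  then obtain m where m: "Poly_Mapping.lookup (partial_deriv v P) m \<noteq> 0" "Poly_Mapping.lookup m w \<noteq> 0"
    unfolding vars_def by (auto simp: in_keys_iff)
  then have "Poly_Mapping.lookup P (m + Poly_Mapping.single v 1) \<noteq> 0"
    "Poly_Mapping.lookup (m + Poly_Mapping.single v 1) w \<noteq> 0"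
    by (auto simp: partial_deriv_lookup lookup_add)
  then show "w \<in> vars P" unfolding vars_def by (auto simp: in_keys_iff)
qed

lemma single_sum_eq_prod:
  "Poly_Mapping.single (\<Sum>i\<in>A. f i) (1::'a::comm_ring_1) = (\<Prod>i\<in>A. Poly_Mapping.single (f i) 1)"
proof (induction A rule: infinite_finite_induct)
  case (insert x F)
  then show ?case using mult_single[of "f x" "1::'a" "sum f F" 1] by simp
qed auto

lemma var_power: "var v ^ k = (Poly_Mapping.single (Poly_Mapping.single v k) 1 :: ('v, 'a::comm_ring_1) mpoly)"
  by (induction k) (auto simp: var_def mult_single simp flip: single_add)

lemma monomial_eq_prod:
  "Poly_Mapping.single m (c::'a::comm_ring_1)
    = const c * (\<Prod>v\<in>Poly_Mapping.keys m. var v ^ Poly_Mapping.lookup m v)"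
proof -
  have "Poly_Mapping.single m (1::'a) = (\<Prod>v\<in>Poly_Mapping.keys m. var v ^ Poly_Mapping.lookup m v)"
    unfolding var_power using mpoly_eq_sum_single[of m] single_sum_eq_prod by metis
  then show ?thesis using mult_single[of 0 c m 1] by (simp add: const_def)
qed

text \<open>The chain rules and the clearing of denominators below are statements closed under sums
  and products, so they need checking only on constants and variables. \<open>V\<close> carries the
  side condition on the variables to the case \<open>var\<close>.\<close>

lemma mpoly_induct [consumes 1, case_names const var add mult]:
  fixes P :: "('v, 'a::comm_ring_1) mpoly"
  assumes V: "vars P \<subseteq> V" and const: "\<And>c. R (const c)" and var: "\<And>v. v \<in> V \<Longrightarrow> R (var v)"
    and add: "\<And>P Q. R P \<Longrightarrow> R Q \<Longrightarrow> R (P + Q)" and mult: "\<And>P Q. R P \<Longrightarrow> R Q \<Longrightarrow> R (P * Q)"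
  shows "R P"
proof -
  have R0: "R 0" and R1: "R 1" using const[of 0] const[of 1] by (simp_all add: const_def)
  have pow: "R (Q ^ k)" if "R Q" for Q k by (induction k) (use that R1 mult in auto)
  have prod: "R (\<Prod>i\<in>A. f i)" if "\<And>i. i \<in> A \<Longrightarrow> R (f i)" for A and f :: "'v \<Rightarrow> _"
    using that by (induction A rule: infinite_finite_induct) (use R1 mult in auto)
  have sum: "R (\<Sum>i\<in>A. f i)" if "\<And>i. i \<in> A \<Longrightarrow> R (f i)" for A and f :: "('v \<Rightarrow>\<^sub>0 nat) \<Rightarrow> _"
    using that by (induction A rule: infinite_finite_induct) (use R0 add in auto)
  have "R (Poly_Mapping.single m c)" if "Poly_Mapping.keys m \<subseteq> V" for m c
    unfolding monomial_eq_prod[of m c] using that by (intro mult const prod pow var) auto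
  moreover have "Poly_Mapping.keys m \<subseteq> V" if "m \<in> Poly_Mapping.keys P" for m
    using V that unfolding vars_def by blast
  ultimately show ?thesis by (subst mpoly_eq_sum_single) (intro sum, blast)
qed

section \<open>Chain rules\<close>

lemma insertion_along_curve:
  fixes H :: "('v, 'a::field) mpoly" and Y :: "'v \<Rightarrow> 'a poly"
  assumes "vars H \<subseteq> V" "finite V"
  shows "\<exists>\<phi>. \<forall>t. poly \<phi> t = insertion (\<lambda>v. poly (Y v) t) H \<and>
    poly (pderiv \<phi>) t = (\<Sum>v\<in>V. insertion (\<lambda>v. poly (Y v) t) (partial_deriv v H) * poly (pderiv (Y v)) t)"
  using assms(1)
proof (induction H rule: mpoly_induct)
  case (const c)
  show ?case by (rule exI[of _ "[:c:]"]) simp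
next
  case (var v)
  have "(\<Sum>w\<in>V. insertion (\<lambda>v. poly (Y v) t) (partial_deriv w (var v)) * poly (pderiv (Y w)) t)
      = (\<Sum>w\<in>V. if w = v then poly (pderiv (Y v)) t else 0)" for t
    by (intro sum.cong) (auto simp: partial_deriv_var)
  then show ?case using assms(2) var by (intro exI[of _ "Y v"]) simp
next
  case (add P Q)
  then obtain \<phi> \<psi> where
    "\<forall>t. poly \<phi> t = insertion (\<lambda>v. poly (Y v) t) P \<and>
      poly (pderiv \<phi>) t = (\<Sum>v\<in>V. insertion (\<lambda>v. poly (Y v) t) (partial_deriv v P) * poly (pderiv (Y v)) t)"
    "\<forall>t. poly \<psi> t = insertion (\<lambda>v. poly (Y v) t) Q \<and>
      poly (pderiv \<psi>) t = (\<Sum>v\<in>V. insertion (\<lambda>v. poly (Y v) t) (partial_deriv v Q) * poly (pderiv (Y v)) t)"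
    by blast
  then show ?case
    by (intro exI[of _ "\<phi> + \<psi>"])
       (simp add: insertion_add partial_deriv_add pderiv_add distrib_right sum.distrib)
next
  case (mult P Q)
  then obtain \<phi> \<psi> where
    "\<forall>t. poly \<phi> t = insertion (\<lambda>v. poly (Y v) t) P \<and>
      poly (pderiv \<phi>) t = (\<Sum>v\<in>V. insertion (\<lambda>v. poly (Y v) t) (partial_deriv v P) * poly (pderiv (Y v)) t)"
    "\<forall>t. poly \<psi> t = insertion (\<lambda>v. poly (Y v) t) Q \<and>
      poly (pderiv \<psi>) t = (\<Sum>v\<in>V. insertion (\<lambda>v. poly (Y v) t) (partial_deriv v Q) * poly (pderiv (Y v)) t)"
    by blast
  then show ?case
    by (intro exI[of _ "\<phi> * \<psi>"])
       (simp add: insertion_add insertion_mult partial_deriv_mult pderiv_mult distrib_right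
          distrib_left sum.distrib sum_distrib_left mult_ac)
qed

text \<open>\<open>H\<close> is the composite of \<open>Q\<close> with the \<open>P i\<close>. It is
  characterized only through its values and those of its derivatives, which lets both statements run
  through one induction over \<open>Q\<close>.\<close>

lemma substitution_chain_rule:
  fixes Q :: "(nat, 'a::comm_ring_1) mpoly" and P :: "nat \<Rightarrow> ('w, 'a) mpoly"
  assumes "vars Q \<subseteq> {..<s}" and P: "\<And>i. i < s \<Longrightarrow> vars (P i) \<subseteq> V"
  shows "\<exists>H. vars H \<subseteq> V \<and> (\<forall>\<psi>. insertion \<psi> H = insertion (\<lambda>i. insertion \<psi> (P i)) Q) \<and>
    (\<forall>v \<psi>. insertion \<psi> (partial_deriv v H)
      = (\<Sum>i<s. insertion (\<lambda>i. insertion \<psi> (P i)) (partial_deriv i Q) * insertion \<psi> (partial_deriv v (P i))))"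
  using assms(1)
proof (induction Q rule: mpoly_induct)
  case (const c)
  show ?case by (rule exI[of _ "const c"]) simp
next
  case (var i)
  have "(\<Sum>j<s. insertion (\<lambda>i. insertion \<psi> (P i)) (partial_deriv j (var i)) * insertion \<psi> (partial_deriv v (P j)))
      = (\<Sum>j<s. if j = i then insertion \<psi> (partial_deriv v (P i)) else 0)" for \<psi> v
    by (intro sum.cong) (auto simp: partial_deriv_var)
  then show ?case using P var by (intro exI[of _ "P i"]) auto
next
  case (add Q1 Q2)
  then obtain H1 H2 where H: "vars H1 \<subseteq> V" "vars H2 \<subseteq> V"
    "\<forall>\<psi>. insertion \<psi> H1 = insertion (\<lambda>i. insertion \<psi> (P i)) Q1"
    "\<forall>\<psi>. insertion \<psi> H2 = insertion (\<lambda>i. insertion \<psi> (P i)) Q2"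
    "\<forall>v \<psi>. insertion \<psi> (partial_deriv v H1)
      = (\<Sum>i<s. insertion (\<lambda>i. insertion \<psi> (P i)) (partial_deriv i Q1) * insertion \<psi> (partial_deriv v (P i)))"
    "\<forall>v \<psi>. insertion \<psi> (partial_deriv v H2)
      = (\<Sum>i<s. insertion (\<lambda>i. insertion \<psi> (P i)) (partial_deriv i Q2) * insertion \<psi> (partial_deriv v (P i)))"
    by blast
  then show ?case using vars_add[of H1 H2]
    by (intro exI[of _ "H1 + H2"])
       (auto simp: insertion_add partial_deriv_add distrib_right sum.distrib)
next
  case (mult Q1 Q2)
  then obtain H1 H2 where H: "vars H1 \<subseteq> V" "vars H2 \<subseteq> V"
    "\<forall>\<psi>. insertion \<psi> H1 = insertion (\<lambda>i. insertion \<psi> (P i)) Q1"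
    "\<forall>\<psi>. insertion \<psi> H2 = insertion (\<lambda>i. insertion \<psi> (P i)) Q2"
    "\<forall>v \<psi>. insertion \<psi> (partial_deriv v H1)
      = (\<Sum>i<s. insertion (\<lambda>i. insertion \<psi> (P i)) (partial_deriv i Q1) * insertion \<psi> (partial_deriv v (P i)))"
    "\<forall>v \<psi>. insertion \<psi> (partial_deriv v H2)
      = (\<Sum>i<s. insertion (\<lambda>i. insertion \<psi> (P i)) (partial_deriv i Q2) * insertion \<psi> (partial_deriv v (P i)))"
    by blast
  then show ?case using vars_mult[of H1 H2]
    by (intro exI[of _ "H1 * H2"])
       (auto simp: insertion_add insertion_mult partial_deriv_mult distrib_right sum.distrib
         sum_distrib_left distrib_left mult_ac)
qed

section \<open>Degree in one variable\<close>

definition var_degree :: "'v \<Rightarrow> ('v, 'a::comm_ring_1) mpoly \<Rightarrow> nat" where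
  "var_degree v P = Max (insert 0 ((\<lambda>m. Poly_Mapping.lookup m v) ` Poly_Mapping.keys P))"

lemma lookup_le_var_degree: "Poly_Mapping.lookup P m \<noteq> 0 \<Longrightarrow> Poly_Mapping.lookup m v \<le> var_degree v P"
  unfolding var_degree_def by (rule Max_ge) (auto simp: in_keys_iff)

lemma var_degree_attained:
  assumes "var_degree v P \<noteq> 0" obtains m where "Poly_Mapping.lookup P m \<noteq> 0" "Poly_Mapping.lookup m v = var_degree v P"
proof -
  have "var_degree v P \<in> insert 0 ((\<lambda>m. Poly_Mapping.lookup m v) ` Poly_Mapping.keys P)"
    unfolding var_degree_def by (rule Max_in) auto
  with assms that show thesis by (auto simp: in_keys_iff)
qed

text \<open>Characteristic 0 keeps the top exponent of \<open>v\<close> alive under differentiation.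
  This is what later turns an algebraic relation of minimal degree into a non-trivial linear
  relation between differentials.\<close>

lemma var_degree_partial_deriv:
  fixes P :: "('v, 'a::field_char_0) mpoly"
  assumes "var_degree v P \<noteq> 0"
  shows "partial_deriv v P \<noteq> 0" "var_degree v (partial_deriv v P) < var_degree v P"
proof -
  from var_degree_attained[OF assms] obtain m where m: "Poly_Mapping.lookup P m \<noteq> 0" "Poly_Mapping.lookup m v = var_degree v P" .
  let ?d = "Poly_Mapping.single v (1::nat)"
  have "m - ?d + ?d = m"
    by (rule poly_mapping_eqI) (use m assms in \<open>auto simp: lookup_add lookup_minus lookup_single when_def\<close>)
  then have "Poly_Mapping.lookup (partial_deriv v P) (m - ?d) \<noteq> 0"
    using m(1) of_nat_neq_0[where 'a = 'a] unfolding partial_deriv_lookup by simp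
  then show "partial_deriv v P \<noteq> 0" by auto
  show "var_degree v (partial_deriv v P) < var_degree v P"
  proof (cases "var_degree v (partial_deriv v P) = 0")
    case False
    from var_degree_attained[OF this] obtain k where
      k: "Poly_Mapping.lookup (partial_deriv v P) k \<noteq> 0" "Poly_Mapping.lookup k v = var_degree v (partial_deriv v P)" .
    from k(1) have "Poly_Mapping.lookup P (k + ?d) \<noteq> 0" by (auto simp: partial_deriv_lookup)
    from lookup_le_var_degree[OF this, of v] k(2) show ?thesis by (simp add: lookup_add)
  qed (use assms in simp)
qed

lemma var_degree_0_vars: "var_degree v P = 0 \<Longrightarrow> v \<notin> vars P"
  using lookup_le_var_degree[of P _ v] unfolding vars_def by (force simp: in_keys_iff)

section \<open>Polynomials in a matrix\<close>

lemma index_mult_mat_sum: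
  assumes "A \<in> carrier_mat nr n" "B \<in> carrier_mat n nc" "i < nr" "j < nc"
  shows "(A * B) $$ (i, j) = (\<Sum>k<n. A $$ (i, k) * B $$ (k, j))"
  using assms by (auto simp: scalar_prod_def lessThan_atLeast0 intro!: sum.cong)

definition poly_mat :: "'a::comm_ring_1 poly \<Rightarrow> 'a mat \<Rightarrow> 'a mat" where
  "poly_mat f A = fold_coeffs (\<lambda>c M. c \<cdot>\<^sub>m 1\<^sub>m (dim_row A) + A * M) f (0\<^sub>m (dim_row A) (dim_row A))"

context
  fixes A :: "'a::comm_ring_1 mat" and n :: nat
  assumes A: "A \<in> carrier_mat n n"
begin

lemma poly_mat_0: "poly_mat 0 A = 0\<^sub>m n n"
  using A by (simp add: poly_mat_def)

lemma poly_mat_pCons: "poly_mat (pCons c f) A = c \<cdot>\<^sub>m 1\<^sub>m n + A * poly_mat f A"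
proof (cases "c = 0 \<and> f = 0")
  case True
  then show ?thesis using A by (auto simp: poly_mat_def intro!: eq_matI)
next
  case False
  then show ?thesis using A by (auto simp: poly_mat_def)
qed

lemma poly_mat_carrier [simp]: "poly_mat f A \<in> carrier_mat n n"
  by (induction f) (use A in \<open>auto simp: poly_mat_0 poly_mat_pCons\<close>)

lemma poly_mat_dim [simp]: "dim_row (poly_mat f A) = n" "dim_col (poly_mat f A) = n"
  by (rule carrier_matD[OF poly_mat_carrier])+

lemma poly_mat_add: "poly_mat (f + g) A = poly_mat f A + poly_mat g A"
proof (induction f arbitrary: g)
  case 0
  then show ?case by (simp add: poly_mat_0)
next
  case (pCons c f)
  show ?case
  proof (cases g)
    case (pCons d h)
    have "A * poly_mat (f + h) A = A * poly_mat f A + A * poly_mat h A"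
      unfolding pCons.IH by (rule mult_add_distrib_mat[OF A poly_mat_carrier poly_mat_carrier])
    then show ?thesis using A
      by (auto simp: pCons poly_mat_pCons algebra_simps intro!: eq_matI)
  qed
qed

lemma poly_mat_smult: "poly_mat (Polynomial.smult c f) A = c \<cdot>\<^sub>m poly_mat f A"
proof (induction f)
  case 0
  then show ?case by (simp add: poly_mat_0)
next
  case (pCons d f)
  have "A * (c \<cdot>\<^sub>m poly_mat f A) = c \<cdot>\<^sub>m (A * poly_mat f A)"
    by (rule mult_smult_distrib[OF A poly_mat_carrier])
  then show ?case using pCons A
    by (auto simp: poly_mat_pCons algebra_simps intro!: eq_matI)
qed

lemma poly_mat_uminus: "poly_mat (- f) A = - poly_mat f A"
  using poly_mat_smult[of "-1" f] A by (auto intro!: eq_matI)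

lemma poly_mat_diff: "poly_mat (f - g) A = poly_mat f A - poly_mat g A"
  using poly_mat_add[of f "- g"] A by (auto simp: poly_mat_uminus intro!: eq_matI)

lemma poly_mat_const: "poly_mat [:c:] A = c \<cdot>\<^sub>m 1\<^sub>m n"
  using A by (auto simp: poly_mat_pCons poly_mat_0 intro!: eq_matI)

lemma poly_mat_1: "poly_mat 1 A = 1\<^sub>m n"
  unfolding one_pCons by (auto simp: poly_mat_const intro!: eq_matI)

lemma poly_mat_X_mult: "poly_mat (pCons 0 f) A = A * poly_mat f A"
  using A by (auto simp: poly_mat_pCons intro!: eq_matI)

lemma poly_mat_mult: "poly_mat (f * g) A = poly_mat f A * poly_mat g A"
proof (induction f)
  case 0
  then show ?case by (simp add: poly_mat_0 left_mult_zero_mat[OF poly_mat_carrier])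
next
  case (pCons c f)
  have "poly_mat (pCons c f * g) A = c \<cdot>\<^sub>m poly_mat g A + A * (poly_mat f A * poly_mat g A)"
    by (simp add: poly_mat_add poly_mat_smult poly_mat_X_mult pCons.IH)
  also have "A * (poly_mat f A * poly_mat g A) = A * poly_mat f A * poly_mat g A"
    using A by (simp add: assoc_mult_mat[OF A poly_mat_carrier poly_mat_carrier])
  also have "c \<cdot>\<^sub>m poly_mat g A + A * poly_mat f A * poly_mat g A
      = (c \<cdot>\<^sub>m 1\<^sub>m n + A * poly_mat f A) * poly_mat g A"
    using A by (subst add_mult_distrib_mat[of _ n n _ _ n])
      (auto simp: mult_smult_assoc_mat[of _ n n] left_mult_one_mat[OF poly_mat_carrier])
  finally show ?case by (simp add: poly_mat_pCons)
qed

lemma poly_mat_commute: "poly_mat f A * poly_mat g A = poly_mat g A * poly_mat f A"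
  by (metis mult.commute poly_mat_mult)

lemma poly_mat_X: "poly_mat [:0, 1:] A = A"
  using A by (simp add: poly_mat_X_mult poly_mat_const one_pCons[symmetric] poly_mat_1)

lemma poly_mat_self_commute: "A * poly_mat f A = poly_mat f A * A"
  using poly_mat_commute[of "[:0, 1:]" f] by (simp add: poly_mat_X)

lemma index_poly_mat_sum:
  assumes "i < n" "j < n"
  shows "poly_mat (\<Sum>k\<in>S. f k) A $$ (i, j) = (\<Sum>k\<in>S. poly_mat (f k) A $$ (i, j))"
  by (induction S rule: infinite_finite_induct) (use assms in \<open>auto simp: poly_mat_add poly_mat_0\<close>)

text \<open>\<open>S\<close> may be rectangular: a square invertible \<open>S\<close> gives
  conjugation, one whose columns are a basis of an invariant subspace gives restriction to that
  subspace.\<close>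

lemma poly_mat_intertwine:
  assumes B: "B \<in> carrier_mat m m" and S: "S \<in> carrier_mat n m" and AS: "A * S = S * B"
  shows "poly_mat f A * S = S * poly_mat f B"
proof (induction f)
  case 0
  have "poly_mat 0 B = 0\<^sub>m m m" using B by (simp add: poly_mat_def)
  then show ?case using S by (simp add: poly_mat_0)
next
  case (pCons c f)
  have Bf: "poly_mat f B \<in> carrier_mat m m" for f
    by (induction f) (use B in \<open>auto simp: poly_mat_def\<close>)
  have pc: "poly_mat (pCons c f) B = c \<cdot>\<^sub>m 1\<^sub>m m + B * poly_mat f B"
    using B pCons.hyps by (auto simp: poly_mat_def)
  have "poly_mat (pCons c f) A * S = c \<cdot>\<^sub>m 1\<^sub>m n * S + A * poly_mat f A * S"
    unfolding poly_mat_pCons using A S by (intro add_mult_distrib_mat[of _ n n]) auto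
  also have "c \<cdot>\<^sub>m 1\<^sub>m n * S = c \<cdot>\<^sub>m S"
    using S by (simp add: mult_smult_assoc_mat[of _ n n])
  also have "A * poly_mat f A * S = A * (S * poly_mat f B)"
    using pCons.IH A S by (simp add: assoc_mult_mat[OF A poly_mat_carrier S])
  also have "\<dots> = S * (B * poly_mat f B)"
    using A S B Bf by (simp add: assoc_mult_mat[OF A S Bf, symmetric] AS assoc_mult_mat[OF S B Bf])
  also have "c \<cdot>\<^sub>m S + S * (B * poly_mat f B) = S * poly_mat (pCons c f) B"
    unfolding pc using S B Bf
    by (subst mult_add_distrib_mat[OF S, of _ m]) (auto simp: mult_smult_distrib[OF S, of _ m])
  finally show ?case .
qed

end

text \<open>Dividing \<open>p\<close> by \<open>t - \<mu>\<close> leaves the remainder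
  \<open>poly p \<mu>\<close>. Evaluated at \<open>A\<close>, where \<open>p\<close> vanishes, the
  quotient times \<open>A - \<mu>\<close> is the non-zero scalar
  \<open>- poly p \<mu>\<close>.\<close>

lemma poly_mat_linear_inverse:
  fixes p :: "'a::field poly"
  assumes A: "A \<in> carrier_mat n n" and p: "poly_mat p A = 0\<^sub>m n n" and \<mu>: "poly p \<mu> \<noteq> 0"
  obtains u where "poly_mat ([:- \<mu>, 1:] * u) A = 1\<^sub>m n"
proof -
  have "[:- \<mu>, 1:] dvd p - [:poly p \<mu>:]" by (simp flip: poly_eq_0_iff_dvd)
  then obtain h where h: "p - [:poly p \<mu>:] = [:- \<mu>, 1:] * h" by (auto elim: dvdE)
  have "poly_mat ([:- \<mu>, 1:] * Polynomial.smult (- 1 / poly p \<mu>) h) A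
      = poly_mat (Polynomial.smult (- 1 / poly p \<mu>) (p - [:poly p \<mu>:])) A"
    by (simp only: h mult_smult_right)
  also have "\<dots> = 1\<^sub>m n"
    unfolding poly_mat_smult[OF A] poly_mat_diff[OF A] poly_mat_const[OF A] p
    using \<mu> by (auto intro!: eq_matI)
  finally show thesis by (rule that)
qed

lemma poly_mat_prod_linear_inverse:
  fixes p :: "'a::field poly"
  assumes A: "A \<in> carrier_mat n n" and p: "poly_mat p A = 0\<^sub>m n n"
    and S: "finite S" "\<And>j. j \<in> S \<Longrightarrow> poly p (\<mu> j) \<noteq> 0"
  shows "\<exists>u. poly_mat (\<Prod>j\<in>S. [:- \<mu> j, 1:]) A * poly_mat u A = 1\<^sub>m n"
  using S
proof (induction S)
  case empty
  show ?case using poly_mat_1[OF A] by (intro exI[of _ 1]) simp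
next
  case (insert x S)
  let ?P = "\<Prod>j\<in>S. [:- \<mu> j, 1:]"
  from insert obtain u where u: "poly_mat (?P * u) A = 1\<^sub>m n"
    by (auto simp: poly_mat_mult[OF A])
  obtain v where v: "poly_mat ([:- \<mu> x, 1:] * v) A = 1\<^sub>m n"
    using poly_mat_linear_inverse[OF A p] insert.prems by (metis insertI1)
  have "poly_mat (([:- \<mu> x, 1:] * v) * (?P * u)) A = 1\<^sub>m n"
    by (subst poly_mat_mult[OF A]) (simp only: u v, simp)
  also have "([:- \<mu> x, 1:] * v) * (?P * u) = ([:- \<mu> x, 1:] * ?P) * (v * u)"
    by (simp only: mult_ac)
  finally show ?case
    unfolding poly_mat_mult[OF A, symmetric] prod.insert[OF insert.hyps(1,2)] by blast
qed

section \<open>Block diagonal, diagonal and transposed matrices\<close>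

lemma poly_mat_four_block_diag:
  assumes D: "D \<in> carrier_mat k k" and R: "R \<in> carrier_mat q q"
  shows "poly_mat f (four_block_mat D (0\<^sub>m k q) (0\<^sub>m q k) R)
    = four_block_mat (poly_mat f D) (0\<^sub>m k q) (0\<^sub>m q k) (poly_mat f R)"
proof -
  let ?Y = "four_block_mat D (0\<^sub>m k q) (0\<^sub>m q k) R"
  have Y: "?Y \<in> carrier_mat (k + q) (k + q)" using D R by auto
  show ?thesis
  proof (induction f)
    case 0
    show ?case unfolding poly_mat_0[OF Y] poly_mat_0[OF D] poly_mat_0[OF R] by (auto intro!: eq_matI)
  next
    case (pCons c f)
    have 1: "c \<cdot>\<^sub>m 1\<^sub>m (k + q) = four_block_mat (c \<cdot>\<^sub>m 1\<^sub>m k) (0\<^sub>m k q) (0\<^sub>m q k) (c \<cdot>\<^sub>m 1\<^sub>m q)"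
      by (auto intro!: eq_matI)
    show ?case
      unfolding poly_mat_pCons[OF Y] poly_mat_pCons[OF D] poly_mat_pCons[OF R] pCons.IH 1
      using D R poly_mat_carrier[OF D] poly_mat_carrier[OF R]
      by (subst mult_four_block_mat[of _ k k _ q _ q _ _ k _ q])
         (auto simp: add_four_block_mat[of _ k k _ q _ q])
  qed
qed

lemma poly_mat_diag:
  assumes D: "D = mat k k (\<lambda>(i, j). if i = j then \<mu> i else 0)"
  shows "poly_mat f D = mat k k (\<lambda>(i, j). if i = j then poly f (\<mu> i) else 0)"
proof -
  have DC: "D \<in> carrier_mat k k" by (simp add: D)
  show ?thesis
  proof (induction f)
    case 0
    show ?case unfolding poly_mat_0[OF DC] by (auto intro!: eq_matI)
  next
    case (pCons c f)
    show ?case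
    proof (rule eq_matI)
      fix i j assume "i < dim_row (mat k k (\<lambda>(i, j). if i = j then poly (pCons c f) (\<mu> i) else 0))"
        "j < dim_col (mat k k (\<lambda>(i, j). if i = j then poly (pCons c f) (\<mu> i) else 0))"
      then have ij: "i < k" "j < k" by auto
      have "(D * poly_mat f D) $$ (i, j) = (\<Sum>l<k. D $$ (i, l) * poly_mat f D $$ (l, j))"
        using ij DC poly_mat_carrier[OF DC] by (intro index_mult_mat_sum)
      also have "\<dots> = (\<Sum>l<k. if l = i then \<mu> i * poly_mat f D $$ (i, j) else 0)"
        using ij by (intro sum.cong) (auto simp: D)
      finally show "poly_mat (pCons c f) D $$ (i, j)
          = mat k k (\<lambda>(i, j). if i = j then poly (pCons c f) (\<mu> i) else 0) $$ (i, j)"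
        using ij DC by (simp add: poly_mat_pCons[OF DC] pCons.IH)
    qed (use DC poly_mat_carrier[OF DC] in auto)
  qed
qed

lemma poly_mat_transpose:
  assumes A: "A \<in> carrier_mat n n"
  shows "poly_mat f (transpose_mat A) = transpose_mat (poly_mat f A)"
proof (induction f)
  case 0
  then show ?case using A by (simp add: poly_mat_0[of _ n])
next
  case (pCons c f)
  have "transpose_mat (c \<cdot>\<^sub>m 1\<^sub>m n + A * poly_mat f A)
      = c \<cdot>\<^sub>m 1\<^sub>m n + transpose_mat (poly_mat f A * A)"
    using A poly_mat_carrier[OF A] unfolding poly_mat_self_commute[OF A, symmetric]
    by (auto intro!: eq_matI)
  also have "transpose_mat (poly_mat f A * A) = transpose_mat A * transpose_mat (poly_mat f A)"
    using A poly_mat_carrier[OF A] by (rule transpose_mult[rotated])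
  finally show ?case using A pCons.IH by (simp add: poly_mat_pCons[of _ n])
qed

text \<open>The module structure over the polynomial ring that \<open>A\<close> defines on column
  vectors. Vectors are plain functions, of which only the entries below the dimension count, so that
  they fit \<open>lin_indep\<close> and \<open>in_span\<close>.\<close>

definition poly_act :: "'a::comm_ring_1 mat \<Rightarrow> 'a poly \<Rightarrow> (nat \<Rightarrow> 'a) \<Rightarrow> nat \<Rightarrow> 'a" where
  "poly_act A f v p = (\<Sum>l<dim_col A. poly_mat f A $$ (p, l) * v l)"

context
  fixes A :: "'a::comm_ring_1 mat" and n p :: nat
  assumes A: "A \<in> carrier_mat n n" and p: "p < n"
begin

lemma poly_act_cong: "(\<And>l. l < n \<Longrightarrow> v l = w l) \<Longrightarrow> poly_act A f v p = poly_act A f w p"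
  using A by (simp add: poly_act_def)

lemma poly_act_add: "poly_act A (f + g) v p = poly_act A f v p + poly_act A g v p"
  using A p by (simp add: poly_act_def poly_mat_add[OF A] poly_mat_dim[OF A] distrib_right sum.distrib)

lemma poly_act_0: "poly_act A 0 v p = 0"
  using A p by (simp add: poly_act_def poly_mat_0[OF A])

lemma poly_act_diff: "poly_act A (f - g) v p = poly_act A f v p - poly_act A g v p"
  using A p by (simp add: poly_act_def poly_mat_diff[OF A] poly_mat_dim[OF A] left_diff_distrib sum_subtractf)

lemma poly_act_smult: "poly_act A (Polynomial.smult c f) v p = c * poly_act A f v p"
  using A p by (simp add: poly_act_def poly_mat_smult[OF A] poly_mat_dim[OF A] sum_distrib_left mult.assoc)

lemma poly_act_sum: "poly_act A (\<Sum>i\<in>S. f i) v p = (\<Sum>i\<in>S. poly_act A (f i) v p)"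
  by (induction S rule: infinite_finite_induct) (auto simp: poly_act_add poly_act_0)

lemma poly_act_1: "poly_act A 1 v p = v p"
proof -
  have "poly_act A 1 v p = (\<Sum>l<n. if l = p then v p else 0)"
    unfolding poly_act_def poly_mat_1[OF A] using A p by (intro sum.cong) auto
  then show ?thesis using p by simp
qed

lemma poly_act_X: "poly_act A [:0, 1:] v p = (\<Sum>l<n. A $$ (p, l) * v l)"
  using A by (simp add: poly_act_def poly_mat_X[OF A])

lemma poly_act_linear:
  "poly_act A [:- c, 1:] v p = (\<Sum>l<n. A $$ (p, l) * v l) - c * v p"
proof -
  have "[:- c, 1:] = [:0, 1:] - Polynomial.smult c 1" by (simp add: one_pCons)
  then show ?thesis by (simp only: poly_act_diff poly_act_smult poly_act_1 poly_act_X)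
qed

lemma poly_act_mult: "poly_act A (f * g) v p = poly_act A f (poly_act A g v) p"
proof -
  have "poly_act A (f * g) v p = (\<Sum>l<n. \<Sum>m<n. poly_mat f A $$ (p, m) * (poly_mat g A $$ (m, l) * v l))"
    using A p unfolding poly_act_def poly_mat_mult[OF A]
    by (intro sum.cong) (auto simp: index_mult_mat_sum[OF poly_mat_carrier[OF A] poly_mat_carrier[OF A]]
      sum_distrib_right mult.assoc simp del: index_mult_mat)
  also have "\<dots> = poly_act A f (poly_act A g v) p"
    using A by (subst sum.swap) (simp add: poly_act_def sum_distrib_left)
  finally show ?thesis .
qed

lemma poly_act_vec_diff: "poly_act A f (\<lambda>l. v l - w l) p = poly_act A f v p - poly_act A f w p"
  by (simp add: poly_act_def right_diff_distrib sum_subtractf)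

lemma poly_act_vec_add: "poly_act A f (\<lambda>l. v l + w l) p = poly_act A f v p + poly_act A f w p"
  by (simp add: poly_act_def distrib_left sum.distrib)

lemma poly_act_vec_scale: "poly_act A f (\<lambda>l. c * v l) p = c * poly_act A f v p"
  by (simp add: poly_act_def sum_distrib_left mult_ac)

lemma poly_act_vec_sum: "poly_act A f (\<lambda>l. \<Sum>i\<in>S. v i l) p = (\<Sum>i\<in>S. poly_act A f (v i) p)"
  unfolding poly_act_def sum_distrib_left by (rule sum.swap)

end

section \<open>Arrow matrices\<close>

definition node_poly :: "nat \<Rightarrow> (nat \<Rightarrow> 'a::field) \<Rightarrow> 'a poly" where
  "node_poly k \<mu> = (\<Prod>j<k. [:- \<mu> j, 1:])"

text \<open>The Lagrange basis polynomial without its normalizing constant: it stays monic, and its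
  product with the linear factor at \<open>\<mu> i\<close> is exactly
  \<open>node_poly\<close>.\<close>

definition lagrange_poly :: "nat \<Rightarrow> (nat \<Rightarrow> 'a::field) \<Rightarrow> nat \<Rightarrow> 'a poly" where
  "lagrange_poly k \<mu> i = (\<Prod>j\<in>{..<k} - {i}. [:- \<mu> j, 1:])"

lemma node_poly_factor: "i < k \<Longrightarrow> node_poly k \<mu> = [:- \<mu> i, 1:] * lagrange_poly k \<mu> i"
  unfolding node_poly_def lagrange_poly_def by (rule prod.remove) auto

lemma poly_lagrange_poly:
  assumes "inj_on \<mu> {..<k}" "i < k" "j < k"
  shows "poly (lagrange_poly k \<mu> i) (\<mu> j) = 0 \<longleftrightarrow> i \<noteq> j"
  using assms by (auto simp: lagrange_poly_def poly_prod inj_on_def)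

lemma poly_node_poly: "j < k \<Longrightarrow> poly (node_poly k \<mu>) (\<mu> j) = 0"
  by (auto simp: node_poly_def poly_prod)

lemma degree_prod_linear:
  "finite A \<Longrightarrow> degree (\<Prod>j\<in>A. [:- \<mu> j, 1::'a::field:]) = card A"
  by (subst degree_prod_eq_sum_degree) auto

lemma degree_node_poly: "degree (node_poly k \<mu>) = k"
  unfolding node_poly_def by (simp add: degree_prod_linear)

lemma monic_node_poly: "coeff (node_poly k \<mu>) k = 1"
  using monic_prod[of "{..<k}" "\<lambda>j. [:- \<mu> j, 1:]"] degree_node_poly[of k \<mu>]
  by (simp add: node_poly_def)

lemma degree_lagrange_poly: "i < k \<Longrightarrow> degree (lagrange_poly k \<mu> i) = k - 1"
  unfolding lagrange_poly_def by (simp add: degree_prod_linear)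

lemma lagrange_interpolation:
  assumes \<mu>: "inj_on \<mu> {..<k}" and f: "degree f < k"
  shows "f = (\<Sum>i<k. Polynomial.smult (poly f (\<mu> i) / poly (lagrange_poly k \<mu> i) (\<mu> i)) (lagrange_poly k \<mu> i))"
    (is "f = ?g")
proof (rule ccontr)
  assume "f \<noteq> ?g"
  then have nz: "f - ?g \<noteq> 0" by simp
  have "degree ?g \<le> k - 1"
    by (intro degree_sum_le) (auto simp: degree_lagrange_poly intro!: order_trans[OF degree_smult_le])
  then have deg: "degree (f - ?g) < k"
    using f by (intro le_less_trans[OF degree_diff_le[of f "k - 1" ?g]]) auto
  have "poly ?g (\<mu> j) = poly f (\<mu> j)" if "j < k" for j
  proof -
    have "poly ?g (\<mu> j) = (\<Sum>i<k. if i = j then poly f (\<mu> j) else 0)"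
      unfolding poly_sum using poly_lagrange_poly[OF \<mu> _ that] by (intro sum.cong) auto
    with that show ?thesis by simp
  qed
  then have "\<mu> ` {..<k} \<subseteq> {t. poly (f - ?g) t = 0}" by auto
  then have "card (\<mu> ` {..<k}) \<le> degree (f - ?g)"
    using poly_roots_finite[OF nz] card_poly_roots_bound[OF nz] by (meson card_mono order_trans)
  with deg show False by (simp add: card_image[OF \<mu>])
qed

section \<open>Block form of the corner and of the arrow\<close>

definition diag_block :: "nat \<Rightarrow> nat \<Rightarrow> (nat \<Rightarrow> 'a::comm_ring_1) \<Rightarrow> 'a mat \<Rightarrow> 'a mat" where
  "diag_block k q \<mu> R
    = four_block_mat (mat k k (\<lambda>(i, j). if i = j then \<mu> i else 0)) (0\<^sub>m k q) (0\<^sub>m q k) R"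

text \<open>The border meets only the diagonal part of the corner. The ones in the first row come
  from the basis used for a cyclic module with generator \<open>v\<close>: \<open>node_poly\<close>
  applied to \<open>v\<close> comes first, then the Lagrange polynomials applied to
  \<open>v\<close>, and multiplication by \<open>t\<close> sends the latter to
  \<open>node_poly\<close> plus \<open>\<mu> i\<close> times themselves.\<close>

definition arrow_block ::
    "nat \<Rightarrow> nat \<Rightarrow> 'a::comm_ring_1 \<Rightarrow> (nat \<Rightarrow> 'a) \<Rightarrow> (nat \<Rightarrow> 'a) \<Rightarrow> 'a mat \<Rightarrow> 'a mat" where
  "arrow_block k q a c \<mu> R = mat (Suc (k + q)) (Suc (k + q)) (\<lambda>(i, j).
     if i = 0 then (if j = 0 then a else if j \<le> k then 1 else 0)
     else if j = 0 then (if i \<le> k then c (i - 1) else 0)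
     else diag_block k q \<mu> R $$ (i - 1, j - 1))"

text \<open>This is the characteristic polynomial of the upper left block of size
  \<open>Suc k\<close>, that is, of the arrow without \<open>R\<close>.\<close>

definition arrow_poly :: "nat \<Rightarrow> 'a::field \<Rightarrow> (nat \<Rightarrow> 'a) \<Rightarrow> (nat \<Rightarrow> 'a) \<Rightarrow> 'a poly" where
  "arrow_poly k a c \<mu>
    = [:- a, 1:] * node_poly k \<mu> - (\<Sum>i<k. Polynomial.smult (c i) (lagrange_poly k \<mu> i))"

definition embed_corner :: "nat \<Rightarrow> nat \<Rightarrow> 'a::zero mat \<Rightarrow> 'a mat" where
  "embed_corner n m z = mat n n (\<lambda>(i, j). if m \<le> i \<and> m \<le> j then z $$ (i - m, j - m) else 0)"

lemma sum_lessThan_split2: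
  fixes k q :: nat and f :: "nat \<Rightarrow> 'a::comm_monoid_add"
  shows "(\<Sum>l<k + q. f l) = (\<Sum>i<k. f i) + (\<Sum>l<q. f (k + l))"
  by (induction q) (simp_all add: add.assoc)

lemma sum_lessThan_split3:
  fixes k q :: nat and f :: "nat \<Rightarrow> 'a::comm_monoid_add"
  shows "(\<Sum>l<Suc (k + q). f l) = f 0 + (\<Sum>i<k. f (Suc i)) + (\<Sum>l<q. f (Suc (k + l)))"
  unfolding sum.lessThan_Suc_shift sum_lessThan_split2 by (simp add: add.assoc)

lemma sum_delta_mult:
  fixes g :: "nat \<Rightarrow> 'a::comm_ring_1"
  assumes "j < k"
  shows "(\<Sum>i<k. f i * (if i = j then g i else 0)) = f j * g j"
    "(\<Sum>i<k. f i * (if j = i then g i else 0)) = f j * g j"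
    "(\<Sum>i<k. (if j = i then g i else 0) * f i) = g j * f j"
    "(\<Sum>i<k. (if i = j then g i else 0) * f i) = g j * f j"
  using assms by (simp_all add: if_distrib[of "\<lambda>x. _ * x"] if_distrib[of "\<lambda>x. x * _"] cong: if_cong)

locale arrow =
  fixes k q :: nat and a :: "'a::field" and c \<mu> :: "nat \<Rightarrow> 'a" and R :: "'a mat"
  assumes R: "R \<in> carrier_mat q q"
begin

abbreviation "n \<equiv> Suc (k + q)"
abbreviation "y \<equiv> arrow_block k q a c \<mu> R"
abbreviation "Y \<equiv> diag_block k q \<mu> R"

lemma y_carrier [simp]: "y \<in> carrier_mat n n"
  by (simp add: arrow_block_def)

lemma Y_carrier [simp]: "Y \<in> carrier_mat (k + q) (k + q)"
  using R by (simp add: diag_block_def)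

lemma index_Y:
  "i < k \<Longrightarrow> j < k \<Longrightarrow> Y $$ (i, j) = (if i = j then \<mu> i else 0)"
  "i < k \<Longrightarrow> j < q \<Longrightarrow> Y $$ (i, k + j) = 0"
  "i < q \<Longrightarrow> j < k \<Longrightarrow> Y $$ (k + i, j) = 0"
  "i < q \<Longrightarrow> j < q \<Longrightarrow> Y $$ (k + i, k + j) = R $$ (i, j)"
  using R by (auto simp: diag_block_def)

lemma index_y:
  "y $$ (0, 0) = a"
  "j < k \<Longrightarrow> y $$ (0, Suc j) = 1"
  "j < q \<Longrightarrow> y $$ (0, Suc (k + j)) = 0"
  "i < k \<Longrightarrow> y $$ (Suc i, 0) = c i"
  "i < q \<Longrightarrow> y $$ (Suc (k + i), 0) = 0"
  "i < k + q \<Longrightarrow> j < k + q \<Longrightarrow> y $$ (Suc i, Suc j) = Y $$ (i, j)"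
  by (auto simp: arrow_block_def)

lemma mult_Y:
  assumes b: "b \<in> carrier_mat (k + q) (k + q)" and i: "i < k + q"
  shows "j < k \<Longrightarrow> (b * Y) $$ (i, j) = b $$ (i, j) * \<mu> j"
    "j < q \<Longrightarrow> (b * Y) $$ (i, k + j) = (\<Sum>l<q. b $$ (i, k + l) * R $$ (l, j))"
  using i by (simp_all add: index_mult_mat_sum[OF b Y_carrier] sum_lessThan_split2 index_Y sum_delta_mult
      del: index_mult_mat)

lemma Y_mult:
  assumes b: "b \<in> carrier_mat (k + q) (k + q)" and j: "j < k + q"
  shows "i < k \<Longrightarrow> (Y * b) $$ (i, j) = \<mu> i * b $$ (i, j)"
    "i < q \<Longrightarrow> (Y * b) $$ (k + i, j) = (\<Sum>l<q. R $$ (i, l) * b $$ (k + l, j))"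
  using j by (simp_all add: index_mult_mat_sum[OF Y_carrier b] sum_lessThan_split2 index_Y sum_delta_mult
      del: index_mult_mat)

lemma mult_y:
  assumes b: "b \<in> carrier_mat n n" and i: "i < n"
  shows "(b * y) $$ (i, 0) = b $$ (i, 0) * a + (\<Sum>l<k. b $$ (i, Suc l) * c l)"
    "j < k \<Longrightarrow> (b * y) $$ (i, Suc j) = b $$ (i, 0) + b $$ (i, Suc j) * \<mu> j"
    "j < q \<Longrightarrow> (b * y) $$ (i, Suc (k + j)) = (\<Sum>l<q. b $$ (i, Suc (k + l)) * R $$ (l, j))"
  using i by (simp_all add: index_mult_mat_sum[OF b y_carrier] sum_lessThan_split3 index_y index_Y
      sum_delta_mult del: index_mult_mat sum.lessThan_Suc)

lemma y_mult:
  assumes b: "b \<in> carrier_mat n n" and j: "j < n"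
  shows "(y * b) $$ (0, j) = a * b $$ (0, j) + (\<Sum>l<k. b $$ (Suc l, j))"
    "i < k \<Longrightarrow> (y * b) $$ (Suc i, j) = c i * b $$ (0, j) + \<mu> i * b $$ (Suc i, j)"
    "i < q \<Longrightarrow> (y * b) $$ (Suc (k + i), j) = (\<Sum>l<q. R $$ (i, l) * b $$ (Suc (k + l), j))"
  using j by (simp_all add: index_mult_mat_sum[OF y_carrier b] sum_lessThan_split3 index_y index_Y
      sum_delta_mult del: index_mult_mat sum.lessThan_Suc)

lemma poly_mat_Y: "poly_mat f Y = diag_block k q (\<lambda>i. poly f (\<mu> i)) (poly_mat f R)"
  unfolding diag_block_def using R by (simp add: poly_mat_four_block_diag poly_mat_diag)

end

lemma index_diag_block:
  assumes "R \<in> carrier_mat q q"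
  shows "i < k \<Longrightarrow> j < k \<Longrightarrow> diag_block k q \<mu> R $$ (i, j) = (if i = j then \<mu> i else 0)"
    "i < k \<Longrightarrow> j < q \<Longrightarrow> diag_block k q \<mu> R $$ (i, k + j) = 0"
    "i < q \<Longrightarrow> j < k \<Longrightarrow> diag_block k q \<mu> R $$ (k + i, j) = 0"
    "i < q \<Longrightarrow> j < q \<Longrightarrow> diag_block k q \<mu> R $$ (k + i, k + j) = R $$ (i, j)"
  using assms by (auto simp: diag_block_def)

lemma less_add_cases: "(i::nat) < k + q \<Longrightarrow> (i < k \<Longrightarrow> P) \<Longrightarrow> (\<And>j. j < q \<Longrightarrow> i = k + j \<Longrightarrow> P) \<Longrightarrow> P"
  by (metis add_less_cancel_left le_add_diff_inverse not_less)

text \<open>Distinct nodes make the diagonal part of the corner regular; \<open>p\<close> kills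
  \<open>R\<close> but no node, so the two summands of the corner have disjoint spectra and every
  \<open>R - \<mu> i\<close> is invertible. The equation \<open>p_eq\<close> ties the border to
  \<open>R\<close>: the polynomial of the arrow part kills \<open>R\<close> as well.\<close>

locale generic_arrow = arrow k q a c \<mu> R
  for k q :: nat and a :: "'a::field" and c \<mu> :: "nat \<Rightarrow> 'a" and R :: "'a mat" +
  fixes p :: "'a poly"
  assumes inj: "inj_on \<mu> {..<k}" and p: "poly_mat p R = 0\<^sub>m q q"
    and p_nonzero: "\<And>i. i < k \<Longrightarrow> poly p (\<mu> i) \<noteq> 0"
    and p_eq: "p = arrow_poly k a c \<mu>"
begin

lemma commutator_quotient: "(u::'a) \<noteq> v \<Longrightarrow> t * v / (v - u) - u * t / (v - u) = t"
proof -
  assume "u \<noteq> v"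
  moreover have "t * v / (v - u) - u * t / (v - u) = t * (v - u) / (v - u)"
    by (simp add: right_diff_distrib diff_divide_distrib mult.commute)
  ultimately show ?thesis by simp
qed

lemma linear_inverse:
  assumes "i < k"
  obtains u where "poly_mat [:- \<mu> i, 1:] R * poly_mat u R = 1\<^sub>m q"
    "poly_mat u R * poly_mat [:- \<mu> i, 1:] R = 1\<^sub>m q"
  using poly_mat_prod_linear_inverse[OF R p, of "{i}" \<mu>] p_nonzero[OF assms] poly_mat_commute[OF R] by auto

lemma index_linear:
  assumes "l < q" "j < q"
  shows "poly_mat [:- \<mu> i, 1:] R $$ (l, j) = R $$ (l, j) - (if l = j then \<mu> i else 0)"
proof -
  have "[:- \<mu> i, 1:] = [:0, 1:] - Polynomial.smult (\<mu> i) 1" by (simp add: one_pCons)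
  then have "poly_mat [:- \<mu> i, 1:] R = R - \<mu> i \<cdot>\<^sub>m 1\<^sub>m q"
    by (simp only: poly_mat_diff[OF R] poly_mat_smult[OF R] poly_mat_1[OF R] poly_mat_X[OF R])
  then show ?thesis using assms R by simp
qed

text \<open>Apply \<open>node_poly\<close> at \<open>A\<close> to \<open>\<rho>\<close>. Each
  \<open>\<gamma>' i\<close> becomes \<open>c i\<close> times the Lagrange polynomial applied to
  \<open>\<gamma>\<close>, so the total is \<open>arrow_poly\<close> applied to
  \<open>\<gamma>\<close>, which is zero as this polynomial is \<open>p\<close>. Since
  \<open>p\<close> has no root among the nodes, \<open>node_poly\<close> at \<open>A\<close> is
  invertible. The lemma serves for the first column with \<open>A = R\<close> and for the first row
  with the transpose.\<close>

lemma arrow_poly_killed: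
  assumes A: "A \<in> carrier_mat q q" "poly_mat p A = 0\<^sub>m q q"
    and \<rho>: "\<And>l. l < q \<Longrightarrow> \<rho> l = (\<Sum>m<q. A $$ (l, m) * \<gamma> m) - a * \<gamma> l - (\<Sum>i<k. \<gamma>' i l)"
    and \<gamma>': "\<And>i l. i < k \<Longrightarrow> l < q \<Longrightarrow> (\<Sum>m<q. A $$ (l, m) * \<gamma>' i m) - \<mu> i * \<gamma>' i l = c i * \<gamma> l"
    and l: "l < q"
  shows "\<rho> l = 0"
proof -
  let ?g = "node_poly k \<mu>"
  have g\<gamma>': "poly_act A ?g (\<gamma>' i) m = c i * poly_act A (lagrange_poly k \<mu> i) \<gamma> m" if "i < k" "m < q" for i m
  proof -
    have "?g = lagrange_poly k \<mu> i * [:- \<mu> i, 1:]" using node_poly_factor[OF that(1)] by (simp only: mult.commute)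
    then have "poly_act A ?g (\<gamma>' i) m = poly_act A (lagrange_poly k \<mu> i) (poly_act A [:- \<mu> i, 1:] (\<gamma>' i)) m"
      by (simp only: poly_act_mult[OF A(1) that(2)])
    also have "\<dots> = poly_act A (lagrange_poly k \<mu> i) (\<lambda>l. c i * \<gamma> l) m"
      by (rule poly_act_cong[OF A(1) that(2)]) (use \<gamma>' that in \<open>simp add: poly_act_linear[OF A(1)]\<close>)
    finally show ?thesis by (simp only: poly_act_vec_scale[OF A(1) that(2)])
  qed
  have g\<rho>: "poly_act A ?g \<rho> m = 0" if m: "m < q" for m
  proof -
    have "poly_act A ?g \<rho> m = poly_act A ?g (\<lambda>l. poly_act A [:- a, 1:] \<gamma> l - (\<Sum>i<k. \<gamma>' i l)) m"
      by (rule poly_act_cong[OF A(1) m]) (simp add: \<rho> poly_act_linear[OF A(1)])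
    also have "\<dots> = poly_act A (?g * [:- a, 1:]) \<gamma> m - (\<Sum>i<k. poly_act A ?g (\<gamma>' i) m)"
      by (simp only: poly_act_vec_diff[OF A(1) m] poly_act_vec_sum[OF A(1) m] poly_act_mult[OF A(1) m])
    also have "\<dots> = poly_act A (arrow_poly k a c \<mu>) \<gamma> m"
      using m by (simp add: arrow_poly_def poly_act_diff[OF A(1)] poly_act_sum[OF A(1)]
          poly_act_smult[OF A(1)] g\<gamma>' mult.commute[of _ ?g] del: mult_pCons_right mult_pCons_left)
    finally show ?thesis using m A by (simp add: poly_act_def flip: p_eq)
  qed
  obtain u where u: "poly_mat ?g A * poly_mat u A = 1\<^sub>m q"
    using poly_mat_prod_linear_inverse[OF A, of "{..<k}" \<mu>] p_nonzero by (auto simp: node_poly_def)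
  have "\<rho> l = poly_act A 1 \<rho> l" by (simp add: poly_act_1[OF A(1) l])
  also have "\<dots> = poly_act A (u * ?g) \<rho> l"
    using u by (simp add: poly_act_def poly_mat_1[OF A(1)] poly_mat_mult[OF A(1)]
        poly_mat_commute[OF A(1), of u])
  also have "\<dots> = poly_act A u (\<lambda>_. 0) l"
    unfolding poly_act_mult[OF A(1) l] by (rule poly_act_cong[OF A(1) l]) (rule g\<rho>)
  finally show ?thesis by (simp add: poly_act_def)
qed

section \<open>Tangent vectors at a generic arrow matrix\<close>

context
  fixes b :: "'a mat" and w :: "nat \<Rightarrow> nat \<Rightarrow> 'a"
  assumes b: "b \<in> carrier_mat n n"
  defines "w \<equiv> \<lambda>i j. (b * y - y * b) $$ (i, j)"
begin

lemma index_w: "i < n \<Longrightarrow> j < n \<Longrightarrow> w i j = (b * y) $$ (i, j) - (y * b) $$ (i, j)"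
  using carrier_matD[OF b] carrier_matD[OF y_carrier] by (simp add: w_def del: index_mult_mat(1))

lemma w_00: "w 0 0 = (\<Sum>l<k. b $$ (0, Suc l) * c l - b $$ (Suc l, 0))"
  by (simp add: index_w mult_y[OF b] y_mult[OF b] sum_subtractf)

lemma w_0D: "j < k \<Longrightarrow> w 0 (Suc j) = b $$ (0, 0) + b $$ (0, Suc j) * \<mu> j - a * b $$ (0, Suc j) - (\<Sum>l<k. b $$ (Suc l, Suc j))"
  by (simp add: index_w mult_y[OF b] y_mult[OF b])

lemma w_0R: "j < q \<Longrightarrow> w 0 (Suc (k + j)) = (\<Sum>l<q. b $$ (0, Suc (k + l)) * R $$ (l, j))
    - a * b $$ (0, Suc (k + j)) - (\<Sum>l<k. b $$ (Suc l, Suc (k + j)))"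
  by (simp add: index_w mult_y[OF b] y_mult[OF b])

lemma w_D0: "i < k \<Longrightarrow> w (Suc i) 0 = b $$ (Suc i, 0) * a + (\<Sum>l<k. b $$ (Suc i, Suc l) * c l)
    - c i * b $$ (0, 0) - \<mu> i * b $$ (Suc i, 0)"
  by (simp add: index_w mult_y[OF b] y_mult[OF b])

lemma w_R0: "i < q \<Longrightarrow> w (Suc (k + i)) 0 = b $$ (Suc (k + i), 0) * a
    + (\<Sum>l<k. b $$ (Suc (k + i), Suc l) * c l) - (\<Sum>l<q. R $$ (i, l) * b $$ (Suc (k + l), 0))"
  by (simp add: index_w mult_y[OF b] y_mult[OF b])

lemma w_DD: "i < k \<Longrightarrow> j < k \<Longrightarrow> w (Suc i) (Suc j) = b $$ (Suc i, 0) - c i * b $$ (0, Suc j)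
    + b $$ (Suc i, Suc j) * (\<mu> j - \<mu> i)"
  by (simp add: index_w mult_y[OF b] y_mult[OF b] algebra_simps)

lemma w_DR: "i < k \<Longrightarrow> j < q \<Longrightarrow> w (Suc i) (Suc (k + j)) = (\<Sum>l<q. b $$ (Suc i, Suc (k + l)) * R $$ (l, j))
    - c i * b $$ (0, Suc (k + j)) - \<mu> i * b $$ (Suc i, Suc (k + j))"
  by (simp add: index_w mult_y[OF b] y_mult[OF b])

lemma w_RD: "i < q \<Longrightarrow> j < k \<Longrightarrow> w (Suc (k + i)) (Suc j) = b $$ (Suc (k + i), 0)
    + b $$ (Suc (k + i), Suc j) * \<mu> j - (\<Sum>l<q. R $$ (i, l) * b $$ (Suc (k + l), Suc j))"
  by (simp add: index_w mult_y[OF b] y_mult[OF b])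

lemma w_RR: "i < q \<Longrightarrow> j < q \<Longrightarrow> w (Suc (k + i)) (Suc (k + j))
    = (\<Sum>l<q. b $$ (Suc (k + i), Suc (k + l)) * R $$ (l, j))
    - (\<Sum>l<q. R $$ (i, l) * b $$ (Suc (k + l), Suc (k + j)))"
  by (simp add: index_w mult_y[OF b] y_mult[OF b])

lemma corner_diagonal_zero:
  assumes orth: "\<And>f. (\<Sum>i<k + q. \<Sum>j<k + q. poly_mat f Y $$ (i, j) * w (Suc j) (Suc i)) = 0"
    and i: "i < k"
  shows "w (Suc i) (Suc i) = 0"
proof -
  let ?l = "lagrange_poly k \<mu> i"
  \<comment> \<open>Divisible by \<open>p\<close>, hence zero on \<open>R\<close>, and scaled to the
    indicator of the node \<open>i\<close>: then \<open>f\<close> at \<open>Y\<close> is the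
    \<open>i\<close>-th diagonal matrix unit, and its pairing with the corner is the wanted
    entry.\<close>
  define f where "f = Polynomial.smult (1 / (poly p (\<mu> i) * poly ?l (\<mu> i))) (?l * p)"
  have f\<mu>: "poly f (\<mu> j) = (if j = i then 1 else 0)" if "j < k" for j
    using poly_lagrange_poly[OF inj i that] p_nonzero[OF i] by (auto simp: f_def)
  have fR: "poly_mat f R = 0\<^sub>m q q"
    using right_mult_zero_mat[OF poly_mat_carrier[OF R]]
    by (simp add: f_def poly_mat_smult[OF R] poly_mat_mult[OF R] p)
  have ent: "poly_mat f Y $$ (r, s) = (if s = i then (if r = i then 1 else 0) else 0)"
    if "r < k + q" "s < k + q" for r s
    using that i by (elim less_add_cases)
      (auto simp: poly_mat_Y fR index_diag_block[OF zero_carrier_mat] f\<mu>)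
  have "(\<Sum>r<k + q. \<Sum>s<k + q. poly_mat f Y $$ (r, s) * w (Suc s) (Suc r))
      = (\<Sum>r<k + q. \<Sum>s<k + q. if s = i then (if r = i then w (Suc i) (Suc i) else 0) else 0)"
    by (intro sum.cong refl) (auto simp: ent)
  also have "\<dots> = w (Suc i) (Suc i)" using i by simp
  finally show ?thesis using orth[of f] by simp
qed

text \<open>The equation for \<open>b'\<close> is solved block by block. Off-diagonal entries of the
  diagonal part are divided by differences of nodes, the diagonal ones vanish by orthogonality, and
  the mixed blocks are solved with the inverses of \<open>R - \<mu> i\<close>. For the
  \<open>R\<close> block nothing has to be inverted: the border is zero there, so the block of
  \<open>b\<close> itself solves the equation.\<close>

lemma corner_tangent:
  assumes orth: "\<And>f. (\<Sum>i<k + q. \<Sum>j<k + q. poly_mat f Y $$ (i, j) * w (Suc j) (Suc i)) = 0"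
  obtains b' where "b' \<in> carrier_mat (k + q) (k + q)"
    "\<And>i j. i < k + q \<Longrightarrow> j < k + q \<Longrightarrow> (b' * Y - Y * b') $$ (i, j) = w (Suc i) (Suc j)"
proof -
  have "\<forall>i. \<exists>N. i < k \<longrightarrow> N \<in> carrier_mat q q \<and> poly_mat [:- \<mu> i, 1:] R * N = 1\<^sub>m q \<and> N * poly_mat [:- \<mu> i, 1:] R = 1\<^sub>m q"
    using linear_inverse poly_mat_carrier[OF R] by metis
  then obtain N where N: "\<And>i. i < k \<Longrightarrow> N i \<in> carrier_mat q q"
    "\<And>i. i < k \<Longrightarrow> poly_mat [:- \<mu> i, 1:] R * N i = 1\<^sub>m q"
    "\<And>i. i < k \<Longrightarrow> N i * poly_mat [:- \<mu> i, 1:] R = 1\<^sub>m q" by metis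
  have NR: "(\<Sum>m<q. N i $$ (l, m) * R $$ (m, j)) - \<mu> i * N i $$ (l, j) = (if l = j then 1 else 0)"
    if "i < k" "l < q" "j < q" for i l j
  proof -
    have "(N i * poly_mat [:- \<mu> i, 1:] R) $$ (l, j)
        = (\<Sum>m<q. N i $$ (l, m) * (R $$ (m, j) - (if m = j then \<mu> i else 0)))"
      using that N(1) by (subst index_mult_mat_sum[OF _ poly_mat_carrier[OF R]]) (auto simp: index_linear)
    also have "\<dots> = (\<Sum>m<q. N i $$ (l, m) * R $$ (m, j)) - N i $$ (l, j) * \<mu> i"
      using that by (simp add: right_diff_distrib sum_subtractf sum_delta_mult)
    finally show ?thesis using that N(3) by (simp add: mult.commute)
  qed
  have RN: "(\<Sum>m<q. R $$ (l, m) * N i $$ (m, j)) - \<mu> i * N i $$ (l, j) = (if l = j then 1 else 0)"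
    if "i < k" "l < q" "j < q" for i l j
  proof -
    have "(poly_mat [:- \<mu> i, 1:] R * N i) $$ (l, j)
        = (\<Sum>m<q. (R $$ (l, m) - (if l = m then \<mu> i else 0)) * N i $$ (m, j))"
      using that N(1) by (subst index_mult_mat_sum[OF poly_mat_carrier[OF R]]) (auto simp: index_linear)
    also have "\<dots> = (\<Sum>m<q. R $$ (l, m) * N i $$ (m, j)) - \<mu> i * N i $$ (l, j)"
      using that by (simp add: left_diff_distrib sum_subtractf sum_delta_mult)
    finally show ?thesis using that N(2) by simp
  qed
  \<comment> \<open>In the mixed blocks the equations read \<open>b' (R - \<mu> i) = w\<close> for
    row \<open>i\<close> and \<open>(\<mu> j - R) b' = w\<close> for column \<open>j\<close>, which
    accounts for the side of \<open>N\<close> and for the minus sign.\<close>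
  define b' where "b' = mat (k + q) (k + q) (\<lambda>(i, j).
    if i < k then (if j < k then w (Suc i) (Suc j) / (\<mu> j - \<mu> i)
      else \<Sum>l<q. w (Suc i) (Suc (k + l)) * N i $$ (l, j - k))
    else (if j < k then - (\<Sum>l<q. N j $$ (i - k, l) * w (Suc (k + l)) (Suc j)) else b $$ (Suc i, Suc j)))"
  have b': "b' \<in> carrier_mat (k + q) (k + q)" by (simp add: b'_def)
  have b'_ent: "i < k \<Longrightarrow> j < k \<Longrightarrow> b' $$ (i, j) = w (Suc i) (Suc j) / (\<mu> j - \<mu> i)"
    "i < k \<Longrightarrow> j < q \<Longrightarrow> b' $$ (i, k + j) = (\<Sum>l<q. w (Suc i) (Suc (k + l)) * N i $$ (l, j))"
    "i < q \<Longrightarrow> j < k \<Longrightarrow> b' $$ (k + i, j) = - (\<Sum>l<q. N j $$ (i, l) * w (Suc (k + l)) (Suc j))"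
    "i < q \<Longrightarrow> j < q \<Longrightarrow> b' $$ (k + i, k + j) = b $$ (Suc (k + i), Suc (k + j))" for i j
    by (simp_all add: b'_def)
  note b'_simps = b'_ent mult_Y[OF b'] Y_mult[OF b']
  show thesis
  proof (rule that[OF b'])
    fix i j assume ij: "i < k + q" "j < k + q"
    have "(b' * Y) $$ (i, j) - (Y * b') $$ (i, j) = w (Suc i) (Suc j)"
      using ij
    proof (elim less_add_cases)
      assume "i < k" "j < k"
      then show ?thesis using ij inj corner_diagonal_zero[OF orth, of i]
        by (cases "i = j") (simp_all add: b'_simps inj_on_eq_iff commutator_quotient)
    next
      fix j' assume i: "i < k" and j': "j' < q" "j = k + j'"
      have "(b' * Y) $$ (i, j) - (Y * b') $$ (i, j)
          = (\<Sum>l<q. (\<Sum>m<q. w (Suc i) (Suc (k + m)) * N i $$ (m, l)) * R $$ (l, j'))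
            - \<mu> i * (\<Sum>m<q. w (Suc i) (Suc (k + m)) * N i $$ (m, j'))"
        using i j' by (simp add: b'_simps)
      also have "(\<Sum>l<q. (\<Sum>m<q. w (Suc i) (Suc (k + m)) * N i $$ (m, l)) * R $$ (l, j'))
          = (\<Sum>m<q. w (Suc i) (Suc (k + m)) * (\<Sum>l<q. N i $$ (m, l) * R $$ (l, j')))"
        unfolding sum_distrib_left sum_distrib_right mult.assoc by (rule sum.swap)
      also have "\<dots> - \<mu> i * (\<Sum>m<q. w (Suc i) (Suc (k + m)) * N i $$ (m, j'))
          = (\<Sum>m<q. w (Suc i) (Suc (k + m)) * ((\<Sum>l<q. N i $$ (m, l) * R $$ (l, j')) - \<mu> i * N i $$ (m, j')))"
        by (simp add: right_diff_distrib sum_subtractf sum_distrib_left mult_ac)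
      also have "\<dots> = w (Suc i) (Suc j)" using i j' by (simp add: NR sum_delta_mult)
      finally show ?thesis .
    next
      fix i' assume j: "j < k" and i': "i' < q" "i = k + i'"
      have "(b' * Y) $$ (i, j) - (Y * b') $$ (i, j)
          = - (\<Sum>m<q. N j $$ (i', m) * w (Suc (k + m)) (Suc j)) * \<mu> j
            + (\<Sum>l<q. R $$ (i', l) * (\<Sum>m<q. N j $$ (l, m) * w (Suc (k + m)) (Suc j)))"
        using j i' by (simp add: b'_simps sum_negf)
      also have "(\<Sum>l<q. R $$ (i', l) * (\<Sum>m<q. N j $$ (l, m) * w (Suc (k + m)) (Suc j)))
          = (\<Sum>m<q. (\<Sum>l<q. R $$ (i', l) * N j $$ (l, m)) * w (Suc (k + m)) (Suc j))"
        unfolding sum_distrib_left sum_distrib_right mult.assoc by (rule sum.swap)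
      also have "- (\<Sum>m<q. N j $$ (i', m) * w (Suc (k + m)) (Suc j)) * \<mu> j + \<dots>
          = (\<Sum>m<q. ((\<Sum>l<q. R $$ (i', l) * N j $$ (l, m)) - \<mu> j * N j $$ (i', m)) * w (Suc (k + m)) (Suc j))"
        by (simp add: left_diff_distrib right_diff_distrib sum_subtractf sum_distrib_left[of "\<mu> j"] mult_ac)
      also have "\<dots> = w (Suc i) (Suc j)" using j i' by (simp add: RN sum_delta_mult)
      finally show ?thesis .
    next
      fix i' j' assume "i' < q" "i = k + i'" "j' < q" "j = k + j'"
      then show ?thesis by (simp add: b'_simps w_RR)
    qed
    then show "(b' * Y - Y * b') $$ (i, j) = w (Suc i) (Suc j)"
      using ij carrier_matD[OF b'] carrier_matD[OF Y_carrier] by (simp del: index_mult_mat(1))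
  qed
qed

text \<open>A vanishing corner forces the border into a space of dimension at most \<open>k\<close>:
  the parts next to \<open>R\<close> vanish by \<open>arrow_poly_killed\<close>, the corner entry
  (0, 0) vanishes, and the first column is determined by the first row. The \<open>k\<close> free
  entries of the row are then matched by the values of a polynomial at the \<open>k\<close>
  nodes.\<close>

lemma border_tangent:
  assumes corner: "\<And>i j. i < k + q \<Longrightarrow> j < k + q \<Longrightarrow> w (Suc i) (Suc j) = 0"
  obtains f where "b * y - y * b = embed_corner n 1 (poly_mat f Y) * y - y * embed_corner n 1 (poly_mat f Y)"
proof -
  have bc: "b $$ (Suc i, 0) = c i * b $$ (0, Suc i)" if "i < k" for i
    using corner[of i i] that by (simp add: w_DD)
  \<comment> \<open>Comparing the vanishing entries (i, j) and (j, i) shows that the diagonal part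
    of \<open>b\<close> is symmetric up to scaling by \<open>c\<close>; this is what links column 0
    to row 0.\<close>
  have sym: "b $$ (Suc i, Suc j) * c j = c i * b $$ (Suc j, Suc i)" if "i < k" "j < k" for i j
  proof (cases "i = j")
    case False
    then have ne: "\<mu> j - \<mu> i \<noteq> 0" using inj that by (auto simp: inj_on_def)
    have h1: "b $$ (Suc i, Suc j) * (\<mu> j - \<mu> i) = c i * (b $$ (0, Suc j) - b $$ (0, Suc i))"
      using corner[of i j] that by (simp add: w_DD bc algebra_simps)
    have h2: "b $$ (Suc j, Suc i) * (\<mu> j - \<mu> i) = c j * (b $$ (0, Suc j) - b $$ (0, Suc i))"
      using corner[of j i] that by (simp add: w_DD bc algebra_simps)
    have "b $$ (Suc i, Suc j) * (\<mu> j - \<mu> i) * c j = b $$ (Suc j, Suc i) * (\<mu> j - \<mu> i) * c i"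
      unfolding h1 h2 by (simp only: mult_ac)
    then have "b $$ (Suc i, Suc j) * c j * (\<mu> j - \<mu> i) = c i * b $$ (Suc j, Suc i) * (\<mu> j - \<mu> i)"
      by (simp only: mult_ac)
    with ne show ?thesis by simp
  qed (simp add: mult.commute)
  have w0D: "w (Suc i) 0 = - c i * w 0 (Suc i)" if i: "i < k" for i
  proof -
    have "(\<Sum>l<k. b $$ (Suc i, Suc l) * c l) = c i * (\<Sum>l<k. b $$ (Suc l, Suc i))"
      unfolding sum_distrib_left by (intro sum.cong refl sym) (use i in auto)
    then show ?thesis using i by (simp add: w_D0 w_0D bc algebra_simps)
  qed
  have w00: "w 0 0 = 0" by (simp add: w_00 bc mult.commute)
  have w0R: "w 0 (Suc (k + j)) = 0" if "j < q" for j
  proof (rule arrow_poly_killed[where A = "transpose_mat R" and \<rho> = "\<lambda>j. w 0 (Suc (k + j))" and l = j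
      and \<gamma> = "\<lambda>l. b $$ (0, Suc (k + l))" and \<gamma>' = "\<lambda>i l. b $$ (Suc i, Suc (k + l))"])
    show "poly_mat p (transpose_mat R) = 0\<^sub>m q q"
      using poly_mat_transpose[OF R, of p] p by simp
    show "(\<Sum>m<q. transpose_mat R $$ (l, m) * b $$ (Suc i, Suc (k + m))) - \<mu> i * b $$ (Suc i, Suc (k + l))
        = c i * b $$ (0, Suc (k + l))" if "i < k" "l < q" for i l
      using corner[of i "k + l"] that R by (simp add: w_DR mult.commute algebra_simps)
  qed (use that R in \<open>auto simp: w_0R mult.commute\<close>)
  have wR0: "- w (Suc (k + i)) 0 = 0" if "i < q" for i
  proof (rule arrow_poly_killed[where A = R and \<rho> = "\<lambda>i. - w (Suc (k + i)) 0" and l = i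
      and \<gamma> = "\<lambda>l. b $$ (Suc (k + l), 0)" and \<gamma>' = "\<lambda>i l. c i * b $$ (Suc (k + l), Suc i)"])
    show "(\<Sum>m<q. R $$ (l, m) * (c i * b $$ (Suc (k + m), Suc i))) - \<mu> i * (c i * b $$ (Suc (k + l), Suc i))
        = c i * b $$ (Suc (k + l), 0)" if "i < k" "l < q" for i l
    proof -
      have "b $$ (Suc (k + l), 0) = (\<Sum>m<q. R $$ (l, m) * b $$ (Suc (k + m), Suc i)) - b $$ (Suc (k + l), Suc i) * \<mu> i"
        using corner[of "k + l" i] that by (simp add: w_RD algebra_simps)
      then show ?thesis by (simp add: sum_distrib_left right_diff_distrib mult_ac)
    qed
  qed (use that R p in \<open>auto simp: w_R0 mult_ac\<close>)
  \<comment> \<open>The embedded matrix has zero first row, so only \<open>- y E\<close> contributes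
    to the first row of the commutator. Its entry at node \<open>j\<close> is minus the value of
    \<open>f\<close> there, hence the sign.\<close>
  define f where "f = (\<Sum>i<k. Polynomial.smult (- w 0 (Suc i) / poly (lagrange_poly k \<mu> i) (\<mu> i)) (lagrange_poly k \<mu> i))"
  have f\<mu>: "poly f (\<mu> j) = - w 0 (Suc j)" if "j < k" for j
  proof -
    have "poly f (\<mu> j) = (\<Sum>i<k. if i = j then - w 0 (Suc j) else 0)"
      unfolding f_def poly_sum using poly_lagrange_poly[OF inj _ that] by (intro sum.cong) auto
    with that show ?thesis by simp
  qed
  define E where "E = embed_corner n 1 (poly_mat f Y)"
  have E: "E \<in> carrier_mat n n" by (simp add: E_def embed_corner_def)
  have E_ent: "E $$ (0, j) = 0" "E $$ (j, 0) = 0" if "j < n" for j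
    using that by (auto simp: E_def embed_corner_def)
  have E_Suc: "E $$ (Suc i, Suc j) = diag_block k q (\<lambda>i. poly f (\<mu> i)) (poly_mat f R) $$ (i, j)"
    if "i < k + q" "j < k + q" for i j
    using that by (simp add: E_def embed_corner_def poly_mat_Y)
  note E_simps = E_ent E_Suc index_diag_block[OF poly_mat_carrier[OF R]] mult_y[OF E] y_mult[OF E]
  have RfR: "(\<Sum>l<q. poly_mat f R $$ (i, l) * R $$ (l, j)) = (\<Sum>l<q. R $$ (i, l) * poly_mat f R $$ (l, j))"
    if "i < q" "j < q" for i j
    unfolding index_mult_mat_sum[OF R poly_mat_carrier[OF R] that, symmetric]
      index_mult_mat_sum[OF poly_mat_carrier[OF R] R that, symmetric] poly_mat_self_commute[OF R] ..
  have "w i j = (E * y) $$ (i, j) - (y * E) $$ (i, j)" if ij: "i < n" "j < n" for i j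
  proof -
    consider "i = 0" "j = 0" | j' where "i = 0" "j = Suc j'" "j' < k" | j' where "i = 0" "j = Suc (k + j')" "j' < q"
      | i' where "j = 0" "i = Suc i'" "i' < k" | i' where "j = 0" "i = Suc (k + i')" "i' < q"
      | i' j' where "i = Suc i'" "j = Suc j'" "i' < k + q" "j' < k + q"
      using ij less_Suc_eq_0_disj[of i "k + q"] less_Suc_eq_0_disj[of j "k + q"]
      by (auto elim: less_add_cases)
    then show ?thesis
    proof cases
      case 1
      then show ?thesis by (simp add: w00 E_simps)
    next
      case (2 j')
      then show ?thesis by (simp add: E_simps f\<mu>)
    next
      case (3 j')
      then show ?thesis by (simp add: w0R E_simps)
    next
      case (4 i')
      then show ?thesis by (simp add: w0D E_simps f\<mu> sum_delta_mult)
    next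
      case (5 i')
      then show ?thesis using wR0[of i'] by (simp add: E_simps)
    next
      case (6 i' j')
      show ?thesis unfolding 6(1,2) corner[OF 6(3,4)]
        by (rule less_add_cases[OF 6(3)]; rule less_add_cases[OF 6(4)])
          (simp_all add: E_simps RfR)
    qed
  qed
  then have "b * y - y * b = E * y - y * E"
    using carrier_matD[OF b] carrier_matD[OF E] carrier_matD[OF y_carrier]
    by (intro eq_matI) (simp_all add: w_def del: index_mult_mat(1))
  then show thesis unfolding E_def by (rule that)
qed

end

end

section \<open>Splitting off a cyclic summand\<close>

text \<open>A vector space over an infinite field is not a finite union of proper subspaces. The new
  condition is met by moving \<open>v\<close> along a line whose direction \<open>u\<close> avoids
  the new kernel.\<close>

lemma avoid_kernels:
  fixes x :: "'a::field_char_0 mat"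
  assumes x: "x \<in> carrier_mat n n" and "finite F" "\<And>f. f \<in> F \<Longrightarrow> poly_mat f x \<noteq> 0\<^sub>m n n"
  shows "\<exists>v. \<forall>f\<in>F. \<exists>r<n. poly_act x f v r \<noteq> 0"
  using assms(2,3)
proof (induction F)
  case (insert f F)
  then obtain v where v: "\<forall>g\<in>F. \<exists>r<n. poly_act x g v r \<noteq> 0" by auto
  have "\<exists>r s. r < n \<and> s < n \<and> poly_mat f x $$ (r, s) \<noteq> 0"
    using insert.prems[of f] poly_mat_dim[OF x, of f] by (metis eq_matI index_zero_mat insertI1)
  then obtain r s where rs: "r < n" "s < n" "poly_mat f x $$ (r, s) \<noteq> 0" by blast
  define u where "u l = (if l = s then 1 else 0 :: 'a)" for l
  have fu: "poly_act x f u r \<noteq> 0"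
    using rs carrier_matD[OF x] by (simp add: poly_act_def u_def sum_delta_mult)
  from v have "\<forall>g. \<exists>\<rho>. g \<in> F \<longrightarrow> \<rho> < n \<and> poly_act x g v \<rho> \<noteq> 0" by blast
  then obtain \<rho> where \<rho>: "\<And>g. g \<in> F \<Longrightarrow> \<rho> g < n \<and> poly_act x g v (\<rho> g) \<noteq> 0" by metis
  \<comment> \<open>Each factor is one coordinate of the image of \<open>v + t u\<close> under a
    member of the family. It is a non-zero polynomial in \<open>t\<close>: for \<open>f\<close>
    because of its slope, for the others because of its value at 0.\<close>
  let ?P = "[:poly_act x f v r, poly_act x f u r:] * (\<Prod>g\<in>F. [:poly_act x g v (\<rho> g), poly_act x g u (\<rho> g):])"
  have "?P \<noteq> 0" using fu \<rho> insert.hyps(1) by (subst mult_eq_0_iff) (auto simp: prod_zero_iff)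
  then have "finite {t. poly ?P t = 0}" by (rule poly_roots_finite)
  then obtain t where t: "poly ?P t \<noteq> 0" using ex_new_if_finite[OF infinite_UNIV_char_0] by blast
  have act: "poly_act x g (\<lambda>l. v l + t * u l) r' = poly_act x g v r' + t * poly_act x g u r'" if "r' < n" for g r'
    using poly_act_vec_add[OF x that] poly_act_vec_scale[OF x that] by simp
  have "\<exists>r<n. poly_act x g (\<lambda>l. v l + t * u l) r \<noteq> 0" if "g \<in> insert f F" for g
  proof (cases "g = f")
    case True
    from t have "poly [:poly_act x f v r, poly_act x f u r:] t \<noteq> 0" by (simp only: poly_mult) simp
    with True rs(1) show ?thesis by (auto simp: act)
  next
    case False
    with that have g: "g \<in> F" by simp
    from t have "poly (\<Prod>g\<in>F. [:poly_act x g v (\<rho> g), poly_act x g u (\<rho> g):]) t \<noteq> 0"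
      by (simp only: poly_mult) simp
    with g insert.hyps(1) have "poly_act x g v (\<rho> g) + t * poly_act x g u (\<rho> g) \<noteq> 0"
      by (auto simp: poly_prod prod_zero_iff)
    then show ?thesis using \<rho>[OF g] by (auto simp: act)
  qed
  then show ?case by blast
qed simp

lemma minimal_polynomial_exists:
  fixes x :: "'a::field mat"
  assumes x: "x \<in> carrier_mat n n" and n: "0 < n"
  obtains p where "poly_mat p x = 0\<^sub>m n n" "coeff p (degree p) = 1" "0 < degree p"
    "\<And>f. f \<noteq> 0 \<Longrightarrow> degree f < degree p \<Longrightarrow> poly_mat f x \<noteq> 0\<^sub>m n n"
proof -
  let ?ann = "\<lambda>f. f \<noteq> 0 \<and> poly_mat f x = 0\<^sub>m n n"
  let ?I = "{..<n} \<times> {..<n}"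
  let ?v = "\<lambda>j pq. poly_mat (monom 1 j) x $$ pq"
  have "\<not> lin_indep ?I (Suc (card ?I)) ?v"
    using lin_indep_le_card[of ?I "Suc (card ?I)" ?v] by auto
  then obtain c j where c: "\<forall>p\<in>?I. (\<Sum>j<Suc (card ?I). c j * ?v j p) = 0" "j < Suc (card ?I)" "c j \<noteq> 0"
    unfolding lin_indep_def by blast
  define f where "f = (\<Sum>j<Suc (card ?I). Polynomial.smult (c j) (monom 1 j))"
  have "coeff f j = (\<Sum>i<Suc (card ?I). if i = j then c j else 0)"
    unfolding f_def coeff_sum by (intro sum.cong) auto
  then have "coeff f j \<noteq> 0" using c by (simp del: sum.lessThan_Suc)
  then have "f \<noteq> 0" by auto
  moreover have "poly_mat f x = 0\<^sub>m n n"
  proof (rule eq_matI)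
    fix r s assume "r < dim_row (0\<^sub>m n n)" "s < dim_col (0\<^sub>m n n)"
    then show "poly_mat f x $$ (r, s) = 0\<^sub>m n n $$ (r, s)"
      using c(1) poly_mat_dim[OF x]
      by (simp add: f_def index_poly_mat_sum[OF x] poly_mat_smult[OF x] del: sum.lessThan_Suc)
  qed (use poly_mat_dim[OF x] in auto)
  ultimately have "?ann f" by simp
  then obtain p where p: "?ann p" and min: "\<And>f. ?ann f \<Longrightarrow> degree p \<le> degree f"
    using ex_has_least_nat[of ?ann f degree] by blast
  define p' where "p' = Polynomial.smult (1 / lead_coeff p) p"
  have deg: "degree p' = degree p" using p by (simp add: p'_def)
  show thesis
  proof (rule that[of p'])
    show "poly_mat p' x = 0\<^sub>m n n" using p by (simp add: p'_def poly_mat_smult[OF x])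
    show "coeff p' (degree p') = 1" unfolding deg using p by (simp add: p'_def)
    show "poly_mat f x \<noteq> 0\<^sub>m n n" if "f \<noteq> 0" "degree f < degree p'" for f
      using min[of f] that by (auto simp: deg)
    show "0 < degree p'"
    proof (rule ccontr)
      assume "\<not> 0 < degree p'"
      then obtain d where d: "p = [:d:]" unfolding deg by (auto elim: degree_eq_zeroE)
      then have "d \<cdot>\<^sub>m 1\<^sub>m n = 0\<^sub>m n n" using p by (simp add: poly_mat_const[OF x])
      then have "(d \<cdot>\<^sub>m 1\<^sub>m n) $$ (0, 0) = 0" using n by simp
      then show False using d p n by simp
    qed
  qed
qed

text \<open>It is enough that \<open>v\<close> avoids the kernels of the finitely many polynomials
  \<open>p div (t - z)\<close> with \<open>z\<close> a root of \<open>p\<close>. Indeed a polynomial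
  \<open>h\<close> of least degree killing \<open>v\<close> divides \<open>p\<close>; if its degree
  is smaller, the cofactor has a root \<open>z\<close>, so \<open>h\<close> divides
  \<open>p div (t - z)\<close> and this polynomial kills \<open>v\<close> too.\<close>

lemma cyclic_vector_exists:
  fixes x :: "'a::{alg_closed_field, field_char_0} mat"
  assumes x: "x \<in> carrier_mat n n" and p: "poly_mat p x = 0\<^sub>m n n" "0 < degree p"
    and min: "\<And>f. f \<noteq> 0 \<Longrightarrow> degree f < degree p \<Longrightarrow> poly_mat f x \<noteq> 0\<^sub>m n n"
  obtains v where "\<And>f. degree f < degree p \<Longrightarrow> (\<And>r. r < n \<Longrightarrow> poly_act x f v r = 0) \<Longrightarrow> f = 0"
proof -
  have p0: "p \<noteq> 0" using p(2) by auto
  let ?Z = "{z. poly p z = 0}"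
  let ?F = "(\<lambda>z. p div [:- z, 1:]) ` ?Z"
  have div: "p = [:- z, 1:] * (p div [:- z, 1:])" if "poly p z = 0" for z
    using that by (simp only: poly_eq_0_iff_dvd dvd_mult_div_cancel)
  have "poly_mat f x \<noteq> 0\<^sub>m n n" if "f \<in> ?F" for f
  proof -
    from that obtain z where z: "poly p z = 0" "f = p div [:- z, 1:]" by blast
    with div have pf: "p = [:- z, 1:] * f" by blast
    then have f0: "f \<noteq> 0" using p0 by auto
    then have "degree p = 1 + degree f" by (subst pf, subst degree_mult_eq) auto
    with min f0 show ?thesis by simp
  qed
  then obtain v where v: "\<forall>f\<in>?F. \<exists>r<n. poly_act x f v r \<noteq> 0"
    using avoid_kernels[OF x, of ?F] poly_roots_finite[OF p0] by blast
  let ?kill = "\<lambda>f. f \<noteq> 0 \<and> (\<forall>r<n. poly_act x f v r = 0)"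
  have "f = 0" if f: "degree f < degree p" "\<And>r. r < n \<Longrightarrow> poly_act x f v r = 0" for f
  proof (rule ccontr)
    assume "f \<noteq> 0"
    with f have "?kill f" by blast
    then obtain h where h: "?kill h" and hmin: "\<And>f. ?kill f \<Longrightarrow> degree h \<le> degree f"
      using ex_has_least_nat[of ?kill f degree] by blast
    have kill_mult: "poly_act x (e * h) v r = 0" if "r < n" for e r
    proof -
      have "poly_act x (e * h) v r = poly_act x e (\<lambda>_. 0) r"
        unfolding poly_act_mult[OF x that] by (rule poly_act_cong[OF x that]) (use h in blast)
      then show ?thesis by (simp add: poly_act_def)
    qed
    have "p mod h = 0"
    proof (rule ccontr)
      assume nz: "p mod h \<noteq> 0"
      have "poly_act x (p mod h) v r = 0" if r: "r < n" for r
      proof -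
        have "p mod h = p - p div h * h" by (simp add: minus_div_mult_eq_mod)
        then show ?thesis using r kill_mult[OF r]
          by (simp only: poly_act_diff[OF x r]) (simp add: poly_act_def p(1) carrier_matD[OF x])
      qed
      with nz hmin[of "p mod h"] have "degree h \<le> degree (p mod h)" by blast
      with degree_mod_less[of h p] nz h show False by auto
    qed
    then obtain e where e: "p = h * e" by (auto elim: dvdE)
    have "degree h < degree p" using hmin[of f] \<open>?kill f\<close> f by auto
    moreover have e0: "e \<noteq> 0" using p0 e by auto
    ultimately have "0 < degree e" using e h by (simp add: degree_mult_eq)
    then obtain z where "poly e z = 0" using alg_closed_imp_poly_has_root[of e] by blast
    then obtain e' where e': "e = [:- z, 1:] * e'" unfolding poly_eq_0_iff_dvd by (auto elim: dvdE)
    have "p = [:- z, 1:] * (e' * h)" using e e' by (simp only: mult_ac)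
    then have "p div [:- z, 1:] = e' * h" "poly p z = 0"
      by (metis nonzero_mult_div_cancel_left pCons_eq_0_iff one_neq_zero, simp)
    then have "e' * h \<in> ?F" by force
    with v kill_mult show False by blast
  qed
  then show thesis by (rule that)
qed

section \<open>Invertible matrices from bases, and a supply of nodes\<close>

lemma det_nonzero_inverse:
  fixes S :: "'a::field mat"
  assumes S: "S \<in> carrier_mat n n" and d: "det S \<noteq> 0"
  obtains T where "T \<in> carrier_mat n n" "S * T = 1\<^sub>m n" "T * S = 1\<^sub>m n"
proof (rule that[of "(1 / det S) \<cdot>\<^sub>m adj_mat S"])
  note a = adj_mat[OF S]
  show "(1 / det S) \<cdot>\<^sub>m adj_mat S \<in> carrier_mat n n" using a by simp
  show "S * ((1 / det S) \<cdot>\<^sub>m adj_mat S) = 1\<^sub>m n"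
    using a d by (auto simp: mult_smult_distrib[OF S a(1)] intro!: eq_matI)
  show "(1 / det S) \<cdot>\<^sub>m adj_mat S * S = 1\<^sub>m n"
    using a d by (auto simp: mult_smult_assoc_mat[OF a(1) S] intro!: eq_matI)
qed

lemma lin_indep_det_nonzero:
  fixes S :: "'a::field mat"
  assumes S: "S \<in> carrier_mat n n" and ind: "lin_indep {..<n} n (\<lambda>j r. S $$ (r, j))"
  shows "det S \<noteq> 0"
proof
  assume "det S = 0"
  then obtain v where v: "v \<in> carrier_vec n" "v \<noteq> 0\<^sub>v n" "S *\<^sub>v v = 0\<^sub>v n"
    using det_0_iff_vec_prod_zero_field[OF S] by blast
  have "(\<Sum>j<n. v $ j * S $$ (r, j)) = 0" if "r \<in> {..<n}" for r
  proof -
    have "(S *\<^sub>v v) $ r = (\<Sum>j<n. v $ j * S $$ (r, j))"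
      using that S v(1) by (auto simp: scalar_prod_def lessThan_atLeast0 mult.commute intro!: sum.cong)
    then show ?thesis using v(3) that by simp
  qed
  from lin_indepD[OF ind this] have "v = 0\<^sub>v n" using v(1) by (intro eq_vecI) auto
  with v(2) show False by simp
qed

lemma unit_vectors_indep: "lin_indep {..<n} n (\<lambda>j r. if r = j then 1 else 0 :: 'a::field)"
  unfolding lin_indep_def
proof (intro allI impI)
  fix c :: "nat \<Rightarrow> 'a" and j
  assume "\<forall>p\<in>{..<n}. (\<Sum>j<n. c j * (if p = j then 1 else 0)) = 0" "j < n"
  then show "c j = 0" by (simp add: sum_delta_mult)
qed

lemma distinct_nonroots:
  fixes p :: "'a::field_char_0 poly"
  assumes "p \<noteq> 0"
  obtains \<mu> :: "nat \<Rightarrow> 'a" where "inj \<mu>" "\<And>i. poly p (\<mu> i) \<noteq> 0"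
proof -
  have "infinite (UNIV - {t. poly p t = 0})"
    by (rule Diff_infinite_finite[OF poly_roots_finite[OF assms] infinite_UNIV_char_0])
  then obtain \<mu> :: "nat \<Rightarrow> 'a" where "inj \<mu>" "range \<mu> \<subseteq> UNIV - {t. poly p t = 0}"
    using infinite_countable_subset by blast
  with that show thesis by blast
qed

text \<open>
  The complement of the cyclic submodule generated by \<open>v\<close> consists of the vectors that are
  annihilated by \<open>\<phi> \<circ> f(x)\<close> for all polynomials \<open>f\<close>, where \<open>\<phi>\<close> reads off the coefficient of
  \<open>x\<^bsup>m-1\<^esup> v\<close>; the pairing of \<open>\<phi> \<circ> x\<^bsup>i\<^esup>\<close> with \<open>x\<^bsup>j\<^esup> v\<close> is antitriangular.
\<close>

lemma cyclic_splitting: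
  fixes x :: "'a::{alg_closed_field, field_char_0} mat"
  assumes x: "x \<in> carrier_mat n n" and n: "0 < n"
  obtains k q a c \<mu> R p where "n = Suc (k + q)" "generic_arrow k q a c \<mu> R p"
    "similar_mat x (arrow_block k q a c \<mu> R)"
proof -
  obtain p where p: "poly_mat p x = 0\<^sub>m n n" "coeff p (degree p) = 1" "0 < degree p"
    and pmin: "\<And>f. f \<noteq> 0 \<Longrightarrow> degree f < degree p \<Longrightarrow> poly_mat f x \<noteq> 0\<^sub>m n n"
    using minimal_polynomial_exists[OF x n] by metis
  obtain v where v: "\<And>f. degree f < degree p \<Longrightarrow> (\<And>r. r < n \<Longrightarrow> poly_act x f v r = 0) \<Longrightarrow> f = 0"
    using cyclic_vector_exists[OF x p(1,3) pmin] by metis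
  define m where "m = degree p"
  obtain k where k: "m = Suc k" using p(3) by (cases m) (auto simp: m_def)
  have poly_of: "\<exists>f. degree f < m \<and> (\<forall>j<m. coeff f j = c j) \<and> (\<forall>u r. r < n \<longrightarrow>
      poly_act x f u r = (\<Sum>j<m. c j * poly_act x (monom 1 j) u r))" for c
  proof (intro exI conjI allI impI)
    let ?f = "\<Sum>j<m. Polynomial.smult (c j) (monom 1 j)"
    show "degree ?f < m"
      by (rule le_less_trans[of _ k], rule degree_sum_le)
         (auto simp: k degree_monom_eq intro!: order_trans[OF degree_smult_le])
    show "coeff ?f i = c i" if "i < m" for i
    proof -
      have "coeff ?f i = (\<Sum>j<m. if j = i then c i else 0)"
        unfolding coeff_sum by (intro sum.cong) auto
      with that show ?thesis by simp
    qed
    show "poly_act x ?f u r = (\<Sum>j<m. c j * poly_act x (monom 1 j) u r)" if "r < n" for u r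
      using that by (simp only: poly_act_sum[OF x] poly_act_smult[OF x])
  qed
  have "lin_indep {..<n} m (\<lambda>j. poly_act x (monom 1 j) v)"
    unfolding lin_indep_def
  proof (intro allI impI)
    fix c j assume c: "\<forall>r\<in>{..<n}. (\<Sum>j<m. c j * poly_act x (monom 1 j) v r) = 0" and j: "j < m"
    obtain f where f: "degree f < m" "\<forall>j<m. coeff f j = c j"
      "\<And>u r. r < n \<Longrightarrow> poly_act x f u r = (\<Sum>j<m. c j * poly_act x (monom 1 j) u r)"
      using poly_of[of c] by blast
    have "f = 0" by (rule v) (use f c in \<open>auto simp: m_def\<close>)
    with f(2) j show "c j = 0" by simp
  qed
  \<comment> \<open>Only the functional with index \<open>k = m - 1\<close> is used below: it reads
    off the top coefficient of a vector of the cyclic module.\<close>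
  from dual_family[OF _ this] obtain \<psi> where \<psi>: "\<And>i j. i < m \<Longrightarrow> j < m \<Longrightarrow>
      (\<Sum>r<n. \<psi> i r * poly_act x (monom 1 j) v r) = (if i = j then 1 else 0)" by blast
  define \<Phi> where "\<Phi> f u = (\<Sum>r<n. \<psi> k r * poly_act x f u r)" for f u
  have \<Phi>_sum: "\<Phi> f (\<lambda>r. \<Sum>i\<in>S. c i * u i r) = (\<Sum>i\<in>S. c i * \<Phi> f (u i))" for f S u and c :: "nat \<Rightarrow> 'a"
  proof -
    have "\<Phi> f (\<lambda>r. \<Sum>i\<in>S. c i * u i r) = (\<Sum>r<n. \<psi> k r * (\<Sum>i\<in>S. c i * poly_act x f (u i) r))"
      unfolding \<Phi>_def
      by (intro sum.cong refl) (simp add: poly_act_vec_sum[OF x] poly_act_vec_scale[OF x])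
    also have "\<dots> = (\<Sum>i\<in>S. c i * \<Phi> f (u i))"
      unfolding \<Phi>_def sum_distrib_left by (subst sum.swap) (simp add: mult_ac)
    finally show ?thesis .
  qed
  have \<Phi>_cong: "(\<And>r. r < n \<Longrightarrow> u r = w r) \<Longrightarrow> \<Phi> f u = \<Phi> f w" for f u w
    unfolding \<Phi>_def by (intro sum.cong refl arg_cong2[of _ _ _ _ "(*)"] poly_act_cong[OF x]) auto
  have \<Phi>_mult: "\<Phi> f (poly_act x g u) = \<Phi> (f * g) u" for f g u
    unfolding \<Phi>_def using poly_act_mult[OF x] by simp
  have \<Phi>_poly: "\<Phi> f u = (\<Sum>j<m. coeff f j * \<Phi> (monom 1 j) u)" if "degree f < m" for f u
  proof -
    obtain h where h: "degree h < m" "\<forall>j<m. coeff h j = coeff f j"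
      "\<And>u r. r < n \<Longrightarrow> poly_act x h u r = (\<Sum>j<m. coeff f j * poly_act x (monom 1 j) u r)"
      using poly_of[of "coeff f"] by blast
    have "coeff h j = coeff f j" for j
      using h(1,2) that by (cases "j < m") (auto simp: coeff_eq_0)
    then have "h = f" by (rule poly_eqI)
    with h(3) have "\<Phi> f u = (\<Sum>r<n. \<Sum>j<m. \<psi> k r * (coeff f j * poly_act x (monom 1 j) u r))"
      by (simp add: \<Phi>_def sum_distrib_left)
    also have "\<dots> = (\<Sum>j<m. coeff f j * \<Phi> (monom 1 j) u)"
      unfolding \<Phi>_def sum_distrib_left by (subst sum.swap) (simp add: mult_ac)
    finally show ?thesis .
  qed
  have \<Phi>v: "\<Phi> f v = coeff f k" if "degree f < m" for f
  proof -
    have "\<Phi> f v = (\<Sum>j<m. if j = k then coeff f k else 0)"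
      unfolding \<Phi>_poly[OF that] using \<psi>[of k] k by (intro sum.cong) (auto simp: \<Phi>_def)
    then show ?thesis using k by (simp del: sum.lessThan_Suc)
  qed
  \<comment> \<open>The largest submodule inside the kernel of the functional. It is invariant under
    \<open>x\<close> by construction, and it will turn out to be a complement of the cyclic
    submodule.\<close>
  define W where "W = {w. \<forall>f. \<Phi> f w = 0}"
  \<comment> \<open>Reducing \<open>f\<close> modulo \<open>p\<close> leaves only the first
    \<open>m\<close> powers of \<open>x\<close> to be tested, so \<open>W\<close> is cut out by
    \<open>m\<close> linear conditions.\<close>
  have WI: "w \<in> W" if "\<And>i. i < m \<Longrightarrow> \<Phi> (monom 1 i) w = 0" for w
  proof -
    have "\<Phi> f w = 0" for f
    proof -
      have "poly_act x (f mod p) w r = poly_act x f w r" if "r < n" for r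
      proof -
        have "f = f div p * p + f mod p" by simp
        then have "poly_act x f w r = poly_act x (f div p * p) w r + poly_act x (f mod p) w r"
          using poly_act_add[OF x that] by metis
        moreover have "poly_mat (f div p * p) x = 0\<^sub>m n n"
          unfolding poly_mat_mult[OF x] p(1) using poly_mat_carrier[OF x] by (rule right_mult_zero_mat)
        then have "poly_act x (f div p * p) w r = 0"
          using that carrier_matD[OF x] by (simp add: poly_act_def)
        ultimately show ?thesis by simp
      qed
      then have "\<Phi> f w = \<Phi> (f mod p) w" unfolding \<Phi>_def by simp
      also have "degree (f mod p) < m" using degree_mod_less'[of p f] p(3) by (cases "f mod p = 0") (force simp: m_def)+
      from \<Phi>_poly[OF this] that have "\<Phi> (f mod p) w = 0" by simp
      finally show ?thesis .
    qed
    then show ?thesis by (simp add: W_def)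
  qed
  \<comment> \<open>Multiplying \<open>f\<close> by a power of \<open>t\<close> raises its degree to
    exactly \<open>k\<close>; the functional then returns the leading coefficient of
    \<open>f\<close>, which cannot be zero.\<close>
  have cyclic_inter_W: "f = 0" if f: "degree f < m" "poly_act x f v \<in> W" for f
  proof (rule ccontr)
    assume f0: "f \<noteq> 0"
    let ?h = "monom 1 (k - degree f) * f"
    have "degree (monom (1::'a) (k - degree f)) = k - degree f" by (rule degree_monom_eq) simp
    then have "degree ?h = (k - degree f) + degree f"
      using degree_mult_eq[of "monom (1::'a) (k - degree f)" f] f0 by (simp only: monom_eq_0_iff) simp
    also have "\<dots> = k" using f(1) k by simp
    finally have "degree ?h = k" .
    then have "\<Phi> ?h v = lead_coeff ?h" using \<Phi>v[of ?h] k by (simp only: lessI)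
    also have "\<dots> = lead_coeff f" by (simp only: lead_coeff_mult lead_coeff_monom mult_1_left)
    finally show False using f f0 by (simp add: W_def \<Phi>_mult)
  qed
  have p0: "p \<noteq> 0" using p(3) by auto
  obtain \<mu> :: "nat \<Rightarrow> 'a" where "inj \<mu>" and \<mu>p: "\<And>i. poly p (\<mu> i) \<noteq> 0"
    using distinct_nonroots[OF p0] by metis
  then have \<mu>: "inj_on \<mu> {..<k}" by (auto intro: inj_on_subset)
  define g where "g = node_poly k \<mu>"
  define \<l> where "\<l> = lagrange_poly k \<mu>"
  have g: "degree g = k" "coeff g k = 1" by (simp_all add: g_def degree_node_poly monic_node_poly)
  \<comment> \<open>\<open>node_poly\<close> accounts for the coefficient of degree
    \<open>k\<close>; what remains has degree below \<open>k\<close> and is interpolated at the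
    \<open>k\<close> nodes.\<close>
  have expand: "\<exists>a c. f = Polynomial.smult a g + (\<Sum>i<k. Polynomial.smult (c i) (\<l> i))"
    if f: "degree f < m" for f
  proof -
    let ?r = "f - Polynomial.smult (coeff f k) g"
    have "\<exists>c. ?r = (\<Sum>i<k. Polynomial.smult (c i) (\<l> i))"
    proof (cases "?r = 0")
      case True
      then show ?thesis by (intro exI[of _ "\<lambda>_. 0"]) simp
    next
      case False
      have "degree ?r \<le> k" using f k g by (intro degree_diff_le) (auto intro: order_trans[OF degree_smult_le])
      moreover have "coeff ?r k = 0" using g by simp
      ultimately have "degree ?r < k" using False
        by (metis leading_coeff_0_iff le_neq_implies_less)
      from lagrange_interpolation[OF \<mu> this] show ?thesis unfolding \<l>_def
        by (intro exI[of _ "\<lambda>i. poly ?r (\<mu> i) / poly (lagrange_poly k \<mu> i) (\<mu> i)"])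
    qed
    then obtain c where "?r = (\<Sum>i<k. Polynomial.smult (c i) (\<l> i))" by blast
    then have "f = Polynomial.smult (coeff f k) g + (\<Sum>i<k. Polynomial.smult (c i) (\<l> i))"
      by (simp add: diff_eq_eq add.commute)
    then show ?thesis by blast
  qed
  have "lin_indep {..<n} 0 (\<lambda>_ _. 0 :: 'a)" by (simp add: lin_indep_def)
  from basis_extension[OF _ this, of W] obtain q w where
    w: "lin_indep {..<n} q w" "\<And>j. j < q \<Longrightarrow> w j \<in> W" "\<And>u. u \<in> W \<Longrightarrow> in_span {..<n} q w u"
    by (metis finite_lessThan less_nat_zero_code)
  \<comment> \<open>The basis in which \<open>x\<close> becomes an arrow: \<open>node_poly\<close>
    and the Lagrange polynomials applied to \<open>v\<close> span the cyclic submodule, and the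
    basis \<open>w\<close> of \<open>W\<close> produces the block \<open>R\<close>.\<close>
  define S where "S j = (if j = 0 then poly_act x g v
      else if j \<le> k then poly_act x (\<l> (j - 1)) v else w (j - Suc k))" for j
  have S_simps: "S 0 = poly_act x g v" "i < k \<Longrightarrow> S (Suc i) = poly_act x (\<l> i) v"
    "S (Suc (k + i)) = w i" for i
    by (simp_all add: S_def)
  have sum_S: "(\<Sum>j<Suc (k + q). e j * S j r)
      = poly_act x (Polynomial.smult (e 0) g + (\<Sum>i<k. Polynomial.smult (e (Suc i)) (\<l> i))) v r
        + (\<Sum>j<q. e (Suc (k + j)) * w j r)" if "r < n" for e r
    using that unfolding sum_lessThan_split3
    by (simp add: S_simps poly_act_add[OF x] poly_act_smult[OF x] poly_act_sum[OF x])
  have ind: "lin_indep {..<n} (Suc (k + q)) S"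
    unfolding lin_indep_def
  proof (rule, rule)
    fix e assume e: "\<forall>r\<in>{..<n}. (\<Sum>j<Suc (k + q). e j * S j r) = 0"
    let ?f = "Polynomial.smult (e 0) g + (\<Sum>i<k. Polynomial.smult (e (Suc i)) (\<l> i))"
    have f_eq: "poly_act x ?f v r = (\<Sum>j<q. - e (Suc (k + j)) * w j r)" if "r < n" for r
    proof -
      have "poly_act x ?f v r + (\<Sum>j<q. e (Suc (k + j)) * w j r) = 0"
        using e that sum_S[OF that, of e] by simp
      then show ?thesis by (simp add: sum_negf eq_neg_iff_add_eq_0)
    qed
    have "\<Phi> h (poly_act x ?f v) = 0" for h
    proof -
      have "\<Phi> h (poly_act x ?f v) = (\<Sum>j<q. - e (Suc (k + j)) * \<Phi> h (w j))"
        unfolding \<Phi>_sum[symmetric] by (rule \<Phi>_cong) (rule f_eq)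
      also have "\<dots> = 0" using w(2) by (intro sum.neutral) (auto simp: W_def)
      finally show ?thesis .
    qed
    then have "poly_act x ?f v \<in> W" by (simp add: W_def)
    moreover have "degree ?f < m"
    proof (rule le_less_trans)
      show "degree ?f \<le> k"
        by (intro degree_add_le degree_sum_le order_trans[OF degree_smult_le])
           (auto simp: g \<l>_def degree_lagrange_poly)
    qed (simp add: k)
    ultimately have f0: "?f = 0" using cyclic_inter_W by blast
    have e1: "e (Suc j) = 0" if j: "j < k" for j
    proof -
      have "0 = poly ?f (\<mu> j)" by (simp only: f0 poly_0)
      also have "\<dots> = (\<Sum>i<k. e (Suc i) * poly (\<l> i) (\<mu> j))"
        using j by (simp add: poly_sum g_def poly_node_poly)
      also have "\<dots> = (\<Sum>i<k. if i = j then e (Suc j) * poly (\<l> j) (\<mu> j) else 0)"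
        using poly_lagrange_poly[OF \<mu> _ j] by (intro sum.cong) (auto simp: \<l>_def)
      finally show ?thesis using j poly_lagrange_poly[OF \<mu> j j] by (simp add: \<l>_def)
    qed
    then have "Polynomial.smult (e 0) g = 0" using f0 by simp
    then have e0: "e 0 = 0" using g by auto
    have "(\<Sum>j<q. e (Suc (k + j)) * w j r) = 0" if "r \<in> {..<n}" for r
      using f_eq[of r] that f0 by (simp add: poly_act_0[OF x] sum_negf)
    from lin_indepD[OF w(1) this] have e2: "j < q \<Longrightarrow> e (Suc (k + j)) = 0" for j by simp
    show "\<forall>j<Suc (k + q). e j = 0"
    proof (intro allI impI)
      fix j assume "j < Suc (k + q)"
      then show "e j = 0" using e0 e1 e2[of "j - Suc k"] by (cases j) (auto elim: less_add_cases)
    qed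
  qed
  \<comment> \<open>The \<open>m\<close> conditions defining \<open>W\<close> are independent on the
    \<open>m\<close>-dimensional cyclic submodule, so their values at any \<open>u\<close> are
    matched by a unique vector of that submodule; subtracting it leaves an element of
    \<open>W\<close>.\<close>
  have span: "in_span {..<n} (Suc (k + q)) S u" for u
  proof -
    let ?T = "\<lambda>j i. \<Phi> (monom 1 i) (poly_act x (monom 1 j) v)"
    have fv: "\<Phi> h (poly_act x f v) = (\<Sum>j<m. coeff f j * \<Phi> h (poly_act x (monom 1 j) v))"
      if "degree f < m" for f h
    proof -
      obtain f' where f': "degree f' < m" "\<forall>j<m. coeff f' j = coeff f j"
        "\<And>u r. r < n \<Longrightarrow> poly_act x f' u r = (\<Sum>j<m. coeff f j * poly_act x (monom 1 j) u r)"
        using poly_of[of "coeff f"] by blast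
      have "coeff f' j = coeff f j" for j
        using f'(1,2) that by (cases "j < m") (auto simp: coeff_eq_0)
      then have "f' = f" by (rule poly_eqI)
      with f'(3) show ?thesis unfolding \<Phi>_sum[symmetric] by (intro \<Phi>_cong) simp
    qed
    have "lin_indep {..<m} m ?T"
      unfolding lin_indep_def
    proof (intro allI impI)
      fix e j assume e: "\<forall>i\<in>{..<m}. (\<Sum>j<m. e j * ?T j i) = 0" and j: "j < m"
      obtain f where f: "degree f < m" "\<forall>j<m. coeff f j = e j" using poly_of[of e] by blast
      have "poly_act x f v \<in> W"
      proof (rule WI)
        fix i assume "i < m"
        then show "\<Phi> (monom 1 i) (poly_act x f v) = 0" using e f fv[OF f(1), of "monom 1 i"] by simp
      qed
      with f cyclic_inter_W[of f] j show "e j = 0" by force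
    qed
    then have "in_span {..<m} m ?T (\<lambda>i. \<Phi> (monom 1 i) u)"
      using lin_indep_card_spans[of "{..<m}"] by simp
    then obtain e where e: "\<And>i. i < m \<Longrightarrow> \<Phi> (monom 1 i) u = (\<Sum>j<m. e j * ?T j i)"
      unfolding in_span_def by auto
    obtain f where f: "degree f < m" "\<forall>j<m. coeff f j = e j" using poly_of[of e] by blast
    have "(\<lambda>r. u r - poly_act x f v r) \<in> W"
    proof (rule WI)
      fix i assume i: "i < m"
      have "\<Phi> (monom 1 i) (\<lambda>r. u r - poly_act x f v r) = \<Phi> (monom 1 i) u - \<Phi> (monom 1 i) (poly_act x f v)"
        unfolding \<Phi>_def using poly_act_vec_diff[OF x] by (simp add: right_diff_distrib sum_subtractf)
      then show "\<Phi> (monom 1 i) (\<lambda>r. u r - poly_act x f v r) = 0"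
        using f e[OF i] fv[OF f(1), of "monom 1 i"] by simp
    qed
    from w(3)[OF this] obtain d where d: "\<And>r. r < n \<Longrightarrow> u r - poly_act x f v r = (\<Sum>j<q. d j * w j r)"
      unfolding in_span_def by auto
    obtain a c where ac: "f = Polynomial.smult a g + (\<Sum>i<k. Polynomial.smult (c i) (\<l> i))"
      using expand[OF f(1)] by blast
    define e' where "e' j = (if j = 0 then a else if j \<le> k then c (j - 1) else d (j - Suc k))" for j
    show ?thesis
    proof (rule in_spanI)
      fix r assume "r \<in> {..<n}"
      then have r: "r < n" by simp
      show "u r = (\<Sum>j<Suc (k + q). e' j * S j r)"
        unfolding sum_S[OF r] using d[OF r] by (simp add: e'_def diff_eq_eq add.commute flip: ac)
    qed
  qed
  have nkq: "n = Suc (k + q)"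
    using lin_indep_le_card[OF ind] steinitz_bound[OF unit_vectors_indep span] by (intro antisym) auto
  define Sm where "Sm = mat n n (\<lambda>(r, j). S j r)"
  have Sm: "Sm \<in> carrier_mat n n" by (simp add: Sm_def)
  have "lin_indep {..<n} n (\<lambda>j r. Sm $$ (r, j))"
    using ind lin_indep_cong[of n "{..<n}" "\<lambda>j r. Sm $$ (r, j)" S] by (simp add: Sm_def nkq)
  from lin_indep_det_nonzero[OF Sm this] obtain Tm where
    Tm: "Tm \<in> carrier_mat n n" "Sm * Tm = 1\<^sub>m n" "Tm * Sm = 1\<^sub>m n"
    using det_nonzero_inverse[OF Sm] by metis
  have "\<forall>j. \<exists>e. j < q \<longrightarrow> (\<forall>r<n. poly_act x [:0, 1:] (w j) r = (\<Sum>l<q. e l * w l r))"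
  proof (intro allI)
    fix j
    have "poly_act x [:0, 1:] (w j) \<in> W" if "j < q"
      using w(2)[OF that] by (simp only: W_def mem_Collect_eq \<Phi>_mult) blast
    then show "\<exists>e. j < q \<longrightarrow> (\<forall>r<n. poly_act x [:0, 1:] (w j) r = (\<Sum>l<q. e l * w l r))"
      using w(3) unfolding in_span_def by (metis lessThan_iff)
  qed
  then obtain E where E: "\<And>j r. j < q \<Longrightarrow> r < n \<Longrightarrow> poly_act x [:0, 1:] (w j) r = (\<Sum>l<q. E j l * w l r)"
    by metis
  define R where "R = mat q q (\<lambda>(l, j). E j l)"
  have R: "R \<in> carrier_mat q q" by (simp add: R_def)
  \<comment> \<open>Both polynomials are monic of degree \<open>m\<close>, so the top terms cancel.
    Modulo \<open>p\<close> the difference is \<open>t\<close> times \<open>node_poly\<close>, and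
    its expansion is the first column \<open>(a, c)\<close> of the arrow.\<close>
  have deg_r: "degree (pCons 0 g - p) < m"
  proof -
    have "degree (pCons 0 g - p) \<le> m" using g k by (intro degree_diff_le) (auto simp: m_def)
    moreover have "coeff (pCons 0 g - p) m = 0" using g p(2) k by (simp add: m_def)
    ultimately show ?thesis using k
      by (metis degree_0 leading_coeff_0_iff le_neq_implies_less zero_less_Suc)
  qed
  obtain a c where ac: "pCons 0 g - p = Polynomial.smult a g + (\<Sum>i<k. Polynomial.smult (c i) (\<l> i))"
    using expand[OF deg_r] by blast
  have p_eq: "p = arrow_poly k a c \<mu>"
    unfolding arrow_poly_def g_def[symmetric] \<l>_def[symmetric] using ac by (simp add: algebra_simps)
  have xS: "x * Sm = Sm * arrow_block k q a c \<mu> R"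
  proof -
    interpret arrow k q a c \<mu> R by unfold_locales (rule R)
    have Sm': "Sm \<in> carrier_mat (Suc (k + q)) (Suc (k + q))" using Sm nkq by simp
    have left: "(x * Sm) $$ (r, j) = poly_act x [:0, 1:] (S j) r" if "r < n" "j < n" for r j
      unfolding index_mult_mat_sum[OF x Sm that] poly_act_X[OF x that(1)] using that by (simp add: Sm_def)
    have entS: "Sm $$ (r, j) = S j r" if "r < n" "j < n" for r j using that by (simp add: Sm_def)
    have "(x * Sm) $$ (r, j) = (Sm * y) $$ (r, j)" if r: "r < n" and j: "j < n" for r j
    proof -
      have r': "r < Suc (k + q)" using r nkq by simp
      consider "j = 0" | j' where "j = Suc j'" "j' < k" | j' where "j = Suc (k + j')" "j' < q"
        using j less_Suc_eq_0_disj[of j "k + q"] unfolding nkq by (auto elim: less_add_cases)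
      then show ?thesis
      proof cases
        case 1
        have "poly_act x [:0, 1:] (S 0) r = poly_act x (pCons 0 g) v r"
          unfolding S_simps poly_act_mult[OF x r, symmetric] by simp
        also have "\<dots> = poly_act x (pCons 0 g - p) v r"
          unfolding poly_act_diff[OF x r] using r carrier_matD[OF x] by (simp add: poly_act_def p(1))
        also have "\<dots> = a * poly_act x g v r + (\<Sum>i<k. c i * poly_act x (\<l> i) v r)"
          unfolding ac poly_act_add[OF x r] poly_act_smult[OF x r] poly_act_sum[OF x r] ..
        finally show ?thesis unfolding left[OF r j] unfolding 1 mult_y(1)[OF Sm' r']
          using r nkq by (simp add: entS S_simps mult.commute)
      next
        case (2 j')
        have "[:0, 1:] * \<l> j' = g + Polynomial.smult (\<mu> j') (\<l> j')"
          unfolding g_def \<l>_def node_poly_factor[OF 2(2)] by simp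
        then have "poly_act x [:0, 1:] (S j) r = poly_act x g v r + \<mu> j' * poly_act x (\<l> j') v r"
          unfolding 2(1) S_simps(2)[OF 2(2)] poly_act_mult[OF x r, symmetric]
          by (simp only: poly_act_add[OF x r] poly_act_smult[OF x r])
        then show ?thesis unfolding left[OF r j] unfolding 2(1) mult_y(2)[OF Sm' r' 2(2)]
          using r nkq 2 by (simp add: entS S_simps mult.commute)
      next
        case (3 j')
        show ?thesis unfolding left[OF r j] unfolding 3(1) mult_y(3)[OF Sm' r' 3(2)]
          using r nkq 3 by (simp add: entS S_simps E R_def mult.commute)
      qed
    qed
    then show ?thesis using carrier_matD[OF x] carrier_matD[OF Sm] carrier_matD[OF y_carrier] nkq
      by (intro eq_matI) (simp_all del: index_mult_mat(1))
  qed
  have "x = Sm * arrow_block k q a c \<mu> R * Tm"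
  proof -
    have "x = x * (Sm * Tm)" using x by (simp add: Tm)
    also have "\<dots> = x * Sm * Tm" using assoc_mult_mat[OF x Sm Tm(1)] by simp
    finally show ?thesis by (simp add: xS)
  qed
  then have sim: "similar_mat x (arrow_block k q a c \<mu> R)"
    using x Sm Tm nkq by (intro similar_matI[of _ _ Sm Tm n]) (auto simp: arrow_block_def)
  \<comment> \<open>The columns \<open>w\<close> of \<open>C\<close> intertwine \<open>x\<close>
    with \<open>R\<close>, hence \<open>C p(R) = p(x) C = 0\<close>, and the columns of
    \<open>C\<close> are independent.\<close>
  have pR: "poly_mat p R = 0\<^sub>m q q"
  proof -
    define C where "C = mat n q (\<lambda>(r, j). w j r)"
    have C: "C \<in> carrier_mat n q" by (simp add: C_def)
    have "x * C = C * R"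
    proof (rule eq_matI)
      fix r j assume "r < dim_row (C * R)" "j < dim_col (C * R)"
      then have rj: "r < n" "j < q" by (auto simp: C_def R_def)
      have "(x * C) $$ (r, j) = poly_act x [:0, 1:] (w j) r"
        unfolding index_mult_mat_sum[OF x C rj] poly_act_X[OF x rj(1)] using rj by (simp add: C_def)
      also have "\<dots> = (C * R) $$ (r, j)"
        unfolding index_mult_mat_sum[OF C R rj] E[OF rj(2,1)] using rj by (simp add: C_def R_def mult.commute)
      finally show "(x * C) $$ (r, j) = (C * R) $$ (r, j)" .
    qed (use x in \<open>auto simp: C_def R_def\<close>)
    from poly_mat_intertwine[OF x R C this, of p] have CR: "C * poly_mat p R = 0\<^sub>m n q"
      using C by (simp add: p)
    show ?thesis
    proof (rule eq_matI)
      fix i j assume "i < dim_row (0\<^sub>m q q)" "j < dim_col (0\<^sub>m q q)"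
      then have ij: "i < q" "j < q" by auto
      have "(\<Sum>l<q. poly_mat p R $$ (l, j) * w l r) = 0" if "r \<in> {..<n}" for r
      proof -
        have "(C * poly_mat p R) $$ (r, j) = (\<Sum>l<q. poly_mat p R $$ (l, j) * w l r)"
          using that ij index_mult_mat_sum[OF C poly_mat_carrier[OF R]] by (simp add: C_def mult.commute)
        with that ij show ?thesis by (simp add: CR)
      qed
      from lin_indepD[OF w(1) this ij(1)] ij show "poly_mat p R $$ (i, j) = 0\<^sub>m q q $$ (i, j)" by simp
    qed (use poly_mat_dim[OF R] in auto)
  qed
  have "generic_arrow k q a c \<mu> R p"
    by unfold_locales (use R \<mu> pR \<mu>p p_eq in auto)
  with nkq sim show thesis by (intro that)
qed

section \<open>Lagrangian points\<close>

definition commutator :: "'a::comm_ring_1 mat \<Rightarrow> 'a mat \<Rightarrow> 'a mat" where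
  "commutator b y = b * y - y * b"

definition trace_pairing :: "nat \<Rightarrow> 'a::comm_ring_1 mat \<Rightarrow> 'a mat \<Rightarrow> 'a" where
  "trace_pairing n A B = (\<Sum>i<n. \<Sum>j<n. A $$ (i, j) * B $$ (j, i))"

lemma commutator_carrier [simp]:
  "b \<in> carrier_mat n n \<Longrightarrow> y \<in> carrier_mat n n \<Longrightarrow> commutator b y \<in> carrier_mat n n"
  unfolding commutator_def by (intro minus_carrier_mat mult_carrier_mat[of _ n n])

lemma
  assumes "A \<in> carrier_mat n n" "B \<in> carrier_mat n n" "y \<in> carrier_mat n n"
  shows commutator_add: "commutator (A + B) y = commutator A y + commutator B y"
    and commutator_diff: "commutator (A - B) y = commutator A y - commutator B y"
proof -
  have "(X + X') - (Z + Z') = (X - Z) + (X' - Z')" "(X - X') - (Z - Z') = (X - Z) - (X' - Z')"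
    if "X \<in> carrier_mat n n" "X' \<in> carrier_mat n n" "Z \<in> carrier_mat n n" "Z' \<in> carrier_mat n n"
    for X X' Z Z' :: "'a mat"
    using that by (auto intro!: eq_matI)
  then show "commutator (A + B) y = commutator A y + commutator B y"
    "commutator (A - B) y = commutator A y - commutator B y"
    unfolding commutator_def using assms
    by (simp_all add: add_mult_distrib_mat[of _ n n] mult_add_distrib_mat[of _ n n]
        minus_mult_distrib_mat[of _ n n] mult_minus_distrib_mat[of _ n n])
qed

lemma trace_pairing_commute: "trace_pairing n A B = trace_pairing n B A"
  unfolding trace_pairing_def by (subst sum.swap) (simp add: mult.commute)

lemma trace_pairing_assoc:
  assumes "A \<in> carrier_mat n n" "B \<in> carrier_mat n n" "C \<in> carrier_mat n n"
  shows "trace_pairing n (A * B) C = trace_pairing n A (B * C)"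
proof -
  have "trace_pairing n (A * B) C = (\<Sum>i<n. \<Sum>j<n. \<Sum>k<n. A $$ (i, k) * (B $$ (k, j) * C $$ (j, i)))"
    using assms by (simp add: trace_pairing_def index_mult_mat_sum[of _ n n _ n] sum_distrib_right mult.assoc
        del: index_mult_mat)
  also have "\<dots> = (\<Sum>i<n. \<Sum>k<n. \<Sum>j<n. A $$ (i, k) * (B $$ (k, j) * C $$ (j, i)))"
    by (intro sum.cong refl sum.swap)
  also have "\<dots> = trace_pairing n A (B * C)"
    using assms by (simp add: trace_pairing_def index_mult_mat_sum[of _ n n _ n] sum_distrib_left
        del: index_mult_mat)
  finally show ?thesis .
qed

lemma trace_pairing_diff:
  assumes "A \<in> carrier_mat n n" "B \<in> carrier_mat n n" "C \<in> carrier_mat n n"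
  shows "trace_pairing n A (B - C) = trace_pairing n A B - trace_pairing n A C"
  using assms by (simp add: trace_pairing_def right_diff_distrib sum_subtractf)

context
  fixes n :: nat and P Q :: "'a::comm_ring_1 mat"
  assumes P: "P \<in> carrier_mat n n" and Q: "Q \<in> carrier_mat n n"
    and PQ: "P * Q = 1\<^sub>m n" and QP: "Q * P = 1\<^sub>m n"
begin

lemma conj_mult:
  assumes "A \<in> carrier_mat n n" "B \<in> carrier_mat n n"
  shows "P * A * Q * (P * B * Q) = P * (A * B) * Q"
proof -
  have "P * A * Q * (P * B * Q) = P * A * ((Q * P) * (B * Q))"
    using P Q assms by (simp add: assoc_mult_mat[of _ n n _ n _ n])
  then show ?thesis unfolding QP using P Q assms by (simp add: assoc_mult_mat[of _ n n _ n _ n])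
qed

lemma conj_diff:
  assumes "A \<in> carrier_mat n n" "B \<in> carrier_mat n n"
  shows "P * (A - B) * Q = P * A * Q - P * B * Q"
  using P Q assms by (simp add: mult_minus_distrib_mat[of _ n n] minus_mult_distrib_mat[of _ n n])

lemma commutator_conj:
  assumes "b \<in> carrier_mat n n" "y \<in> carrier_mat n n"
  shows "P * commutator b y * Q = commutator (P * b * Q) (P * y * Q)"
  unfolding commutator_def conj_diff[OF mult_carrier_mat[OF assms] mult_carrier_mat[OF assms(2,1)]]
    conj_mult[OF assms] conj_mult[OF assms(2,1)] ..

lemma trace_pairing_conj:
  assumes "A \<in> carrier_mat n n" "B \<in> carrier_mat n n"
  shows "trace_pairing n (P * A * Q) (P * B * Q) = trace_pairing n A B"
proof -
  have "trace_pairing n (P * A * Q) (P * B * Q) = trace_pairing n (P * A) (Q * (P * B * Q))"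
    using P Q assms by (intro trace_pairing_assoc) auto
  also have "Q * (P * B * Q) = (Q * P) * (B * Q)"
    using P Q assms by (simp add: assoc_mult_mat[of _ n n _ n _ n])
  also have "\<dots> = B * Q" using Q assms by (simp add: QP)
  also have "trace_pairing n (P * A) (B * Q) = trace_pairing n (B * Q) (P * A)"
    by (rule trace_pairing_commute)
  also have "\<dots> = trace_pairing n B (Q * (P * A))"
    using P Q assms by (intro trace_pairing_assoc) auto
  also have "Q * (P * A) = (Q * P) * A"
    using P Q assms by (simp add: assoc_mult_mat[of _ n n _ n _ n])
  also have "\<dots> = A" using assms by (simp add: QP)
  finally show ?thesis by (simp add: trace_pairing_commute)
qed

lemma poly_mat_conj:
  assumes "A \<in> carrier_mat n n"
  shows "poly_mat f (P * A * Q) = P * poly_mat f A * Q"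
proof -
  have PAQ: "P * A * Q \<in> carrier_mat n n" using P Q assms by simp
  have "P * A * Q * P = P * A"
    using P Q assms by (simp add: assoc_mult_mat[of _ n n _ n _ n] QP)
  from poly_mat_intertwine[OF PAQ assms P this, of f] have "poly_mat f (P * A * Q) * P * Q = P * poly_mat f A * Q" by simp
  moreover have "poly_mat f (P * A * Q) * P * Q = poly_mat f (P * A * Q)"
    using P Q poly_mat_carrier[OF PAQ, of f] by (simp add: assoc_mult_mat[of _ n n _ n _ n] PQ)
  ultimately show ?thesis by simp
qed

end

section \<open>Corners, embeddings and bordered conjugation\<close>

lemma south_east_corner_diff:
  assumes "A \<in> carrier_mat n n" "B \<in> carrier_mat n n"
  shows "south_east_corner m (A - B) = south_east_corner m A - south_east_corner m B"
  using assms by (intro eq_matI) (auto simp: south_east_corner_def)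

lemma south_east_corner_carrier:
  "A \<in> carrier_mat n n \<Longrightarrow> south_east_corner m A \<in> carrier_mat (n - m) (n - m)"
  by (auto simp: south_east_corner_def)

lemma index_south_east_corner:
  "A \<in> carrier_mat n n \<Longrightarrow> i < n - m \<Longrightarrow> j < n - m \<Longrightarrow> south_east_corner m A $$ (i, j) = A $$ (i + m, j + m)"
  by (auto simp: south_east_corner_def)

lemma south_east_corner_0 [simp]: "south_east_corner 0 A = A"
  by (auto simp: south_east_corner_def)

lemma south_east_corner_Suc: "south_east_corner m (south_east_corner 1 A) = south_east_corner (Suc m) A"
  by (auto simp: south_east_corner_def)

lemma embed_corner_carrier [simp]: "embed_corner n m z \<in> carrier_mat n n"
  by (simp add: embed_corner_def)

lemma embed_corner_0: "z \<in> carrier_mat n n \<Longrightarrow> embed_corner n 0 z = z"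
  by (auto simp: embed_corner_def)

lemma embed_corner_Suc: "embed_corner (Suc n) 1 (embed_corner n m z) = embed_corner (Suc n) (Suc m) z"
proof (rule eq_matI)
  fix i j assume "i < dim_row (embed_corner (Suc n) (Suc m) z)" "j < dim_col (embed_corner (Suc n) (Suc m) z)"
  then show "embed_corner (Suc n) 1 (embed_corner n m z) $$ (i, j) = embed_corner (Suc n) (Suc m) z $$ (i, j)"
    by (cases i; cases j) (auto simp: embed_corner_def)
qed (auto simp: embed_corner_def)

lemma trace_pairing_embed_corner:
  assumes "V \<in> carrier_mat (Suc n) (Suc n)"
  shows "trace_pairing (Suc n) (embed_corner (Suc n) 1 z) V = trace_pairing n z (south_east_corner 1 V)"
  using assms unfolding trace_pairing_def sum.lessThan_Suc_shift
  by (simp add: embed_corner_def index_south_east_corner)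

definition border :: "'a::comm_ring_1 mat \<Rightarrow> 'a mat" where
  "border P = four_block_mat (1\<^sub>m 1) (0\<^sub>m 1 (dim_col P)) (0\<^sub>m (dim_row P) 1) P"

lemma corner_decomposition:
  fixes A :: "'a::comm_ring_1 mat"
  assumes A: "A \<in> carrier_mat (Suc n) (Suc n)"
  obtains a r c where "A = four_block_mat a r c (south_east_corner 1 A)"
    "a \<in> carrier_mat 1 1" "r \<in> carrier_mat 1 n" "c \<in> carrier_mat n 1"
proof -
  let ?a = "mat 1 1 (\<lambda>_. A $$ (0, 0))" and ?r = "mat 1 n (\<lambda>(i, j). A $$ (0, Suc j))"
    and ?c = "mat n 1 (\<lambda>(i, j). A $$ (Suc i, 0))"
  have "A = four_block_mat ?a ?r ?c (south_east_corner 1 A)"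
    using A by (intro eq_matI) (auto simp: index_south_east_corner south_east_corner_def gr0_conv_Suc)
  then show thesis by (rule that) auto
qed

lemma south_east_corner_four_block:
  assumes "a \<in> carrier_mat 1 1" "r \<in> carrier_mat 1 n" "c \<in> carrier_mat n 1" "Y \<in> carrier_mat n n"
  shows "south_east_corner 1 (four_block_mat a r c Y) = Y"
  using assms by (intro eq_matI) (auto simp: south_east_corner_def)

lemma embed_corner_four_block:
  "z \<in> carrier_mat n n \<Longrightarrow> embed_corner (Suc n) 1 z = four_block_mat (0\<^sub>m 1 1) (0\<^sub>m 1 n) (0\<^sub>m n 1) z"
  by (intro eq_matI) (auto simp: embed_corner_def)

text \<open>Under the trace form the corner map is dual to the embedding of the smaller matrix
  algebra, hence equivariant under it. Thus a vector field generated by a corner matrix induces on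
  the corner the field generated there.\<close>

lemma corner_commutator_embed:
  fixes y :: "'a::comm_ring_1 mat"
  assumes y: "y \<in> carrier_mat (Suc n) (Suc n)" and z: "z \<in> carrier_mat n n"
  shows "south_east_corner 1 (commutator (embed_corner (Suc n) 1 z) y) = commutator z (south_east_corner 1 y)"
proof -
  let ?Y = "south_east_corner 1 y"
  have Y: "?Y \<in> carrier_mat n n" using south_east_corner_carrier[OF y, of 1] by simp
  obtain a r c where y_eq: "y = four_block_mat a r c ?Y"
    and arc: "a \<in> carrier_mat 1 1" "r \<in> carrier_mat 1 n" "c \<in> carrier_mat n 1"
    using corner_decomposition[OF y] by metis
  have 1: "embed_corner (Suc n) 1 z * y = four_block_mat (0\<^sub>m 1 1 * a + 0\<^sub>m 1 n * c) (0\<^sub>m 1 1 * r + 0\<^sub>m 1 n * ?Y)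
      (0\<^sub>m n 1 * a + z * c) (0\<^sub>m n 1 * r + z * ?Y)"
    by (subst y_eq, unfold embed_corner_four_block[OF z], rule mult_four_block_mat) (use arc z Y in auto)
  have 2: "y * embed_corner (Suc n) 1 z = four_block_mat (a * 0\<^sub>m 1 1 + r * 0\<^sub>m n 1) (a * 0\<^sub>m 1 n + r * z)
      (c * 0\<^sub>m 1 1 + ?Y * 0\<^sub>m n 1) (c * 0\<^sub>m 1 n + ?Y * z)"
    by (subst (1) y_eq, unfold embed_corner_four_block[OF z], rule mult_four_block_mat) (use arc z Y in auto)
  have "south_east_corner 1 (embed_corner (Suc n) 1 z * y) = z * ?Y"
    unfolding 1 using arc z Y by (subst south_east_corner_four_block[of _ _ n]) auto
  moreover have "south_east_corner 1 (y * embed_corner (Suc n) 1 z) = ?Y * z"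
    unfolding 2 using arc z Y by (subst south_east_corner_four_block[of _ _ n]) auto
  ultimately show ?thesis unfolding commutator_def
    by (subst south_east_corner_diff[of _ "Suc n"])
      (use y in \<open>auto intro!: mult_carrier_mat[of _ "Suc n" "Suc n"]\<close>)
qed

lemma border_carrier: "P \<in> carrier_mat n n \<Longrightarrow> border P \<in> carrier_mat (Suc n) (Suc n)"
  by (auto simp: border_def)

lemma border_mult_left:
  fixes a :: "'a::comm_ring_1 mat"
  assumes "a \<in> carrier_mat 1 1" "r \<in> carrier_mat 1 n" "c \<in> carrier_mat n 1" "Y \<in> carrier_mat n n"
    and P: "P \<in> carrier_mat n n"
  shows "border P * four_block_mat a r c Y = four_block_mat a r (P * c) (P * Y)"
proof -
  have "border P * four_block_mat a r c Y = four_block_mat (1\<^sub>m 1 * a + 0\<^sub>m 1 n * c) (1\<^sub>m 1 * r + 0\<^sub>m 1 n * Y)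
      (0\<^sub>m n 1 * a + P * c) (0\<^sub>m n 1 * r + P * Y)"
    unfolding border_def carrier_matD[OF P] by (rule mult_four_block_mat) (use assms in auto)
  then show ?thesis using assms by simp
qed

lemma border_mult_right:
  fixes a :: "'a::comm_ring_1 mat"
  assumes "a \<in> carrier_mat 1 1" "r \<in> carrier_mat 1 n" "c \<in> carrier_mat n 1" "Y \<in> carrier_mat n n"
    and P: "P \<in> carrier_mat n n"
  shows "four_block_mat a r c Y * border P = four_block_mat a (r * P) c (Y * P)"
proof -
  have "four_block_mat a r c Y * border P = four_block_mat (a * 1\<^sub>m 1 + r * 0\<^sub>m n 1) (a * 0\<^sub>m 1 n + r * P)
      (c * 1\<^sub>m 1 + Y * 0\<^sub>m n 1) (c * 0\<^sub>m 1 n + Y * P)"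
    unfolding border_def carrier_matD[OF P] by (rule mult_four_block_mat) (use assms in auto)
  then show ?thesis using assms by simp
qed

lemma border_mult:
  fixes P :: "'a::comm_ring_1 mat"
  assumes "P \<in> carrier_mat n n" "Q \<in> carrier_mat n n" "P * Q = 1\<^sub>m n"
  shows "border P * border Q = 1\<^sub>m (Suc n)"
proof -
  have "border P * border Q = four_block_mat (1\<^sub>m 1) (0\<^sub>m 1 n) (P * 0\<^sub>m n 1) (P * Q)"
    unfolding border_def[of Q] carrier_matD[OF assms(2)] by (rule border_mult_left) (use assms in auto)
  also have "\<dots> = 1\<^sub>m (Suc n)" unfolding assms(3) using assms(1) by (intro eq_matI) auto
  finally show ?thesis .
qed

lemma corner_border_conj:
  fixes A :: "'a::comm_ring_1 mat"
  assumes A: "A \<in> carrier_mat (Suc n) (Suc n)" and P: "P \<in> carrier_mat n n" and Q: "Q \<in> carrier_mat n n"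
  shows "south_east_corner 1 (border P * A * border Q) = P * south_east_corner 1 A * Q"
proof -
  obtain a r c where A_eq: "A = four_block_mat a r c (south_east_corner 1 A)"
    and arc: "a \<in> carrier_mat 1 1" "r \<in> carrier_mat 1 n" "c \<in> carrier_mat n 1"
    using corner_decomposition[OF A] by metis
  have Y: "south_east_corner 1 A \<in> carrier_mat n n" using south_east_corner_carrier[OF A, of 1] by simp
  have "border P * A * border Q = four_block_mat a (r * Q) (P * c) (P * south_east_corner 1 A * Q)"
    by (subst A_eq) (use arc Y P Q in \<open>simp add: border_mult_left[of _ _ n] border_mult_right[of _ _ n]\<close>)
  then show ?thesis using arc Y P Q by (simp only:) (rule south_east_corner_four_block, auto)
qed

lemma embed_border_conj:
  fixes z :: "'a::comm_ring_1 mat"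
  assumes "z \<in> carrier_mat n n" and P: "P \<in> carrier_mat n n" and Q: "Q \<in> carrier_mat n n"
  shows "border P * embed_corner (Suc n) 1 z * border Q = embed_corner (Suc n) 1 (P * z * Q)"
proof -
  have "P * z * Q \<in> carrier_mat n n" using assms by simp
  then show ?thesis unfolding embed_corner_four_block[OF assms(1)] embed_corner_four_block[OF \<open>P * z * Q \<in> _\<close>]
    using assms by (simp add: border_mult_left[of _ _ n] border_mult_right[of _ _ n])
qed

section \<open>Lagrangian points and the inductive step\<close>

definition gt_span :: "nat \<Rightarrow> 'a::comm_ring_1 mat \<Rightarrow> 'a mat \<Rightarrow> bool" where
  "gt_span n y z \<longleftrightarrow> z \<in> carrier_mat n n \<and> (\<exists>F. \<forall>i<n. \<forall>j<n. z $$ (i, j)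
     = (\<Sum>m<n. embed_corner n m (poly_mat (F m) (south_east_corner m y)) $$ (i, j)))"

text \<open>
  The gradients at \<open>y\<close> of the Gelfand--Tsetlin generators span the matrices in \<open>gt_span n y\<close>.
  Hence the following says that the tangent vectors of the orbit on which all of their differentials
  vanish are values of Hamiltonian vector fields.
\<close>

definition lagrangian :: "nat \<Rightarrow> 'a::comm_ring_1 mat \<Rightarrow> bool" where
  "lagrangian n y \<longleftrightarrow> (\<forall>b\<in>carrier_mat n n.
     (\<forall>m<n. \<forall>f. trace_pairing n (embed_corner n m (poly_mat f (south_east_corner m y))) (commutator b y) = 0)
     \<longrightarrow> (\<exists>z. gt_span n y z \<and> commutator b y = commutator z y))"

text \<open>The corner of a tangent vector orthogonal to all gradients is orthogonal to the
  gradients of the corner. By \<open>corner_tangent\<close> it is tangent to the orbit of the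
  corner, so the hypothesis writes it as a commutator with some \<open>z'\<close> from the smaller
  span. Subtracting the embedded \<open>z'\<close> leaves a tangent vector with zero corner, and
  \<open>border_tangent\<close> describes it by one polynomial in the corner.\<close>

lemma lagrangian_step:
  fixes R :: "'a::field mat"
  assumes arrow: "generic_arrow k q a c \<mu> R p"
    and n: "n = k + q"
    and P: "P \<in> carrier_mat n n" and Q: "Q \<in> carrier_mat n n" and PQ: "P * Q = 1\<^sub>m n" and QP: "Q * P = 1\<^sub>m n"
    and lag: "lagrangian n (P * diag_block k q \<mu> R * Q)"
  shows "lagrangian (Suc n) (border P * arrow_block k q a c \<mu> R * border Q)"
  unfolding lagrangian_def
proof (intro ballI impI)
  interpret generic_arrow k q a c \<mu> R p by (rule arrow)
  note yc = y_carrier[folded n] note Yc = Y_carrier[folded n]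
  have Y: "south_east_corner 1 y = diag_block k q \<mu> R"
    using carrier_matD[OF yc] carrier_matD[OF Yc] n
    by (intro eq_matI) (simp_all add: index_y south_east_corner_def)
  let ?P = "border P" and ?Q = "border Q"
  note bP = border_carrier[OF P] and bQ = border_carrier[OF Q]
    and bPQ = border_mult[OF P Q PQ] and bQP = border_mult[OF Q P QP]
  \<comment> \<open>The block computations are available at \<open>y\<close>, the hypothesis at the
    conjugated corner. Primed objects live at \<open>y'\<close>; conjugation with the bordered
    matrices carries tangent vectors back and forth.\<close>
  define y' where "y' = ?P * y * ?Q"
  have y'c: "y' \<in> carrier_mat (Suc n) (Suc n)" using bP bQ yc by (simp add: y'_def)
  have y_y': "y = ?Q * y' * ?P"
    unfolding y'_def using bP bQ yc bQP by (simp add: assoc_mult_mat[of _ "Suc n" "Suc n" _ "Suc n" _ "Suc n"])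
      (simp add: assoc_mult_mat[of _ "Suc n" "Suc n" _ "Suc n" _ "Suc n", symmetric])
  define Y' where "Y' = south_east_corner 1 y'"
  have Y'_eq: "Y' = P * diag_block k q \<mu> R * Q"
    unfolding Y'_def y'_def using corner_border_conj[OF yc P Q] Y by simp
  have Y'c: "Y' \<in> carrier_mat n n" using P Q Yc by (simp add: Y'_eq)
  fix b' :: "'a mat" assume b': "b' \<in> carrier_mat (Suc n) (Suc n)"
  assume "\<forall>m<Suc n. \<forall>f. trace_pairing (Suc n) (embed_corner (Suc n) m
      (poly_mat f (south_east_corner m (?P * y * ?Q)))) (commutator b' (?P * y * ?Q)) = 0"
  then have orth: "trace_pairing (Suc n) (embed_corner (Suc n) m
      (poly_mat f (south_east_corner m y'))) (commutator b' y') = 0" if "m < Suc n" for m f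
    using that by (simp add: y'_def)
  let ?v' = "commutator b' y'"
  have v'c: "?v' \<in> carrier_mat (Suc n) (Suc n)" using b' y'c by simp
  have orth': "trace_pairing n (embed_corner n m (poly_mat f (south_east_corner m Y'))) (south_east_corner 1 ?v') = 0"
    if "m < n" for m f
    using orth[of "Suc m" f] that trace_pairing_embed_corner[OF v'c]
    unfolding Y'_def south_east_corner_Suc embed_corner_Suc[symmetric] by simp
  define b where "b = ?Q * b' * ?P"
  have bc: "b \<in> carrier_mat (Suc n) (Suc n)" using bP bQ b' by (simp add: b_def)
  have v: "commutator b y = ?Q * ?v' * ?P"
    unfolding b_def y_y' by (rule commutator_conj[OF bQ bP bQP bPQ b' y'c, symmetric])
  let ?v1 = "south_east_corner 1 (commutator b y)"
  have v1: "?v1 = Q * south_east_corner 1 ?v' * P"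
    unfolding v by (rule corner_border_conj[OF v'c Q P])
  have v1'c: "south_east_corner 1 ?v' \<in> carrier_mat n n" using south_east_corner_carrier[OF v'c, of 1] by simp
  have v'1: "south_east_corner 1 ?v' = P * ?v1 * Q"
    unfolding v1 using P Q PQ v1'c by (simp add: assoc_mult_mat[of _ n n _ n _ n])
      (simp add: assoc_mult_mat[of _ n n _ n _ n, symmetric])
  have v1c: "?v1 \<in> carrier_mat n n" unfolding v1 by (rule mult_carrier_mat[OF mult_carrier_mat[OF Q v1'c] P])
  \<comment> \<open>This is level 1 of the orthogonality assumption, moved from \<open>y'\<close> to
    \<open>y\<close>. For \<open>n = 0\<close> there is no such level and the pairing is an empty
    sum.\<close>
  have "trace_pairing n (poly_mat f (diag_block k q \<mu> R)) ?v1 = 0" for f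
  proof (cases "n = 0")
    case False
    have "trace_pairing n (poly_mat f (diag_block k q \<mu> R)) ?v1
        = trace_pairing n (poly_mat f Y') (south_east_corner 1 ?v')"
      unfolding Y'_eq poly_mat_conj[OF P Q PQ QP Yc] v'1
      by (rule trace_pairing_conj[OF P Q PQ QP poly_mat_carrier[OF Yc] v1c, symmetric])
    then show ?thesis using orth'[of 0 f] False poly_mat_carrier[OF Y'c] by (simp add: embed_corner_0)
  qed (simp add: trace_pairing_def)
  then have orthY: "(\<Sum>i<k + q. \<Sum>j<k + q. poly_mat f (diag_block k q \<mu> R) $$ (i, j)
      * (b * arrow_block k q a c \<mu> R - arrow_block k q a c \<mu> R * b) $$ (Suc j, Suc i)) = 0" for f
    using commutator_carrier[OF bc yc] unfolding trace_pairing_def n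
    by (simp add: index_south_east_corner[of _ "Suc (k + q)"] commutator_def del: index_mult_mat(1))
  have index_v1: "(b * arrow_block k q a c \<mu> R - arrow_block k q a c \<mu> R * b) $$ (Suc i, Suc j) = ?v1 $$ (i, j)"
    if "i < k + q" "j < k + q" for i j
    using that index_south_east_corner[OF commutator_carrier[OF bc yc], of i 1 j] n
    by (simp add: commutator_def)
  obtain b1 where b1: "b1 \<in> carrier_mat n n" "commutator b1 (diag_block k q \<mu> R) = ?v1"
  proof -
    from corner_tangent[OF bc[unfolded n] orthY] obtain b1 where b1: "b1 \<in> carrier_mat (k + q) (k + q)"
      "\<And>i j. i < k + q \<Longrightarrow> j < k + q \<Longrightarrow> (b1 * diag_block k q \<mu> R - diag_block k q \<mu> R * b1) $$ (i, j)
        = (b * arrow_block k q a c \<mu> R - arrow_block k q a c \<mu> R * b) $$ (Suc i, Suc j)" by metis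
    have "commutator b1 (diag_block k q \<mu> R) = ?v1"
    proof (rule eq_matI)
      fix i j assume "i < dim_row ?v1" "j < dim_col ?v1"
      then have ij: "i < k + q" "j < k + q" using v1c n by auto
      show "commutator b1 (diag_block k q \<mu> R) $$ (i, j) = ?v1 $$ (i, j)"
        using b1(2)[OF ij] index_v1[OF ij] by (simp only: commutator_def)
    qed (use carrier_matD[OF b1(1)] carrier_matD[OF Yc] carrier_matD[OF v1c] n in \<open>simp_all add: commutator_def[of b1]\<close>)
    with b1 n show thesis by (intro that) auto
  qed
  have "commutator (P * b1 * Q) Y' = south_east_corner 1 ?v'"
    unfolding Y'_eq v'1 b1(2)[symmetric] by (rule commutator_conj[OF P Q PQ QP b1(1) Yc, symmetric])
  moreover have "P * b1 * Q \<in> carrier_mat n n" using P Q b1 by simp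
  ultimately obtain z' where z': "gt_span n Y' z'" "south_east_corner 1 ?v' = commutator z' Y'"
    using lag[folded Y'_eq, unfolded lagrangian_def] orth' by metis
  have z'c: "z' \<in> carrier_mat n n" using z'(1) by (simp add: gt_span_def)
  define E where "E = embed_corner (Suc n) 1 z'"
  have Ec: "E \<in> carrier_mat (Suc n) (Suc n)" by (simp add: E_def)
  have diff: "commutator (b' - E) y' = ?v' - commutator E y'"
    by (rule commutator_diff[OF b' Ec y'c])
  have v''0: "south_east_corner 1 (commutator (b' - E) y') = 0\<^sub>m n n"
    unfolding diff south_east_corner_diff[OF v'c commutator_carrier[OF Ec y'c]]
    unfolding z'(2) E_def corner_commutator_embed[OF y'c z'c] Y'_def[symmetric]
    by (rule minus_r_inv_mat[OF commutator_carrier[OF z'c Y'c]])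
  define b2 where "b2 = ?Q * (b' - E) * ?P"
  have b'E: "b' - E \<in> carrier_mat (Suc n) (Suc n)" using Ec by (rule minus_carrier_mat)
  have b2c: "b2 \<in> carrier_mat (Suc n) (Suc n)" using bP bQ b'E by (simp add: b2_def)
  have v2: "commutator b2 y = ?Q * commutator (b' - E) y' * ?P"
    unfolding b2_def y_y' by (rule commutator_conj[OF bQ bP bQP bPQ b'E y'c, symmetric])
  have "south_east_corner 1 (commutator b2 y) = 0\<^sub>m n n"
    unfolding v2 corner_border_conj[OF commutator_carrier[OF b'E y'c] Q P] v''0 using P Q by simp
  then have "(b2 * arrow_block k q a c \<mu> R - arrow_block k q a c \<mu> R * b2) $$ (Suc i, Suc j) = 0"
    if "i < k + q" "j < k + q" for i j
    using that index_south_east_corner[OF commutator_carrier[OF b2c yc], of i 1 j] n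
    by (simp add: commutator_def)
  from border_tangent[OF b2c[unfolded n] this] obtain f where
    f: "commutator b2 y = commutator (embed_corner (Suc n) 1 (poly_mat f (diag_block k q \<mu> R))) y"
    unfolding commutator_def n by metis
  have "commutator (b' - E) y' = ?P * commutator b2 y * ?Q"
    unfolding v2 using bP bQ bPQ commutator_carrier[OF b'E y'c]
    by (simp add: assoc_mult_mat[of _ "Suc n" "Suc n" _ "Suc n" _ "Suc n"])
      (simp add: assoc_mult_mat[of _ "Suc n" "Suc n" _ "Suc n" _ "Suc n", symmetric])
  also have "\<dots> = commutator (?P * embed_corner (Suc n) 1 (poly_mat f (diag_block k q \<mu> R)) * ?Q) y'"
    unfolding f y'_def by (rule commutator_conj[OF bP bQ bPQ bQP _ yc]) simp
  also have "?P * embed_corner (Suc n) 1 (poly_mat f (diag_block k q \<mu> R)) * ?Q = embed_corner (Suc n) 1 (poly_mat f Y')"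
    unfolding Y'_eq poly_mat_conj[OF P Q PQ QP Yc] by (rule embed_border_conj[OF poly_mat_carrier[OF Yc] P Q])
  finally have f': "?v' - commutator E y' = commutator (embed_corner (Suc n) 1 (poly_mat f Y')) y'"
    using diff by simp
  let ?F = "embed_corner (Suc n) 1 (poly_mat f Y')"
  have "?v' = commutator (E + ?F) y'"
  proof -
    have "?v' = commutator E y' + (?v' - commutator E y')"
      using v'c commutator_carrier[OF Ec y'c] by (intro eq_matI) auto
    also have "\<dots> = commutator (E + ?F) y'"
      unfolding f' by (rule commutator_add[OF Ec embed_corner_carrier y'c, symmetric])
    finally show ?thesis .
  qed
  moreover have "gt_span (Suc n) y' (E + ?F)"
  proof -
    from z'(1) obtain G where G: "\<And>i j. i < n \<Longrightarrow> j < n \<Longrightarrow> z' $$ (i, j)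
        = (\<Sum>m<n. embed_corner n m (poly_mat (G m) (south_east_corner m Y')) $$ (i, j))"
      unfolding gt_span_def by blast
    \<comment> \<open>Level \<open>m\<close> of the corner is level \<open>m + 1\<close> of the
      whole matrix, and \<open>f\<close> joins level 1. Level 0 receives 0: polynomials in
      \<open>y'\<close> commute with \<open>y'\<close> and generate no tangent vector.\<close>
    define H where "H m = (if m = 0 then 0 else if m = 1 then G 0 + f else G (m - 1))" for m
    have emb: "embed_corner (Suc n) (Suc m) (poly_mat (H (Suc m)) (south_east_corner (Suc m) y'))
        = embed_corner (Suc n) 1 (embed_corner n m (poly_mat (H (Suc m)) (south_east_corner m Y')))" for m
      unfolding Y'_def south_east_corner_Suc embed_corner_Suc ..
    have "(E + ?F) $$ (i, j) = (\<Sum>m<Suc n. embed_corner (Suc n) m (poly_mat (H m) (south_east_corner m y')) $$ (i, j))"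
      if ij: "i < Suc n" "j < Suc n" for i j
    proof -
      have "(\<Sum>m<Suc n. embed_corner (Suc n) m (poly_mat (H m) (south_east_corner m y')) $$ (i, j))
          = (\<Sum>m<n. embed_corner (Suc n) 1 (embed_corner n m (poly_mat (H (Suc m)) (south_east_corner m Y'))) $$ (i, j))"
        unfolding sum.lessThan_Suc_shift emb using ij y'c
        by (simp add: H_def poly_mat_0[OF y'c] embed_corner_def)
      also have "\<dots> = (E + ?F) $$ (i, j)"
      proof (cases "i = 0 \<or> j = 0")
        case True
        then show ?thesis using ij by (auto simp: E_def embed_corner_def)
      next
        case False
        then obtain i' j' where ij': "i = Suc i'" "j = Suc j'" "i' < n" "j' < n"
          using ij by (cases i; cases j) auto
        then obtain n' where n': "n = Suc n'" by (cases n) auto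
        have corner: "poly_mat (G 0 + f) Y' $$ (i', j') = poly_mat (G 0) Y' $$ (i', j') + poly_mat f Y' $$ (i', j')"
          using ij' poly_mat_dim[OF Y'c] by (simp add: poly_mat_add[OF Y'c])
        have "(\<Sum>m<n. embed_corner (Suc n) 1 (embed_corner n m (poly_mat (H (Suc m)) (south_east_corner m Y'))) $$ (i, j))
            = (\<Sum>m<n. embed_corner n m (poly_mat (H (Suc m)) (south_east_corner m Y')) $$ (i', j'))"
          using ij' by (simp add: embed_corner_def)
        also have "\<dots> = (\<Sum>m<n. embed_corner n m (poly_mat (G m) (south_east_corner m Y')) $$ (i', j'))
            + poly_mat f Y' $$ (i', j')"
          unfolding n' sum.lessThan_Suc_shift
          using corner ij' by (simp add: H_def embed_corner_def n')
        also have "\<dots> = (E + ?F) $$ (i, j)" using ij' G[of i' j'] by (simp add: E_def embed_corner_def)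
        finally show ?thesis .
      qed
      finally show ?thesis by simp
    qed
    then show ?thesis unfolding gt_span_def using Ec by auto
  qed
  ultimately show "\<exists>z. gt_span (Suc n) (?P * y * ?Q) z \<and>
      commutator b' (?P * y * ?Q) = commutator z (?P * y * ?Q)"
    unfolding y'_def[symmetric] by blast
qed

lemma lagrangian_exists:
  fixes x :: "'a::{alg_closed_field, field_char_0} mat"
  assumes "x \<in> carrier_mat n n"
  shows "\<exists>y. similar_mat y x \<and> lagrangian n y"
  using assms
proof (induction n arbitrary: x)
  case 0
  have "gt_span 0 x x" unfolding gt_span_def using 0 by auto
  moreover have "commutator b x = commutator x x" if "b \<in> carrier_mat 0 0" for b
    using that 0 by (intro eq_matI) (auto simp: commutator_def)
  ultimately have "lagrangian 0 x" unfolding lagrangian_def by blast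
  with 0 show ?case using similar_mat_refl by blast
next
  case (Suc n)
  from cyclic_splitting[OF Suc.prems] obtain k q a c \<mu> R p where
    kq: "Suc n = Suc (k + q)" and arrow: "generic_arrow k q a c \<mu> R p"
    and sim: "similar_mat x (arrow_block k q a c \<mu> R)" by blast
  interpret generic_arrow k q a c \<mu> R p by (rule arrow)
  from kq have n: "n = k + q" by simp
  from Suc.IH[OF Y_carrier[folded n]] obtain Y' where Y': "similar_mat Y' Y" "lagrangian n Y'" by blast
  from similar_matD[OF Y'(1)] obtain n' P Q where
    "{Y', Y, P, Q} \<subseteq> carrier_mat n' n'" "P * Q = 1\<^sub>m n'" "Q * P = 1\<^sub>m n'" "Y' = P * Y * Q"
    by blast
  moreover from this have "n' = n" using carrier_matD(1)[of Y n' n'] carrier_matD(1)[OF Y_carrier] n by simp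
  ultimately have PQ: "P \<in> carrier_mat n n" "Q \<in> carrier_mat n n" "P * Q = 1\<^sub>m n" "Q * P = 1\<^sub>m n"
    and Y'_eq: "Y' = P * Y * Q" by auto
  have lag: "lagrangian (Suc n) (border P * y * border Q)"
    by (rule lagrangian_step[OF arrow n PQ Y'(2)[unfolded Y'_eq]])
  have "similar_mat (border P * y * border Q) y"
    using border_carrier[OF PQ(1)] border_carrier[OF PQ(2)] y_carrier[folded n]
      border_mult[OF PQ(1-3)] border_mult[OF PQ(2,1,4)]
    by (intro similar_matI[of _ _ "border P" "border Q" "Suc n"]) auto
  with similar_mat_sym[OF sim] have "similar_mat (border P * y * border Q) x"
    using similar_mat_trans by blast
  with lag show ?case by blast
qed

section \<open>Gradients of the Gelfand--Tsetlin generators\<close>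

text \<open>Jacobi's formula for an arbitrary derivation of a commutative ring. The generality is
  needed because it is applied to a matrix over polynomials in \<open>t\<close>, with a derivation
  that acts on their coefficients.\<close>

lemma det_derivation:
  fixes \<delta> :: "'r::comm_ring_1 \<Rightarrow> 'r"
  assumes add: "\<And>x y. \<delta> (x + y) = \<delta> x + \<delta> y"
    and mult: "\<And>x y. \<delta> (x * y) = \<delta> x * y + x * \<delta> y"
    and A: "A \<in> carrier_mat n n"
  shows "\<delta> (det A) = (\<Sum>i<n. \<Sum>j<n. \<delta> (A $$ (i, j)) * cofactor A i j)"
proof -
  have \<delta>0: "\<delta> 0 = 0" using add[of 0 0] by simp
  have \<delta>1: "\<delta> 1 = 0" using mult[of 1 1] by simp
  have \<delta>m: "\<delta> (- x) = - \<delta> x" for x using add[of x "- x"] \<delta>0 by (simp add: eq_neg_iff_add_eq_0 add.commute)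
  have \<delta>sum: "\<delta> (sum f S) = (\<Sum>s\<in>S. \<delta> (f s))" for f and S :: "'x set"
    by (induction S rule: infinite_finite_induct) (auto simp: \<delta>0 add)
  have \<delta>prod: "\<delta> (prod f S) = (\<Sum>s\<in>S. \<delta> (f s) * prod f (S - {s}))" if "finite S" for f and S :: "nat set"
    using that
  proof (induction S)
    case (insert x S)
    have "(\<Sum>s\<in>S. \<delta> (f s) * prod f (insert x S - {s})) = (\<Sum>s\<in>S. f x * (\<delta> (f s) * prod f (S - {s})))"
    proof (intro sum.cong refl)
      fix s assume "s \<in> S"
      with insert.hyps have "insert x S - {s} = insert x (S - {s})" "x \<notin> S - {s}" by auto
      then show "\<delta> (f s) * prod f (insert x S - {s}) = f x * (\<delta> (f s) * prod f (S - {s}))"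
        using insert.hyps by (simp add: mult_ac)
    qed
    then show ?case using insert by (simp add: mult sum_distrib_left)
  qed (simp add: \<delta>1)
  have \<delta>sign: "\<delta> (signof p * x) = signof p * \<delta> x" for p :: "nat \<Rightarrow> nat" and x
    by (cases p rule: sign_cases) (auto simp: \<delta>m)
  \<comment> \<open>By the Leibniz rule the derivative of the determinant is the sum over
    \<open>i\<close> of the determinants with row \<open>i\<close> differentiated; expansion along
    that row leaves the cofactors of \<open>A\<close>.\<close>
  define Ai where "Ai i = mat n n (\<lambda>(r, s). if r = i then \<delta> (A $$ (i, s)) else A $$ (r, s))" for i
  have Ai: "Ai i \<in> carrier_mat n n" for i by (simp add: Ai_def)
  have det_Ai: "det (Ai i) = (\<Sum>j<n. \<delta> (A $$ (i, j)) * cofactor A i j)" if i: "i < n" for i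
  proof -
    have "mat_delete (Ai i) i j = mat_delete A i j" if "j < n" for j
      using A that i by (intro eq_matI) (auto simp: mat_delete_def Ai_def)
    then show ?thesis unfolding laplace_expansion_row[OF Ai i]
      using i by (intro sum.cong) (auto simp: cofactor_def Ai_def)
  qed
  let ?\<P> = "{p. p permutes {0..<n}}"
  have "\<delta> (det A) = (\<Sum>p\<in>?\<P>. \<Sum>i\<in>{0..<n}. signof p * (\<delta> (A $$ (i, p i)) * (\<Prod>r\<in>{0..<n} - {i}. A $$ (r, p r))))"
    unfolding det_def'[OF A] \<delta>sum \<delta>sign by (intro sum.cong refl) (simp add: \<delta>prod sum_distrib_left)
  also have "\<dots> = (\<Sum>i<n. \<Sum>p\<in>?\<P>. signof p * (\<delta> (A $$ (i, p i)) * (\<Prod>r\<in>{0..<n} - {i}. A $$ (r, p r))))"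
    unfolding lessThan_atLeast0 by (rule sum.swap)
  also have "\<dots> = (\<Sum>i<n. det (Ai i))"
  proof (intro sum.cong refl)
    fix i assume "i \<in> {..<n}"
    then have i: "i < n" by simp
    have "\<delta> (A $$ (i, p i)) * (\<Prod>r\<in>{0..<n} - {i}. A $$ (r, p r)) = (\<Prod>r = 0..<n. Ai i $$ (r, p r))"
      if p: "p permutes {0..<n}" for p
    proof -
      have pr: "p r < n" if "r < n" for r using permutes_in_image[OF p, of r] that by simp
      have "(\<Prod>r = 0..<n. Ai i $$ (r, p r)) = Ai i $$ (i, p i) * (\<Prod>r\<in>{0..<n} - {i}. Ai i $$ (r, p r))"
        using i by (subst prod.remove[of _ i]) auto
      also have "(\<Prod>r\<in>{0..<n} - {i}. Ai i $$ (r, p r)) = (\<Prod>r\<in>{0..<n} - {i}. A $$ (r, p r))"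
        by (intro prod.cong) (auto simp: Ai_def pr)
      finally show ?thesis using i pr by (simp add: Ai_def)
    qed
    then show "(\<Sum>p\<in>?\<P>. signof p * (\<delta> (A $$ (i, p i)) * (\<Prod>r\<in>{0..<n} - {i}. A $$ (r, p r)))) = det (Ai i)"
      unfolding det_def'[OF Ai] by (intro sum.cong) auto
  qed
  also have "\<dots> = (\<Sum>i<n. \<Sum>j<n. \<delta> (A $$ (i, j)) * cofactor A i j)"
    by (intro sum.cong refl) (simp add: det_Ai)
  finally show ?thesis .
qed

text \<open>The coefficient at the \<open>j\<close>-th power of \<open>t\<close> of the adjugate of
  \<open>t - M\<close>, that is, one of the Faddeev-LeVerrier matrices. Up to sign these are the
  gradients of the coefficients of the characteristic polynomial.\<close>

definition adj_coeff :: "'a::comm_ring_1 mat \<Rightarrow> nat \<Rightarrow> 'a mat" where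
  "adj_coeff M j = mat (dim_row M) (dim_row M) (\<lambda>(i, l). coeff (adj_mat (char_poly_matrix M) $$ (i, l)) j)"

context
  fixes M :: "'a::comm_ring_1 mat" and N :: nat
  assumes M: "M \<in> carrier_mat N N"
begin

lemma adj_coeff_carrier: "adj_coeff M j \<in> carrier_mat N N"
  using M by (simp add: adj_coeff_def)

lemma index_char_poly_matrix:
  "i < N \<Longrightarrow> l < N \<Longrightarrow> char_poly_matrix M $$ (i, l) = [:- M $$ (i, l), if i = l then 1 else 0:]"
  using M by (simp add: char_poly_matrix_def)

lemma adj_char_poly_matrix:
  assumes "i < N" "l < N"
  shows "(\<Sum>s<N. adj_mat (char_poly_matrix M) $$ (i, s) * [:- M $$ (s, l), if s = l then 1 else 0:])
    = (if i = l then char_poly M else 0)"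
proof -
  have C: "char_poly_matrix M \<in> carrier_mat N N" using M by simp
  have "(\<Sum>s<N. adj_mat (char_poly_matrix M) $$ (i, s) * [:- M $$ (s, l), if s = l then 1 else 0:])
      = (adj_mat (char_poly_matrix M) * char_poly_matrix M) $$ (i, l)"
    unfolding index_mult_mat_sum[OF adj_mat(1)[OF C] C assms]
    using assms by (intro sum.cong) (auto simp: index_char_poly_matrix)
  also have "\<dots> = (if i = l then char_poly M else 0)"
    unfolding adj_mat(3)[OF C] using assms by (simp add: char_poly_def)
  finally show ?thesis .
qed

text \<open>Coefficient comparison in the identity that the adjugate times \<open>t - M\<close> is
  the characteristic polynomial times the identity matrix.\<close>

lemma adj_coeff_Suc:
  "adj_coeff M j = adj_coeff M (Suc j) * M + coeff (char_poly M) (Suc j) \<cdot>\<^sub>m 1\<^sub>m N"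
proof (rule eq_matI)
  fix i l assume "i < dim_row (adj_coeff M (Suc j) * M + coeff (char_poly M) (Suc j) \<cdot>\<^sub>m 1\<^sub>m N)"
    "l < dim_col (adj_coeff M (Suc j) * M + coeff (char_poly M) (Suc j) \<cdot>\<^sub>m 1\<^sub>m N)"
  then have il: "i < N" "l < N" by auto
  let ?a = "\<lambda>s. adj_mat (char_poly_matrix M) $$ (i, s)"
  have "coeff (if i = l then char_poly M else 0) (Suc j)
      = (\<Sum>s<N. coeff (?a s * [:- M $$ (s, l), if s = l then 1 else 0:]) (Suc j))"
    unfolding adj_char_poly_matrix[OF il, symmetric] coeff_sum ..
  also have "\<dots> = (\<Sum>s<N. - (coeff (?a s) (Suc j) * M $$ (s, l)) + (if s = l then coeff (?a l) j else 0))"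
    by (intro sum.cong) (auto simp: coeff_mult_0 mult.commute)
  also have "\<dots> = - (adj_coeff M (Suc j) * M) $$ (i, l) + adj_coeff M j $$ (i, l)"
    unfolding index_mult_mat_sum[OF adj_coeff_carrier M il]
    using il M by (simp add: sum.distrib sum_negf sum_subtractf adj_coeff_def)
  finally show "adj_coeff M j $$ (i, l)
      = (adj_coeff M (Suc j) * M + coeff (char_poly M) (Suc j) \<cdot>\<^sub>m 1\<^sub>m N) $$ (i, l)"
    using il M adj_coeff_carrier by (auto simp del: index_mult_mat(1))
qed (use M adj_coeff_carrier in auto)

lemma adj_coeff_0: "adj_coeff M 0 * M + coeff (char_poly M) 0 \<cdot>\<^sub>m 1\<^sub>m N = 0\<^sub>m N N"
proof (rule eq_matI)
  fix i l assume "i < dim_row (0\<^sub>m N N)" "l < dim_col (0\<^sub>m N N)"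
  then have il: "i < N" "l < N" by auto
  let ?a = "\<lambda>s. adj_mat (char_poly_matrix M) $$ (i, s)"
  have "coeff (if i = l then char_poly M else 0) 0
      = (\<Sum>s<N. coeff (?a s * [:- M $$ (s, l), if s = l then 1 else 0:]) 0)"
    unfolding adj_char_poly_matrix[OF il, symmetric] coeff_sum ..
  also have "\<dots> = (\<Sum>s<N. - (coeff (?a s) 0 * M $$ (s, l)))"
    by (intro sum.cong) (auto simp: coeff_mult_0)
  also have "\<dots> = - (adj_coeff M 0 * M) $$ (i, l)"
    unfolding index_mult_mat_sum[OF adj_coeff_carrier M il]
    using il M by (simp add: sum_negf adj_coeff_def)
  finally show "(adj_coeff M 0 * M + coeff (char_poly M) 0 \<cdot>\<^sub>m 1\<^sub>m N) $$ (i, l) = 0\<^sub>m N N $$ (i, l)"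
    using il M adj_coeff_carrier by (auto simp del: index_mult_mat(1))
qed (use M adj_coeff_carrier in auto)

text \<open>Some crude bound \<open>J\<close> on the degrees of the entries exists since there are
  finitely many. From there the recursion descends to \<open>N\<close>, because the characteristic
  polynomial has no coefficient above degree \<open>N\<close>; no degree estimate for minors
  enters.\<close>

lemma adj_coeff_eq_0:
  assumes "N \<le> j"
  shows "adj_coeff M j = 0\<^sub>m N N"
proof -
  have "\<exists>J. \<forall>j\<ge>J. adj_coeff M j = 0\<^sub>m N N"
  proof (intro exI allI impI)
    let ?J = "Suc (Max ((\<lambda>(i, l). degree (adj_mat (char_poly_matrix M) $$ (i, l))) ` ({..<N} \<times> {..<N})))"
    fix j assume j: "?J \<le> j"
    have "degree (adj_mat (char_poly_matrix M) $$ (i, l)) < j" if "i < N" "l < N" for i l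
    proof -
      have "degree (adj_mat (char_poly_matrix M) $$ (i, l))
          \<le> Max ((\<lambda>(i, l). degree (adj_mat (char_poly_matrix M) $$ (i, l))) ` ({..<N} \<times> {..<N}))"
        by (rule Max_ge) (use that in auto)
      with j show ?thesis by simp
    qed
    then show "adj_coeff M j = 0\<^sub>m N N"
      using M by (intro eq_matI) (auto simp: adj_coeff_def coeff_eq_0)
  qed
  then obtain J where J: "\<And>j. J \<le> j \<Longrightarrow> adj_coeff M j = 0\<^sub>m N N" by blast
  show ?thesis
  proof (cases "J \<le> j")
    case False
    then have "j \<le> J" by simp
    then show ?thesis using assms
    proof (induction rule: inc_induct)
      case base
      then show ?case by (simp add: J)
    next
      case (step i)
      have "coeff (char_poly M) (Suc i) = 0"
        using degree_monic_char_poly[OF M] step.prems by (intro coeff_eq_0) simp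
      then show ?case using step M by (subst adj_coeff_Suc) (auto intro!: eq_matI)
    qed
  qed (rule J)
qed

lemma adj_coeff_last:
  assumes "0 < N"
  shows "adj_coeff M (N - 1) = 1\<^sub>m N"
proof -
  have "adj_coeff M (N - 1) = adj_coeff M N * M + coeff (char_poly M) N \<cdot>\<^sub>m 1\<^sub>m N"
    using adj_coeff_Suc[of "N - 1"] assms by simp
  also have "\<dots> = 1\<^sub>m N"
    using degree_monic_char_poly[OF M] M by (simp add: adj_coeff_eq_0) (auto intro!: eq_matI)
  finally show ?thesis .
qed

text \<open>Descending along the recursion from 0 exhibits each coefficient as a polynomial in
  \<open>M\<close>.\<close>

lemma adj_coeff_commute: "adj_coeff M j * M = M * adj_coeff M j"
proof -
  have "\<exists>f. adj_coeff M j = poly_mat f M" if "j \<le> N"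
    using that
  proof (induction rule: inc_induct)
    case base
    show ?case using poly_mat_0[OF M] adj_coeff_eq_0[of N] by (intro exI[of _ 0]) simp
  next
    case (step i)
    then obtain f where f: "adj_coeff M (Suc i) = poly_mat f M" by blast
    show ?case
    proof (rule exI[of _ "pCons (coeff (char_poly M) (Suc i)) f"])
      have "adj_coeff M i = poly_mat f M * M + coeff (char_poly M) (Suc i) \<cdot>\<^sub>m 1\<^sub>m N"
        using adj_coeff_Suc[of i] by (simp add: f)
      also have "\<dots> = coeff (char_poly M) (Suc i) \<cdot>\<^sub>m 1\<^sub>m N + M * poly_mat f M"
        unfolding poly_mat_self_commute[OF M, symmetric]
        using M poly_mat_carrier[OF M] by (intro comm_add_mat[of _ N N]) auto
      finally show "adj_coeff M i = poly_mat (pCons (coeff (char_poly M) (Suc i)) f) M"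
        by (simp add: poly_mat_pCons[OF M])
    qed
  qed
  then show ?thesis
  proof (cases "j \<le> N")
    case True
    with \<open>j \<le> N \<Longrightarrow> _\<close> show ?thesis using poly_mat_self_commute[OF M] by metis
  next
    case False
    then show ?thesis using M by (simp add: adj_coeff_eq_0)
  qed
qed

end

text \<open>Jacobi's formula yields the cofactor at \<open>(b - m, a - m)\<close>, which is the
  adjugate at \<open>(a - m, b - m)\<close>: because \<open>generic_matrix\<close> is transposed,
  the gradient is the adjugate itself and not its transpose. The sign is that of \<open>M\<close> in
  \<open>t - M\<close>.\<close>

lemma partial_deriv_Delta:
  fixes n m k :: nat
  defines "G \<equiv> generic_matrix n :: (nat \<times> nat, 'a::comm_ring_1) mpoly mat"
  shows "partial_deriv (a, b) (Delta n m k :: (nat \<times> nat, 'a) mpoly)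
    = (if m \<le> a \<and> m \<le> b \<and> a < n \<and> b < n
       then - adj_coeff (south_east_corner m G) (n - m - k) $$ (a - m, b - m) else 0)"
proof -
  let ?M = "south_east_corner m G" and ?N = "n - m"
  have G: "G \<in> carrier_mat n n" by (simp add: G_def generic_matrix_def)
  have M: "?M \<in> carrier_mat ?N ?N" by (rule south_east_corner_carrier[OF G])
  have C: "char_poly_matrix ?M \<in> carrier_mat ?N ?N" using M by simp
  \<comment> \<open>The partial derivative extended to polynomials in \<open>t\<close> by treating
    \<open>t\<close> as a constant.\<close>
  define \<delta> where "\<delta> = map_poly (partial_deriv (a, b) :: (nat \<times> nat, 'a) mpoly \<Rightarrow> _)"
  have coeff_\<delta>: "coeff (\<delta> f) i = partial_deriv (a, b) (coeff f i)" for f i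
    by (simp add: \<delta>_def coeff_map_poly)
  have \<delta>_add: "\<delta> (f + g) = \<delta> f + \<delta> g" for f g
    by (rule poly_eqI) (simp add: coeff_\<delta> partial_deriv_add)
  have \<delta>_mult: "\<delta> (f * g) = \<delta> f * g + f * \<delta> g" for f g
    by (rule poly_eqI) (simp add: coeff_\<delta> coeff_mult partial_deriv_sum partial_deriv_mult sum.distrib)
  have \<delta>_entry: "\<delta> (char_poly_matrix ?M $$ (i, j)) = [:if (a, b) = (j + m, i + m) then - 1 else 0:]"
    if "i < ?N" "j < ?N" for i j
  proof -
    have "?M $$ (i, j) = var (j + m, i + m)"
      using that index_south_east_corner[OF G that] by (simp add: G_def generic_matrix_def)
    then show ?thesis
      unfolding index_char_poly_matrix[OF M that]
      by (intro poly_eqI) (auto simp: coeff_\<delta> coeff_pCons partial_deriv_uminus partial_deriv_var split: nat.splits)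
  qed
  have "\<delta> (char_poly ?M) = (\<Sum>i<?N. \<Sum>j<?N. [:if (a, b) = (j + m, i + m) then - 1 else 0:] * cofactor (char_poly_matrix ?M) i j)"
    unfolding char_poly_def det_derivation[of \<delta>, OF \<delta>_add \<delta>_mult C]
    by (intro sum.cong refl) (simp add: \<delta>_entry)
  also have "\<dots> = (if m \<le> a \<and> m \<le> b \<and> a < n \<and> b < n then - cofactor (char_poly_matrix ?M) (b - m) (a - m) else 0)"
  proof (cases "m \<le> a \<and> m \<le> b \<and> a < n \<and> b < n")
    case True
    have "(\<Sum>i<?N. \<Sum>j<?N. [:if (a, b) = (j + m, i + m) then - 1 else 0:] * cofactor (char_poly_matrix ?M) i j)
        = (\<Sum>i<?N. \<Sum>j<?N. if j = a - m then (if i = b - m then - cofactor (char_poly_matrix ?M) (b - m) (a - m) else 0) else 0)"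
      using True by (intro sum.cong refl) auto
    also have "\<dots> = - cofactor (char_poly_matrix ?M) (b - m) (a - m)"
      using True by (simp add: diff_less_mono)
    finally show ?thesis using True by simp
  next
    case False
    then show ?thesis by (auto intro!: sum.neutral)
  qed
  finally have "coeff (\<delta> (char_poly ?M)) (?N - k) = (if m \<le> a \<and> m \<le> b \<and> a < n \<and> b < n
      then - coeff (cofactor (char_poly_matrix ?M) (b - m) (a - m)) (?N - k) else 0)" by simp
  moreover have "adj_coeff ?M j $$ (a - m, b - m) = coeff (cofactor (char_poly_matrix ?M) (b - m) (a - m)) j"
    if "m \<le> a" "m \<le> b" "a < n" "b < n" for j
    using carrier_matD[OF M] carrier_matD[OF C] that by (simp add: adj_coeff_def adj_mat_def diff_less_mono)
  ultimately show ?thesis by (auto simp: Delta_def G_def coeff_\<delta> del: if_split)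
qed

section \<open>The Lie-Poisson bracket as a trace pairing\<close>

definition gradient :: "nat \<Rightarrow> (nat \<times> nat, 'a::comm_ring_1) mpoly \<Rightarrow> (nat \<times> nat, 'a) mpoly mat" where
  "gradient n P = mat n n (\<lambda>v. partial_deriv v P)"

lemma gradient_carrier [simp]: "gradient n P \<in> carrier_mat n n"
  by (simp add: gradient_def)

lemma generic_matrix_carrier [simp]: "generic_matrix n \<in> carrier_mat n n"
  by (simp add: generic_matrix_def)

lemma gradient_Delta:
  "gradient n (Delta n m k)
    = - embed_corner n m (adj_coeff (south_east_corner m (generic_matrix n)) (n - m - k))"
  by (rule eq_matI) (auto simp: gradient_def embed_corner_def partial_deriv_Delta)

text \<open>The formula for the bracket as the trace form of one gradient with the Hamiltonian
  vector field of the other. It is kept over the polynomial ring, so that vanishing of brackets is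
  obtained as an identity of polynomials.\<close>

lemma lie_poisson_eq_pairing:
  "lie_poisson n P Q = trace_pairing n (gradient n P) (commutator (gradient n Q) (generic_matrix n))"
proof -
  let ?p = "\<lambda>i j. partial_deriv (i, j) P" and ?q = "\<lambda>i j. partial_deriv (i, j) Q"
  have "lie_poisson n P Q = (\<Sum>i<n. \<Sum>j<n. \<Sum>k<n. \<Sum>l<n. ?p i j * ?q k l *
      ((if j = k then var (i, l) else 0) - (if l = i then var (k, j) else 0)))"
    unfolding lie_poisson_def lie_bracket_units_def sum.cartesian_product' by (simp cong: if_cong)
  also have "\<dots> = (\<Sum>i<n. \<Sum>j<n. ?p i j * ((\<Sum>l<n. ?q j l * var (i, l)) - (\<Sum>k<n. var (k, j) * ?q k i)))"
  proof (intro sum.cong refl)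
    fix i j assume "i \<in> {..<n}" "j \<in> {..<n}"
    then have ij: "i < n" "j < n" by auto
    have "(\<Sum>k<n. \<Sum>l<n. ?p i j * ?q k l * ((if j = k then var (i, l) else 0) - (if l = i then var (k, j) else 0)))
        = (\<Sum>k<n. \<Sum>l<n. if k = j then ?p i j * (?q j l * var (i, l)) else 0)
          - (\<Sum>k<n. \<Sum>l<n. if l = i then ?p i j * (var (k, j) * ?q k i) else 0)"
      unfolding sum_subtractf[symmetric] by (intro sum.cong refl) (auto simp: algebra_simps)
    also have "(\<Sum>k<n. \<Sum>l<n. if k = j then ?p i j * (?q j l * var (i, l)) else 0)
        = (\<Sum>l<n. \<Sum>k<n. if k = j then ?p i j * (?q j l * var (i, l)) else 0)" by (rule sum.swap)
    finally show "(\<Sum>k<n. \<Sum>l<n. ?p i j * ?q k l * ((if j = k then var (i, l) else 0) - (if l = i then var (k, j) else 0)))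
        = ?p i j * ((\<Sum>l<n. ?q j l * var (i, l)) - (\<Sum>k<n. var (k, j) * ?q k i))"
      using ij by (simp add: sum_distrib_left right_diff_distrib)
  qed
  also have "\<dots> = trace_pairing n (gradient n P) (commutator (gradient n Q) (generic_matrix n))"
    unfolding trace_pairing_def commutator_def
    by (intro sum.cong refl)
       (simp add: index_mult_mat_sum[of _ n n _ n] gradient_def generic_matrix_def mult.commute del: index_mult_mat(1))
  finally show ?thesis .
qed

lemma trace_pairing_commutator:
  assumes "A \<in> carrier_mat n n" "b \<in> carrier_mat n n" "y \<in> carrier_mat n n"
  shows "trace_pairing n A (commutator b y) = - trace_pairing n b (commutator A y)"
proof -
  have "trace_pairing n A (commutator b y) = trace_pairing n A (b * y) - trace_pairing n A (y * b)"
    unfolding commutator_def using assms by (intro trace_pairing_diff) auto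
  also have "trace_pairing n A (b * y) = trace_pairing n b (y * A)"
    using assms by (simp add: trace_pairing_commute[of n A] trace_pairing_assoc)
  also have "trace_pairing n A (y * b) = trace_pairing n b (A * y)"
    using assms by (simp add: trace_pairing_assoc[symmetric] trace_pairing_commute[of n _ b])
  also have "trace_pairing n b (y * A) - trace_pairing n b (A * y) = - trace_pairing n b (commutator A y)"
    unfolding commutator_def using assms by (subst trace_pairing_diff) auto
  finally show ?thesis .
qed

lemma lie_poisson_skew: "lie_poisson n P Q = - lie_poisson n Q P"
  unfolding lie_poisson_eq_pairing by (rule trace_pairing_commutator) auto

lemma commutator_embed_corner:
  assumes y: "y \<in> carrier_mat n n" and B: "B \<in> carrier_mat (n - m) (n - m)"
    and com: "B * south_east_corner m y = south_east_corner m y * B"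
    and ij: "m \<le> i" "m \<le> j" "i < n" "j < n"
  shows "commutator (embed_corner n m B) y $$ (i, j) = 0"
proof -
  let ?E = "embed_corner n m B" and ?N = "n - m"
  have M: "south_east_corner m y \<in> carrier_mat ?N ?N" by (rule south_east_corner_carrier[OF y])
  have ij': "i - m < ?N" "j - m < ?N" using ij by auto
  have shift: "(\<Sum>s<n. f s) = (\<Sum>s<?N. f (s + m))" if "\<And>s. s < m \<Longrightarrow> f s = 0" for f :: "nat \<Rightarrow> 'a"
  proof -
    have "(\<Sum>s<n. f s) = (\<Sum>s\<in>{m..<n}. f s)"
      using that by (intro sum.mono_neutral_right) auto
    also have "\<dots> = (\<Sum>s<?N. f (s + m))"
      by (rule sum.reindex_bij_witness[of _ "\<lambda>s. s + m" "\<lambda>s. s - m"]) auto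
    finally show ?thesis .
  qed
  have "(?E * y) $$ (i, j) = (\<Sum>s<n. ?E $$ (i, s) * y $$ (s, j))"
    using ij by (intro index_mult_mat_sum[OF embed_corner_carrier y]) auto
  also have "\<dots> = (\<Sum>s<?N. ?E $$ (i, s + m) * y $$ (s + m, j))"
    by (rule shift) (use ij in \<open>simp add: embed_corner_def\<close>)
  also have "\<dots> = (B * south_east_corner m y) $$ (i - m, j - m)"
    unfolding index_mult_mat_sum[OF B M ij'] using ij
    by (intro sum.cong refl) (simp add: embed_corner_def index_south_east_corner[OF y])
  finally have 1: "(?E * y) $$ (i, j) = (B * south_east_corner m y) $$ (i - m, j - m)" .
  have "(y * ?E) $$ (i, j) = (\<Sum>s<n. y $$ (i, s) * ?E $$ (s, j))"
    using ij by (intro index_mult_mat_sum[OF y embed_corner_carrier]) auto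
  also have "\<dots> = (\<Sum>s<?N. y $$ (i, s + m) * ?E $$ (s + m, j))"
    by (rule shift) (use ij in \<open>simp add: embed_corner_def\<close>)
  also have "\<dots> = (south_east_corner m y * B) $$ (i - m, j - m)"
    unfolding index_mult_mat_sum[OF M B ij'] using ij
    by (intro sum.cong refl) (simp add: embed_corner_def index_south_east_corner[OF y])
  finally have 2: "(y * ?E) $$ (i, j) = (south_east_corner m y * B) $$ (i - m, j - m)" .
  have "commutator ?E y $$ (i, j) = (?E * y) $$ (i, j) - (y * ?E) $$ (i, j)"
    unfolding commutator_def using ij carrier_matD[OF y] carrier_matD[OF embed_corner_carrier[of n m B]]
    by (simp del: index_mult_mat(1))
  then show ?thesis by (simp add: 1 2 com)
qed

text \<open>Let \<open>m \<le> m'\<close>. The gradient at level \<open>m\<close> lives on the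
  corner \<open>m\<close> and commutes with it, so its Hamiltonian vector field vanishes on that
  corner. The gradient at level \<open>m'\<close> is supported in the smaller corner, hence the two
  are orthogonal. The other order of the levels follows by skew symmetry.\<close>

lemma lie_poisson_Delta: "lie_poisson n (Delta n m k) (Delta n m' k') = (0 :: (nat \<times> nat, 'a::comm_ring_1) mpoly)"
proof -
  have main: "lie_poisson n (Delta n m' k') (Delta n m k) = (0 :: (nat \<times> nat, 'a) mpoly)" if "m \<le> m'" for m m' k k'
  proof -
    let ?G = "generic_matrix n :: (nat \<times> nat, 'a) mpoly mat"
    let ?B = "adj_coeff (south_east_corner m ?G) (n - m - k)"
    have M: "south_east_corner m ?G \<in> carrier_mat (n - m) (n - m)"
      by (rule south_east_corner_carrier) simp
    have "lie_poisson n (Delta n m k) (Delta n m' k')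
        = - (\<Sum>i<n. \<Sum>j<n. gradient n (Delta n m' k') $$ (i, j)
            * commutator (- embed_corner n m ?B) ?G $$ (j, i))"
      unfolding gradient_Delta[of n m k, symmetric] trace_pairing_def[symmetric]
        lie_poisson_eq_pairing[symmetric] by (rule lie_poisson_skew)
    also have "\<dots> = 0"
    proof -
      have "gradient n (Delta n m' k') $$ (i, j) * commutator (- embed_corner n m ?B) ?G $$ (j, i) = 0"
        if ij: "i < n" "j < n" for i j
      proof (cases "m' \<le> i \<and> m' \<le> j")
        case True
        with \<open>m \<le> m'\<close> have "commutator (embed_corner n m ?B) ?G $$ (j, i) = 0"
          using ij by (intro commutator_embed_corner adj_coeff_carrier[OF M] adj_coeff_commute[OF M]) auto
        moreover have "commutator (- embed_corner n m ?B) ?G = - commutator (embed_corner n m ?B) ?G"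
          unfolding commutator_def using carrier_matD[OF embed_corner_carrier[of n m ?B]]
              carrier_matD[OF generic_matrix_carrier[of n, where 'a = 'a]]
          by (intro eq_matI) (simp_all add: uminus_mult_left_mat uminus_mult_right_mat del: index_mult_mat(1))
        ultimately show ?thesis using ij
            carrier_matD[OF commutator_carrier[OF embed_corner_carrier[of n m ?B] generic_matrix_carrier]] by simp
      next
        case False
        then have "gradient n (Delta n m' k') $$ (i, j) = (0 :: (nat \<times> nat, 'a) mpoly)"
          using ij by (auto simp: gradient_def partial_deriv_Delta)
        then show ?thesis by simp
      qed
      then show ?thesis by simp
    qed
    finally show ?thesis unfolding lie_poisson_skew[of n "Delta n m' k'"] by simp
  qed
  show ?thesis
  proof (cases "m \<le> m'")
    case True
    then show ?thesis unfolding lie_poisson_skew[of n "Delta n m k"] using main by simp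
  qed (use main in simp)
qed

lemma lie_poisson_algebra:
  "lie_poisson n (const c) Q = 0"
  "lie_poisson n (P1 + P2) Q = lie_poisson n P1 Q + lie_poisson n P2 Q"
  "lie_poisson n (P1 * P2) Q = lie_poisson n P1 Q * P2 + P1 * lie_poisson n P2 Q"
  by (simp_all add: lie_poisson_def partial_deriv_add partial_deriv_mult sum.distrib
      sum_distrib_left sum_distrib_right algebra_simps)

text \<open>In characteristic 0 a variable that occurs has a non-zero partial derivative, and
  \<open>partial_deriv_Delta\<close> shows which ones can be non-zero.\<close>

lemma Delta_in_sym_gl:
  fixes n :: nat
  shows "(Delta n m k :: (nat \<times> nat, 'a::field_char_0) mpoly) \<in> sym_gl n"
  unfolding sym_gl_def
proof (rule CollectI, rule subsetI)
  fix v assume v: "v \<in> vars (Delta n m k :: (nat \<times> nat, 'a) mpoly)"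
  then have "var_degree v (Delta n m k :: (nat \<times> nat, 'a) mpoly) \<noteq> 0"
    using var_degree_0_vars[of v "Delta n m k :: (nat \<times> nat, 'a) mpoly"] by (metis (no_types))
  then have "partial_deriv v (Delta n m k :: (nat \<times> nat, 'a) mpoly) \<noteq> 0"
    by (rule var_degree_partial_deriv)
  then show "v \<in> {..<n} \<times> {..<n}"
    by (cases v) (auto simp: partial_deriv_Delta split: if_splits)
qed

lemma subalgebra_generated_sym_gl:
  assumes "\<And>P. P \<in> G \<Longrightarrow> P \<in> sym_gl n" "P \<in> subalgebra_generated G"
  shows "P \<in> sym_gl n"
  using assms(2)
proof induction
  case (add P Q)
  then show ?case using vars_add[of P Q] by (auto simp: sym_gl_def)
next
  case (mult P Q)
  then show ?case using vars_mult[of P Q] by (auto simp: sym_gl_def)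
qed (use assms(1) in \<open>auto simp: sym_gl_def\<close>)

lemma lie_poisson_subalgebra_generated:
  assumes G: "\<And>P Q. P \<in> G \<Longrightarrow> Q \<in> G \<Longrightarrow> lie_poisson n P Q = 0"
    and P: "P \<in> subalgebra_generated G" and Q: "Q \<in> subalgebra_generated G"
  shows "lie_poisson n P Q = 0"
proof -
  have half: "lie_poisson n P Q = 0" if "P \<in> subalgebra_generated G" "\<And>P. P \<in> G \<Longrightarrow> lie_poisson n P Q = 0" for P Q
    using that(1) by induction (auto simp: lie_poisson_algebra that(2))
  have "lie_poisson n Q P' = 0" if "P' \<in> G" for P'
    using Q by (rule half) (use that G in blast)
  then have "lie_poisson n P' Q = 0" if "P' \<in> G" for P'
    using that lie_poisson_skew[of n P' Q] by simp
  with P show ?thesis by (rule half)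
qed

lemma gelfand_tsetlin_poisson_commutative:
  "poisson_commutative_subalgebra n (gelfand_tsetlin n :: (nat \<times> nat, 'a::field_char_0) mpoly set)"
  unfolding poisson_commutative_subalgebra_def gelfand_tsetlin_def
proof (intro conjI ballI allI)
  let ?G = "{Delta n m k | m k. m \<le> n - 1 \<and> 1 \<le> k \<and> k \<le> n - m} :: (nat \<times> nat, 'a) mpoly set"
  show "subalgebra_generated ?G \<subseteq> sym_gl n"
    using subalgebra_generated_sym_gl[of ?G n] Delta_in_sym_gl by blast
  fix P Q assume PQ: "P \<in> subalgebra_generated ?G" "Q \<in> subalgebra_generated ?G"
  show "P + Q \<in> subalgebra_generated ?G" "P * Q \<in> subalgebra_generated ?G"
    using PQ by (auto intro: subalgebra_generated.intros)
  show "lie_poisson n P Q = 0"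
    by (rule lie_poisson_subalgebra_generated[OF _ PQ]) (auto simp: lie_poisson_Delta)
qed (rule subalgebra_generated.const)

section \<open>Gradients at a point\<close>

lemma eval_at_add: "eval_at (P + Q) A = eval_at P A + eval_at Q A"
  and eval_at_mult: "eval_at (P * Q) A = eval_at P A * eval_at Q A"
  and eval_at_diff: "eval_at (P - Q) A = eval_at P A - eval_at Q A"
  and eval_at_uminus: "eval_at (- P) A = - eval_at P A"
  and eval_at_sum: "eval_at (\<Sum>i\<in>S. f i) A = (\<Sum>i\<in>S. eval_at (f i) A)"
  and eval_at_const [simp]: "eval_at (const c) A = c"
  and eval_at_var [simp]: "eval_at (var (i, j)) A = A $$ (j, i)"
  and eval_at_zero [simp]: "eval_at 0 A = 0"
  and eval_at_one [simp]: "eval_at 1 A = 1"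
  by (simp_all add: eval_at_def insertion_add insertion_mult insertion_diff insertion_uminus insertion_sum)

lemma eval_at_comm_ring_hom: "comm_ring_hom (\<lambda>P. eval_at P A)"
  unfolding eval_at_def by (rule insertion_comm_ring_hom)

definition gradient_at :: "nat \<Rightarrow> (nat \<times> nat, 'a::comm_ring_1) mpoly \<Rightarrow> 'a mat \<Rightarrow> 'a mat" where
  "gradient_at n P A = mat n n (\<lambda>v. eval_at (partial_deriv v P) A)"

lemma gradient_at_carrier [simp]: "gradient_at n P A \<in> carrier_mat n n"
  by (simp add: gradient_at_def)

lemma gradient_at_eq_map: "gradient_at n P A = map_mat (\<lambda>P. eval_at P A) (gradient n P)"
  by (auto simp: gradient_at_def gradient_def)

lemma eval_at_generic_matrix:
  "A \<in> carrier_mat n n \<Longrightarrow> map_mat (\<lambda>P. eval_at P A) (generic_matrix n) = A"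
  by (auto simp: generic_matrix_def)

lemma eval_at_lie_poisson:
  assumes A: "A \<in> carrier_mat n n"
  shows "eval_at (lie_poisson n P Q) A
    = trace_pairing n (gradient_at n P A) (commutator (gradient_at n Q A) A)"
proof -
  interpret ev: comm_ring_hom "\<lambda>P. eval_at P A" by (rule eval_at_comm_ring_hom)
  let ?ev = "\<lambda>P. eval_at P A"
  have 1: "map_mat ?ev (gradient n Q * generic_matrix n) = gradient_at n Q A * A"
    unfolding gradient_at_eq_map ev.mat_hom_mult[OF gradient_carrier generic_matrix_carrier]
      eval_at_generic_matrix[OF A] ..
  have 2: "map_mat ?ev (generic_matrix n * gradient n Q) = A * gradient_at n Q A"
    unfolding gradient_at_eq_map ev.mat_hom_mult[OF generic_matrix_carrier gradient_carrier]
      eval_at_generic_matrix[OF A] ..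
  have "?ev (commutator (gradient n Q) (generic_matrix n) $$ (j, i))
      = commutator (gradient_at n Q A) A $$ (j, i)" if "i < n" "j < n" for i j
    unfolding commutator_def 1[symmetric] 2[symmetric]
    using that carrier_matD[OF gradient_carrier[of n Q]] carrier_matD[OF generic_matrix_carrier[of n, where 'a = 'a]]
    by (simp add: eval_at_diff del: index_mult_mat(1))
  then show ?thesis
    unfolding lie_poisson_eq_pairing trace_pairing_def eval_at_sum
    by (intro sum.cong refl) (simp add: eval_at_mult gradient_at_def gradient_def)
qed

text \<open>
  The span of the values at a point of the coefficients of the adjugate of \<open>t - A\<^sub>m\<close> is closed
  under multiplication by \<open>A\<^sub>m\<close>, by the recursion for these coefficients.
\<close>

lemma poly_mat_in_adj_coeff_span:
  fixes A :: "'a::comm_ring_1 mat" and m n :: nat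
  defines "M \<equiv> south_east_corner m (generic_matrix n :: (nat \<times> nat, 'a) mpoly mat)"
  assumes A: "A \<in> carrier_mat n n" and m: "m < n"
  shows "\<exists>e. \<forall>i<n - m. \<forall>j<n - m. poly_mat f (south_east_corner m A) $$ (i, j)
    = (\<Sum>l<n - m. e l * eval_at (adj_coeff M l $$ (i, j)) A)"
proof -
  interpret ev: comm_ring_hom "\<lambda>P. eval_at P A" by (rule eval_at_comm_ring_hom)
  let ?N = "n - m" and ?ev = "\<lambda>P. eval_at P A"
  have N: "0 < ?N" using m by simp
  have M: "M \<in> carrier_mat ?N ?N" unfolding M_def by (rule south_east_corner_carrier) simp
  define A' where "A' = south_east_corner m A"
  have A': "A' \<in> carrier_mat ?N ?N" unfolding A'_def by (rule south_east_corner_carrier[OF A])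
  have evM: "map_mat ?ev M = A'"
    using A by (intro eq_matI) (auto simp: M_def A'_def south_east_corner_def generic_matrix_def)
  define B where "B l = map_mat ?ev (adj_coeff M l)" for l
  have B: "B l \<in> carrier_mat ?N ?N" for l using adj_coeff_carrier[OF M] by (simp add: B_def)
  have evBM: "map_mat ?ev (adj_coeff M l * M) = B l * A'" for l
    unfolding B_def evM[symmetric] by (rule ev.mat_hom_mult[OF adj_coeff_carrier[OF M] M])
  let ?\<chi> = "\<lambda>l. ?ev (coeff (char_poly M) l)"
  have ent: "?ev ((adj_coeff M l * M) $$ (i, j)) = (B l * A') $$ (i, j)" if "i < ?N" "j < ?N" for i j l
    using that carrier_matD[OF M] carrier_matD[OF adj_coeff_carrier[OF M]]
    unfolding evBM[symmetric] by (simp del: index_mult_mat(1))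
  have BS: "(B (Suc l) * A') $$ (i, j) = B l $$ (i, j) - ?\<chi> (Suc l) * (if i = j then 1 else 0)"
    if ij: "i < ?N" "j < ?N" for i j l
  proof -
    have "B l $$ (i, j) = ?ev (adj_coeff M l $$ (i, j))"
      using ij carrier_matD[OF adj_coeff_carrier[OF M]] by (simp add: B_def)
    also have "\<dots> = (B (Suc l) * A') $$ (i, j) + ?\<chi> (Suc l) * (if i = j then 1 else 0)"
      unfolding ent[OF ij, symmetric] using ij carrier_matD[OF M] carrier_matD[OF adj_coeff_carrier[OF M]]
      by (subst adj_coeff_Suc[OF M]) (simp add: eval_at_add eval_at_mult del: index_mult_mat(1))
    finally show ?thesis by simp
  qed
  have B0: "(B 0 * A') $$ (i, j) = - ?\<chi> 0 * (if i = j then 1 else 0)" if ij: "i < ?N" "j < ?N" for i j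
  proof -
    have "?ev ((adj_coeff M 0 * M + coeff (char_poly M) 0 \<cdot>\<^sub>m 1\<^sub>m ?N) $$ (i, j)) = 0"
      unfolding adj_coeff_0[OF M] using ij by simp
    then have "(B 0 * A') $$ (i, j) + ?\<chi> 0 * (if i = j then 1 else 0) = 0"
      unfolding ent[OF ij, symmetric] using ij carrier_matD[OF M] carrier_matD[OF adj_coeff_carrier[OF M]]
      by (simp add: eval_at_add eval_at_mult del: index_mult_mat(1) split: if_splits)
    then show ?thesis by (simp add: eq_neg_iff_add_eq_0)
  qed
  have Blast: "B (?N - 1) $$ (i, j) = (if i = j then 1 else 0)" if "i < ?N" "j < ?N" for i j
    unfolding B_def adj_coeff_last[OF M N] using that by simp
  have "\<exists>e. \<forall>i<?N. \<forall>j<?N. poly_mat f A' $$ (i, j) = (\<Sum>l<?N. e l * B l $$ (i, j))"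
  proof (induction f)
    case 0
    show ?case by (rule exI[of _ "\<lambda>_. 0"]) (simp add: poly_mat_0[OF A'])
  next
    case (pCons c f)
    then obtain e where e: "\<And>i j. i < ?N \<Longrightarrow> j < ?N \<Longrightarrow> poly_mat f A' $$ (i, j) = (\<Sum>l<?N. e l * B l $$ (i, j))"
      by blast
    obtain N' where N': "?N = Suc N'" using N by (cases ?N) auto
    \<comment> \<open>Multiplication by \<open>A'\<close> turns the coefficient \<open>l + 1\<close>
      into the coefficient \<open>l\<close> minus a scalar, and turns the coefficient 0 into a
      scalar. All scalars, together with \<open>c\<close>, are collected at the last coefficient
      \<open>N'\<close>, which is the identity matrix.\<close>
    define e' where "e' l = (if l < N' then e (Suc l) else c - (\<Sum>l<Suc N'. e l * ?\<chi> l))" for l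
    have "poly_mat (pCons c f) A' $$ (i, j) = (\<Sum>l<?N. e' l * B l $$ (i, j))" if ij: "i < ?N" "j < ?N" for i j
    proof -
      let ?d = "if i = j then 1 else 0 :: 'a"
      have "(poly_mat f A' * A') $$ (i, j) = (\<Sum>s<?N. \<Sum>l<?N. e l * (B l $$ (i, s) * A' $$ (s, j)))"
        unfolding index_mult_mat_sum[OF poly_mat_carrier[OF A'] A' ij]
        using e ij by (intro sum.cong refl) (simp add: sum_distrib_right mult.assoc)
      also have "\<dots> = (\<Sum>l<?N. e l * (B l * A') $$ (i, j))"
        unfolding index_mult_mat_sum[OF B A' ij] sum_distrib_left by (rule sum.swap)
      also have "\<dots> = e 0 * (- ?\<chi> 0 * ?d) + (\<Sum>l<N'. e (Suc l) * (B l $$ (i, j) - ?\<chi> (Suc l) * ?d))"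
        unfolding N' sum.lessThan_Suc_shift using B0[OF ij] BS[OF ij] by simp
      also have "\<dots> = (\<Sum>l<N'. e (Suc l) * B l $$ (i, j)) - (\<Sum>l<Suc N'. e l * ?\<chi> l) * ?d"
        unfolding sum.lessThan_Suc_shift
        by (simp add: right_diff_distrib distrib_right sum_subtractf sum_distrib_right mult.assoc)
      finally have "poly_mat (pCons c f) A' $$ (i, j)
          = c * ?d + ((\<Sum>l<N'. e (Suc l) * B l $$ (i, j)) - (\<Sum>l<Suc N'. e l * ?\<chi> l) * ?d)"
        unfolding poly_mat_pCons[OF A'] poly_mat_self_commute[OF A']
        using ij carrier_matD[OF A'] poly_mat_dim[OF A'] by (simp del: index_mult_mat(1))
      also have "\<dots> = (\<Sum>l<N'. e (Suc l) * B l $$ (i, j)) + (c - (\<Sum>l<Suc N'. e l * ?\<chi> l)) * B N' $$ (i, j)"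
        using Blast[OF ij] N' by (simp add: left_diff_distrib)
      also have "\<dots> = (\<Sum>l<?N. e' l * B l $$ (i, j))"
        unfolding N' by (simp add: e'_def)
      finally show ?thesis .
    qed
    then show ?case by blast
  qed
  then show ?thesis using carrier_matD[OF adj_coeff_carrier[OF M]] unfolding A'_def[symmetric] by (simp add: B_def)
qed

definition gt_indices :: "nat \<Rightarrow> (nat \<times> nat) set" where
  "gt_indices n = {(m, k). m < n \<and> 1 \<le> k \<and> k \<le> n - m}"

lemma finite_gt_indices: "finite (gt_indices n)"
  by (rule finite_subset[of _ "{..<n} \<times> {..n}"]) (auto simp: gt_indices_def)

lemma gt_span_gradients:
  fixes y :: "'a::comm_ring_1 mat"
  assumes y: "y \<in> carrier_mat n n" and z: "gt_span n y z"
  shows "\<exists>c. \<forall>i<n. \<forall>j<n. z $$ (i, j)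
    = (\<Sum>(m, k)\<in>gt_indices n. c (m, k) * gradient_at n (Delta n m k) y $$ (i, j))"
proof -
  from z obtain F where F: "\<And>i j. i < n \<Longrightarrow> j < n \<Longrightarrow> z $$ (i, j)
      = (\<Sum>m<n. embed_corner n m (poly_mat (F m) (south_east_corner m y)) $$ (i, j))"
    unfolding gt_span_def by blast
  let ?M = "\<lambda>m. south_east_corner m (generic_matrix n :: (nat \<times> nat, 'a) mpoly mat)"
  have "\<forall>m. \<exists>e. m < n \<longrightarrow> (\<forall>i<n - m. \<forall>j<n - m. poly_mat (F m) (south_east_corner m y) $$ (i, j)
      = (\<Sum>l<n - m. e l * eval_at (adj_coeff (?M m) l $$ (i, j)) y))"
    using poly_mat_in_adj_coeff_span[OF y] by blast
  from choice[OF this] obtain e where e: "\<And>m i j. m < n \<Longrightarrow> i < n - m \<Longrightarrow> j < n - m \<Longrightarrow>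
      poly_mat (F m) (south_east_corner m y) $$ (i, j)
      = (\<Sum>l<n - m. e m l * eval_at (adj_coeff (?M m) l $$ (i, j)) y)" by blast
  have grad: "gradient_at n (Delta n m k) y $$ (i, j) = (if m \<le> i \<and> m \<le> j
      then - eval_at (adj_coeff (?M m) (n - m - k) $$ (i - m, j - m)) y else 0)" if "i < n" "j < n" for m k i j
    using that by (simp add: gradient_at_def partial_deriv_Delta eval_at_uminus)
  have "z $$ (i, j) = (\<Sum>(m, k)\<in>gt_indices n. - e m (n - m - k) * gradient_at n (Delta n m k) y $$ (i, j))"
    if ij: "i < n" "j < n" for i j
  proof -
    have "embed_corner n m (poly_mat (F m) (south_east_corner m y)) $$ (i, j)
        = (\<Sum>k\<in>{1..n - m}. - e m (n - m - k) * gradient_at n (Delta n m k) y $$ (i, j))" if m: "m < n" for m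
    proof (cases "m \<le> i \<and> m \<le> j")
      case True
      then have "embed_corner n m (poly_mat (F m) (south_east_corner m y)) $$ (i, j)
          = (\<Sum>l<n - m. e m l * eval_at (adj_coeff (?M m) l $$ (i - m, j - m)) y)"
        using ij by (simp add: embed_corner_def e[OF m] diff_less_mono)
      also have "\<dots> = (\<Sum>k\<in>{1..n - m}. e m (n - m - k) * eval_at (adj_coeff (?M m) (n - m - k) $$ (i - m, j - m)) y)"
        by (rule sum.reindex_bij_witness[of _ "\<lambda>k. n - m - k" "\<lambda>l. n - m - l"]) auto
      finally show ?thesis using True by (simp add: grad[OF ij])
    next
      case False
      then show ?thesis using ij by (auto simp: grad[OF ij] embed_corner_def)
    qed
    then have "z $$ (i, j) = (\<Sum>m<n. \<Sum>k\<in>{1..n - m}. - e m (n - m - k) * gradient_at n (Delta n m k) y $$ (i, j))"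
      unfolding F[OF ij] by (intro sum.cong refl) simp
    also have "\<dots> = (\<Sum>(m, k)\<in>Sigma {..<n} (\<lambda>m. {1..n - m}). - e m (n - m - k) * gradient_at n (Delta n m k) y $$ (i, j))"
      by (rule sum.Sigma) auto
    also have "Sigma {..<n} (\<lambda>m. {1..n - m}) = gt_indices n"
      by (auto simp: gt_indices_def)
    finally show ?thesis .
  qed
  then show ?thesis by (intro exI[of _ "\<lambda>(m, k). - e m (n - m - k)"]) auto
qed

section \<open>Polynomial curves in an orbit and tangent directions\<close>

lemma adjoint_orbit_carrier:
  assumes "x \<in> carrier_mat n n" "y \<in> adjoint_orbit x" shows "y \<in> carrier_mat n n"
  using assms similar_matD[of y x] unfolding adjoint_orbit_def by fastforce

lemma adjoint_orbitE:
  assumes x: "x \<in> carrier_mat n n" and y: "y \<in> adjoint_orbit x"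
  obtains P Q where "P \<in> carrier_mat n n" "Q \<in> carrier_mat n n" "P * Q = 1\<^sub>m n" "Q * P = 1\<^sub>m n" "y = P * x * Q"
proof -
  from y obtain n' P Q where *: "{y, x, P, Q} \<subseteq> carrier_mat n' n'" "P * Q = 1\<^sub>m n'" "Q * P = 1\<^sub>m n'" "y = P * x * Q"
    using similar_matD[of y x] unfolding adjoint_orbit_def by blast
  then have "n' = n" using x by auto
  with * that show thesis by auto
qed

lemma adjoint_orbit_conj:
  assumes "P \<in> carrier_mat n n" "Q \<in> carrier_mat n n" "P * Q = 1\<^sub>m n" "Q * P = 1\<^sub>m n"
    and x: "x \<in> carrier_mat n n" and y: "y \<in> adjoint_orbit x"
  shows "P * y * Q \<in> adjoint_orbit x"
proof -
  have "similar_mat (P * y * Q) y"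
    using assms adjoint_orbit_carrier[OF x y] by (intro similar_matI[of _ _ P Q n]) auto
  then show ?thesis using y similar_mat_trans unfolding adjoint_orbit_def by blast
qed

text \<open>For a square-zero \<open>a\<close> the matrices \<open>1 + t a\<close> have the
  polynomial inverse \<open>1 - t a\<close>, so conjugation traces a curve in the orbit that is
  polynomial in \<open>t\<close> with velocity \<open>commutator a y\<close> at 0. This replaces the
  exponential map.\<close>

lemma square_zero_curve:
  fixes a :: "'a::comm_ring_1 mat"
  assumes a: "a \<in> carrier_mat n n" and y: "y \<in> carrier_mat n n" and aa: "a * a = 0\<^sub>m n n"
  shows "(1\<^sub>m n + t \<cdot>\<^sub>m a) * (1\<^sub>m n - t \<cdot>\<^sub>m a) = 1\<^sub>m n"
    "(1\<^sub>m n - t \<cdot>\<^sub>m a) * (1\<^sub>m n + t \<cdot>\<^sub>m a) = 1\<^sub>m n"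
    "(1\<^sub>m n + t \<cdot>\<^sub>m a) * y * (1\<^sub>m n - t \<cdot>\<^sub>m a)
      = mat n n (\<lambda>(i, j). y $$ (i, j) + t * commutator a y $$ (i, j) - t * t * (a * y * a) $$ (i, j))"
proof -
  have ta: "t \<cdot>\<^sub>m a \<in> carrier_mat n n" using a by simp
  have t2: "(t \<cdot>\<^sub>m a) * (t \<cdot>\<^sub>m a) = 0\<^sub>m n n"
    using a by (simp add: mult_smult_distrib[of _ n n] mult_smult_assoc_mat[of _ n n] aa)
  show "(1\<^sub>m n + t \<cdot>\<^sub>m a) * (1\<^sub>m n - t \<cdot>\<^sub>m a) = 1\<^sub>m n"
  proof -
    have "(1\<^sub>m n + t \<cdot>\<^sub>m a) * (1\<^sub>m n - t \<cdot>\<^sub>m a)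
        = (1\<^sub>m n + t \<cdot>\<^sub>m a) * 1\<^sub>m n - (1\<^sub>m n + t \<cdot>\<^sub>m a) * (t \<cdot>\<^sub>m a)"
      using ta by (intro mult_minus_distrib_mat[of _ n n _ n]) auto
    also have "(1\<^sub>m n + t \<cdot>\<^sub>m a) * 1\<^sub>m n = 1\<^sub>m n + t \<cdot>\<^sub>m a" using ta by (intro right_mult_one_mat[of _ n n]) auto
    also have "(1\<^sub>m n + t \<cdot>\<^sub>m a) * (t \<cdot>\<^sub>m a) = 1\<^sub>m n * (t \<cdot>\<^sub>m a) + t \<cdot>\<^sub>m a * (t \<cdot>\<^sub>m a)"
      using ta by (intro add_mult_distrib_mat[of _ n n _ _ n]) auto
    also have "1\<^sub>m n + t \<cdot>\<^sub>m a - (1\<^sub>m n * (t \<cdot>\<^sub>m a) + t \<cdot>\<^sub>m a * (t \<cdot>\<^sub>m a)) = 1\<^sub>m n"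
      unfolding t2 left_mult_one_mat[OF ta] using carrier_matD[OF a] by (intro eq_matI) simp_all
    finally show ?thesis .
  qed
  show "(1\<^sub>m n - t \<cdot>\<^sub>m a) * (1\<^sub>m n + t \<cdot>\<^sub>m a) = 1\<^sub>m n"
  proof -
    have "(1\<^sub>m n - t \<cdot>\<^sub>m a) * (1\<^sub>m n + t \<cdot>\<^sub>m a)
        = (1\<^sub>m n - t \<cdot>\<^sub>m a) * 1\<^sub>m n + (1\<^sub>m n - t \<cdot>\<^sub>m a) * (t \<cdot>\<^sub>m a)"
      using ta by (intro mult_add_distrib_mat[of _ n n _ n]) (auto intro: minus_carrier_mat)
    also have "(1\<^sub>m n - t \<cdot>\<^sub>m a) * 1\<^sub>m n = 1\<^sub>m n - t \<cdot>\<^sub>m a"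
      using ta by (intro right_mult_one_mat[of _ n n] minus_carrier_mat)
    also have "(1\<^sub>m n - t \<cdot>\<^sub>m a) * (t \<cdot>\<^sub>m a) = 1\<^sub>m n * (t \<cdot>\<^sub>m a) - t \<cdot>\<^sub>m a * (t \<cdot>\<^sub>m a)"
      using ta by (intro minus_mult_distrib_mat[of _ n n _ _ n]) auto
    also have "1\<^sub>m n - t \<cdot>\<^sub>m a + (1\<^sub>m n * (t \<cdot>\<^sub>m a) - t \<cdot>\<^sub>m a * (t \<cdot>\<^sub>m a)) = 1\<^sub>m n"
      unfolding t2 left_mult_one_mat[OF ta] using carrier_matD[OF a] by (intro eq_matI) simp_all
    finally show ?thesis .
  qed
  have ya: "y * a \<in> carrier_mat n n" and ay: "a * y \<in> carrier_mat n n" and aya: "a * y * a \<in> carrier_mat n n"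
    using a y by auto
  have "(1\<^sub>m n + t \<cdot>\<^sub>m a) * y * (1\<^sub>m n - t \<cdot>\<^sub>m a) = (y + t \<cdot>\<^sub>m (a * y)) * (1\<^sub>m n - t \<cdot>\<^sub>m a)"
    using a y ta by (simp add: add_mult_distrib_mat[of _ n n _ _ n] mult_smult_assoc_mat[of _ n n])
  also have "\<dots> = (y + t \<cdot>\<^sub>m (a * y)) - (y + t \<cdot>\<^sub>m (a * y)) * (t \<cdot>\<^sub>m a)"
    using y ay ta by (subst mult_minus_distrib_mat[of _ n n _ n]) auto
  also have "(y + t \<cdot>\<^sub>m (a * y)) * (t \<cdot>\<^sub>m a) = t \<cdot>\<^sub>m (y * a) + t \<cdot>\<^sub>m (t \<cdot>\<^sub>m (a * y * a))"
    using a y ta ay by (subst add_mult_distrib_mat[of _ n n _ _ n])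
      (auto simp: mult_smult_distrib[of _ n n] mult_smult_assoc_mat[of _ n n])
  also have "(y + t \<cdot>\<^sub>m (a * y)) - (t \<cdot>\<^sub>m (y * a) + t \<cdot>\<^sub>m (t \<cdot>\<^sub>m (a * y * a)))
      = mat n n (\<lambda>(i, j). y $$ (i, j) + t * commutator a y $$ (i, j) - t * t * (a * y * a) $$ (i, j))"
    unfolding commutator_def using carrier_matD[OF y] carrier_matD[OF ya] carrier_matD[OF ay] carrier_matD[OF aya] carrier_matD[OF a]
    by (intro eq_matI) (simp_all add: algebra_simps del: index_mult_mat(1))
  finally show "(1\<^sub>m n + t \<cdot>\<^sub>m a) * y * (1\<^sub>m n - t \<cdot>\<^sub>m a)
      = mat n n (\<lambda>(i, j). y $$ (i, j) + t * commutator a y $$ (i, j) - t * t * (a * y * a) $$ (i, j))" .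
qed

lemma poly_eq_0_if_all_zero:
  fixes p :: "'a::field_char_0 poly"
  assumes "\<And>t. poly p t = 0" shows "p = 0"
  using assms poly_all_0_iff_0 by blast

lemma differential_vanishes_square_zero:
  fixes x :: "'a::field_char_0 mat"
  assumes x: "x \<in> carrier_mat n n" and H: "H \<in> sym_gl n" and zero: "\<And>y. y \<in> adjoint_orbit x \<Longrightarrow> eval_at H y = 0"
    and y: "y \<in> adjoint_orbit x" and a: "a \<in> carrier_mat n n" and aa: "a * a = 0\<^sub>m n n"
  shows "trace_pairing n (gradient_at n H y) (commutator a y) = 0"
proof -
  have yc: "y \<in> carrier_mat n n" by (rule adjoint_orbit_carrier[OF x y])
  let ?I = "{..<n} \<times> {..<n}"
  define Y where "Y = (\<lambda>(i, j). [:y $$ (j, i), commutator a y $$ (j, i), - (a * y * a) $$ (j, i):])"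
  obtain \<phi> where \<phi>: "\<And>t. poly \<phi> t = insertion (\<lambda>v. poly (Y v) t) H"
    "\<And>t. poly (pderiv \<phi>) t = (\<Sum>v\<in>?I. insertion (\<lambda>v. poly (Y v) t) (partial_deriv v H) * poly (pderiv (Y v)) t)"
    using insertion_along_curve[of H ?I Y] H by (auto simp: sym_gl_def)
  have "poly \<phi> t = 0" for t
  proof -
    let ?yt = "(1\<^sub>m n + t \<cdot>\<^sub>m a) * y * (1\<^sub>m n - t \<cdot>\<^sub>m a)"
    note c = square_zero_curve[OF a yc aa, of t]
    have "?yt \<in> adjoint_orbit x"
      using a x y c(1,2) by (intro adjoint_orbit_conj[of _ n]) (auto intro!: minus_carrier_mat)
    then have "eval_at H ?yt = 0" by (rule zero)
    also have "eval_at H ?yt = insertion (\<lambda>v. poly (Y v) t) H"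
      unfolding eval_at_def c(3) using H
      by (intro insertion_cong) (auto simp: sym_gl_def Y_def algebra_simps)
    finally show ?thesis by (simp add: \<phi>)
  qed
  then have "\<phi> = 0" by (rule poly_eq_0_if_all_zero)
  then have "(\<Sum>v\<in>?I. insertion (\<lambda>v. poly (Y v) 0) (partial_deriv v H) * poly (pderiv (Y v)) 0) = 0"
    using \<phi>(2)[of 0] by simp
  moreover have "insertion (\<lambda>v. poly (Y v) 0) P = eval_at P y" for P
    unfolding eval_at_def by (rule arg_cong[where f = "\<lambda>\<phi>. insertion \<phi> P"]) (auto simp: Y_def)
  ultimately show ?thesis
    by (simp add: trace_pairing_def gradient_at_def sum.cartesian_product' Y_def pderiv_pCons)
qed

text \<open>Square-zero matrices of rank one span the traceless matrices, and together with the
  identity they span everything; the trace form is non-degenerate. Characteristic 0 enters when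
  \<open>n\<close> times a diagonal entry is zero.\<close>

lemma scalar_if_orthogonal_to_square_zero:
  fixes M :: "'a::field_char_0 mat"
  assumes M: "M \<in> carrier_mat n n"
    and orth: "\<And>a. a \<in> carrier_mat n n \<Longrightarrow> a * a = 0\<^sub>m n n \<Longrightarrow> trace_pairing n a M = 0"
    and tr: "trace_pairing n (1\<^sub>m n) M = 0"
  shows "M = 0\<^sub>m n n"
proof -
  have rank1: "(\<Sum>i<n. \<Sum>j<n. u i * w j * M $$ (j, i)) = 0" if uw: "(\<Sum>i<n. w i * u i) = 0" for u w
  proof -
    define a where "a = mat n n (\<lambda>(i, j). u i * w j)"
    have a: "a \<in> carrier_mat n n" by (simp add: a_def)
    have "a * a = 0\<^sub>m n n"
    proof (rule eq_matI)
      fix i j assume "i < dim_row (0\<^sub>m n n)" "j < dim_col (0\<^sub>m n n)"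
      then have ij: "i < n" "j < n" by auto
      have "(a * a) $$ (i, j) = (\<Sum>k<n. u i * w j * (w k * u k))"
        unfolding index_mult_mat_sum[OF a a ij] using ij by (intro sum.cong) (auto simp: a_def)
      also have "\<dots> = 0" using uw by (simp flip: sum_distrib_left)
      finally show "(a * a) $$ (i, j) = 0\<^sub>m n n $$ (i, j)" using ij by simp
    qed (use a in auto)
    from orth[OF a this] show ?thesis by (simp add: trace_pairing_def a_def)
  qed
  have pick: "(\<Sum>i<n. \<Sum>j<n. (if i = r then 1 else 0) * (if j = s then 1 else 0) * f i j) = f r s"
    if "r < n" "s < n" for r s and f :: "nat \<Rightarrow> nat \<Rightarrow> 'a"
  proof -
    have "(\<Sum>i<n. \<Sum>j<n. (if i = r then 1 else 0) * (if j = s then 1 else 0) * f i j)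
        = (\<Sum>i<n. \<Sum>j<n. if j = s then (if i = r then f r s else 0) else 0)"
      by (intro sum.cong refl) auto
    with that show ?thesis by simp
  qed
  have off: "M $$ (s, r) = 0" if "r < n" "s < n" "r \<noteq> s" for r s
    using rank1[of "\<lambda>j. if j = s then 1 else 0" "\<lambda>i. if i = r then 1 else 0"] that pick[of r s "\<lambda>i j. M $$ (j, i)"]
    by (simp add: sum_delta_mult)
  \<comment> \<open>The vectors \<open>e r + e s\<close> and \<open>e r - e s\<close> are
    orthogonal. The rank one matrix built from them compares the two diagonal entries, the
    off-diagonal ones being zero already.\<close>
  have diag: "M $$ (r, r) = M $$ (s, s)" if rs: "r < n" "s < n" "r \<noteq> s" for r s
  proof -
    let ?e = "\<lambda>k i. if i = k then 1 else 0 :: 'a"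
    have "(\<Sum>i<n. (?e r i + ?e s i) * (?e r i - ?e s i)) = (\<Sum>i<n. ?e r i - ?e s i)"
      by (intro sum.cong refl) (use rs in auto)
    also have "\<dots> = 0" using rs by (simp add: sum_subtractf)
    finally have "(\<Sum>i<n. \<Sum>j<n. (?e r i - ?e s i) * (?e r j + ?e s j) * M $$ (j, i)) = 0" by (rule rank1)
    also have "(\<Sum>i<n. \<Sum>j<n. (?e r i - ?e s i) * (?e r j + ?e s j) * M $$ (j, i))
        = (\<Sum>i<n. \<Sum>j<n. ?e r i * ?e r j * M $$ (j, i)) + (\<Sum>i<n. \<Sum>j<n. ?e r i * ?e s j * M $$ (j, i))
          - (\<Sum>i<n. \<Sum>j<n. ?e s i * ?e r j * M $$ (j, i)) - (\<Sum>i<n. \<Sum>j<n. ?e s i * ?e s j * M $$ (j, i))"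
      unfolding sum.distrib[symmetric] sum_subtractf[symmetric]
      by (intro sum.cong refl) (simp only: algebra_simps)
    also have "\<dots> = M $$ (r, r) + M $$ (s, r) - M $$ (r, s) - M $$ (s, s)"
      using pick[of _ _ "\<lambda>i j. M $$ (j, i)"] rs by simp
    finally show ?thesis using off[of r s] off[of s r] rs by simp
  qed
  have "M $$ (r, s) = 0" if rs: "r < n" "s < n" for r s
  proof (cases "r = s")
    case True
    have "trace_pairing n (1\<^sub>m n) M = (\<Sum>i<n. \<Sum>j<n. if j = i then M $$ (i, i) else 0)"
      unfolding trace_pairing_def by (intro sum.cong refl) auto
    also have "\<dots> = (\<Sum>i<n. M $$ (r, r))" 
    proof (intro sum.cong refl)
      fix i assume "i \<in> {..<n}"
      then show "(\<Sum>j<n. if j = i then M $$ (i, i) else 0) = M $$ (r, r)"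
        using diag[of i r] rs by (cases "i = r") auto
    qed
    also have "\<dots> = of_nat n * M $$ (r, r)" by simp
    finally show ?thesis using tr rs True by simp
  qed (use off rs in auto)
  then show ?thesis using M by (intro eq_matI) auto
qed

text \<open>By skewness the claim is that the commutator of the gradient with \<open>y\<close> is
  zero. It is orthogonal to square-zero matrices by the curves above and to the identity because the
  identity commutes with \<open>y\<close>.\<close>

lemma differential_vanishes:
  fixes x :: "'a::field_char_0 mat"
  assumes x: "x \<in> carrier_mat n n" and H: "H \<in> sym_gl n" and zero: "\<And>y. y \<in> adjoint_orbit x \<Longrightarrow> eval_at H y = 0"
    and y: "y \<in> adjoint_orbit x" and a: "a \<in> carrier_mat n n"
  shows "trace_pairing n (gradient_at n H y) (commutator a y) = 0"
proof -
  have yc: "y \<in> carrier_mat n n" by (rule adjoint_orbit_carrier[OF x y])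
  let ?M = "commutator (gradient_at n H y) y"
  have flip: "trace_pairing n b ?M = - trace_pairing n (gradient_at n H y) (commutator b y)"
    if "b \<in> carrier_mat n n" for b
    by (rule trace_pairing_commutator[OF that gradient_at_carrier yc])
  have "?M = 0\<^sub>m n n"
  proof (rule scalar_if_orthogonal_to_square_zero)
    show "trace_pairing n b ?M = 0" if "b \<in> carrier_mat n n" "b * b = 0\<^sub>m n n" for b
      using flip[OF that(1)] differential_vanishes_square_zero[OF x H zero y that] by simp
    have "commutator (1\<^sub>m n) y = 0\<^sub>m n n" using yc by (simp add: commutator_def minus_r_inv_mat[OF yc])
    then show "trace_pairing n (1\<^sub>m n) ?M = 0"
      using flip[of "1\<^sub>m n"] by (simp add: trace_pairing_def)
  qed (use yc in auto)
  then have "trace_pairing n a ?M = 0" by (simp add: trace_pairing_def)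
  with flip[OF a] show ?thesis by simp
qed

section \<open>Rational curves and charts on an orbit\<close>

text \<open>Two instances are used: polynomial functions of one variable with the constant
  filtration, for curves, and polynomial functions of \<open>d\<close> variables filtered by the
  exponents, for counting. Determinants, adjugates and the clearing of denominators are thus treated
  once.\<close>

locale function_filtration =
  fixes \<A> :: "nat \<Rightarrow> ('s \<Rightarrow> 'a::field) set"
  assumes const: "(\<lambda>_. c) \<in> \<A> 0"
    and add: "F \<in> \<A> L \<Longrightarrow> G \<in> \<A> L \<Longrightarrow> (\<lambda>s. F s + G s) \<in> \<A> L"
    and mult: "F \<in> \<A> L \<Longrightarrow> G \<in> \<A> L' \<Longrightarrow> (\<lambda>s. F s * G s) \<in> \<A> (L + L')"
    and mono: "L \<le> L' \<Longrightarrow> F \<in> \<A> L \<Longrightarrow> F \<in> \<A> L'"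
begin

lemma const': "(\<lambda>_. c) \<in> \<A> L"
  by (rule mono[OF _ const]) simp

lemma scale: "F \<in> \<A> L \<Longrightarrow> (\<lambda>s. c * F s) \<in> \<A> L"
  using mult[OF const[of c], of F L] by simp

lemma sum: "(\<And>i. i \<in> S \<Longrightarrow> F i \<in> \<A> L) \<Longrightarrow> (\<lambda>s. \<Sum>i\<in>S. F i s) \<in> \<A> L"
  by (induction S rule: infinite_finite_induct) (auto intro: add const')

lemma prod: "(\<And>i. i \<in> S \<Longrightarrow> F i \<in> \<A> L) \<Longrightarrow> (\<lambda>s. \<Prod>i\<in>S. F i s) \<in> \<A> (card S * L)"
proof (induction S rule: infinite_finite_induct)
  case (insert i S)
  then have "(\<lambda>s. F i s * (\<Prod>i\<in>S. F i s)) \<in> \<A> (L + card S * L)" by (intro mult) auto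
  with insert.hyps show ?case by simp
qed (simp_all add: const')

lemma power: "F \<in> \<A> L \<Longrightarrow> (\<lambda>s. F s ^ k) \<in> \<A> (k * L)"
  using prod[of "{..<k}" "\<lambda>_. F"] by simp

lemma det:
  assumes M: "\<And>s. M s \<in> carrier_mat n n"
    and ent: "\<And>i j. i < n \<Longrightarrow> j < n \<Longrightarrow> (\<lambda>s. M s $$ (i, j)) \<in> \<A> L"
  shows "(\<lambda>s. det (M s)) \<in> \<A> (n * L)"
  unfolding det_def'[OF M]
proof (intro sum scale)
  fix p assume "p \<in> {p. p permutes {0..<n}}"
  then have "p permutes {0..<n}" by simp
  from permutes_in_image[OF this] have "(\<lambda>s. \<Prod>i = 0..<n. M s $$ (i, p i)) \<in> \<A> (card {0..<n} * L)"
    by (intro prod ent) auto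
  then show "(\<lambda>s. \<Prod>i = 0..<n. M s $$ (i, p i)) \<in> \<A> (n * L)" by simp
qed

lemma adj_mat:
  assumes M: "\<And>s. M s \<in> carrier_mat n n"
    and ent: "\<And>i j. i < n \<Longrightarrow> j < n \<Longrightarrow> (\<lambda>s. M s $$ (i, j)) \<in> \<A> L"
    and ij: "i < n" "j < n"
  shows "(\<lambda>s. adj_mat (M s) $$ (i, j)) \<in> \<A> (n * L)"
proof -
  have "(\<lambda>s. det (mat_delete (M s) j i)) \<in> \<A> ((n - 1) * L)"
  proof (rule det)
    show "mat_delete (M s) j i \<in> carrier_mat (n - 1) (n - 1)" for s by (rule mat_delete_carrier[OF M])
    fix k l assume kl: "k < n - 1" "l < n - 1"
    have "mat_delete (M s) j i $$ (k, l) = M s $$ (if k < j then k else Suc k, if l < i then l else Suc l)" for s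
      using kl carrier_matD[OF M[of s]] by (simp add: mat_delete_def)
    then show "(\<lambda>s. mat_delete (M s) j i $$ (k, l)) \<in> \<A> L" using kl by (simp only:) (rule ent, auto)
  qed
  then have "(\<lambda>s. (- 1) ^ (j + i) * det (mat_delete (M s) j i)) \<in> \<A> ((n - 1) * L)" by (rule scale)
  then have "(\<lambda>s. (- 1) ^ (j + i) * det (mat_delete (M s) j i)) \<in> \<A> (n * L)" by (rule mono[rotated]) simp
  then show ?thesis using ij carrier_matD[OF M] by (simp add: adj_mat_def cofactor_def)
qed

lemma conj_entry:
  assumes M: "\<And>s. M s \<in> carrier_mat n n"
    and ent: "\<And>i j. i < n \<Longrightarrow> j < n \<Longrightarrow> (\<lambda>s. M s $$ (i, j)) \<in> \<A> L"
    and y: "y \<in> carrier_mat n n" and ij: "i < n" "j < n"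
  shows "(\<lambda>s. (M s * y * Determinant.adj_mat (M s)) $$ (i, j)) \<in> \<A> (L + n * L)"
proof -
  have "(M s * y * Determinant.adj_mat (M s)) $$ (i, j)
      = (\<Sum>k<n. (\<Sum>l<n. y $$ (l, k) * M s $$ (i, l)) * Determinant.adj_mat (M s) $$ (k, j))" for s
    using ij index_mult_mat_sum[OF mult_carrier_mat[OF M y] Determinant.adj_mat(1)[OF M], of i j s s]
      index_mult_mat_sum[OF M y] by (simp add: mult.commute del: index_mult_mat(1))
  moreover have "(\<lambda>s. \<Sum>k<n. (\<Sum>l<n. y $$ (l, k) * M s $$ (i, l)) * Determinant.adj_mat (M s) $$ (k, j)) \<in> \<A> (L + n * L)"
    using ij by (intro sum mult scale ent adj_mat[OF M]) auto
  ultimately show ?thesis by simp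
qed

text \<open>Clearing denominators: multiplied by a suitable power of \<open>\<delta>\<close>, a
  polynomial in the entries of \<open>N / \<delta>\<close> becomes a function in the filtration.
  Where \<open>\<delta>\<close> vanishes nothing is claimed, because division by 0 there yields a
  meaningless matrix.\<close>

lemma homogenize:
  assumes \<delta>: "\<delta> \<in> \<A> c" and ent: "\<And>i j. i < n \<Longrightarrow> j < n \<Longrightarrow> (\<lambda>s. N s $$ (i, j)) \<in> \<A> c'"
    and N: "\<And>s. N s \<in> carrier_mat n n" and H: "H \<in> sym_gl n"
  shows "\<exists>D C G. G \<in> \<A> C \<and> (\<forall>s. \<delta> s \<noteq> 0 \<longrightarrow> G s = \<delta> s ^ D * eval_at H ((1 / \<delta> s) \<cdot>\<^sub>m N s))"
proof -
  have "vars H \<subseteq> {..<n} \<times> {..<n}" using H by (simp add: sym_gl_def)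
  then show ?thesis
  proof (induction H rule: mpoly_induct)
    case (const a)
    show ?case by (intro exI[of _ 0] exI[of _ "\<lambda>_. a"]) (simp add: function_filtration.const[OF function_filtration_axioms])
  next
    case (var v)
    then obtain i j where v: "v = (i, j)" "i < n" "j < n" by auto
    have "((1 / \<delta> s) \<cdot>\<^sub>m N s) $$ (j, i) = N s $$ (j, i) / \<delta> s" for s
      using v carrier_matD[OF N[of s]] by simp
    then show ?case using v ent[of j i]
      by (intro exI[of _ 1] exI[of _ c'] exI[of _ "\<lambda>s. N s $$ (j, i)"]) simp
  next
    case (add P Q)
    then obtain D1 C1 G1 D2 C2 G2 where 1: "G1 \<in> \<A> C1" "G2 \<in> \<A> C2"
      "\<And>s. \<delta> s \<noteq> 0 \<Longrightarrow> G1 s = \<delta> s ^ D1 * eval_at P ((1 / \<delta> s) \<cdot>\<^sub>m N s)"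
      "\<And>s. \<delta> s \<noteq> 0 \<Longrightarrow> G2 s = \<delta> s ^ D2 * eval_at Q ((1 / \<delta> s) \<cdot>\<^sub>m N s)" by blast
    let ?C = "max (C1 + D2 * c) (C2 + D1 * c)"
    have "(\<lambda>s. G1 s * \<delta> s ^ D2) \<in> \<A> ?C" "(\<lambda>s. G2 s * \<delta> s ^ D1) \<in> \<A> ?C"
      using mult[OF 1(1) power[OF \<delta>, of D2]] mult[OF 1(2) power[OF \<delta>, of D1]] mono[of _ ?C]
      by (meson max.cobounded1 max.cobounded2)+
    then have "(\<lambda>s. G1 s * \<delta> s ^ D2 + G2 s * \<delta> s ^ D1) \<in> \<A> ?C"
      by (rule function_filtration.add[OF function_filtration_axioms])
    then show ?case
      by (intro exI[of _ "D1 + D2"] exI[of _ ?C] exI[of _ "\<lambda>s. G1 s * \<delta> s ^ D2 + G2 s * \<delta> s ^ D1"])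
         (simp add: 1 eval_at_add power_add algebra_simps)
  next
    case (mult P Q)
    then obtain D1 C1 G1 D2 C2 G2 where 1: "G1 \<in> \<A> C1" "G2 \<in> \<A> C2"
      "\<And>s. \<delta> s \<noteq> 0 \<Longrightarrow> G1 s = \<delta> s ^ D1 * eval_at P ((1 / \<delta> s) \<cdot>\<^sub>m N s)"
      "\<And>s. \<delta> s \<noteq> 0 \<Longrightarrow> G2 s = \<delta> s ^ D2 * eval_at Q ((1 / \<delta> s) \<cdot>\<^sub>m N s)" by blast
    show ?case
      by (intro exI[of _ "D1 + D2"] exI[of _ "C1 + C2"] exI[of _ "\<lambda>s. G1 s * G2 s"] conjI
          function_filtration.mult[OF function_filtration_axioms] 1(1,2))
         (simp add: 1 eval_at_mult power_add algebra_simps)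
  qed
qed

end

text \<open>Conjugation of \<open>y\<close> by \<open>h\<close>, with the inverse written by
  Cramer's rule so that numerator and denominator are polynomial in the entries of
  \<open>h\<close>.\<close>

definition conj_mat :: "'a::field mat \<Rightarrow> 'a mat \<Rightarrow> 'a mat" where
  "conj_mat h y = (1 / det h) \<cdot>\<^sub>m (h * y * adj_mat h)"

lemma (in function_filtration) homogenize_conj:
  assumes M: "\<And>s. M s \<in> carrier_mat n n"
    and ent: "\<And>i j. i < n \<Longrightarrow> j < n \<Longrightarrow> (\<lambda>s. M s $$ (i, j)) \<in> \<A> L"
    and y: "y \<in> carrier_mat n n" and H: "H \<in> sym_gl n"
  shows "\<exists>D C G. G \<in> \<A> C \<and> (\<forall>s. det (M s) \<noteq> 0 \<longrightarrow> G s = det (M s) ^ D * eval_at H (conj_mat (M s) y))"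
  unfolding conj_mat_def
  by (rule homogenize[OF det[OF M ent] conj_entry[OF M ent y] _ H])
     (use mult_carrier_mat[OF mult_carrier_mat[OF M y] Determinant.adj_mat(1)[OF M]] in auto)

context
  fixes h y :: "'a::field mat" and n :: nat
  assumes h: "h \<in> carrier_mat n n" and y: "y \<in> carrier_mat n n" and d: "det h \<noteq> 0"
begin

lemma conj_mat_carrier: "conj_mat h y \<in> carrier_mat n n"
  using h y adj_mat(1)[OF h] by (simp add: conj_mat_def)

lemma conj_mat_mult: "conj_mat h y * h = h * y"
proof -
  have hy: "h * y \<in> carrier_mat n n" using h y by simp
  have "conj_mat h y * h = (1 / det h) \<cdot>\<^sub>m (h * y * (adj_mat h * h))"
    unfolding conj_mat_def using hy adj_mat(1)[OF h] h
    by (simp add: mult_smult_assoc_mat[of _ n n] assoc_mult_mat[OF hy adj_mat(1)[OF h] h] del: assoc_mult_mat)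
  also have "\<dots> = h * y"
    unfolding adj_mat(3)[OF h] mult_smult_distrib[OF hy one_carrier_mat] right_mult_one_mat[OF hy]
    using d carrier_matD[OF hy] by (intro eq_matI) (simp_all del: index_mult_mat(1))
  finally show ?thesis .
qed

lemma conj_mat_unique:
  assumes z: "z \<in> carrier_mat n n" and zh: "z * h = h * y"
  shows "z = conj_mat h y"
proof -
  obtain T where T: "T \<in> carrier_mat n n" "h * T = 1\<^sub>m n" using det_nonzero_inverse[OF h d] by metis
  have "z = z * (h * T)" using z T by simp
  also have "\<dots> = h * y * T" using assoc_mult_mat[OF z h T(1)] by (simp add: zh)
  also have "\<dots> = conj_mat h y * (h * T)"
    using assoc_mult_mat[OF conj_mat_carrier h T(1)] by (simp add: conj_mat_mult)
  finally show ?thesis using conj_mat_carrier T by simp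
qed

lemma similar_conj_mat: "similar_mat (conj_mat h y) y"
proof -
  obtain T where T: "T \<in> carrier_mat n n" "h * T = 1\<^sub>m n" "T * h = 1\<^sub>m n" using det_nonzero_inverse[OF h d] by metis
  have "h * y * T * h = h * y * (T * h)" using assoc_mult_mat[of "h * y" n n T n h n] h y T by auto
  also have "\<dots> = h * y" using T h y by simp
  finally have "h * y * T = conj_mat h y" using h y T by (intro conj_mat_unique) auto
  with h y T conj_mat_carrier show ?thesis by (intro similar_matI[of _ _ h T n]) auto
qed

end

lemma conj_mat_in_orbit:
  assumes "x \<in> carrier_mat n n" "y \<in> adjoint_orbit x" "h \<in> carrier_mat n n" "det h \<noteq> 0"
  shows "conj_mat h y \<in> adjoint_orbit x"
  using similar_conj_mat[OF assms(3) adjoint_orbit_carrier[OF assms(1,2)] assms(4)] assms(2) similar_mat_trans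
  unfolding adjoint_orbit_def by blast

lemma adjoint_orbit_conj_matE:
  fixes x :: "'a::field mat"
  assumes x: "x \<in> carrier_mat n n" and y: "y \<in> adjoint_orbit x"
  obtains g where "g \<in> carrier_mat n n" "det g \<noteq> 0" "y = conj_mat g x"
proof -
  obtain P Q where PQ: "P \<in> carrier_mat n n" "Q \<in> carrier_mat n n" "P * Q = 1\<^sub>m n" "Q * P = 1\<^sub>m n" "y = P * x * Q"
    using adjoint_orbitE[OF x y] by metis
  have "det P * det Q = 1" using det_mult[OF PQ(1,2)] PQ(3) by simp
  then have dP: "det P \<noteq> 0" by auto
  have "y * P = P * x * (Q * P)" unfolding PQ(5) using PQ x assoc_mult_mat[of "P * x" n n Q n P n] by auto
  also have "\<dots> = P * x" using PQ x by simp
  finally have "y = conj_mat P x" using PQ x adjoint_orbit_carrier[OF x y] by (intro conj_mat_unique[OF PQ(1) x dP])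
  with PQ(1) dP show thesis by (rule that)
qed

section \<open>Lines of group elements and irreducibility of orbits\<close>

abbreviation poly_functions :: "('a::field \<Rightarrow> 'a) set" where
  "poly_functions \<equiv> {F. \<exists>p. \<forall>t. F t = poly p t}"

interpretation poly_functions: function_filtration "\<lambda>_. poly_functions :: ('a::field \<Rightarrow> 'a) set"
proof
  show "(\<lambda>_. c) \<in> poly_functions" for c :: 'a by (auto intro: exI[of _ "[:c:]"])
  fix F G :: "'a \<Rightarrow> 'a" assume "F \<in> poly_functions" "G \<in> poly_functions"
  then obtain p q where "\<forall>t. F t = poly p t" "\<forall>t. G t = poly q t" by auto
  then show "(\<lambda>t. F t + G t) \<in> poly_functions" "(\<lambda>t. F t * G t) \<in> poly_functions"
    by (auto intro: exI[of _ "p + q"] exI[of _ "p * q"])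
qed auto

lemma poly_functions_common_nonroot:
  fixes F :: "'i \<Rightarrow> 'a::field_char_0 \<Rightarrow> 'a"
  assumes "finite S" "\<And>i. i \<in> S \<Longrightarrow> F i \<in> poly_functions" "\<And>i. i \<in> S \<Longrightarrow> \<exists>t. F i t \<noteq> 0"
  shows "\<exists>t. \<forall>i\<in>S. F i t \<noteq> 0"
proof -
  have "\<forall>i. \<exists>p. i \<in> S \<longrightarrow> (\<forall>t. F i t = poly p t)" using assms(2) by blast
  from choice[OF this] obtain p where p: "\<And>i t. i \<in> S \<Longrightarrow> F i t = poly (p i) t" by blast
  have "p i \<noteq> 0" if "i \<in> S" for i using assms(3)[OF that] p[OF that] by auto
  then have "(\<Prod>i\<in>S. p i) \<noteq> 0" using assms(1) by simp
  then have "finite {t. poly (\<Prod>i\<in>S. p i) t = 0}" by (rule poly_roots_finite)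
  then obtain t where "poly (\<Prod>i\<in>S. p i) t \<noteq> 0" using ex_new_if_finite[OF infinite_UNIV_char_0] by blast
  then have "\<forall>i\<in>S. F i t \<noteq> 0" using p assms(1) by (simp add: poly_prod)
  then show ?thesis ..
qed

definition segment :: "nat \<Rightarrow> 'a::field mat \<Rightarrow> 'a \<Rightarrow> 'a mat" where
  "segment n g t = mat n n (\<lambda>p. (1\<^sub>m n) $$ p + t * (g $$ p - (1\<^sub>m n) $$ p))"

lemma segment_carrier [simp]: "segment n g t \<in> carrier_mat n n"
  by (simp add: segment_def)

lemma segment_0: "segment n g 0 = 1\<^sub>m n"
  by (auto simp: segment_def)

lemma segment_1: "g \<in> carrier_mat n n \<Longrightarrow> segment n g 1 = g"
  by (auto simp: segment_def)

lemma segment_poly: "i < n \<Longrightarrow> j < n \<Longrightarrow> (\<lambda>t. segment n g t $$ (i, j)) \<in> poly_functions"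
  by (auto simp: segment_def intro!: exI[of _ "[:(1\<^sub>m n) $$ (i, j), g $$ (i, j) - (1\<^sub>m n) $$ (i, j):]"])

text \<open>Two non-empty open subsets of an orbit meet. Join \<open>y1\<close> to \<open>y2\<close>
  by conjugating along the line from 1 to \<open>g\<close>: after clearing denominators both
  functions become polynomials in \<open>t\<close>, non-zero at 0 and at 1 respectively, and so is
  the determinant; three non-zero polynomials have a common non-root.\<close>

lemma orbit_irreducible:
  fixes x :: "'a::field_char_0 mat"
  assumes x: "x \<in> carrier_mat n n" and H: "H1 \<in> sym_gl n" "H2 \<in> sym_gl n"
    and y1: "y1 \<in> adjoint_orbit x" "eval_at H1 y1 \<noteq> 0" and y2: "y2 \<in> adjoint_orbit x" "eval_at H2 y2 \<noteq> 0"
  shows "\<exists>y\<in>adjoint_orbit x. eval_at H1 y \<noteq> 0 \<and> eval_at H2 y \<noteq> 0"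
proof -
  have c1: "y1 \<in> carrier_mat n n" by (rule adjoint_orbit_carrier[OF x y1(1)])
  have "y2 \<in> adjoint_orbit y1"
    using y1(1) y2(1) similar_mat_sym similar_mat_trans unfolding adjoint_orbit_def by blast
  then obtain g where g: "g \<in> carrier_mat n n" "det g \<noteq> 0" "y2 = conj_mat g y1"
    by (rule adjoint_orbit_conj_matE[OF c1])
  have y1': "y1 = conj_mat (1\<^sub>m n) y1" using c1 by (intro conj_mat_unique) auto
  let ?g = "segment n g"
  obtain D1 G1 where G1: "G1 \<in> poly_functions"
    "\<And>t. det (?g t) \<noteq> 0 \<Longrightarrow> G1 t = det (?g t) ^ D1 * eval_at H1 (conj_mat (?g t) y1)"
    using poly_functions.homogenize_conj[OF segment_carrier segment_poly c1 H(1)] by blast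
  obtain D2 G2 where G2: "G2 \<in> poly_functions"
    "\<And>t. det (?g t) \<noteq> 0 \<Longrightarrow> G2 t = det (?g t) ^ D2 * eval_at H2 (conj_mat (?g t) y1)"
    using poly_functions.homogenize_conj[OF segment_carrier segment_poly c1 H(2)] by blast
  have det_poly: "(\<lambda>t. det (?g t)) \<in> poly_functions"
    by (rule poly_functions.det[OF segment_carrier segment_poly])
  define F where "F i = (if i = 0 then \<lambda>t. det (?g t) else if i = 1 then G1 else G2)" for i :: nat
  have "\<exists>t. \<forall>i\<in>{0, 1, 2}. F i t \<noteq> 0"
  proof (rule poly_functions_common_nonroot)
    show "F i \<in> poly_functions" if "i \<in> {0, 1, 2}" for i using that det_poly G1(1) G2(1) by (auto simp: F_def)
    have "F 0 0 \<noteq> 0" by (simp add: F_def segment_0)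
    moreover have "F 1 0 \<noteq> 0" using G1(2)[of 0] y1(2) y1' by (simp add: F_def segment_0)
    moreover have "F 2 1 \<noteq> 0" using G2(2)[of 1] y2(2) g by (simp add: F_def segment_1)
    ultimately show "\<exists>t. F i t \<noteq> 0" if "i \<in> {0, 1, 2}" for i using that by auto
  qed simp
  then obtain t where t: "F 0 t \<noteq> 0" "F 1 t \<noteq> 0" "F 2 t \<noteq> 0" by auto
  then have "det (?g t) \<noteq> 0" "eval_at H1 (conj_mat (?g t) y1) \<noteq> 0" "eval_at H2 (conj_mat (?g t) y1) \<noteq> 0"
    using G1(2)[of t] G2(2)[of t] by (auto simp: F_def)
  moreover from this(1) have "conj_mat (?g t) y1 \<in> adjoint_orbit x"
    by (intro conj_mat_in_orbit[OF x y1(1)]) auto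
  ultimately show ?thesis by blast
qed

lemma orbit_irreducible_finite:
  fixes x :: "'a::field_char_0 mat"
  assumes x: "x \<in> carrier_mat n n" and "finite S" "\<And>i. i \<in> S \<Longrightarrow> H i \<in> sym_gl n"
    and "\<And>i. i \<in> S \<Longrightarrow> \<exists>y\<in>adjoint_orbit x. eval_at (H i) y \<noteq> 0"
  shows "\<exists>y\<in>adjoint_orbit x. \<forall>i\<in>S. eval_at (H i) y \<noteq> 0"
proof -
  let ?H = "\<lambda>S. \<Prod>i\<in>S. H i"
  have eval: "eval_at (?H S) y = (\<Prod>i\<in>S. eval_at (H i) y)" for S y
    unfolding eval_at_def by (rule insertion_prod)
  have "\<exists>y\<in>adjoint_orbit x. eval_at (?H S) y \<noteq> 0"
    using assms(2-4)
  proof (induction S)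
    case empty
    show ?case using similar_mat_refl[OF x] by (auto simp: adjoint_orbit_def)
  next
    case (insert i S)
    from insert obtain y1 where y1: "y1 \<in> adjoint_orbit x" "eval_at (H i) y1 \<noteq> 0" by blast
    from insert obtain y2 where y2: "y2 \<in> adjoint_orbit x" "eval_at (?H S) y2 \<noteq> 0" by auto
    have "?H S \<in> sym_gl n" using insert.prems(1) vars_prod[of S H] unfolding sym_gl_def by blast
    from orbit_irreducible[OF x _ this y1 y2] insert.prems(1)[of i] insert.hyps show ?case
      by (auto simp: eval_at_mult)
  qed
  then show ?thesis using assms(2) by (auto simp: eval)
qed

text \<open>Matrices are treated here as functions on index pairs, so that tangent spaces fall under
  \<open>lin_indep\<close> and \<open>in_span\<close> over \<open>index_square\<close>.\<close>

definition ad :: "nat \<Rightarrow> 'a::comm_ring_1 mat \<Rightarrow> (nat \<times> nat \<Rightarrow> 'a) \<Rightarrow> nat \<times> nat \<Rightarrow> 'a" where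
  "ad n x w p = commutator (mat n n w) x $$ p"

abbreviation index_square :: "nat \<Rightarrow> (nat \<times> nat) set" where
  "index_square n \<equiv> {..<n} \<times> {..<n}"

lemma ad_entry:
  assumes x: "x \<in> carrier_mat n n" and "i < n" "j < n"
  shows "ad n x w (i, j) = (\<Sum>k<n. w (i, k) * x $$ (k, j)) - (\<Sum>k<n. x $$ (i, k) * w (k, j))"
proof -
  have w: "mat n n w \<in> carrier_mat n n" by simp
  have "ad n x w (i, j) = (mat n n w * x) $$ (i, j) - (x * mat n n w) $$ (i, j)"
    unfolding ad_def commutator_def using assms carrier_matD[OF x] by (simp del: index_mult_mat(1))
  then show ?thesis
    using assms by (simp add: index_mult_mat_sum[OF w x] index_mult_mat_sum[OF x w] del: index_mult_mat(1))
qed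

lemma ad_sum:
  assumes x: "x \<in> carrier_mat n n" and p: "p \<in> index_square n"
  shows "ad n x (\<lambda>p. \<Sum>j\<in>S. c j * u j p) p = (\<Sum>j\<in>S. c j * ad n x (u j) p)"
proof -
  obtain i j where p': "p = (i, j)" "i < n" "j < n" using p by auto
  have "(\<Sum>k<n. (\<Sum>l\<in>S. c l * u l (i, k)) * x $$ (k, j)) = (\<Sum>l\<in>S. c l * (\<Sum>k<n. u l (i, k) * x $$ (k, j)))"
    unfolding sum_distrib_left sum_distrib_right mult.assoc by (rule sum.swap)
  moreover have "(\<Sum>k<n. x $$ (i, k) * (\<Sum>l\<in>S. c l * u l (k, j))) = (\<Sum>l\<in>S. c l * (\<Sum>k<n. x $$ (i, k) * u l (k, j)))"
    unfolding sum_distrib_left by (subst sum.swap) (simp add: mult.left_commute)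
  ultimately show ?thesis
    unfolding p'(1) ad_entry[OF x p'(2,3)] by (simp add: right_diff_distrib sum_subtractf)
qed

lemma ad_cong: "(\<And>p. p \<in> index_square n \<Longrightarrow> u p = w p) \<Longrightarrow> ad n x u = ad n x w"
proof -
  assume "\<And>p. p \<in> index_square n \<Longrightarrow> u p = w p"
  then have "mat n n u = mat n n w" by (intro eq_matI) auto
  then show ?thesis by (simp add: ad_def fun_eq_iff)
qed

text \<open>\<open>d\<close> is the dimension of the tangent space of the orbit at \<open>x\<close>.
  The chosen preimages \<open>\<alpha>\<close> of a basis span a complement of the centralizer of
  \<open>x\<close>.\<close>

definition ad_basis :: "nat \<Rightarrow> 'a::field mat \<Rightarrow> nat \<Rightarrow> (nat \<Rightarrow> nat \<times> nat \<Rightarrow> 'a) \<Rightarrow> bool" where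
  "ad_basis n x d \<alpha> \<longleftrightarrow> lin_indep (index_square n) d (\<lambda>j. ad n x (\<alpha> j))
     \<and> (\<forall>w. in_span (index_square n) d (\<lambda>j. ad n x (\<alpha> j)) (ad n x w))"

lemma ad_basis_exists: obtains d \<alpha> where "ad_basis n x d \<alpha>"
proof -
  have "lin_indep (index_square n) 0 (\<lambda>_ _. 0 :: 'a)" by (simp add: lin_indep_def)
  then obtain d v where v: "lin_indep (index_square n) d v" "\<And>j. j < d \<Longrightarrow> v j \<in> range (ad n x)"
    "\<And>w. w \<in> range (ad n x) \<Longrightarrow> in_span (index_square n) d v w"
    using basis_extension[of "index_square n" 0 "\<lambda>_ _. 0" "range (ad n x)"] by auto
  have "\<forall>j. \<exists>a. j < d \<longrightarrow> v j = ad n x a" using v(2) by blast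
  from choice[OF this] obtain \<alpha> where \<alpha>: "\<And>j. j < d \<Longrightarrow> v j = ad n x (\<alpha> j)" by blast
  have "lin_indep (index_square n) d (\<lambda>j. ad n x (\<alpha> j))"
    using v(1) \<alpha> lin_indep_cong[of d "index_square n" v "\<lambda>j. ad n x (\<alpha> j)"] by simp
  moreover have "in_span (index_square n) d (\<lambda>j. ad n x (\<alpha> j)) (ad n x w)" for w
    using v(3)[of "ad n x w"] \<alpha> unfolding in_span_def by auto
  ultimately show thesis by (intro that) (auto simp: ad_basis_def)
qed

lemma lin_indep_reindex:
  assumes h: "bij_betw h J I" and "lin_indep I N v"
  shows "lin_indep J N (\<lambda>j r. v j (h r))"
  unfolding lin_indep_def
proof (intro allI impI)
  fix c j assume c: "\<forall>r\<in>J. (\<Sum>j<N. c j * v j (h r)) = 0" and j: "j < N"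
  have "(\<Sum>j<N. c j * v j p) = 0" if p: "p \<in> I" for p
  proof -
    obtain r where "r \<in> J" "p = h r" using h p unfolding bij_betw_def by auto
    with c show ?thesis by simp
  qed
  from lin_indepD[OF assms(2) this j] show "c j = 0" .
qed

definition chart :: "nat \<Rightarrow> nat \<Rightarrow> (nat \<Rightarrow> nat \<times> nat \<Rightarrow> 'a::field) \<Rightarrow> (nat \<Rightarrow> 'a) \<Rightarrow> 'a mat" where
  "chart n d \<alpha> s = mat n n (\<lambda>p. (1\<^sub>m n) $$ p + (\<Sum>j<d. s j * \<alpha> j p))"

lemma chart_carrier [simp]: "chart n d \<alpha> s \<in> carrier_mat n n"
  by (simp add: chart_def)

text \<open>
  The orbit is dominated by conjugation with \<open>1 + M\<close>, where \<open>M\<close> is a complement of the centralizer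
  \<open>Z\<close> of \<open>x\<close>. Since \<open>M + gZ\<close> is the whole matrix algebra for generic \<open>g\<close>, Cramer's rule provides
  \<open>z \<in> Z\<close> with \<open>gz \<in> 1 + M\<close>, rationally along the line from \<open>1\<close> to \<open>g\<close>.
\<close>

lemma chart_dominant:
  fixes x :: "'a::field_char_0 mat"
  assumes x: "x \<in> carrier_mat n n" and basis: "ad_basis n x d \<alpha>" and H: "H \<in> sym_gl n"
    and zero: "\<And>s. det (chart n d \<alpha> s) \<noteq> 0 \<Longrightarrow> eval_at H (conj_mat (chart n d \<alpha> s) x) = 0"
    and y: "y \<in> adjoint_orbit x"
  shows "eval_at H y = 0"
proof (rule ccontr)
  assume Hy: "eval_at H y \<noteq> 0"
  let ?I = "index_square n"
  define \<iota> where "\<iota> p = (1\<^sub>m n :: 'a mat) $$ p" for p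
  obtain g where g: "g \<in> carrier_mat n n" "det g \<noteq> 0" "y = conj_mat g x"
    using adjoint_orbit_conj_matE[OF x y] by metis
  let ?g = "segment n g"
  define Z where "Z = {w. \<forall>p\<in>?I. ad n x w p = 0}"
  have "lin_indep ?I 0 (\<lambda>_ _. 0 :: 'a)" by (simp add: lin_indep_def)
  then obtain e z where z: "lin_indep ?I e z" "\<And>k. k < e \<Longrightarrow> z k \<in> Z" "\<And>w. w \<in> Z \<Longrightarrow> in_span ?I e z w"
    using basis_extension[of ?I 0 "\<lambda>_ _. 0" Z] by auto
  have zZ: "ad n x (z k) p = 0" if "k < e" "p \<in> ?I" for k p using z(2)[OF that(1)] that(2) unfolding Z_def by blast
  \<comment> \<open>A basis of all matrices: first the complement \<open>\<alpha>\<close>, then a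
    basis \<open>z\<close> of the centralizer of \<open>x\<close>.\<close>
  define u where "u j = (if j < d then \<alpha> j else z (j - d))" for j
  have sum_u: "(\<Sum>j<d + e. c j * u j p) = (\<Sum>j<d. c j * \<alpha> j p) + (\<Sum>k<e. c (d + k) * z k p)" for c p
    unfolding sum_lessThan_split2 by (simp add: u_def)
  have indu: "c j = 0" if c: "\<And>p. p \<in> ?I \<Longrightarrow> (\<Sum>j<d. c j * \<alpha> j p) + (\<Sum>k<e. c (d + k) * z k p) = 0" and j: "j < d + e" for c j
  proof -
    have "(\<Sum>j<d. c j * ad n x (\<alpha> j) p) = 0" if p: "p \<in> ?I" for p
    proof -
      have "0 = ad n x (\<lambda>p. \<Sum>j<d + e. c j * u j p) p"
      proof -
        have "ad n x (\<lambda>p. \<Sum>j<d + e. c j * u j p) = ad n x (\<lambda>_. 0)"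
          by (rule ad_cong) (use c in \<open>simp add: sum_u\<close>)
        then show ?thesis using ad_sum[OF x p, of "\<lambda>_. 0" "\<lambda>_ _. 0" "{}"] by simp
      qed
      also have "\<dots> = (\<Sum>j<d + e. c j * ad n x (u j) p)" by (rule ad_sum[OF x p])
      also have "\<dots> = (\<Sum>j<d. c j * ad n x (\<alpha> j) p) + (\<Sum>k<e. c (d + k) * ad n x (z k) p)"
        unfolding sum_lessThan_split2 by (simp add: u_def)
      also have "(\<Sum>k<e. c (d + k) * ad n x (z k) p) = 0"
        using zZ p by (intro sum.neutral) (simp del: mem_Sigma_iff)
      finally show ?thesis by simp
    qed
    then have c1: "c j = 0" if "j < d" for j
      using lin_indepD[of ?I d "\<lambda>j. ad n x (\<alpha> j)" c j] basis that by (simp add: ad_basis_def)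
    have "(\<Sum>k<e. c (d + k) * z k p) = 0" if "p \<in> ?I" for p using c[OF that] c1 by simp
    from lin_indepD[OF z(1) this] have "c (d + k) = 0" if "k < e" for k using that by blast
    with c1 j show ?thesis by (auto elim: less_add_cases)
  qed
  have ind: "lin_indep ?I (d + e) u"
    unfolding lin_indep_def sum_u using indu by blast
  have span: "in_span ?I (d + e) u w" for w
  proof -
    obtain c where c: "\<And>p. p \<in> ?I \<Longrightarrow> ad n x w p = (\<Sum>j<d. c j * ad n x (\<alpha> j) p)"
      using basis unfolding ad_basis_def in_span_def by blast
    \<comment> \<open>The difference of \<open>w\<close> and its component in the complement,
      written as a sum over two indices so that \<open>ad_sum\<close> applies.\<close>
    let ?w = "\<lambda>p. \<Sum>b\<in>{True, False}. (if b then 1 else - 1) * (if b then w p else (\<Sum>j<d. c j * \<alpha> j p))"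
    have "ad n x ?w p = 0" if p: "p \<in> ?I" for p
      unfolding ad_sum[OF x p] using c[OF p] ad_sum[OF x p, of c \<alpha> "{..<d}"] by simp
    then have "?w \<in> Z" by (simp add: Z_def)
    from z(3)[OF this] obtain c' where c': "\<And>p. p \<in> ?I \<Longrightarrow> w p - (\<Sum>j<d. c j * \<alpha> j p) = (\<Sum>k<e. c' k * z k p)"
      unfolding in_span_def by auto
    show ?thesis
    proof (rule in_spanI)
      fix p assume p: "p \<in> ?I"
      show "w p = (\<Sum>j<d + e. (if j < d then c j else c' (j - d)) * u j p)"
        unfolding sum_u using c'[OF p] by (simp add: diff_eq_eq add.commute)
    qed
  qed
  define q where "q = card ?I"
  have q: "d + e = q"
  proof (rule antisym)
    show "d + e \<le> q" unfolding q_def by (rule lin_indep_le_card[OF ind]) simp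
    obtain h where "bij_betw h {..<card ?I} ?I"
      using ex_bij_betw_nat_finite[of ?I] unfolding lessThan_atLeast0 by auto
    then have "bij_betw (inv_into {..<card ?I} h) ?I {..<card ?I}" by (rule bij_betw_inv_into)
    then have "lin_indep ?I q (\<lambda>j p. if inv_into {..<card ?I} h p = j then 1 else 0 :: 'a)"
      unfolding q_def by (rule lin_indep_reindex[OF _ unit_vectors_indep])
    then show "q \<le> d + e" by (rule steinitz_bound) (rule span)
  qed
  obtain h where h: "bij_betw h {..<q} ?I"
    using ex_bij_betw_nat_finite[of ?I] unfolding lessThan_atLeast0 q_def by auto
  have h_in: "h r \<in> ?I" if "r < q" for r using h that unfolding bij_betw_def by auto
  \<comment> \<open>The same family with the centralizer part moved by the group element at time
    \<open>t\<close>. It is polynomial in \<open>t\<close> and equals the basis \<open>u\<close> at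
    \<open>t = 0\<close>.\<close>
  define U where "U t j p = (if j < d then \<alpha> j p else (?g t * mat n n (z (j - d))) $$ p)" for t j p
  have gz: "(?g t * mat n n w) $$ (i, j) = (\<Sum>k<n. ?g t $$ (i, k) * w (k, j))" if "i < n" "j < n" for t w i j
    using that index_mult_mat_sum[OF segment_carrier, of "mat n n w" n n i j g t] by simp
  have U_poly: "(\<lambda>t. U t j p) \<in> poly_functions" if pI: "p \<in> ?I" for j p
  proof -
    obtain i l where p: "p = (i, l)" "i < n" "l < n" using pI by auto
    have "(\<lambda>t. \<Sum>k<n. z (j - d) (k, l) * ?g t $$ (i, k)) \<in> poly_functions"
      using p by (intro poly_functions.sum poly_functions.scale segment_poly) auto
    then show ?thesis unfolding U_def p(1) gz[OF p(2,3)] using poly_functions.const'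
      by (cases "j < d") (simp_all add: mult.commute)
  qed
  define M where "M t = mat q q (\<lambda>(r, j). U t j (h r))" for t
  have Mc: "M t \<in> carrier_mat q q" for t by (simp add: M_def)
  have M_poly: "(\<lambda>t. M t $$ (r, j)) \<in> poly_functions" if "r < q" "j < q" for r j
    using that U_poly[OF h_in[OF that(1)], of j] by (simp add: M_def)
  define D where "D t = det (M t)" for t
  have D_poly: "D \<in> poly_functions"
    using poly_functions.det[OF Mc M_poly] unfolding D_def by simp
  have U0: "U 0 j p = u j p" if p: "p \<in> ?I" for j p
    using p by (auto simp: U_def u_def segment_0)
  have D0: "D 0 \<noteq> 0"
    unfolding D_def
  proof (rule lin_indep_det_nonzero[OF Mc])
    have "lin_indep {..<q} q (\<lambda>j r. u j (h r))"
      using lin_indep_reindex[OF h ind] by (simp add: q)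
    also have "?this = lin_indep {..<q} q (\<lambda>j r. M 0 $$ (r, j))"
      by (rule lin_indep_cong) (simp add: M_def U0 h_in)
    finally show "lin_indep {..<q} q (\<lambda>j r. M 0 $$ (r, j))" .
  qed
  \<comment> \<open>Cramer's numerators of the coefficients of the identity matrix in the family
    \<open>U t\<close>; the denominator is the determinant \<open>D t\<close>.\<close>
  define \<gamma> where "\<gamma> t j = (\<Sum>r<q. \<iota> (h r) * adj_mat (M t) $$ (j, r))" for t j
  have \<gamma>_poly: "(\<lambda>t. \<gamma> t j) \<in> poly_functions" if "j < q" for j
    unfolding \<gamma>_def using that
    by (intro poly_functions.sum poly_functions.scale poly_functions.adj_mat[OF Mc M_poly]) auto
  have cramer: "(\<Sum>j<q. \<gamma> t j * U t j p) = D t * \<iota> p" if p: "p \<in> ?I" for t p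
  proof -
    obtain r where r: "r < q" "p = h r" using h p unfolding bij_betw_def by auto
    have "(\<Sum>j<q. \<gamma> t j * U t j p) = (\<Sum>j<q. \<Sum>r'<q. \<iota> (h r') * (M t $$ (r, j) * adj_mat (M t) $$ (j, r')))"
      unfolding \<gamma>_def sum_distrib_right using r by (intro sum.cong refl) (simp add: M_def)
    also have "\<dots> = (\<Sum>r'<q. \<iota> (h r') * (\<Sum>j<q. M t $$ (r, j) * adj_mat (M t) $$ (j, r')))"
      unfolding sum_distrib_left by (rule sum.swap)
    also have "\<dots> = (\<Sum>r'<q. \<iota> (h r') * (if r' = r then D t else 0))"
    proof (intro sum.cong refl)
      fix r' assume "r' \<in> {..<q}"
      then have "(\<Sum>j<q. M t $$ (r, j) * adj_mat (M t) $$ (j, r')) = (M t * adj_mat (M t)) $$ (r, r')"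
        using r by (simp add: index_mult_mat_sum[OF Mc adj_mat(1)[OF Mc]] del: index_mult_mat(1))
      also have "\<dots> = (if r' = r then D t else 0)"
        unfolding adj_mat(2)[OF Mc] using r \<open>r' \<in> {..<q}\<close> by (simp add: D_def)
      finally show "\<iota> (h r') * (\<Sum>j<q. M t $$ (r, j) * adj_mat (M t) $$ (j, r'))
          = \<iota> (h r') * (if r' = r then D t else 0)" by simp
    qed
    also have "\<dots> = D t * \<iota> p" using r by (simp add: sum_delta_mult)
    finally show ?thesis .
  qed
  define \<zeta> where "\<zeta> t = mat n n (\<lambda>p. \<Sum>k<e. \<gamma> t (d + k) * z k p)" for t
  have \<zeta>c: "\<zeta> t \<in> carrier_mat n n" for t by (simp add: \<zeta>_def)
  have g\<zeta>: "(?g t * \<zeta> t) $$ p = (\<Sum>k<e. \<gamma> t (d + k) * U t (d + k) p)" if pI: "p \<in> ?I" for t p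
  proof -
    obtain i l where p: "p = (i, l)" "i < n" "l < n" using pI by auto
    show ?thesis unfolding p(1) \<zeta>_def gz[OF p(2,3)] U_def
      using gz[OF p(2,3)] by (simp add: sum_distrib_left mult_ac) (rule sum.swap)
  qed
  have decomp: "D t * \<iota> p = (\<Sum>j<d. \<gamma> t j * \<alpha> j p) + (?g t * \<zeta> t) $$ p" if "p \<in> ?I" for t p
    unfolding cramer[OF that, symmetric] q[symmetric] sum_lessThan_split2 g\<zeta>[OF that] by (simp add: U_def)
  have \<zeta>_poly: "(\<lambda>t. \<zeta> t $$ (i, j)) \<in> poly_functions" if ij: "i < n" "j < n" for i j
  proof -
    have "(\<lambda>t. \<Sum>k<e. z k (i, j) * \<gamma> t (d + k)) \<in> poly_functions"
      using q by (intro poly_functions.sum poly_functions.scale \<gamma>_poly) auto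
    then show ?thesis using ij by (simp add: \<zeta>_def mult.commute)
  qed
  have "\<iota> \<in> Z"
  proof -
    have "mat n n \<iota> = 1\<^sub>m n" by (auto simp: \<iota>_def)
    moreover have "commutator (1\<^sub>m n) x = 0\<^sub>m n n" using x by (simp add: commutator_def minus_r_inv_mat[OF x])
    ultimately show ?thesis by (auto simp: Z_def ad_def)
  qed
  from z(3)[OF this] obtain f where f: "\<And>p. p \<in> ?I \<Longrightarrow> \<iota> p = (\<Sum>k<e. f k * z k p)" unfolding in_span_def by blast
  \<comment> \<open>At \<open>t = 0\<close> the identity matrix lies in the centralizer, so by
    uniqueness it has no component in the complement. Hence \<open>\<zeta> 0\<close> is a non-zero
    scalar matrix, which guarantees that \<open>\<zeta> t\<close> is invertible for almost all
    \<open>t\<close>.\<close>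
  have \<gamma>0: "\<gamma> 0 j = 0" if "j < d" for j
  proof -
    let ?c = "\<lambda>j. if j < d then \<gamma> 0 j else \<gamma> 0 j - D 0 * f (j - d)"
    have "?c j = 0"
    proof (rule indu[where c = ?c])
      fix p assume p: "p \<in> ?I"
      have "D 0 * \<iota> p = (\<Sum>j<d. \<gamma> 0 j * \<alpha> j p) + (\<Sum>k<e. \<gamma> 0 (d + k) * z k p)"
        unfolding cramer[OF p, symmetric] q[symmetric] sum_lessThan_split2 using U0[OF p] by (simp add: u_def)
      then show "(\<Sum>j<d. ?c j * \<alpha> j p) + (\<Sum>k<e. ?c (d + k) * z k p) = 0"
        unfolding f[OF p] by (simp add: left_diff_distrib sum_subtractf sum_distrib_left mult.assoc)
    qed (use that in simp)
    with that show ?thesis by simp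
  qed
  have "\<zeta> 0 = D 0 \<cdot>\<^sub>m 1\<^sub>m n"
  proof (rule eq_matI)
    fix i j assume "i < dim_row (D 0 \<cdot>\<^sub>m 1\<^sub>m n)" "j < dim_col (D 0 \<cdot>\<^sub>m 1\<^sub>m n)"
    then show "\<zeta> 0 $$ (i, j) = (D 0 \<cdot>\<^sub>m 1\<^sub>m n) $$ (i, j)"
      using decomp[of "(i, j)" 0] \<gamma>0 left_mult_one_mat[OF \<zeta>c[of 0]] by (simp add: segment_0 \<iota>_def del: index_mult_mat(1))
  qed (auto simp: \<zeta>_def)
  then have det\<zeta>0: "det (\<zeta> 0) \<noteq> 0" using D0 by simp
  obtain E G where G: "G \<in> poly_functions"
    "\<And>t. det (?g t) \<noteq> 0 \<Longrightarrow> G t = det (?g t) ^ E * eval_at H (conj_mat (?g t) x)"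
    using poly_functions.homogenize_conj[OF segment_carrier segment_poly x H] by blast
  \<comment> \<open>The four conditions to be met at one \<open>t\<close>: the group element is
    invertible, \<open>H\<close> is non-zero at its conjugate of \<open>x\<close>, the family
    \<open>U t\<close> is a basis, and \<open>\<zeta> t\<close> is invertible. The second one holds
    at \<open>t = 1\<close>, the others at \<open>t = 0\<close>.\<close>
  define F where "F i = (if i = 0 then \<lambda>t. det (?g t) else if i = 1 then G else if i = 2 then D else (\<lambda>t. det (\<zeta> t)))" for i :: nat
  have "\<exists>t. \<forall>i\<in>{0, 1, 2, 3}. F i t \<noteq> 0"
  proof (rule poly_functions_common_nonroot)
    show "F i \<in> poly_functions" if "i \<in> {0, 1, 2, 3}" for i
      using that G(1) D_poly poly_functions.det[OF segment_carrier segment_poly] poly_functions.det[OF \<zeta>c \<zeta>_poly]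
      by (auto simp: F_def)
    have "F 0 0 \<noteq> 0" "F 1 1 \<noteq> 0" "F 2 0 \<noteq> 0" "F 3 0 \<noteq> 0"
      using G(2)[of 1] g Hy D0 det\<zeta>0 by (simp_all add: F_def segment_0 segment_1)
    then show "\<exists>t. F i t \<noteq> 0" if "i \<in> {0, 1, 2, 3}" for i using that by auto
  qed simp
  then obtain t where t: "det (?g t) \<noteq> 0" "G t \<noteq> 0" "D t \<noteq> 0" "det (\<zeta> t) \<noteq> 0"
    by (auto simp: F_def)
  define s where "s j = - \<gamma> t j / D t" for j
  have chart_eq: "chart n d \<alpha> s = (1 / D t) \<cdot>\<^sub>m (?g t * \<zeta> t)"
  proof (rule eq_matI)
    fix i j assume "i < dim_row ((1 / D t) \<cdot>\<^sub>m (?g t * \<zeta> t))" "j < dim_col ((1 / D t) \<cdot>\<^sub>m (?g t * \<zeta> t))"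
    then have ij: "i < n" "j < n" by (auto simp: segment_def \<zeta>_def)
    have "chart n d \<alpha> s $$ (i, j) = \<iota> (i, j) - (\<Sum>l<d. \<gamma> t l * \<alpha> l (i, j)) / D t"
      using ij by (simp add: chart_def s_def \<iota>_def sum_negf sum_divide_distrib)
    also have "\<dots> = (?g t * \<zeta> t) $$ (i, j) / D t"
      using decomp[of "(i, j)" t] ij t(3) by (simp add: field_simps del: index_mult_mat(1))
    finally show "chart n d \<alpha> s $$ (i, j) = ((1 / D t) \<cdot>\<^sub>m (?g t * \<zeta> t)) $$ (i, j)"
      using ij carrier_matD[OF segment_carrier[of n g t]] carrier_matD[OF \<zeta>c[of t]] by (simp del: index_mult_mat(1))
  qed (auto simp: chart_def segment_def \<zeta>_def)
  have g\<zeta>c: "?g t * \<zeta> t \<in> carrier_mat n n" by (rule mult_carrier_mat[OF segment_carrier \<zeta>c])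
  have det_chart: "det (chart n d \<alpha> s) \<noteq> 0"
    unfolding chart_eq using t det_mult[OF segment_carrier[of n g t] \<zeta>c[of t]] by simp
  have \<zeta>x: "\<zeta> t * x = x * \<zeta> t"
  proof -
    have "commutator (\<zeta> t) x $$ p = 0" if p: "p \<in> ?I" for p
    proof -
      have "commutator (\<zeta> t) x $$ p = ad n x (\<lambda>p. \<Sum>k<e. \<gamma> t (d + k) * z k p) p" by (simp add: ad_def \<zeta>_def)
      also have "\<dots> = 0" unfolding ad_sum[OF x p] using zZ p by (intro sum.neutral) (simp del: mem_Sigma_iff)
      finally show ?thesis .
    qed
    then have "(\<zeta> t * x) $$ (i, j) = (x * \<zeta> t) $$ (i, j)" if "i < n" "j < n" for i j
      using that carrier_matD[OF x] carrier_matD[OF \<zeta>c[of t]] unfolding commutator_def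
      by (fastforce simp del: index_mult_mat(1))
    then show ?thesis using carrier_matD[OF x] carrier_matD[OF \<zeta>c[of t]]
      by (intro eq_matI) (simp_all del: index_mult_mat(1))
  qed
  let ?y = "conj_mat (?g t) x"
  have yc: "?y \<in> carrier_mat n n" by (rule conj_mat_carrier[OF segment_carrier x t(1)])
  \<comment> \<open>The chart point is a multiple of the group element times
    \<open>\<zeta> t\<close>, and \<open>\<zeta> t\<close> commutes with \<open>x\<close>; both
    therefore conjugate \<open>x\<close> to the same matrix.\<close>
  have "?y * chart n d \<alpha> s = (1 / D t) \<cdot>\<^sub>m (?y * ?g t * \<zeta> t)"
    unfolding chart_eq mult_smult_distrib[OF yc g\<zeta>c] by (subst assoc_mult_mat[OF yc segment_carrier \<zeta>c]) simp
  also have "?y * ?g t * \<zeta> t = ?g t * x * \<zeta> t"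
    unfolding conj_mat_mult[OF segment_carrier x t(1)] ..
  also have "\<dots> = ?g t * (\<zeta> t * x)" unfolding \<zeta>x by (rule assoc_mult_mat[OF segment_carrier x \<zeta>c])
  also have "\<dots> = ?g t * \<zeta> t * x" by (rule assoc_mult_mat[OF segment_carrier \<zeta>c x, symmetric])
  also have "(1 / D t) \<cdot>\<^sub>m (?g t * \<zeta> t * x) = chart n d \<alpha> s * x"
    unfolding chart_eq mult_smult_assoc_mat[OF g\<zeta>c x] ..
  finally have "?y = conj_mat (chart n d \<alpha> s) x"
    by (rule conj_mat_unique[OF chart_carrier x det_chart yc])
  with zero[OF det_chart] have "eval_at H ?y = 0" by simp
  with G(2)[OF t(1)] t(2) show False by simp
qed

text \<open>Exponents are bounded in each coordinate instead of by total degree, because the number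
  of monomials is then exactly a power, \<open>(L + 1) ^ d\<close>. Membership is a property of
  functions; the coefficients are not fixed.\<close>

definition box_functions :: "nat \<Rightarrow> nat \<Rightarrow> ((nat \<Rightarrow> 'a::field) \<Rightarrow> 'a) set" where
  "box_functions d L = {F. \<exists>c. \<forall>s. F s = (\<Sum>\<beta>\<in>{..<d} \<rightarrow>\<^sub>E {..L}. c \<beta> * (\<Prod>i<d. s i ^ \<beta> i))}"

lemma box_functions_scale:
  "F \<in> box_functions d L \<Longrightarrow> (\<lambda>s. a * F s) \<in> box_functions d L"
proof -
  assume "F \<in> box_functions d L"
  then obtain c where c: "\<And>s. F s = (\<Sum>\<beta>\<in>{..<d} \<rightarrow>\<^sub>E {..L}. c \<beta> * (\<Prod>i<d. s i ^ \<beta> i))"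
    unfolding box_functions_def by blast
  then show ?thesis unfolding box_functions_def
    by (auto simp: sum_distrib_left mult.assoc intro!: exI[of _ "\<lambda>\<beta>. a * c \<beta>"])
qed

lemma box_functions_add:
  "F \<in> box_functions d L \<Longrightarrow> G \<in> box_functions d L \<Longrightarrow> (\<lambda>s. F s + G s) \<in> box_functions d L"
proof -
  assume "F \<in> box_functions d L" "G \<in> box_functions d L"
  then obtain c e where c: "\<And>s. F s = (\<Sum>\<beta>\<in>{..<d} \<rightarrow>\<^sub>E {..L}. c \<beta> * (\<Prod>i<d. s i ^ \<beta> i))"
    "\<And>s. G s = (\<Sum>\<beta>\<in>{..<d} \<rightarrow>\<^sub>E {..L}. e \<beta> * (\<Prod>i<d. s i ^ \<beta> i))"
    unfolding box_functions_def by blast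
  then show ?thesis unfolding box_functions_def
    by (auto simp: sum.distrib distrib_right intro!: exI[of _ "\<lambda>\<beta>. c \<beta> + e \<beta>"])
qed

lemma box_functions_sum:
  "(\<And>i. i \<in> S \<Longrightarrow> F i \<in> box_functions d L) \<Longrightarrow> (\<lambda>s. \<Sum>i\<in>S. F i s) \<in> box_functions d L"
proof (induction S rule: infinite_finite_induct)
  case (insert i S)
  then show ?case using box_functions_add[of "F i" d L "\<lambda>s. \<Sum>i\<in>S. F i s"] by simp
qed (auto simp: box_functions_def intro!: exI[of _ "\<lambda>_. 0"])

lemma finite_box: "finite ({..<d} \<rightarrow>\<^sub>E {..L::nat} :: (nat \<Rightarrow> nat) set)"
  by (rule finite_PiE) auto

lemma box_functions_monomial:
  assumes "\<And>i. i < d \<Longrightarrow> \<beta> i \<le> L"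
  shows "(\<lambda>s. \<Prod>i<d. s i ^ \<beta> i) \<in> box_functions d L"
proof -
  let ?\<beta> = "restrict \<beta> {..<d}"
  have mem: "?\<beta> \<in> {..<d} \<rightarrow>\<^sub>E {..L}" using assms by auto
  have "(\<Prod>i<d. s i ^ \<beta> i) = (\<Sum>\<gamma>\<in>{..<d} \<rightarrow>\<^sub>E {..L}. (if \<gamma> = ?\<beta> then 1 else 0) * (\<Prod>i<d. s i ^ \<gamma> i))" for s :: "nat \<Rightarrow> 'a"
  proof -
    have "(\<Sum>\<gamma>\<in>{..<d} \<rightarrow>\<^sub>E {..L}. (if \<gamma> = ?\<beta> then 1 else 0) * (\<Prod>i<d. s i ^ \<gamma> i))
        = (\<Sum>\<gamma>\<in>{..<d} \<rightarrow>\<^sub>E {..L}. if \<gamma> = ?\<beta> then (\<Prod>i<d. s i ^ ?\<beta> i) else 0)"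
      by (intro sum.cong) auto
    also have "\<dots> = (\<Prod>i<d. s i ^ ?\<beta> i)" using mem finite_box[of d L] by (subst sum.delta) auto
    also have "\<dots> = (\<Prod>i<d. s i ^ \<beta> i)" by (intro prod.cong) auto
    finally show ?thesis ..
  qed
  then show ?thesis unfolding box_functions_def
    by (intro CollectI exI[of _ "\<lambda>\<gamma>. if \<gamma> = ?\<beta> then 1 else 0"] allI)
qed

interpretation box_functions: function_filtration "box_functions d :: nat \<Rightarrow> ((nat \<Rightarrow> 'a::field) \<Rightarrow> 'a) set" for d
proof
  show "(\<lambda>_. c) \<in> box_functions d 0" for c :: 'a
    using box_functions_scale[OF box_functions_monomial[of d "\<lambda>_. 0" 0], of c] by simp
  fix F G :: "(nat \<Rightarrow> 'a) \<Rightarrow> 'a" and L L' :: nat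
  show "F \<in> box_functions d L \<Longrightarrow> G \<in> box_functions d L \<Longrightarrow> (\<lambda>s. F s + G s) \<in> box_functions d L"
    by (rule box_functions_add)
  show "(\<lambda>s. F s * G s) \<in> box_functions d (L + L')" if F: "F \<in> box_functions d L" and G: "G \<in> box_functions d L'"
  proof -
    obtain c e where c: "\<And>s. F s = (\<Sum>\<beta>\<in>{..<d} \<rightarrow>\<^sub>E {..L}. c \<beta> * (\<Prod>i<d. s i ^ \<beta> i))"
      "\<And>s. G s = (\<Sum>\<beta>\<in>{..<d} \<rightarrow>\<^sub>E {..L'}. e \<beta> * (\<Prod>i<d. s i ^ \<beta> i))"
      using F G unfolding box_functions_def by blast
    have "F s * G s = (\<Sum>\<beta>\<in>{..<d} \<rightarrow>\<^sub>E {..L}. \<Sum>\<gamma>\<in>{..<d} \<rightarrow>\<^sub>E {..L'}.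
        c \<beta> * e \<gamma> * (\<Prod>i<d. s i ^ (\<beta> i + \<gamma> i)))" for s
      unfolding c by (simp add: sum_product power_add prod.distrib mult_ac)
    moreover have "(\<lambda>s. \<Sum>\<beta>\<in>{..<d} \<rightarrow>\<^sub>E {..L}. \<Sum>\<gamma>\<in>{..<d} \<rightarrow>\<^sub>E {..L'}.
        c \<beta> * e \<gamma> * (\<Prod>i<d. s i ^ (\<beta> i + \<gamma> i))) \<in> box_functions d (L + L')"
    proof (intro box_functions_sum box_functions_scale box_functions_monomial)
      fix \<beta> \<gamma> i assume "\<beta> \<in> {..<d} \<rightarrow>\<^sub>E {..L}" "\<gamma> \<in> {..<d} \<rightarrow>\<^sub>E {..L'}" "i < d"
      then have "\<beta> i \<le> L" "\<gamma> i \<le> L'" by (auto dest: PiE_mem)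
      then show "\<beta> i + \<gamma> i \<le> L + L'" by simp
    qed
    ultimately show ?thesis by simp
  qed
  show "F \<in> box_functions d L'" if le: "L \<le> L'" and F: "F \<in> box_functions d L"
  proof -
    obtain c where c: "\<And>s. F s = (\<Sum>\<beta>\<in>{..<d} \<rightarrow>\<^sub>E {..L}. c \<beta> * (\<Prod>i<d. s i ^ \<beta> i))"
      using F unfolding box_functions_def by blast
    have "(\<lambda>s. \<Sum>\<beta>\<in>{..<d} \<rightarrow>\<^sub>E {..L}. c \<beta> * (\<Prod>i<d. s i ^ \<beta> i)) \<in> box_functions d L'"
    proof (intro box_functions_sum box_functions_scale box_functions_monomial)
      fix \<beta> i assume "\<beta> \<in> {..<d} \<rightarrow>\<^sub>E {..L}" "i < d"
      then have "\<beta> i \<le> L" by (auto dest: PiE_mem)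
      with le show "\<beta> i \<le> L'" by simp
    qed
    moreover have "F = (\<lambda>s. \<Sum>\<beta>\<in>{..<d} \<rightarrow>\<^sub>E {..L}. c \<beta> * (\<Prod>i<d. s i ^ \<beta> i))" by (rule ext) (rule c)
    ultimately show ?thesis by simp
  qed
qed

definition exponent :: "nat \<Rightarrow> (nat \<Rightarrow> nat) \<Rightarrow> nat \<Rightarrow>\<^sub>0 nat" where
  "exponent r \<beta> = (\<Sum>i<r. Poly_Mapping.single i (\<beta> i))"

lemma lookup_exponent: "Poly_Mapping.lookup (exponent r \<beta>) i = (if i < r then \<beta> i else 0)"
proof -
  have "Poly_Mapping.lookup (exponent r \<beta>) i = (\<Sum>j<r. if j = i then \<beta> i else 0)"
    unfolding exponent_def lookup_sum by (intro sum.cong) (auto simp: lookup_single when_def)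
  then show ?thesis by simp
qed

lemma keys_exponent: "Poly_Mapping.keys (exponent r \<beta>) \<subseteq> {..<r}"
  by (auto simp: in_keys_iff lookup_exponent split: if_splits)

lemma mon_value_exponent: "mon_value \<phi> (exponent r \<beta>) = (\<Prod>i<r. \<phi> i ^ \<beta> i)"
  by (subst mon_value_superset[of "{..<r}"]) (auto simp: keys_exponent lookup_exponent)

lemma inj_on_exponent: "inj_on (exponent r) ({..<r} \<rightarrow>\<^sub>E S)"
proof (rule inj_onI)
  fix \<beta> \<gamma> assume \<beta>: "\<beta> \<in> {..<r} \<rightarrow>\<^sub>E S" and \<gamma>: "\<gamma> \<in> {..<r} \<rightarrow>\<^sub>E S" and eq: "exponent r \<beta> = exponent r \<gamma>"
  show "\<beta> = \<gamma>"
  proof (rule PiE_ext[OF \<beta> \<gamma>])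
    fix i assume "i \<in> {..<r}"
    then show "\<beta> i = \<gamma> i" using lookup_exponent[of r \<beta> i] lookup_exponent[of r \<gamma> i] eq by simp
  qed
qed

lemma box_exceeds: "\<exists>N>0. (N * c + 1) ^ d < (N ^ Suc d :: nat)"
proof (intro exI conjI)
  \<comment> \<open>Since \<open>N c + 1 \<le> N (c + 1)\<close>, it suffices that \<open>N\<close>
    exceeds \<open>(c + 1) ^ d\<close>; the spare factor \<open>N\<close> on the right then
    wins.\<close>
  let ?N = "(c + 1) ^ d + 1"
  have "(?N * c + 1) ^ d \<le> (?N * (c + 1)) ^ d" by (intro power_mono) auto
  also have "\<dots> = ?N ^ d * (c + 1) ^ d" by (rule power_mult_distrib)
  also have "\<dots> < ?N ^ d * ?N" by (intro mult_strict_left_mono) auto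
  finally show "(?N * c + 1) ^ d < ?N ^ Suc d" by (simp add: mult.commute)
qed simp

text \<open>
  Counting: the \<open>N\<^bsup>r\<^esup>\<close> monomials with exponents below \<open>N\<close> in the given functions, pulled back to the
  chart and multiplied by a power of the determinant, lie in a space of dimension \<open>O(N\<^bsup>d\<^esup>)\<close>.
\<close>

lemma independent_functions_bound:
  fixes x :: "'a::field_char_0 mat"
  assumes x: "x \<in> carrier_mat n n" and basis: "ad_basis n x d \<alpha>"
    and P: "\<And>i. i < r \<Longrightarrow> P i \<in> sym_gl n"
    and indep: "algebraically_independent (adjoint_orbit x) r (\<lambda>i. eval_at (P i))"
  shows "r \<le> d"
proof (rule ccontr)
  assume "\<not> r \<le> d"
  then have r: "Suc d \<le> r" by simp
  define \<delta> where "\<delta> s = det (chart n d \<alpha> s)" for s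
  have single_box: "(\<lambda>s::nat \<Rightarrow> 'a. s j) \<in> box_functions d 1" if "j < d" for j
  proof -
    have "(\<lambda>s::nat \<Rightarrow> 'a. \<Prod>i<d. s i ^ (if i = j then 1 else 0)) \<in> box_functions d 1"
      by (rule box_functions_monomial) auto
    moreover have "(\<Prod>i<d. s i ^ (if i = j then 1 else 0)) = s j" for s :: "nat \<Rightarrow> 'a"
    proof -
      have "(\<Prod>i<d. s i ^ (if i = j then 1 else 0)) = (\<Prod>i<d. if i = j then s j else 1)"
        by (intro prod.cong) auto
      with that show ?thesis by simp
    qed
    ultimately show ?thesis by (simp only:)
  qed
  have chart_box: "(\<lambda>s. chart n d \<alpha> s $$ (i, j)) \<in> box_functions d 1" if ij: "i < n" "j < n" for i j
  proof -
    have "(\<lambda>s. (1\<^sub>m n) $$ (i, j) + (\<Sum>l<d. \<alpha> l (i, j) * s l)) \<in> box_functions d 1"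
      by (intro box_functions.add box_functions.const' box_functions.sum box_functions.scale single_box) auto
    then show ?thesis using ij by (simp add: chart_def mult.commute)
  qed
  have \<delta>_box: "\<delta> \<in> box_functions d n"
    using box_functions.det[OF chart_carrier chart_box] by (simp add: \<delta>_def[abs_def])
  have "\<forall>i. \<exists>DCG. i < r \<longrightarrow> snd (snd DCG) \<in> box_functions d (fst (snd DCG)) \<and>
      (\<forall>s. \<delta> s \<noteq> 0 \<longrightarrow> snd (snd DCG) s = \<delta> s ^ fst DCG * eval_at (P i) (conj_mat (chart n d \<alpha> s) x))"
  proof (intro allI)
    fix i
    show "\<exists>DCG. i < r \<longrightarrow> snd (snd DCG) \<in> box_functions d (fst (snd DCG)) \<and>
      (\<forall>s. \<delta> s \<noteq> 0 \<longrightarrow> snd (snd DCG) s = \<delta> s ^ fst DCG * eval_at (P i) (conj_mat (chart n d \<alpha> s) x))"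
    proof (cases "i < r")
      case True
      obtain D C G where "G \<in> box_functions d C"
        "\<forall>s. \<delta> s \<noteq> 0 \<longrightarrow> G s = \<delta> s ^ D * eval_at (P i) (conj_mat (chart n d \<alpha> s) x)"
        using box_functions.homogenize_conj[OF chart_carrier chart_box x P[OF True]] unfolding \<delta>_def by blast
      then show ?thesis by (intro exI[of _ "(D, C, G)"]) simp
    qed simp
  qed
  from choice[OF this] obtain W where W: "\<And>i. i < r \<Longrightarrow> snd (snd (W i)) \<in> box_functions d (fst (snd (W i)))"
    "\<And>i s. i < r \<Longrightarrow> \<delta> s \<noteq> 0 \<Longrightarrow> snd (snd (W i)) s = \<delta> s ^ fst (W i) * eval_at (P i) (conj_mat (chart n d \<alpha> s) x)"
    by blast
  \<comment> \<open>A common exponent for the denominators of all the functions; each numerator is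
    padded to it in \<open>G\<close>.\<close>
  define D where "D = (\<Sum>i<r. fst (W i))"
  define K where "K = D * n + (\<Sum>i<r. fst (snd (W i)))"
  define G where "G i s = \<delta> s ^ (D - fst (W i)) * snd (snd (W i)) s" for i s
  have D_le: "fst (W i) \<le> D" if "i < r" for i
    unfolding D_def using that by (intro member_le_sum) auto
  have G_box: "G i \<in> box_functions d K" if i: "i < r" for i
  proof -
    have "fst (snd (W i)) \<le> (\<Sum>i<r. fst (snd (W i)))" using i by (intro member_le_sum) auto
    then have "(D - fst (W i)) * n + fst (snd (W i)) \<le> K" unfolding K_def by (intro add_mono mult_right_mono) auto
    moreover have "G i \<in> box_functions d ((D - fst (W i)) * n + fst (snd (W i)))"
      unfolding G_def[abs_def] by (intro box_functions.mult box_functions.power \<delta>_box W(1) i)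
    ultimately show ?thesis by (rule box_functions.mono)
  qed
  have G_eval: "G i s = \<delta> s ^ D * eval_at (P i) (conj_mat (chart n d \<alpha> s) x)" if "i < r" "\<delta> s \<noteq> 0" for i s
    unfolding G_def W(2)[OF that] using D_le[OF that(1)] by (simp add: mult.assoc[symmetric] power_add[symmetric])
  define c where "c = r * (K + D * n)"
  obtain N where N: "N > 0" "(N * c + 1) ^ d < N ^ Suc d" using box_exceeds[of c d] by (elim exE conjE) (rule that)
  \<comment> \<open>The second factor pads the denominator so that it no longer depends on
    \<open>\<beta>\<close>: every \<open>\<Phi> \<beta>\<close> is the monomial in the given
    functions times the same power of the determinant, so linear relations between the
    \<open>\<Phi> \<beta>\<close> are relations between the monomials.\<close>
  define \<Phi> where "\<Phi> \<beta> s = (\<Prod>i<r. G i s ^ \<beta> i * \<delta> s ^ (D * (N - \<beta> i)))" for \<beta> s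
  let ?E = "{..<r} \<rightarrow>\<^sub>E {..<N}" and ?B = "{..<d} \<rightarrow>\<^sub>E {..N * c}"
  have \<Phi>_box: "\<Phi> \<beta> \<in> box_functions d (N * c)" if \<beta>: "\<beta> \<in> ?E" for \<beta>
  proof -
    have "(\<lambda>s. \<Prod>i\<in>{..<r}. G i s ^ \<beta> i * \<delta> s ^ (D * (N - \<beta> i))) \<in> box_functions d (card {..<r} * (N * (K + D * n)))"
    proof (rule box_functions.prod)
      fix i assume "i \<in> {..<r}"
      then have i: "i < r" and \<beta>i: "\<beta> i \<le> N" using PiE_mem[OF \<beta>, of i] by auto
      have "\<beta> i * K + D * (N - \<beta> i) * n \<le> N * K + D * N * n" using \<beta>i by (intro add_mono mult_mono) auto
      also have "\<dots> = N * (K + D * n)" by (simp add: algebra_simps)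
      finally show "(\<lambda>s. G i s ^ \<beta> i * \<delta> s ^ (D * (N - \<beta> i))) \<in> box_functions d (N * (K + D * n))"
        by (rule box_functions.mono) (intro box_functions.mult box_functions.power G_box i \<delta>_box)
    qed
    then show ?thesis by (simp add: \<Phi>_def[abs_def] c_def mult_ac)
  qed
  have \<Phi>_eval: "\<Phi> \<beta> s = \<delta> s ^ (D * N * r) * (\<Prod>i<r. eval_at (P i) (conj_mat (chart n d \<alpha> s) x) ^ \<beta> i)"
    if \<beta>: "\<beta> \<in> ?E" and s: "\<delta> s \<noteq> 0" for \<beta> s
  proof -
    let ?p = "\<lambda>i. eval_at (P i) (conj_mat (chart n d \<alpha> s) x)"
    have "\<Phi> \<beta> s = (\<Prod>i<r. \<delta> s ^ (D * N) * ?p i ^ \<beta> i)"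
      unfolding \<Phi>_def
    proof (intro prod.cong refl)
      fix i assume "i \<in> {..<r}"
      then have i: "i < r" and \<beta>i: "\<beta> i \<le> N" using PiE_mem[OF \<beta>, of i] by auto
      have "D * \<beta> i + D * (N - \<beta> i) = D * N" using \<beta>i by (simp add: distrib_left[symmetric])
      then have "\<delta> s ^ (D * N) = \<delta> s ^ (D * \<beta> i) * \<delta> s ^ (D * (N - \<beta> i))"
        by (simp only: power_add[symmetric])
      then show "G i s ^ \<beta> i * \<delta> s ^ (D * (N - \<beta> i)) = \<delta> s ^ (D * N) * ?p i ^ \<beta> i"
        unfolding G_eval[OF i s] power_mult_distrib power_mult[symmetric] by (simp only: mult_ac)
    qed
    then show ?thesis by (simp add: prod.distrib power_mult)
  qed
  have "\<forall>\<beta>. \<exists>\<kappa>. \<beta> \<in> ?E \<longrightarrow> (\<forall>s. \<Phi> \<beta> s = (\<Sum>\<gamma>\<in>?B. \<kappa> \<gamma> * (\<Prod>i<d. s i ^ \<gamma> i)))"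
    using \<Phi>_box unfolding box_functions_def by blast
  from choice[OF this] obtain \<kappa> where \<kappa>: "\<And>\<beta> s. \<beta> \<in> ?E \<Longrightarrow> \<Phi> \<beta> s = (\<Sum>\<gamma>\<in>?B. \<kappa> \<beta> \<gamma> * (\<Prod>i<d. s i ^ \<gamma> i))"
    by blast
  have cardE: "card ?E = N ^ r" and cardB: "card ?B = (N * c + 1) ^ d"
    by (simp_all add: card_PiE)
  have finE: "finite ?E" by (rule finite_PiE) auto
  obtain hE where hE: "bij_betw hE {..<N ^ r} ?E"
    using ex_bij_betw_nat_finite[OF finE] unfolding atLeast0LessThan cardE by blast
  obtain hB where hB: "bij_betw hB {..<(N * c + 1) ^ d} ?B"
    using ex_bij_betw_nat_finite[OF finite_box[of d "N * c"]] unfolding atLeast0LessThan cardB by blast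
  have "(N * c + 1) ^ d < N ^ r"
    using N(2) power_increasing[OF r, of N] N(1) by linarith
  from homogeneous_system_solution[OF this, of "\<lambda>i j. \<kappa> (hE j) (hB i)"] obtain e where
    e: "\<exists>j<N ^ r. e j \<noteq> 0" "\<And>i. i < (N * c + 1) ^ d \<Longrightarrow> (\<Sum>j<N ^ r. \<kappa> (hE j) (hB i) * e j) = 0" by blast
  have hE_in: "hE j \<in> ?E" if "j < N ^ r" for j using hE that unfolding bij_betw_def by auto
  have sum\<Phi>: "(\<Sum>j<N ^ r. e j * \<Phi> (hE j) s) = 0" for s
  proof -
    have "(\<Sum>j<N ^ r. e j * \<Phi> (hE j) s) = (\<Sum>j<N ^ r. \<Sum>\<gamma>\<in>?B. \<kappa> (hE j) \<gamma> * e j * (\<Prod>i<d. s i ^ \<gamma> i))"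
      using \<kappa>[OF hE_in] by (intro sum.cong refl) (simp add: sum_distrib_left mult_ac)
    also have "\<dots> = (\<Sum>\<gamma>\<in>?B. (\<Sum>j<N ^ r. \<kappa> (hE j) \<gamma> * e j) * (\<Prod>i<d. s i ^ \<gamma> i))"
      by (subst sum.swap) (simp add: sum_distrib_right)
    also have "\<dots> = (\<Sum>i<(N * c + 1) ^ d. (\<Sum>j<N ^ r. \<kappa> (hE j) (hB i) * e j) * (\<Prod>l<d. s l ^ hB i l))"
      by (rule sum.reindex_bij_betw[OF hB, symmetric])
    also have "\<dots> = 0" using e(2) by (intro sum.neutral) simp
    finally show ?thesis .
  qed
  \<comment> \<open>The polynomial whose coefficients are the linear relation found by counting. It
    is non-zero because different \<open>j\<close> give different exponents.\<close>
  define Q where "Q = (\<Sum>j<N ^ r. Poly_Mapping.single (exponent r (hE j)) (e j))"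
  have insQ: "insertion \<phi> Q = (\<Sum>j<N ^ r. e j * (\<Prod>i<r. \<phi> i ^ hE j i))" for \<phi>
    unfolding Q_def by (simp add: insertion_sum insertion_single mon_value_exponent)
  have varsQ: "vars Q \<subseteq> {..<r}"
    unfolding Q_def by (rule vars_sum) (use keys_exponent in \<open>auto simp: vars_def split: if_splits\<close>)
  have "Q \<noteq> 0"
  proof -
    from e(1) obtain j where j: "j < N ^ r" "e j \<noteq> 0" by blast
    have "Poly_Mapping.lookup Q (exponent r (hE j)) = (\<Sum>i<N ^ r. if i = j then e j else 0)"
      unfolding Q_def lookup_sum
    proof (intro sum.cong refl)
      fix i assume "i \<in> {..<N ^ r}"
      then have "exponent r (hE i) = exponent r (hE j) \<longleftrightarrow> i = j"
        using inj_on_exponent[of r "{..<N}"] hE_in j(1) hE unfolding bij_betw_def inj_on_def by auto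
      then show "Poly_Mapping.lookup (Poly_Mapping.single (exponent r (hE i)) (e i)) (exponent r (hE j))
          = (if i = j then e j else 0)" by (simp add: lookup_single when_def)
    qed
    with j show ?thesis by auto
  qed
  obtain H where H: "vars H \<subseteq> {..<n} \<times> {..<n}" "\<And>\<psi>. insertion \<psi> H = insertion (\<lambda>i. insertion \<psi> (P i)) Q"
    using substitution_chain_rule[OF varsQ, of P "{..<n} \<times> {..<n}"] P by (auto simp: sym_gl_def)
  have "eval_at H y = 0" if "y \<in> adjoint_orbit x" for y
  proof (rule chart_dominant[OF x basis _ _ that])
    show "H \<in> sym_gl n" using H(1) by (simp add: sym_gl_def)
    fix s assume s: "det (chart n d \<alpha> s) \<noteq> 0"
    let ?y = "conj_mat (chart n d \<alpha> s) x"
    have s': "\<delta> s \<noteq> 0" using s by (simp add: \<delta>_def)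
    have "\<delta> s ^ (D * N * r) * eval_at H ?y = (\<Sum>j<N ^ r. e j * \<Phi> (hE j) s)"
      unfolding eval_at_def[of H] H(2) insQ sum_distrib_left
      using \<Phi>_eval[OF hE_in s'] by (intro sum.cong refl) (simp add: eval_at_def mult_ac)
    then show "eval_at H ?y = 0" using sum\<Phi>[of s] s' by simp
  qed
  then have "insertion (\<lambda>i. eval_at (P i) y) Q = 0" if "y \<in> adjoint_orbit x" for y
    using that by (simp add: eval_at_def H(2))
  with indep varsQ \<open>Q \<noteq> 0\<close> show False unfolding algebraically_independent_def by blast
qed

section \<open>Differentials of functions on an orbit\<close>

text \<open>The derivative of \<open>P\<close> at \<open>y\<close> in the tangent direction
  \<open>commutator w y\<close>. It is indexed by the matrix \<open>w\<close> that generates the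
  direction, so linear algebra takes place in one fixed space for all points of the orbit.\<close>

definition differential ::
    "nat \<Rightarrow> (nat \<times> nat, 'a::comm_ring_1) mpoly \<Rightarrow> 'a mat \<Rightarrow> (nat \<times> nat \<Rightarrow> 'a) \<Rightarrow> 'a" where
  "differential n P y w = trace_pairing n (gradient_at n P y) (commutator (mat n n w) y)"

lemma differential_eq_ad:
  "differential n P y w = (\<Sum>i<n. \<Sum>j<n. gradient_at n P y $$ (i, j) * ad n y w (j, i))"
  by (simp add: differential_def trace_pairing_def ad_def)

lemma differential_sum:
  assumes y: "y \<in> carrier_mat n n"
  shows "differential n P y (\<lambda>p. \<Sum>j\<in>S. c j * u j p) = (\<Sum>j\<in>S. c j * differential n P y (u j))"
proof -
  have "differential n P y (\<lambda>p. \<Sum>j\<in>S. c j * u j p)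
      = (\<Sum>i<n. \<Sum>k<n. \<Sum>j\<in>S. c j * (gradient_at n P y $$ (i, k) * ad n y (u j) (k, i)))"
    unfolding differential_eq_ad by (intro sum.cong refl) (simp add: ad_sum[OF y] sum_distrib_left mult_ac)
  also have "\<dots> = (\<Sum>j\<in>S. \<Sum>i<n. \<Sum>k<n. c j * (gradient_at n P y $$ (i, k) * ad n y (u j) (k, i)))"
    by (subst sum.swap[of _ "{..<n}" S, symmetric]) (intro sum.cong refl sum.swap)
  finally show ?thesis by (simp add: differential_eq_ad sum_distrib_left)
qed

lemma differential_var:
  assumes "(i, j) \<in> index_square n"
  shows "differential n (var (i, j)) y w = ad n y w (j, i)"
proof -
  have "differential n (var (i, j)) y w
      = (\<Sum>r<n. \<Sum>s<n. if s = j then (if r = i then ad n y w (j, i) else 0) else 0)"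
    unfolding differential_eq_ad
    by (intro sum.cong refl) (auto simp: gradient_at_def partial_deriv_var)
  then show ?thesis using assms by simp
qed

section \<open>Algebraic independence and kernels of differentials\<close>

lemma algebraically_independent_cong:
  assumes "\<And>i z. i < r \<Longrightarrow> z \<in> X \<Longrightarrow> f i z = g i z"
  shows "algebraically_independent X r f = algebraically_independent X r g"
proof -
  have "insertion (\<lambda>i. f i z) P = insertion (\<lambda>i. g i z) P" if "vars P \<subseteq> {..<r}" "z \<in> X" for P z
    by (rule insertion_cong) (use assms that in auto)
  then show ?thesis unfolding algebraically_independent_def by metis
qed

lemma mpoly_without_vars:
  assumes "vars P = {}" shows "P = const (Poly_Mapping.lookup P 0)"
proof (rule poly_mapping_eqI)
  fix m
  have "m = 0" if "Poly_Mapping.lookup P m \<noteq> 0"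
    using that assms unfolding vars_def by (auto simp: in_keys_iff)
  then show "Poly_Mapping.lookup P m = Poly_Mapping.lookup (const (Poly_Mapping.lookup P 0)) m"
    by (auto simp: const_def lookup_single when_def)
qed

lemma algebraically_independent_0:
  assumes "z \<in> X" shows "algebraically_independent X 0 f"
  unfolding algebraically_independent_def
proof (intro allI impI)
  fix P :: "(nat, 'b) mpoly"
  assume "vars P \<subseteq> {..<0}" and zero: "\<forall>x\<in>X. insertion (\<lambda>i. f i x) P = 0"
  then have P: "P = const (Poly_Mapping.lookup P 0)" using mpoly_without_vars[of P] by simp
  have "insertion (\<lambda>i. f i z) P = Poly_Mapping.lookup P 0" by (subst P) simp
  with zero assms have "Poly_Mapping.lookup P 0 = 0" by auto
  then show "P = 0" using P by (simp add: const_def)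
qed

text \<open>Take a relation \<open>Q\<close> of least degree in the last variable and let
  \<open>H\<close> be its derivative in that variable, evaluated at the functions. Minimality keeps
  \<open>H\<close> from vanishing identically on the orbit. Differentiating the relation along the
  orbit in a direction killed by all \<open>P i\<close> leaves \<open>H\<close> times the
  differential of \<open>F\<close>.\<close>

lemma algebraic_relation:
  fixes x :: "'a::field_char_0 mat"
  assumes x: "x \<in> carrier_mat n n"
    and P: "\<And>i. i < s \<Longrightarrow> P i \<in> sym_gl n" and F: "F \<in> sym_gl n"
    and indep: "algebraically_independent (adjoint_orbit x) s (\<lambda>i. eval_at (P i))"
    and dep: "\<not> algebraically_independent (adjoint_orbit x) (Suc s) (\<lambda>i. eval_at ((P(s := F)) i))"
  shows "\<exists>H\<in>sym_gl n. (\<exists>y\<in>adjoint_orbit x. eval_at H y \<noteq> 0) \<and>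
    (\<forall>y\<in>adjoint_orbit x. \<forall>w. (\<forall>i<s. differential n (P i) y w = 0) \<longrightarrow> eval_at H y * differential n F y w = 0)"
proof -
  let ?P = "P(s := F)" and ?X = "adjoint_orbit x" and ?I = "{..<n} \<times> {..<n}"
  have P': "vars (?P i) \<subseteq> ?I" if "i < Suc s" for i
    using that P F by (auto simp: sym_gl_def less_Suc_eq)
  let ?rel = "\<lambda>Q. Q \<noteq> 0 \<and> vars Q \<subseteq> {..<Suc s} \<and> (\<forall>y\<in>?X. insertion (\<lambda>i. eval_at (?P i) y) Q = 0)"
  obtain Q0 :: "(nat, 'a) mpoly" where "?rel Q0"
    using dep unfolding algebraically_independent_def by blast
  then obtain Q :: "(nat, 'a) mpoly" where Q: "?rel Q" and Qmin: "\<And>Q'. ?rel Q' \<Longrightarrow> var_degree s Q \<le> var_degree s Q'"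
    using ex_has_least_nat[of ?rel Q0 "var_degree s"] by blast
  have deg: "var_degree s Q \<noteq> 0"
  proof
    assume "var_degree s Q = 0"
    then have vQ: "vars Q \<subseteq> {..<s}" using var_degree_0_vars[of s Q] Q by (auto simp: less_Suc_eq)
    have "insertion (\<lambda>i. eval_at (P i) y) Q = 0" if "y \<in> ?X" for y
    proof -
      have "insertion (\<lambda>i. eval_at (P i) y) Q = insertion (\<lambda>i. eval_at (?P i) y) Q"
        by (rule insertion_cong) (use vQ in auto)
      with Q that show ?thesis by simp
    qed
    with indep vQ Q show False unfolding algebraically_independent_def by blast
  qed
  let ?dQ = "partial_deriv s Q"
  have "\<not> ?rel ?dQ" using Qmin[of ?dQ] var_degree_partial_deriv(2)[OF deg] by auto
  moreover have vdQ: "vars ?dQ \<subseteq> {..<Suc s}" using vars_partial_deriv[of s Q] Q by blast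
  ultimately obtain y0 where y0: "y0 \<in> ?X" "insertion (\<lambda>i. eval_at (?P i) y0) ?dQ \<noteq> 0"
    using var_degree_partial_deriv(1)[OF deg] by blast
  obtain H where H: "vars H \<subseteq> ?I" "\<And>\<psi>. insertion \<psi> H = insertion (\<lambda>i. insertion \<psi> (?P i)) ?dQ"
    using substitution_chain_rule[where P = ?P, OF vdQ P'] by blast
  have "vars Q \<subseteq> {..<Suc s}" using Q by blast
  from substitution_chain_rule[where P = ?P, OF this P'] obtain HQ where HQ: "vars HQ \<subseteq> ?I"
    "\<And>\<psi>. insertion \<psi> HQ = insertion (\<lambda>i. insertion \<psi> (?P i)) Q"
    "\<And>v \<psi>. insertion \<psi> (partial_deriv v HQ)
      = (\<Sum>i<Suc s. insertion (\<lambda>i. insertion \<psi> (?P i)) (partial_deriv i Q) * insertion \<psi> (partial_deriv v (?P i)))"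
    by blast
  have evH: "eval_at H y = insertion (\<lambda>i. eval_at (?P i) y) ?dQ" for y by (simp add: eval_at_def H(2))
  have "eval_at H y * differential n F y w = 0" if y: "y \<in> ?X" and w: "\<forall>i<s. differential n (P i) y w = 0" for y w
  proof -
    let ?c = "\<lambda>i. insertion (\<lambda>i. eval_at (?P i) y) (partial_deriv i Q)"
    have grad: "gradient_at n HQ y $$ (i, j) = (\<Sum>l<Suc s. ?c l * gradient_at n (?P l) y $$ (i, j))"
      if "i < n" "j < n" for i j
      using that by (simp add: gradient_at_def eval_at_def HQ(3) del: sum.lessThan_Suc)
    have "0 = differential n HQ y w"
      unfolding differential_def using differential_vanishes[OF x _ _ y, of HQ "mat n n w"] HQ Q
      by (simp add: sym_gl_def eval_at_def)
    also have "\<dots> = (\<Sum>i<n. \<Sum>j<n. \<Sum>l<Suc s. ?c l * (gradient_at n (?P l) y $$ (i, j) * ad n y w (j, i)))"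
      unfolding differential_eq_ad by (intro sum.cong refl) (simp add: grad sum_distrib_right mult.assoc del: sum.lessThan_Suc)
    also have "\<dots> = (\<Sum>l<Suc s. \<Sum>i<n. \<Sum>j<n. ?c l * (gradient_at n (?P l) y $$ (i, j) * ad n y w (j, i)))"
      by (subst sum.swap[of _ "{..<n}" "{..<Suc s}", symmetric]) (intro sum.cong refl sum.swap)
    also have "\<dots> = (\<Sum>l<Suc s. ?c l * differential n (?P l) y w)"
      by (simp add: differential_eq_ad sum_distrib_left)
    also have "\<dots> = ?c s * differential n F y w" using w by simp
    finally show ?thesis by (simp add: evH)
  qed
  moreover have "eval_at H y0 \<noteq> 0" using y0 by (simp add: evH)
  moreover have "H \<in> sym_gl n" using H(1) by (simp add: sym_gl_def)
  ultimately show ?thesis using y0(1) by blast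
qed

text \<open>The new members are drawn from \<open>\<F>\<close>, so afterwards every element of
  \<open>\<F>\<close> is algebraic over the family, in the form that \<open>generic_kernel\<close>
  takes as input.\<close>

lemma maximal_independent_extension:
  assumes bound: "\<And>r P. (\<And>i. i < r \<Longrightarrow> P i \<in> S) \<Longrightarrow>
      algebraically_independent X r (\<lambda>i. eval_at (P i :: (nat \<times> nat, 'a::comm_ring_1) mpoly)) \<Longrightarrow> r \<le> B"
    and P: "\<And>i. i < r \<Longrightarrow> P i \<in> S" and indep: "algebraically_independent X r (\<lambda>i. eval_at (P i))"
    and \<F>: "\<F> \<subseteq> S"
  obtains s P' where "r \<le> s" "\<And>i. i < r \<Longrightarrow> P' i = P i" "\<And>i. r \<le> i \<Longrightarrow> i < s \<Longrightarrow> P' i \<in> \<F>"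
    "algebraically_independent X s (\<lambda>i. eval_at (P' i))"
    "\<And>F. F \<in> \<F> \<Longrightarrow> \<not> algebraically_independent X (Suc s) (\<lambda>i. eval_at ((P'(s := F)) i))"
proof -
  let ?ext = "\<lambda>s. \<exists>P'. r \<le> s \<and> (\<forall>i<r. P' i = P i) \<and> (\<forall>i. r \<le> i \<and> i < s \<longrightarrow> P' i \<in> \<F>) \<and>
    algebraically_independent X s (\<lambda>i. eval_at (P' i))"
  have ext_r: "?ext r" using indep by (intro exI[of _ P]) auto
  have le_B: "s \<le> B" if s: "?ext s" for s
  proof -
    obtain P' where P': "\<forall>i<r. P' i = P i" "\<forall>i. r \<le> i \<and> i < s \<longrightarrow> P' i \<in> \<F>"
      "algebraically_independent X s (\<lambda>i. eval_at (P' i))" using s by blast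
    have "P' i \<in> S" if "i < s" for i using P' P \<F> that by (cases "i < r") auto
    from bound[OF this P'(3)] show ?thesis .
  qed
  define s where "s = (GREATEST s. ?ext s)"
  have s: "?ext s" unfolding s_def by (rule GreatestI_nat[where P = ?ext, OF ext_r le_B])
  have max: "s' \<le> s" if "?ext s'" for s'
    unfolding s_def by (rule Greatest_le_nat[where P = ?ext, OF that le_B])
  from s obtain P' where P': "r \<le> s" "\<forall>i<r. P' i = P i" "\<forall>i. r \<le> i \<and> i < s \<longrightarrow> P' i \<in> \<F>"
    "algebraically_independent X s (\<lambda>i. eval_at (P' i))" by blast
  have "\<not> algebraically_independent X (Suc s) (\<lambda>i. eval_at ((P'(s := F)) i))" if F: "F \<in> \<F>" for F
  proof
    assume "algebraically_independent X (Suc s) (\<lambda>i. eval_at ((P'(s := F)) i))"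
    then have "?ext (Suc s)" using P' F by (intro exI[of _ "P'(s := F)"]) (auto simp: less_Suc_eq)
    with max[of "Suc s"] show False by simp
  qed
  with P' that show thesis by blast
qed

text \<open>Irreducibility provides one point at which the factors \<open>H\<close> from
  \<open>algebraic_relation\<close> are non-zero for all \<open>F\<close> at once. \<open>H0\<close>
  is a further open condition, by which a property of a special point is carried to the generic
  one.\<close>

lemma generic_kernel:
  fixes x :: "'a::field_char_0 mat"
  assumes x: "x \<in> carrier_mat n n"
    and P: "\<And>i. i < s \<Longrightarrow> P i \<in> sym_gl n" and \<F>: "finite \<F>" "\<F> \<subseteq> sym_gl n"
    and indep: "algebraically_independent (adjoint_orbit x) s (\<lambda>i. eval_at (P i))"
    and dep: "\<And>F. F \<in> \<F> \<Longrightarrow> \<not> algebraically_independent (adjoint_orbit x) (Suc s) (\<lambda>i. eval_at ((P(s := F)) i))"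
    and H0: "H0 \<in> sym_gl n" "\<exists>y\<in>adjoint_orbit x. eval_at H0 y \<noteq> 0"
  shows "\<exists>y\<in>adjoint_orbit x. eval_at H0 y \<noteq> 0 \<and>
    (\<forall>w. (\<forall>i<s. differential n (P i) y w = 0) \<longrightarrow> (\<forall>F\<in>\<F>. differential n F y w = 0))"
proof -
  have "\<forall>F. \<exists>H. F \<in> \<F> \<longrightarrow> H \<in> sym_gl n \<and> (\<exists>y\<in>adjoint_orbit x. eval_at H y \<noteq> 0) \<and>
    (\<forall>y\<in>adjoint_orbit x. \<forall>w. (\<forall>i<s. differential n (P i) y w = 0) \<longrightarrow> eval_at H y * differential n F y w = 0)"
    using algebraic_relation[OF x P _ indep dep] \<F>(2) by blast
  from choice[OF this] obtain H where H: "\<And>F. F \<in> \<F> \<Longrightarrow> H F \<in> sym_gl n"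
    "\<And>F. F \<in> \<F> \<Longrightarrow> \<exists>y\<in>adjoint_orbit x. eval_at (H F) y \<noteq> 0"
    "\<And>F y w. F \<in> \<F> \<Longrightarrow> y \<in> adjoint_orbit x \<Longrightarrow> \<forall>i<s. differential n (P i) y w = 0 \<Longrightarrow>
      eval_at (H F) y * differential n F y w = 0" by blast
  let ?H = "\<lambda>F. case F of None \<Rightarrow> H0 | Some F \<Rightarrow> H F"
  have "\<exists>y\<in>adjoint_orbit x. \<forall>F\<in>insert None (Some ` \<F>). eval_at (?H F) y \<noteq> 0"
    by (rule orbit_irreducible_finite[OF x]) (use \<F>(1) H H0 in auto)
  then obtain y where y: "y \<in> adjoint_orbit x" "eval_at H0 y \<noteq> 0" "\<And>F. F \<in> \<F> \<Longrightarrow> eval_at (H F) y \<noteq> 0" by auto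
  have "differential n F y w = 0" if "\<forall>i<s. differential n (P i) y w = 0" "F \<in> \<F>" for w F
    using H(3)[OF that(2) y(1) that(1)] y(3)[OF that(2)] by simp
  with y show ?thesis by blast
qed

lemma adjoint_orbit_eq: "y \<in> adjoint_orbit x \<Longrightarrow> adjoint_orbit y = adjoint_orbit x"
  unfolding adjoint_orbit_def using similar_mat_sym similar_mat_trans by blast

lemma independent_functions_bound_at:
  fixes x :: "'a::field_char_0 mat"
  assumes "x \<in> carrier_mat n n" "y \<in> adjoint_orbit x" "ad_basis n y d \<alpha>"
    and "\<And>i. i < r \<Longrightarrow> P i \<in> sym_gl n"
    and "algebraically_independent (adjoint_orbit x) r (\<lambda>i. eval_at (P i))"
  shows "r \<le> d"
  using independent_functions_bound[of y n d \<alpha> r P] adjoint_orbit_carrier[OF assms(1,2)]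
    assms(3-5) adjoint_orbit_eq[OF assms(2)] by simp

text \<open>
  The Hamiltonian vector fields of Poisson-commuting functions with independent differentials are
  themselves independent and lie in the common kernel of these differentials.
\<close>

lemma poisson_commuting_bound:
  fixes x :: "'a::field_char_0 mat"
  assumes x: "x \<in> carrier_mat n n"
    and P: "\<And>i. i < r \<Longrightarrow> P i \<in> sym_gl n" and indep: "algebraically_independent (adjoint_orbit x) r (\<lambda>i. eval_at (P i))"
    and com: "\<And>i j. i < r \<Longrightarrow> j < r \<Longrightarrow> lie_poisson n (P i) (P j) = 0"
  shows "\<exists>s P'. 2 * r \<le> s \<and> (\<forall>i<s. P' i \<in> sym_gl n) \<and> algebraically_independent (adjoint_orbit x) s (\<lambda>i. eval_at (P' i))"
proof -
  let ?X = "adjoint_orbit x" and ?I = "index_square n"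
  have xX: "x \<in> ?X" using similar_mat_refl[OF x] by (simp add: adjoint_orbit_def)
  \<comment> \<open>The coordinate functions: once the given family is extended by some of them to a
    maximal independent one, a direction killed by all its differentials is killed by all
    coordinates and is the zero tangent vector.\<close>
  define \<F> where "\<F> = (var ` ?I :: (nat \<times> nat, 'a) mpoly set)"
  have \<F>: "finite \<F>" "\<F> \<subseteq> sym_gl n" by (auto simp: \<F>_def sym_gl_def)
  obtain d0 \<alpha>0 where "ad_basis n x d0 \<alpha>0" by (rule ad_basis_exists)
  from independent_functions_bound[OF x this] have bound: "r \<le> d0" if "\<And>i. i < r \<Longrightarrow> Q i \<in> sym_gl n"
      "algebraically_independent ?X r (\<lambda>i. eval_at (Q i))" for r and Q :: "nat \<Rightarrow> (nat \<times> nat, 'a) mpoly"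
    using that by blast
  obtain s P' where P': "r \<le> s" "\<And>i. i < r \<Longrightarrow> P' i = P i" "\<And>i. r \<le> i \<Longrightarrow> i < s \<Longrightarrow> P' i \<in> \<F>"
    "algebraically_independent ?X s (\<lambda>i. eval_at (P' i))"
    "\<And>F. F \<in> \<F> \<Longrightarrow> \<not> algebraically_independent ?X (Suc s) (\<lambda>i. eval_at ((P'(s := F)) i))"
    by (rule maximal_independent_extension[where X = ?X and S = "sym_gl n" and B = d0, OF bound P indep \<F>(2)])
      (assumption | rule that; assumption)+
  have P'S: "P' i \<in> sym_gl n" if "i < s" for i using P'(2,3) P \<F>(2) that by (cases "i < r") auto
  have "\<exists>y\<in>?X. eval_at (1 :: (nat \<times> nat, 'a) mpoly) y \<noteq> 0 \<and>
    (\<forall>w. (\<forall>i<s. differential n (P' i) y w = 0) \<longrightarrow> (\<forall>F\<in>\<F>. differential n F y w = 0))"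
    by (rule generic_kernel[OF x P'S \<F> P'(4,5)]) (use xX in \<open>auto simp: sym_gl_def\<close>)
  then obtain y where y: "y \<in> ?X"
    "\<And>w. (\<And>i. i < s \<Longrightarrow> differential n (P' i) y w = 0) \<Longrightarrow> \<forall>F\<in>\<F>. differential n F y w = 0" by blast
  have yc: "y \<in> carrier_mat n n" by (rule adjoint_orbit_carrier[OF x y(1)])
  have kernel: "ad n y w p = 0" if "\<And>i. i < s \<Longrightarrow> differential n (P' i) y w = 0" "p \<in> ?I" for w p
  proof -
    have "differential n (var (snd p, fst p)) y w = 0" using y(2)[OF that(1)] that(2) by (auto simp: \<F>_def)
    then show ?thesis using that(2) differential_var[of "snd p" "fst p" n y w] by auto
  qed
  obtain d \<alpha> where \<alpha>: "ad_basis n y d \<alpha>" by (rule ad_basis_exists)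
  have sd: "s \<le> d" by (rule independent_functions_bound_at[OF x y(1) \<alpha> P'S P'(4)])
  have ind: "lin_indep {..<s} d (\<lambda>j i. differential n (P' i) y (\<alpha> j))"
    unfolding lin_indep_def
  proof (intro allI impI)
    fix c j assume c: "\<forall>i\<in>{..<s}. (\<Sum>j<d. c j * differential n (P' i) y (\<alpha> j)) = 0" and j: "j < d"
    have "(\<Sum>j<d. c j * ad n y (\<alpha> j) p) = 0" if p: "p \<in> ?I" for p
      unfolding ad_sum[OF yc p, symmetric]
      by (rule kernel[OF _ p]) (use c in \<open>simp add: differential_sum[OF yc]\<close>)
    with \<alpha> j show "c j = 0" using lin_indepD[of ?I d "\<lambda>j. ad n y (\<alpha> j)" c j] by (simp add: ad_basis_def)
  qed
  with sd have d: "d = s" using lin_indep_le_card[OF ind] by simp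
  \<comment> \<open>The differentials of the \<open>P'\<close> along a tangent basis form a square
    matrix with independent columns, hence an invertible one.\<close>
  have onto: "\<exists>w. \<forall>i<s. differential n (P' i) y w = (if i = i0 then 1 else 0)" for i0
  proof -
    have "in_span {..<s} s (\<lambda>j i. differential n (P' i) y (\<alpha> j)) (\<lambda>i. if i = i0 then 1 else 0)"
      using lin_indep_card_spans[of "{..<s}"] ind d by simp
    then obtain c where c: "\<And>i. i < s \<Longrightarrow> (if i = i0 then 1 else 0) = (\<Sum>j<s. c j * differential n (P' i) y (\<alpha> j))"
      unfolding in_span_def by auto
    then show ?thesis by (intro exI[of _ "\<lambda>p. \<Sum>j<s. c j * \<alpha> j p"]) (simp add: differential_sum[OF yc])
  qed
  define W where "W i = (\<lambda>p. gradient_at n (P i) y $$ p)" for i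
  have matW: "mat n n (W i) = gradient_at n (P i) y" for i by (auto simp: W_def gradient_at_def)
  have com': "differential n (P k) y (W i) = 0" if "i < r" "k < r" for i k
    using eval_at_lie_poisson[OF yc, of "P k" "P i"] com[OF that(2,1)] by (simp add: differential_def matW)
  have flip: "trace_pairing n (mat n n u) (commutator (mat n n w) y) = - trace_pairing n (mat n n w) (commutator (mat n n u) y)" for u w
    by (rule trace_pairing_commutator) (use yc in auto)
  \<comment> \<open>Commutativity makes the Hamiltonian vector fields of the \<open>P i\<close>
    invisible to the first \<open>r\<close> differentials, so the other \<open>s - r\<close> must
    separate them. This is the inequality \<open>r \<le> s - r\<close>.\<close>
  have "lin_indep {..<s - r} r (\<lambda>i k. differential n (P' (r + k)) y (W i))"
    unfolding lin_indep_def
  proof (intro allI impI)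
    fix c i0 assume c: "\<forall>k\<in>{..<s - r}. (\<Sum>i<r. c i * differential n (P' (r + k)) y (W i)) = 0" and i0: "i0 < r"
    let ?w = "\<lambda>p. \<Sum>i<r. c i * W i p"
    have "differential n (P' k) y ?w = 0" if k: "k < s" for k
    proof (cases "k < r")
      case True
      then show ?thesis using com' P'(2) by (simp add: differential_sum[OF yc])
    next
      case False
      then have "k - r \<in> {..<s - r}" "r + (k - r) = k" using k by auto
      then show ?thesis using c by (metis differential_sum[OF yc])
    qed
    then have ad0: "ad n y ?w p = 0" if "p \<in> ?I" for p using kernel that by blast
    obtain b where b: "\<And>i. i < s \<Longrightarrow> differential n (P' i) y b = (if i = i0 then 1 else 0)"
      using onto[of i0] by blast
    \<comment> \<open>By skewness, pairing the vanishing combination of Hamiltonian vector fields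
      with \<open>b\<close> is the same combination of differentials along \<open>b\<close>, and
      \<open>b\<close> is dual to the differential \<open>i0\<close>.\<close>
    have "c i0 = (\<Sum>i<r. c i * differential n (P i) y b)"
    proof -
      have "(\<Sum>i<r. c i * differential n (P i) y b) = (\<Sum>i<r. c i * (if i = i0 then 1 else 0))"
      proof (intro sum.cong refl)
        fix i assume "i \<in> {..<r}"
        then show "c i * differential n (P i) y b = c i * (if i = i0 then 1 else 0)"
          using b[of i] P'(1) P'(2)[of i] by simp
      qed
      then show ?thesis using i0 by (simp add: sum_delta_mult)
    qed
    also have "\<dots> = - (\<Sum>i<r. c i * (\<Sum>k<n. \<Sum>l<n. b (k, l) * ad n y (W i) (l, k)))"
    proof -
      have "differential n (P i) y b = - (\<Sum>k<n. \<Sum>l<n. b (k, l) * ad n y (W i) (l, k))" for i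
        unfolding differential_def matW[symmetric] flip[of "W i"]
        by (simp add: trace_pairing_def ad_def)
      then show ?thesis by (simp add: sum_negf)
    qed
    also have "(\<Sum>i<r. c i * (\<Sum>k<n. \<Sum>l<n. b (k, l) * ad n y (W i) (l, k)))
        = (\<Sum>k<n. \<Sum>l<n. b (k, l) * (\<Sum>i<r. c i * ad n y (W i) (l, k)))"
    proof -
      have "(\<Sum>i<r. \<Sum>k<n. \<Sum>l<n. c i * (b (k, l) * ad n y (W i) (l, k)))
          = (\<Sum>k<n. \<Sum>i<r. \<Sum>l<n. c i * (b (k, l) * ad n y (W i) (l, k)))" by (rule sum.swap)
      also have "\<dots> = (\<Sum>k<n. \<Sum>l<n. \<Sum>i<r. c i * (b (k, l) * ad n y (W i) (l, k)))"
        by (intro sum.cong refl sum.swap)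
      finally show ?thesis by (simp add: sum_distrib_left mult.left_commute)
    qed
    also have "\<dots> = 0" using ad0 by (intro sum.neutral ballI) (simp add: ad_sum[OF yc, symmetric])
    finally show "c i0 = 0" by simp
  qed
  from lin_indep_le_card[OF this] P'(1) have "2 * r \<le> s" by simp
  with P'S P'(4) show ?thesis by blast
qed

section \<open>Brackets and differentials as polynomial functions of the point\<close>

lemma lie_poisson_in_sym_gl:
  assumes "P \<in> sym_gl n" "Q \<in> sym_gl n" shows "lie_poisson n P Q \<in> sym_gl n"
proof -
  have "vars (lie_poisson n P Q) \<subseteq> {..<n} \<times> {..<n}"
    unfolding lie_poisson_def
  proof (intro vars_sum)
    fix p q :: "nat \<times> nat" assume pq: "p \<in> {..<n} \<times> {..<n}" "q \<in> {..<n} \<times> {..<n}"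
    let ?b = "lie_bracket_units p q :: (nat \<times> nat, 'a) mpoly"
    have "vars ?b \<subseteq> {..<n} \<times> {..<n}"
      unfolding lie_bracket_units_def using pq by (intro order_trans[OF vars_diff]) auto
    then show "vars (partial_deriv p P * partial_deriv q Q * ?b) \<subseteq> {..<n} \<times> {..<n}"
      using assms vars_partial_deriv[of p P] vars_partial_deriv[of q Q]
        vars_mult[of "partial_deriv p P" "partial_deriv q Q"] vars_mult[of "partial_deriv p P * partial_deriv q Q" ?b]
      unfolding sym_gl_def by blast
  qed
  then show ?thesis by (simp add: sym_gl_def)
qed

lemma det_in_sym_gl:
  fixes M :: "(nat \<times> nat, 'a::comm_ring_1) mpoly mat"
  assumes M: "M \<in> carrier_mat N N" and ent: "\<And>i j. i < N \<Longrightarrow> j < N \<Longrightarrow> M $$ (i, j) \<in> sym_gl n"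
  shows "det M \<in> sym_gl n"
proof -
  have "vars (det M) \<subseteq> {..<n} \<times> {..<n}"
    unfolding det_def'[OF M]
  proof (rule vars_sum)
    fix p assume "p \<in> {p. p permutes {0..<N}}"
    then have p: "p permutes {0..<N}" by simp
    have "vars (\<Prod>i = 0..<N. M $$ (i, p i)) \<subseteq> {..<n} \<times> {..<n}"
      using ent permutes_in_image[OF p] by (intro vars_prod) (auto simp: sym_gl_def)
    then show "vars (signof p * (\<Prod>i = 0..<N. M $$ (i, p i))) \<subseteq> {..<n} \<times> {..<n}"
      by (cases p rule: sign_cases) auto
  qed
  then show ?thesis by (simp add: sym_gl_def)
qed

text \<open>Its gradient is the constant matrix \<open>w\<close>. Bracketing with it shows that, for
  fixed \<open>w\<close>, the differential of \<open>P\<close> in direction \<open>w\<close> is a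
  polynomial function of the point.\<close>

definition linear_form :: "nat \<Rightarrow> (nat \<times> nat \<Rightarrow> 'a::comm_ring_1) \<Rightarrow> (nat \<times> nat, 'a) mpoly" where
  "linear_form n w = (\<Sum>p\<in>index_square n. const (w p) * var p)"

lemma linear_form_in_sym_gl: "linear_form n w \<in> sym_gl n"
proof -
  have "vars (linear_form n w) \<subseteq> {..<n} \<times> {..<n}"
    unfolding linear_form_def by (intro vars_sum order_trans[OF vars_mult]) auto
  then show ?thesis by (simp add: sym_gl_def)
qed

lemma gradient_linear_form: "gradient_at n (linear_form n w) y = mat n n w"
proof (rule eq_matI)
  fix i j assume "i < dim_row (mat n n w)" "j < dim_col (mat n n w)"
  then have ij: "i < n" "j < n" by auto
  have "partial_deriv (i, j) (linear_form n w) = (\<Sum>p\<in>index_square n. if p = (i, j) then const (w (i, j)) else 0)"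
    unfolding linear_form_def partial_deriv_sum
    by (intro sum.cong refl) (auto simp: partial_deriv_mult partial_deriv_var)
  also have "\<dots> = const (w (i, j))" using ij by (subst sum.delta) auto
  finally show "gradient_at n (linear_form n w) y $$ (i, j) = mat n n w $$ (i, j)"
    using ij by (simp add: gradient_at_def)
qed (auto simp: gradient_at_def)

lemma eval_at_lie_poisson_linear_form:
  "y \<in> carrier_mat n n \<Longrightarrow> eval_at (lie_poisson n P (linear_form n w)) y = differential n P y w"
  by (simp add: eval_at_lie_poisson gradient_linear_form differential_def)

lemma differential_unit:
  assumes y: "y \<in> carrier_mat n n" and kl: "(k, l) \<in> index_square n"
  shows "differential n P y (\<lambda>p. if p = (k, l) then 1 else 0) = - ad n y (\<lambda>p. gradient_at n P y $$ p) (l, k)"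
proof -
  let ?u = "\<lambda>p. if p = (k, l) then 1 else 0" and ?G = "gradient_at n P y"
  have G: "mat n n (\<lambda>p. ?G $$ p) = ?G" by (auto simp: gradient_at_def)
  have "differential n P y ?u = - trace_pairing n (mat n n ?u) (commutator ?G y)"
    unfolding differential_def by (rule trace_pairing_commutator) (use y in auto)
  also have "trace_pairing n (mat n n ?u) (commutator ?G y)
      = (\<Sum>i<n. \<Sum>j<n. if j = l then (if i = k then commutator ?G y $$ (l, k) else 0) else 0)"
    unfolding trace_pairing_def by (intro sum.cong refl) auto
  also have "\<dots> = ad n y (\<lambda>p. ?G $$ p) (l, k)" using kl by (simp add: ad_def G)
  finally show ?thesis .
qed

text \<open>A linear relation between differentials on the tangent space passes to the Hamiltonian
  vector fields, since each entry of such a field is, up to sign, the differential in the direction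
  of a matrix unit.\<close>

lemma hamiltonian_in_span:
  assumes y: "y \<in> carrier_mat n n"
    and c: "\<And>w. differential n P y w = (\<Sum>i<N. c i * differential n (Q i) y w)"
    and p: "p \<in> index_square n"
  shows "ad n y (\<lambda>p. gradient_at n P y $$ p) p = (\<Sum>i<N. c i * ad n y (\<lambda>p. gradient_at n (Q i) y $$ p) p)"
proof -
  obtain l k where p': "p = (l, k)" "(k, l) \<in> index_square n" using p by auto
  have "- ad n y (\<lambda>p. gradient_at n P y $$ p) p = - (\<Sum>i<N. c i * ad n y (\<lambda>p. gradient_at n (Q i) y $$ p) p)"
    using c[of "\<lambda>p. if p = (k, l) then 1 else 0"] unfolding differential_unit[OF y p'(2)] p'(1)
    by (simp add: sum_negf)
  then show ?thesis by simp
qed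

lemma differential_combination:
  assumes y: "y \<in> carrier_mat n n" and \<beta>: "ad_basis n y e \<beta>"
    and c: "\<And>j. j < e \<Longrightarrow> differential n P y (\<beta> j) = (\<Sum>i<N. c i * differential n (Q i) y (\<beta> j))"
  shows "differential n P y w = (\<Sum>i<N. c i * differential n (Q i) y w)"
proof -
  obtain b where b: "\<And>p. p \<in> index_square n \<Longrightarrow> ad n y w p = (\<Sum>j<e. b j * ad n y (\<beta> j) p)"
    using \<beta> unfolding ad_basis_def in_span_def by blast
  have exp: "differential n R y w = (\<Sum>j<e. b j * differential n R y (\<beta> j))" for R
  proof -
    have "differential n R y w = differential n R y (\<lambda>p. \<Sum>j<e. b j * \<beta> j p)"
      unfolding differential_eq_ad by (intro sum.cong refl) (simp add: b ad_sum[OF y])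
    then show ?thesis by (simp add: differential_sum[OF y])
  qed
  have "differential n P y w = (\<Sum>j<e. \<Sum>i<N. b j * (c i * differential n (Q i) y (\<beta> j)))"
    unfolding exp[of P] by (intro sum.cong refl) (simp add: c sum_distrib_left)
  also have "\<dots> = (\<Sum>i<N. \<Sum>j<e. b j * (c i * differential n (Q i) y (\<beta> j)))" by (rule sum.swap)
  finally show ?thesis by (simp add: exp[of "Q _"] sum_distrib_left mult.left_commute)
qed

section \<open>The kernel of the differentials at a Lagrangian point\<close>

lemma trace_pairing_gt_span:
  assumes y: "y \<in> carrier_mat n n" and z: "gt_span n y z"
    and zero: "\<And>m k. (m, k) \<in> gt_indices n \<Longrightarrow> differential n (Delta n m k) y w = 0"
  shows "trace_pairing n z (commutator (mat n n w) y) = 0"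
proof -
  obtain c where c: "\<And>i j. i < n \<Longrightarrow> j < n \<Longrightarrow> z $$ (i, j)
    = (\<Sum>(m, k)\<in>gt_indices n. c (m, k) * gradient_at n (Delta n m k) y $$ (i, j))"
    using gt_span_gradients[OF y z] by blast
  let ?V = "commutator (mat n n w) y" and ?G = "\<lambda>p. gradient_at n (Delta n (fst p) (snd p)) y"
  have "trace_pairing n z ?V = (\<Sum>i<n. \<Sum>j<n. \<Sum>p\<in>gt_indices n. c p * (?G p $$ (i, j) * ?V $$ (j, i)))"
    unfolding trace_pairing_def by (intro sum.cong refl) (simp add: c sum_distrib_right case_prod_unfold mult.assoc)
  also have "\<dots> = (\<Sum>p\<in>gt_indices n. \<Sum>i<n. \<Sum>j<n. c p * (?G p $$ (i, j) * ?V $$ (j, i)))"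
    by (subst sum.swap[of _ "{..<n}" "gt_indices n", symmetric]) (intro sum.cong refl sum.swap)
  also have "\<dots> = (\<Sum>p\<in>gt_indices n. c p * differential n (Delta n (fst p) (snd p)) y w)"
    by (simp add: differential_def trace_pairing_def sum_distrib_left)
  also have "\<dots> = 0" using zero by (intro sum.neutral) auto
  finally show ?thesis .
qed

lemma gt_span_poly_mat:
  assumes "y \<in> carrier_mat n n" "m < n"
  shows "gt_span n y (embed_corner n m (poly_mat f (south_east_corner m y)))"
proof -
  have z: "poly_mat 0 (south_east_corner l y) = 0\<^sub>m (n - l) (n - l)" for l
    by (rule poly_mat_0[OF south_east_corner_carrier[OF assms(1)]])
  let ?F = "\<lambda>l. if l = m then f else 0"
  have "embed_corner n m (poly_mat f (south_east_corner m y)) $$ (i, j)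
      = (\<Sum>l<n. embed_corner n l (poly_mat (?F l) (south_east_corner l y)) $$ (i, j))" if "i < n" "j < n" for i j
  proof -
    have "embed_corner n l (poly_mat (?F l) (south_east_corner l y)) $$ (i, j)
        = (if l = m then embed_corner n m (poly_mat f (south_east_corner m y)) $$ (i, j) else 0)" for l
      using that by (auto simp: z embed_corner_def)
    then show ?thesis using assms(2) by simp
  qed
  then show ?thesis unfolding gt_span_def by (intro conjI exI[of _ ?F]) auto
qed

lemma lagrangian_kernel:
  assumes y: "y \<in> carrier_mat n n" and lag: "lagrangian n y"
    and zero: "\<And>m k. (m, k) \<in> gt_indices n \<Longrightarrow> differential n (Delta n m k) y w = 0"
  shows "\<exists>c. \<forall>p\<in>index_square n. ad n y w p
    = (\<Sum>q\<in>gt_indices n. c q * ad n y (\<lambda>p. gradient_at n (Delta n (fst q) (snd q)) y $$ p) p)"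
proof -
  have "trace_pairing n (embed_corner n m (poly_mat f (south_east_corner m y))) (commutator (mat n n w) y) = 0"
    if "m < n" for m f
    by (rule trace_pairing_gt_span[OF y gt_span_poly_mat[OF y that] zero])
  then obtain z where z: "gt_span n y z" "commutator (mat n n w) y = commutator z y"
    using lag[unfolded lagrangian_def, rule_format, of "mat n n w"] by auto
  obtain c where c: "\<And>i j. i < n \<Longrightarrow> j < n \<Longrightarrow> z $$ (i, j)
    = (\<Sum>(m, k)\<in>gt_indices n. c (m, k) * gradient_at n (Delta n m k) y $$ (i, j))"
    using gt_span_gradients[OF y z(1)] by blast
  have zm: "mat n n (\<lambda>p. z $$ p) = z" using z(1) by (auto simp: gt_span_def)
  have "ad n y w = ad n y (\<lambda>p. z $$ p)" by (simp add: ad_def fun_eq_iff zm z(2))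
  also have "\<dots> = ad n y (\<lambda>p. \<Sum>q\<in>gt_indices n. c q * gradient_at n (Delta n (fst q) (snd q)) y $$ p)"
    by (rule ad_cong) (auto simp: c case_prod_unfold)
  finally show ?thesis by (intro exI[of _ c]) (simp add: ad_sum[OF y])
qed

text \<open>Rank plus nullity: the tangent space is spanned by \<open>N\<close> directions dual to a
  maximal independent set of differentials together with their common kernel. At a Lagrangian point
  this kernel is spanned by Hamiltonian vector fields, of which the same \<open>N\<close> suffice by
  \<open>hamiltonian_in_span\<close>.\<close>

lemma lagrangian_bound:
  assumes y: "y \<in> carrier_mat n n" and lag: "lagrangian n y" and \<beta>: "ad_basis n y e \<beta>"
    and sp: "\<And>q. q \<in> gt_indices n \<Longrightarrow> in_span {..<e} N (\<lambda>i j. differential n (D (\<sigma> i)) y (\<beta> j)) (\<lambda>j. differential n (D q) y (\<beta> j))"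
    and D: "\<And>m k. D (m, k) = Delta n m k"
    and dual: "\<And>i k. i < N \<Longrightarrow> k < N \<Longrightarrow> differential n (D (\<sigma> k)) y (a i) = (if i = k then 1 else 0)"
  shows "e \<le> 2 * N"
proof -
  let ?I = "index_square n" and ?h = "\<lambda>q. ad n y (\<lambda>p. gradient_at n (D q) y $$ p)"
  have D': "D q = Delta n (fst q) (snd q)" for q using D[of "fst q" "snd q"] by simp
  have "\<forall>q. \<exists>c. q \<in> gt_indices n \<longrightarrow> (\<forall>w. differential n (D q) y w = (\<Sum>i<N. c i * differential n (D (\<sigma> i)) y w))"
  proof
    fix q
    show "\<exists>c. q \<in> gt_indices n \<longrightarrow> (\<forall>w. differential n (D q) y w = (\<Sum>i<N. c i * differential n (D (\<sigma> i)) y w))"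
    proof (cases "q \<in> gt_indices n")
      case True
      then obtain c where "\<And>j. j < e \<Longrightarrow> differential n (D q) y (\<beta> j) = (\<Sum>i<N. c i * differential n (D (\<sigma> i)) y (\<beta> j))"
        using sp unfolding in_span_def by (meson lessThan_iff)
      from differential_combination[OF y \<beta> this] show ?thesis by blast
    qed simp
  qed
  from choice[OF this] obtain c where
    c: "\<And>q w. q \<in> gt_indices n \<Longrightarrow> differential n (D q) y w = (\<Sum>i<N. c q i * differential n (D (\<sigma> i)) y w)"
    by blast
  let ?v = "\<lambda>i. if i < N then ad n y (a i) else ?h (\<sigma> (i - N))"
  have "in_span ?I (N + N) ?v (ad n y (\<beta> j))" for j
  proof -
    let ?t = "\<lambda>i. differential n (D (\<sigma> i)) y (\<beta> j)"
    \<comment> \<open>\<open>\<beta> j\<close> minus its components along the dual directions, hence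
      in the common kernel. The summand with index \<open>N\<close> carries \<open>\<beta> j\<close>
      itself, which makes this a single sum for \<open>ad_sum\<close>.\<close>
    define w where "w = (\<lambda>p. \<Sum>i<Suc N. (if i < N then - ?t i else 1) * (if i < N then a i else \<beta> j) p)"
    have ad_w: "ad n y w p = ad n y (\<beta> j) p - (\<Sum>i<N. ?t i * ad n y (a i) p)" if "p \<in> ?I" for p
      unfolding w_def ad_sum[OF y that] by (simp add: sum_negf)
    have "differential n (D (\<sigma> k)) y w = 0" if "k < N" for k
    proof -
      have "differential n (D (\<sigma> k)) y w = ?t k - (\<Sum>i<N. ?t i * (if i = k then 1 else 0))"
        unfolding w_def differential_sum[OF y] using dual that by (simp add: sum_negf)
      then show ?thesis using that by (simp add: sum_delta_mult)
    qed
    then have "differential n (D q) y w = 0" if "q \<in> gt_indices n" for q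
      using c[OF that] by simp
    then have "differential n (Delta n m k) y w = 0" if "(m, k) \<in> gt_indices n" for m k
      using that D by metis
    from lagrangian_kernel[OF y lag this] obtain b where
      b: "\<And>p. p \<in> ?I \<Longrightarrow> ad n y w p = (\<Sum>q\<in>gt_indices n. b q * ?h q p)" unfolding D' by blast
    let ?b = "\<lambda>i. \<Sum>q\<in>gt_indices n. b q * c q i"
    have "ad n y (\<beta> j) p = (\<Sum>i<N + N. (if i < N then ?t i else ?b (i - N)) * ?v i p)" if p: "p \<in> ?I" for p
    proof -
      have "ad n y w p = (\<Sum>q\<in>gt_indices n. \<Sum>i<N. b q * (c q i * ?h (\<sigma> i) p))"
        unfolding b[OF p] by (intro sum.cong refl) (simp add: hamiltonian_in_span[OF y c p] sum_distrib_left)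
      also have "\<dots> = (\<Sum>i<N. ?b i * ?h (\<sigma> i) p)"
        by (subst sum.swap) (simp add: sum_distrib_right mult.assoc)
      finally show ?thesis using ad_w[OF p] by (simp add: sum_lessThan_split2 algebra_simps)
    qed
    then show ?thesis by (rule in_spanI)
  qed
  then show ?thesis using steinitz_bound[of ?I e "\<lambda>j. ad n y (\<beta> j)" "N + N" ?v] \<beta>
    by (simp add: ad_basis_def)
qed

text \<open>Rank is lower semicontinuous: the rank \<open>N\<close> of the differentials at the
  special point persists generically, and at a generic point the differentials of a maximal
  independent set of \<open>s\<close> generators cut out the kernel of all of them, so
  \<open>N \<le> s\<close>.\<close>

lemma independent_gt_generators:
  fixes x :: "'a::field_char_0 mat"
  assumes x: "x \<in> carrier_mat n n" and y0: "y0 \<in> adjoint_orbit x" and lag: "lagrangian n y0" and \<beta>: "ad_basis n y0 e \<beta>"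
  shows "\<exists>s P. e \<le> 2 * s \<and> (\<forall>i<s. P i \<in> (\<lambda>(m, k). Delta n m k) ` gt_indices n) \<and>
    algebraically_independent (adjoint_orbit x) s (\<lambda>i. eval_at (P i))"
proof -
  let ?X = "adjoint_orbit x"
  define D where "D = (\<lambda>(m, k). Delta n m k :: (nat \<times> nat, 'a) mpoly)"
  have D: "D (m, k) = Delta n m k" for m k by (simp add: D_def)
  have D_sym: "D q \<in> sym_gl n" for q using Delta_in_sym_gl[of n "fst q" "snd q"] by (simp add: D_def case_prod_unfold)
  have y0c: "y0 \<in> carrier_mat n n" by (rule adjoint_orbit_carrier[OF x y0])
  let ?row = "\<lambda>q j. differential n (D q) y0 (\<beta> j)"
  obtain N \<sigma> where N: "lin_indep {..<e} N (\<lambda>i. ?row (\<sigma> i))" "\<And>i. i < N \<Longrightarrow> \<sigma> i \<in> gt_indices n"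
    "\<And>q. q \<in> gt_indices n \<Longrightarrow> in_span {..<e} N (\<lambda>i. ?row (\<sigma> i)) (?row q)"
    by (rule independent_subfamily[of "{..<e}" ?row "gt_indices n"]) auto
  obtain u where u: "\<And>i k. i < N \<Longrightarrow> k < N \<Longrightarrow> (\<Sum>j<e. u i j * ?row (\<sigma> k) j) = (if i = k then 1 else 0)"
    by (rule dual_family[OF _ N(1)]) auto
  define a where "a i = (\<lambda>p. \<Sum>j<e. u i j * \<beta> j p)" for i
  have dual: "differential n (D (\<sigma> k)) y0 (a i) = (if i = k then 1 else 0)" if "i < N" "k < N" for i k
    unfolding a_def differential_sum[OF y0c] by (rule u[OF that])
  have eN: "e \<le> 2 * N" by (rule lagrangian_bound[OF y0c lag \<beta> N(3) D dual])
  \<comment> \<open>The \<open>N\<close> by \<open>N\<close> minor of differentials along the fixed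
    directions \<open>a i\<close>, as a matrix of polynomials; at \<open>y0\<close> it evaluates to
    the identity.\<close>
  define M where "M = mat N N (\<lambda>(k, i). lie_poisson n (D (\<sigma> k)) (linear_form n (a i)))"
  have H0: "det M \<in> sym_gl n"
    by (rule det_in_sym_gl[of _ N]) (auto simp: M_def intro!: lie_poisson_in_sym_gl D_sym linear_form_in_sym_gl)
  let ?M = "\<lambda>y. mat N N (\<lambda>(k, i). differential n (D (\<sigma> k)) y (a i))"
  have evM: "eval_at (det M) y = det (?M y)" if y: "y \<in> ?X" for y
  proof -
    interpret ev: comm_ring_hom "\<lambda>P. eval_at P y" by (rule eval_at_comm_ring_hom)
    have "map_mat (\<lambda>P. eval_at P y) M = ?M y"
      unfolding M_def using eval_at_lie_poisson_linear_form[OF adjoint_orbit_carrier[OF x y]] by (intro eq_matI) auto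
    then show ?thesis using ev.hom_det[of M] by simp
  qed
  have "?M y0 = 1\<^sub>m N" using dual by (intro eq_matI) auto
  then have H0': "\<exists>y\<in>?X. eval_at (det M) y \<noteq> 0" using evM[OF y0] by (intro bexI[OF _ y0]) simp
  have \<F>: "finite (D ` gt_indices n)" "D ` gt_indices n \<subseteq> sym_gl n" using finite_gt_indices D_sym by auto
  have indep_0: "algebraically_independent ?X 0 (\<lambda>i. eval_at (D (\<sigma> i)))" by (rule algebraically_independent_0[OF y0])
  obtain s P where P: "\<And>i. i < s \<Longrightarrow> P i \<in> D ` gt_indices n" "algebraically_independent ?X s (\<lambda>i. eval_at (P i))"
    "\<And>F. F \<in> D ` gt_indices n \<Longrightarrow> \<not> algebraically_independent ?X (Suc s) (\<lambda>i. eval_at ((P(s := F)) i))"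
  proof (rule maximal_independent_extension[where X = ?X and S = "sym_gl n" and B = e and r = 0 and P = "\<lambda>i. D (\<sigma> i)",
        OF independent_functions_bound_at[OF x y0 \<beta>] _ indep_0 \<F>(2)], goal_cases)
    case (4 s P)
    show ?case by (rule 4(1)[OF 4(4)[OF le0] 4(5,6)])
  qed auto
  have P_sym: "P i \<in> sym_gl n" if "i < s" for i using P(1)[OF that] \<F>(2) by blast
  from generic_kernel[OF x P_sym \<F> P(2,3) H0 H0'] obtain y where y: "y \<in> ?X" "eval_at (det M) y \<noteq> 0"
    "\<And>w F. (\<And>i. i < s \<Longrightarrow> differential n (P i) y w = 0) \<Longrightarrow> F \<in> D ` gt_indices n \<Longrightarrow> differential n F y w = 0"
    by blast
  have yc: "y \<in> carrier_mat n n" by (rule adjoint_orbit_carrier[OF x y(1)])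
  \<comment> \<open>Otherwise some combination of the \<open>a i\<close> is killed by the
    \<open>s\<close> differentials at \<open>y\<close>, hence by the differentials of all
    generators, and the minor at \<open>y\<close> would be singular.\<close>
  have "N \<le> s"
  proof (rule ccontr)
    assume "\<not> N \<le> s"
    then obtain c where c: "\<exists>i<N. c i \<noteq> 0" "\<And>k. k < s \<Longrightarrow> (\<Sum>i<N. differential n (P k) y (a i) * c i) = 0"
      using homogeneous_system_solution[of s N "\<lambda>k i. differential n (P k) y (a i)"] by auto
    let ?w = "\<lambda>p. \<Sum>i<N. c i * a i p"
    have w0: "differential n (D (\<sigma> k)) y ?w = 0" if "k < N" for k
      by (rule y(3)) (use c(2) N(2)[OF that] in \<open>auto simp: differential_sum[OF yc] mult.commute\<close>)
    have "?M y *\<^sub>v vec N c = 0\<^sub>v N"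
    proof (rule eq_vecI)
      fix k assume "k < dim_vec (0\<^sub>v N)"
      then have k: "k < N" by simp
      then show "(?M y *\<^sub>v vec N c) $ k = 0\<^sub>v N $ k"
        using w0[OF k] by (simp add: differential_sum[OF yc] scalar_prod_def lessThan_atLeast0 mult.commute)
    qed simp
    moreover have "vec N c \<noteq> 0\<^sub>v N"
    proof
      assume zero: "vec N c = 0\<^sub>v N"
      obtain i where i: "i < N" "c i \<noteq> 0" using c(1) by blast
      then show False using arg_cong[OF zero, of "\<lambda>v. v $ i"] by simp
    qed
    ultimately have "det (?M y) = 0" by (subst det_0_iff_vec_prod_zero_field[of _ N]) (auto intro!: exI[of _ "vec N c"])
    with y(1,2) evM show False by simp
  qed
  with eN P show ?thesis by (intro exI[of _ s] exI[of _ P]) (auto simp: D_def)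
qed

lemma tr_deg_restrict_functions:
  assumes P: "\<And>i. i < t \<Longrightarrow> P i \<in> \<A>" "algebraically_independent X t (\<lambda>i. eval_at (P i))"
    and max: "\<And>r Q. (\<And>i. i < r \<Longrightarrow> Q i \<in> \<A>) \<Longrightarrow> algebraically_independent X r (\<lambda>i. eval_at (Q i)) \<Longrightarrow> r \<le> t"
  shows "tr_deg X (restrict_functions X \<A>) = enat t"
  unfolding tr_deg_def
proof (rule antisym)
  show "Sup {enat r |r. \<exists>f. (\<forall>i<r. f i \<in> restrict_functions X \<A>) \<and> algebraically_independent X r f} \<le> enat t"
  proof (rule Sup_least, clarify)
    fix r f assume f: "\<forall>i<r. f i \<in> restrict_functions X \<A>" "algebraically_independent X r f"
    have "\<forall>i. \<exists>Q. i < r \<longrightarrow> Q \<in> \<A> \<and> f i = restrict (eval_at Q) X"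
      using f(1) unfolding restrict_functions_def by blast
    from choice[OF this] obtain Q where Q: "\<And>i. i < r \<Longrightarrow> Q i \<in> \<A> \<and> f i = restrict (eval_at (Q i)) X" by blast
    have "algebraically_independent X r (\<lambda>i. eval_at (Q i)) = algebraically_independent X r f"
      by (rule algebraically_independent_cong) (simp add: Q)
    then show "enat r \<le> enat t" using max[of r Q] Q f(2) by simp
  qed
next
  have "algebraically_independent X t (\<lambda>i. restrict (eval_at (P i)) X) = algebraically_independent X t (\<lambda>i. eval_at (P i))"
    by (rule algebraically_independent_cong) simp
  then show "enat t \<le> Sup {enat r |r. \<exists>f. (\<forall>i<r. f i \<in> restrict_functions X \<A>) \<and> algebraically_independent X r f}"
    using P by (intro Sup_upper CollectI exI[of _ t] conjI refl exI[of _ "\<lambda>i. restrict (eval_at (P i)) X"])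
      (auto simp: restrict_functions_def)
qed

text \<open>The bound makes the supremum in \<open>enat\<close> an attained natural number, which
  reduces the comparison of transcendence degrees to inequalities between lengths of independent
  families.\<close>

lemma tr_deg_maximum:
  assumes "z \<in> X"
    and bound: "\<And>r Q. (\<And>i. i < r \<Longrightarrow> Q i \<in> \<A>) \<Longrightarrow> algebraically_independent X r (\<lambda>i. eval_at (Q i)) \<Longrightarrow> r \<le> B"
  obtains t P where "tr_deg X (restrict_functions X \<A>) = enat t" "\<And>i. i < t \<Longrightarrow> P i \<in> \<A>"
    "algebraically_independent X t (\<lambda>i. eval_at (P i))"
    "\<And>r Q. (\<And>i. i < r \<Longrightarrow> Q i \<in> \<A>) \<Longrightarrow> algebraically_independent X r (\<lambda>i. eval_at (Q i)) \<Longrightarrow> r \<le> t"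
proof -
  let ?ok = "\<lambda>r. \<exists>Q. (\<forall>i<r. Q i \<in> \<A>) \<and> algebraically_independent X r (\<lambda>i. eval_at (Q i))"
  have ok_0: "?ok 0" using algebraically_independent_0[OF assms(1)] by blast
  have le_B: "r \<le> B" if "?ok r" for r using that bound by blast
  define t where "t = (GREATEST r. ?ok r)"
  have "?ok t" unfolding t_def by (rule GreatestI_nat[where P = ?ok, OF ok_0 le_B])
  then obtain P where P: "\<And>i. i < t \<Longrightarrow> P i \<in> \<A>" "algebraically_independent X t (\<lambda>i. eval_at (P i))" by blast
  have max: "r \<le> t" if "\<And>i. i < r \<Longrightarrow> Q i \<in> \<A>" "algebraically_independent X r (\<lambda>i. eval_at (Q i))" for r Q
    unfolding t_def by (rule Greatest_le_nat[where P = ?ok, OF _ le_B]) (use that in blast)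
  from that[OF tr_deg_restrict_functions[OF P max] P max] show thesis .
qed

theorem theorem4p3:
  fixes x :: "'a::{alg_closed_field, field_char_0} mat" and n :: nat
  assumes "n \<ge> 1" and "x \<in> carrier_mat n n"
  shows "complete_on n (gelfand_tsetlin n) (adjoint_orbit x)"
proof -
  let ?X = "adjoint_orbit x" and ?C = "gelfand_tsetlin n :: (nat \<times> nat, 'a) mpoly set"
  note x = assms(2)
  note C = gelfand_tsetlin_poisson_commutative[where 'a = 'a, of n]
  then have C_sym: "?C \<subseteq> sym_gl n" unfolding poisson_commutative_subalgebra_def by blast
  obtain y0 where y0: "y0 \<in> ?X" "lagrangian n y0"
    using lagrangian_exists[OF x] by (auto simp: adjoint_orbit_def)
  \<comment> \<open>\<open>e\<close> is the dimension of the tangent space at \<open>y0\<close>;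
    through \<open>bound\<close> it limits both transcendence degrees.\<close>
  obtain e \<beta> where \<beta>: "ad_basis n y0 e \<beta>" by (rule ad_basis_exists)
  note bound = independent_functions_bound_at[OF x y0(1) \<beta>]
  obtain t P where t: "tr_deg ?X (restrict_functions ?X (sym_gl n :: (nat \<times> nat, 'a) mpoly set)) = enat t"
    "\<And>i. i < t \<Longrightarrow> P i \<in> sym_gl n" "algebraically_independent ?X t (\<lambda>i. eval_at (P i))"
    "\<And>r Q. (\<And>i. i < r \<Longrightarrow> Q i \<in> sym_gl n) \<Longrightarrow> algebraically_independent ?X r (\<lambda>i. eval_at (Q i)) \<Longrightarrow> r \<le> t"
  proof (rule tr_deg_maximum[OF y0(1), where \<A> = "sym_gl n :: (nat \<times> nat, 'a) mpoly set" and B = e], goal_cases)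
    case (1 r Q)
    show ?case by (rule bound[OF 1(2,3)])
  next
    case (2 t P)
    show ?case by (rule 2(1)[OF 2(2-5)])
  qed
  have bound_C: "r \<le> e" if "\<And>i. i < r \<Longrightarrow> Q i \<in> ?C" "algebraically_independent ?X r (\<lambda>i. eval_at (Q i))" for r Q
    using bound[OF _ that(2)] that(1) C_sym by blast
  obtain r Q where r: "tr_deg ?X (restrict_functions ?X ?C) = enat r"
    "\<And>i. i < r \<Longrightarrow> Q i \<in> ?C" "algebraically_independent ?X r (\<lambda>i. eval_at (Q i))"
    "\<And>r' Q. (\<And>i. i < r' \<Longrightarrow> Q i \<in> ?C) \<Longrightarrow> algebraically_independent ?X r' (\<lambda>i. eval_at (Q i)) \<Longrightarrow> r' \<le> r"
  proof (rule tr_deg_maximum[OF y0(1), where \<A> = ?C and B = e], goal_cases)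
    case (1 r Q)
    show ?case by (rule bound_C[OF 1(2,3)])
  next
    case (2 r Q)
    show ?case by (rule 2(1)[OF 2(2-5)])
  qed
  have Q_sym: "Q i \<in> sym_gl n" if "i < r" for i using r(2)[OF that] C_sym by blast
  have "lie_poisson n (Q i) (Q j) = 0" if "i < r" "j < r" for i j
    using C r(2)[OF that(1)] r(2)[OF that(2)] unfolding poisson_commutative_subalgebra_def by blast
  from poisson_commuting_bound[OF x Q_sym r(3) this] obtain s P' where
    "2 * r \<le> s" "\<forall>i<s. P' i \<in> sym_gl n" "algebraically_independent ?X s (\<lambda>i. eval_at (P' i))" by blast
  with t(4)[of s P'] have "2 * r \<le> t" by simp
  moreover have "t \<le> e" by (rule bound[OF t(2,3)])
  moreover have "e \<le> 2 * r"
  proof -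
    obtain s R where R: "e \<le> 2 * s" "\<And>i. i < s \<Longrightarrow> R i \<in> (\<lambda>(m, k). Delta n m k) ` gt_indices n"
      "algebraically_independent ?X s (\<lambda>i. eval_at (R i))"
      using independent_gt_generators[OF x y0 \<beta>] by blast
    have "R i \<in> ?C" if "i < s" for i
      using R(2)[OF that] unfolding gelfand_tsetlin_def gt_indices_def
      by (auto intro!: subalgebra_generated.gen exI)
    from r(4)[OF this R(3)] R(1) show ?thesis by simp
  qed
  \<comment> \<open>The chain \<open>2 r \<le> t \<le> e \<le> 2 r\<close> closes.\<close>
  ultimately have "2 * r = t" by simp
  then have "2 * enat r = enat t" by (simp add: numeral_eq_enat)
  with C show ?thesis unfolding complete_on_def dim_variety_def by (simp add: r(1) t(1))
qed

end
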